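(* Let $\mathcal T$ be a quasi-uniform triangulation of $\Omega$. Let the data satisfy $u^0\in D(A^2)$, $v^0\in D(A^{3/2})$, $f(0)\in D(A)$, $f_t(0)\in D(A^{1/2})$, $f_{tt}(0)\in L^2(\Omega)$, $f,f_t,f_{tt},f_{ttt}\in L^2(0,T;L^2(\Omega))$, and let $u$ be the weak solution of the biharmonic wave problem. Let $U^0,\dots,U^N\in V_h$ be given by the explicit scheme $U^0=\mathcal R_hu^0$, $$2k^{-1}(\bar\partial_tU^{1/2},v_h)+a_h(U^{1/2},v_h)=(f^{1/2}+2k^{-1}v^0,v_h)\quad\text{for all }v_h\in V_h,$$ $$(\bar\partial_t^2U^n,v_h)+a_h(U^n,v_h)=(f^n,v_h)\quad\text{for all }v_h\in V_h,\ n=1,\dots,N-1 .$$ If the CFL condition $k\le\beta^{-1/2}C_{\rm inv}^{-1}h^2$ holds, then there is a constant $C>0$, independent of $h$ and $k$, such that for $1\le m\le N-1$ $$\|u^{m+1}-U^{m+1}\|\le C\big(h^{2\gamma_0}L_{(f,u)}+k^2M_{(u)}\big),$$ where $$L_{(f,u)}=\|f\|_{L^\infty(L^2)}+\|f_t\|_{L^2(L^2)}+\|u\|_{L^\infty(H^{2+\gamma_0})}+\|u_t\|_{L^\infty(H^{2+\gamma_0})}+\|u_{tt}\|_{L^\infty(L^2)}+\|u_{tt}\|_{L^2(H^{2+\gamma_0})}+\|u_{ttt}\|_{L^2(L^2)},$$ $$M_{(u)}=\|u_{ttt}\|_{L^\infty(L^2)}+\|u_{tttt}\|_{L^2(L^2)}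 .$$
   Context: Time grid: $N$ is a positive integer, $k=T/N$, $t_n=nk$. For a function of time $\phi$ (or a sequence $\phi^n$): $\phi^n=\phi(t_n)$, $\phi^{n+1/2}=\frac12(\phi^{n+1}+\phi^n)$, $\bar\partial_t\phi^{n+1/2}=(\phi^{n+1}-\phi^n)/k$, $\bar\partial_t^2\phi^n=(\phi^{n+1}-2\phi^n+\phi^{n-1})/k^2$. $\Omega\subset\mathbb R^2$ is a bounded polygonal Lipschitz domain, $T>0$; $(\cdot,\cdot)$ and $\|\cdot\|$ are the $L^2(\Omega)$ inner product and norm; $a(w,v)=\int_\Omega D^2w:D^2v\,dx$; $L^p(X)$ abbreviates $L^p(0,T;X)$ with $X=L^2(\Omega)$ or $H^{2+\gamma_0}(\Omega)$. The weak solution $u\in C^0([0,T];H^2_0(\Omega))\cap C^1([0,T];L^2(\Omega))$ satisfies $(u_{tt},v)+a(u,v)=(f,v)$ for all $v\in H^2_0(\Omega)$, $u(0)=u^0$, $u_t(0)=v^0$. Under the stated data assumptions, $u,u_t,u_{tt}\in L^\infty(0,T;H^{2+\gamma_0}(\Omega))$ and $u_{tt},u_{ttt},u_{tttt}\in L^\infty(0,T;L^2(\Omega))$. $A\psi=\Delta^2\psi$ with $D(A)=\{\psi\in H^2_0(\Omega):\Delta^2\psi\in L^2(\Omega)\}$, and $D(A^r)=\{w\in L^2(\Omega):\sum_n\lambda_n^{2r}|(w,\psi_n)|^2<\infty\}$, where $(\lambda_n,\psi_n)$ are the eigenpairs of $A$, with $\{\psi_n\}$ an orthonormal basis of $L^2(\Omega)$.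 $\gamma_0\in(1/2,1]$ is the elliptic regularity index of the clamped biharmonic operator; $D(A)\subset H^{2+\gamma_0}(\Omega)$ continuously. Mesh: $\mathcal T$ is a shape-regular triangulation of $\overline\Omega$ with mesh-size $h=\max_{K\in\mathcal T}\mathrm{diam}(K)$, edges $\mathcal E$, vertices $\mathcal V$; $\mathcal V(e)$ is the set of endpoints of edge $e$ and $h_e$ its length; $[\![\cdot]\!]$ is the jump across an interior edge and the trace on a boundary edge; $\{\!\{\cdot\}\!\}$ is the average across an interior edge; $H^m(\mathcal T)$ is the space of piecewise $H^m$ functions; $P_r(\mathcal T)$ is the space of piecewise polynomials of degree at most $r$. Discrete space and form: $\mathrm M(\mathcal T)\subset P_2(\mathcal T)$ is the Morley space: piecewise quadratics continuous at interior vertices, with normal derivatives continuous at midpoints of interior edges, vanishing at boundary vertices and with normal derivatives vanishing at midpoints of boundary edges. $V_h\subset H^2(\mathcal T)$ is a finite-dimensional subspace; on $H^2_0(\Omega)+V_h$ one uses $$\|v\|_h^2=\sum_{K\in\mathcal T}|v|_{H^2(K)}^2+\sum_{e\in\mathcal E}\sum_{z\in\mathcal V(e)}h_e^{-2}\big|[\![v]\!](z)\big|^2+\sum_{e\in\mathcal E}\Big|\frac1{h_e}\int_e\Big[\!\Big[\frac{\partial v}{\partial n}\Big]\!\Big]ds\Big|^2 ,$$ and $a_h$ is a symmetric bilinear form on $V_h+\mathrm M(\mathcal T)$ such that, for all $w_h,v_h\in V_h$, $\alpha\|w_h\|_h^2\le a_h(w_h,w_h)$ and $a_h(w_h,v_h)\le\beta\|w_h\|_h\|v_h\|_h$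 with constants $\alpha,\beta>0$ independent of $h$. (The Morley, quadratic discontinuous Galerkin and quadratic $C^0$ interior penalty methods are instances.) $C_{\rm inv}>0$ is the constant of the discrete inverse inequality on quasi-uniform meshes: $\|v_h\|_h\le C_{\rm inv}h^{-2}\|v_h\|$ for all $v_h\in V_h$. Smoother: $I_{\mathrm M}:H^2(\mathcal T)\to\mathrm M(\mathcal T)$ is the extended Morley interpolation: at each interior vertex $z$, $(I_{\mathrm M}v)(z)$ is the average of the values $(v|_K)(z)$ over the triangles $K$ containing $z$, and on each interior edge $\int_e\partial_n(I_{\mathrm M}v)\,ds=\int_e\{\!\{\partial_nv\}\!\}\,ds$ (boundary degrees of freedom vanish). $J:\mathrm M(\mathcal T)\to H^2_0(\Omega)$ is a fixed linear companion operator, with values in the sum of the Hsieh–Clough–Tocher space and $P_8(\mathcal T)$, such that for $w\in\mathrm M(\mathcal T)$: $Jw=w$ at all vertices, $\nabla(Jw)(z)$ is the average of $(\nabla w|_K)(z)$ over the triangles $K$ containing $z$ at every interior vertex $z$, and $\int_e\partial_n(Jw)\,ds=\int_e\partial_nw\,ds$ for every edge $e$. $Q:=J I_{\mathrm M}:V_h\to H^2_0(\Omega)$ satisfies, with $C_1>0$ independent of $h$, $$\|v_h-Qv_h\|_{H^s(\mathcal T)}\le C_1h^{2-s}\min_{v\in H^2_0(\Omega)}\|v-v_h\|_h,\qquad v_h\in V_h,\ 0\le s\le2 .$$ Modified Ritz projection $\mathcal R_h:H^2_0(\Omega)\to V_h$: $a_h(\mathcal R_hw,v_h)=a(w,Qv_h)$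 for all $v_h\in V_h$. It satisfies, with $C_2>0$ independent of $h$, $\|v-\mathcal R_hv\|+h^{\gamma_0}\|v-\mathcal R_hv\|_h\le C_2h^{2\gamma_0}\|v\|_{H^{2+\gamma_0}(\Omega)}$ for all $v\in H^2_0(\Omega)\cap H^{2+\gamma_0}(\Omega)$. The constant $C$ of the claim may depend on $\Omega,\gamma_0,\alpha,\beta,T,C_1,C_2$. *)

theory Defs
  imports "HOL-Analysis.Analysis" "HOL-Probability.Essential_Supremum"
begin

text \<open>
  Elements of function spaces over a planar set are represented by functions on the whole plane, read
  up to almost-everywhere equality on that set. Norms that serve to decide membership in a space
  take values in \<^typ>\<open>ennreal\<close> and equal \<^term>\<open>\<infinity> :: ennreal\<close> outside the space.
\<close>

type_synonym pt = "real^2"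
type_synonym sfun = "real^2 \<Rightarrow> real"

section \<open>Lebesgue and Sobolev spaces\<close>

definition L2_space :: "'a::euclidean_space set \<Rightarrow> ('a \<Rightarrow> real) set" where
  "L2_space S = {v. v \<in> borel_measurable (lebesgue_on S) \<and> integrable (lebesgue_on S) (\<lambda>x. (v x)\<^sup>2)}"

definition L2_inner :: "'a::euclidean_space set \<Rightarrow> ('a \<Rightarrow> real) \<Rightarrow> ('a \<Rightarrow> real) \<Rightarrow> real" where
  "L2_inner S v w = (LINT x|lebesgue_on S. v x * w x)"

definition L2_norm :: "'a::euclidean_space set \<Rightarrow> ('a \<Rightarrow> real) \<Rightarrow> real" where
  "L2_norm S v = sqrt (L2_inner S v v)"

definition L2_enorm :: "'a::euclidean_space set \<Rightarrow> ('a \<Rightarrow> real) \<Rightarrow> ennreal" where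
  "L2_enorm S v = (if v \<in> L2_space S then ennreal (L2_norm S v) else \<infinity>)"

definition esqrt :: "ennreal \<Rightarrow> ennreal" where
  "esqrt x = (if x = \<infinity> then \<infinity> else ennreal (sqrt (enn2real x)))"

primrec Ck :: "nat \<Rightarrow> ('a::euclidean_space \<Rightarrow> real) \<Rightarrow> bool" where
  "Ck 0 v \<longleftrightarrow> continuous_on UNIV v"
| "Ck (Suc m) v \<longleftrightarrow> (\<forall>x. v differentiable (at x)) \<and>
     (\<forall>b\<in>Basis. Ck m (\<lambda>x. frechet_derivative v (at x) b))"

definition smooth_fun :: "('a::euclidean_space \<Rightarrow> real) \<Rightarrow> bool" where
  "smooth_fun v \<longleftrightarrow> (\<forall>m. Ck m v)"

definition test_fun :: "'a::euclidean_space set \<Rightarrow> ('a \<Rightarrow> real) set" where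
  "test_fun S = {v. smooth_fun v \<and> (\<exists>K. compact K \<and> K \<subseteq> S \<and> (\<forall>x. x \<notin> K \<longrightarrow> v x = 0))}"

text \<open>
  A derivative of order \<^term>\<open>j\<close> is indexed by the list of its \<^term>\<open>j\<close> directions. Sums over
  all lists of length two thus give the Frobenius product of Hessians.
\<close>

primrec pderivs :: "2 list \<Rightarrow> sfun \<Rightarrow> sfun" where
  "pderivs [] v = v"
| "pderivs (i # is) v = (\<lambda>x. frechet_derivative (pderivs is v) (at x) (axis i 1))"

definition locally_integrable :: "pt set \<Rightarrow> sfun \<Rightarrow> bool" where
  "locally_integrable S v \<longleftrightarrow> (\<forall>K. compact K \<and> K \<subseteq> S \<longrightarrow> integrable (lebesgue_on K) v)"

definition has_weak_deriv :: "pt set \<Rightarrow> 2 list \<Rightarrow> sfun \<Rightarrow> sfun \<Rightarrow> bool" where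
  "has_weak_deriv S is v g \<longleftrightarrow> locally_integrable S v \<and> locally_integrable S g \<and>
     (\<forall>\<phi>\<in>test_fun S. L2_inner S v (pderivs is \<phi>) = (-1) ^ length is * L2_inner S g \<phi>)"

definition wderiv :: "pt set \<Rightarrow> 2 list \<Rightarrow> sfun \<Rightarrow> sfun" where
  "wderiv S is v = (SOME g. has_weak_deriv S is v g)"

definition Hm_space :: "pt set \<Rightarrow> nat \<Rightarrow> sfun set" where
  "Hm_space S m = {v. \<forall>is. length is \<le> m \<longrightarrow> (\<exists>g\<in>L2_space S. has_weak_deriv S is v g)}"

text \<open>Sobolev--Slobodeckij norm of real order \<^term>\<open>s \<ge> (0::real)\<close>, in dimension two.\<close>

definition slobodeckij_sq :: "pt set \<Rightarrow> real \<Rightarrow> sfun \<Rightarrow> ennreal" where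
  "slobodeckij_sq S \<sigma> g =
     (\<integral>\<^sup>+x. (\<integral>\<^sup>+y. ennreal ((g x - g y)\<^sup>2 / norm (x - y) powr (2 + 2 * \<sigma>)) \<partial>lebesgue_on S) \<partial>lebesgue_on S)"

definition sobolev_norm :: "pt set \<Rightarrow> real \<Rightarrow> sfun \<Rightarrow> ennreal" where
  "sobolev_norm S s v =
     (let m = nat \<lfloor>s\<rfloor>; \<sigma> = s - real m in
      if v \<in> Hm_space S m
      then esqrt ((\<Sum>is | length is \<le> m. ennreal ((L2_norm S (wderiv S is v))\<^sup>2)) +
                  (if \<sigma> = 0 then 0 else \<Sum>is | length is = m. slobodeckij_sq S \<sigma> (wderiv S is v)))
      else \<infinity>)"

definition Hs_space :: "pt set \<Rightarrow> real \<Rightarrow> sfun set" where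
  "Hs_space S s = {v. sobolev_norm S s v < \<infinity>}"

definition H20 :: "pt set \<Rightarrow> sfun set" where
  "H20 S = {v \<in> Hm_space S 2. \<exists>\<phi>. (\<forall>j::nat. \<phi> j \<in> test_fun S) \<and>
      (\<lambda>j. sobolev_norm S 2 (\<lambda>x. v x - \<phi> j x)) \<longlonglongrightarrow> 0}"

definition a_form :: "pt set \<Rightarrow> sfun \<Rightarrow> sfun \<Rightarrow> real" where
  "a_form S w v = (\<Sum>is | length is = 2. L2_inner S (wderiv S is w) (wderiv S is v))"

section \<open>The domain and the clamped biharmonic operator\<close>

definition lipschitz_boundary :: "pt set \<Rightarrow> bool" where
  "lipschitz_boundary \<Omega> \<longleftrightarrow>
     (\<forall>x\<in>frontier \<Omega>. \<exists>r>0. \<exists>\<tau> \<nu> g L. norm \<tau> = 1 \<and> norm \<nu> = 1 \<and> \<tau> \<bullet> \<nu> = 0 \<and>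
        L-lipschitz_on (UNIV :: real set) g \<and>
        (\<forall>y\<in>ball x r. y \<in> \<Omega> \<longleftrightarrow> (y - x) \<bullet> \<nu> > g ((y - x) \<bullet> \<tau>)))"

definition polygonal_lipschitz_domain :: "pt set \<Rightarrow> bool" where
  "polygonal_lipschitz_domain \<Omega> \<longleftrightarrow>
     open \<Omega> \<and> connected \<Omega> \<and> \<Omega> \<noteq> {} \<and> bounded \<Omega> \<and> lipschitz_boundary \<Omega> \<and>
     (\<exists>E. finite E \<and> (\<forall>e\<in>E. \<exists>a b. e = closed_segment a b) \<and> frontier \<Omega> = \<Union>E)"

definition has_bilaplacian :: "pt set \<Rightarrow> sfun \<Rightarrow> sfun \<Rightarrow> bool" where
  "has_bilaplacian \<Omega> \<psi> g \<longleftrightarrow>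
     (\<forall>\<phi>\<in>test_fun \<Omega>. L2_inner \<Omega> \<psi> (\<lambda>x. \<Sum>i\<in>UNIV. \<Sum>j\<in>UNIV. pderivs [i, i, j, j] \<phi> x) = L2_inner \<Omega> g \<phi>)"

definition dom_A :: "pt set \<Rightarrow> sfun set" where
  "dom_A \<Omega> = {\<psi> \<in> H20 \<Omega>. \<exists>g\<in>L2_space \<Omega>. has_bilaplacian \<Omega> \<psi> g}"

definition eigensystem_A :: "pt set \<Rightarrow> (nat \<Rightarrow> real) \<Rightarrow> (nat \<Rightarrow> sfun) \<Rightarrow> bool" where
  "eigensystem_A \<Omega> ev \<psi> \<longleftrightarrow>
     (\<forall>n. \<psi> n \<in> dom_A \<Omega> \<and> has_bilaplacian \<Omega> (\<psi> n) (\<lambda>x. ev n * \<psi> n x)) \<and>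
     (\<forall>m n. L2_inner \<Omega> (\<psi> m) (\<psi> n) = (if m = n then 1 else 0)) \<and>
     (\<forall>w\<in>L2_space \<Omega>. (\<lambda>m. L2_norm \<Omega> (\<lambda>x. w x - (\<Sum>n<m. L2_inner \<Omega> w (\<psi> n) * \<psi> n x))) \<longlonglongrightarrow> 0)"

definition dom_A_pow :: "pt set \<Rightarrow> real \<Rightarrow> sfun set" where
  "dom_A_pow \<Omega> r = {w \<in> L2_space \<Omega>. \<exists>ev \<psi>. eigensystem_A \<Omega> ev \<psi> \<and>
     summable (\<lambda>n. ev n powr (2 * r) * (L2_inner \<Omega> w (\<psi> n))\<^sup>2)}"

definition elliptic_regularity :: "pt set \<Rightarrow> real \<Rightarrow> bool" where
  "elliptic_regularity \<Omega> \<gamma> \<longleftrightarrow>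
     (\<exists>c\<ge>0. \<forall>\<psi>\<in>H20 \<Omega>. \<forall>g\<in>L2_space \<Omega>. has_bilaplacian \<Omega> \<psi> g \<longrightarrow>
        sobolev_norm \<Omega> (2 + \<gamma>) \<psi> \<le> ennreal (c * (L2_norm \<Omega> \<psi> + L2_norm \<Omega> g)))"

section \<open>Functions of time with values in a normed function space\<close>

text \<open>The argument \<^term>\<open>X\<close> is the extended norm of the function space.\<close>

definition strongly_measurable :: "(sfun \<Rightarrow> ennreal) \<Rightarrow> real \<Rightarrow> (real \<Rightarrow> sfun) \<Rightarrow> bool" where
  "strongly_measurable X T g \<longleftrightarrow> (\<exists>s :: nat \<Rightarrow> real \<Rightarrow> sfun.
     (\<forall>j. finite (s j ` {0..T}) \<and> (\<forall>c. {t \<in> {0..T}. s j t = c} \<in> sets lebesgue) \<and>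
          (\<forall>t\<in>{0..T}. X (s j t) < \<infinity>)) \<and>
     (AE t in lebesgue_on {0..T}. (\<lambda>j. X (\<lambda>x. s j t x - g t x)) \<longlonglongrightarrow> 0))"

definition bochner_integrable :: "(sfun \<Rightarrow> ennreal) \<Rightarrow> real \<Rightarrow> (real \<Rightarrow> sfun) \<Rightarrow> bool" where
  "bochner_integrable X T g \<longleftrightarrow> strongly_measurable X T g \<and> (\<integral>\<^sup>+t. X (g t) \<partial>lebesgue_on {0..T}) < \<infinity>"

definition L2_time_norm :: "(sfun \<Rightarrow> ennreal) \<Rightarrow> real \<Rightarrow> (real \<Rightarrow> sfun) \<Rightarrow> ennreal" where
  "L2_time_norm X T g =
     (if strongly_measurable X T g then esqrt (\<integral>\<^sup>+t. (X (g t))\<^sup>2 \<partial>lebesgue_on {0..T}) else \<infinity>)"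

definition Linf_time_norm :: "(sfun \<Rightarrow> ennreal) \<Rightarrow> real \<Rightarrow> (real \<Rightarrow> sfun) \<Rightarrow> ennreal" where
  "Linf_time_norm X T g =
     (if strongly_measurable X T g then esssup (lebesgue_on {0..T}) (\<lambda>t. X (g t)) else \<infinity>)"

text \<open>
  The \<^term>\<open>j\<close>-th distributional derivative of a Bochner integrable function with values in
  \<open>L\<^sup>2(\<Omega>)\<close>; the identity between Bochner integrals is tested with all elements of \<open>L\<^sup>2(\<Omega>)\<close>.
\<close>

definition has_time_deriv :: "pt set \<Rightarrow> real \<Rightarrow> nat \<Rightarrow> (real \<Rightarrow> sfun) \<Rightarrow> (real \<Rightarrow> sfun) \<Rightarrow> bool" where
  "has_time_deriv \<Omega> T j w g \<longleftrightarrow>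
     bochner_integrable (L2_enorm \<Omega>) T w \<and> bochner_integrable (L2_enorm \<Omega>) T g \<and>
     (\<forall>\<phi>\<in>test_fun {0<..<T}. \<forall>v\<in>L2_space \<Omega>.
        (LINT t|lebesgue_on {0..T}. L2_inner \<Omega> (w t) v * (deriv ^^ j) \<phi> t) =
        (-1) ^ j * (LINT t|lebesgue_on {0..T}. L2_inner \<Omega> (g t) v * \<phi> t))"

text \<open>
  Norms of the \<^term>\<open>j\<close>-th time derivative. That derivative is unique up to null sets, so the
  infimum ranges over representatives of one object; it is \<^term>\<open>\<infinity> :: ennreal\<close> if the derivative does
  not exist as an integrable function.
\<close>

definition L2_deriv_norm :: "pt set \<Rightarrow> (sfun \<Rightarrow> ennreal) \<Rightarrow> real \<Rightarrow> nat \<Rightarrow> (real \<Rightarrow> sfun) \<Rightarrow> ennreal" where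
  "L2_deriv_norm \<Omega> X T j w = (INF g\<in>{g. has_time_deriv \<Omega> T j w g}. L2_time_norm X T g)"

definition Linf_deriv_norm :: "pt set \<Rightarrow> (sfun \<Rightarrow> ennreal) \<Rightarrow> real \<Rightarrow> nat \<Rightarrow> (real \<Rightarrow> sfun) \<Rightarrow> ennreal" where
  "Linf_deriv_norm \<Omega> X T j w = (INF g\<in>{g. has_time_deriv \<Omega> T j w g}. Linf_time_norm X T g)"

definition time_continuous :: "(sfun \<Rightarrow> ennreal) \<Rightarrow> real \<Rightarrow> (real \<Rightarrow> sfun) \<Rightarrow> bool" where
  "time_continuous X T w \<longleftrightarrow> (\<forall>t\<in>{0..T}. X (w t) < \<infinity> \<and>
     ((\<lambda>s. X (\<lambda>x. w s x - w t x)) \<longlongrightarrow> 0) (at t within {0..T}))"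

section \<open>The biharmonic wave equation\<close>

text \<open>
  The pairing of the second time derivative with \<^term>\<open>v\<close> is the time derivative of the inner product
  of the first one with \<^term>\<open>v\<close>. It exists at every \<^term>\<open>t\<close>, since the other two terms of the
  equation are continuous in time.
\<close>

definition weak_solution ::
  "pt set \<Rightarrow> real \<Rightarrow> (real \<Rightarrow> sfun) \<Rightarrow> sfun \<Rightarrow> sfun \<Rightarrow> (real \<Rightarrow> sfun) \<Rightarrow> bool" where
  "weak_solution \<Omega> T f u0 v0 u \<longleftrightarrow>
     (\<forall>t\<in>{0..T}. u t \<in> H20 \<Omega>) \<and> time_continuous (sobolev_norm \<Omega> 2) T u \<and>
     (\<exists>ut. time_continuous (L2_enorm \<Omega>) T ut \<and>
        (\<forall>t\<in>{0..T}. ((\<lambda>s. L2_enorm \<Omega> (\<lambda>x. (u s x - u t x) / (s - t) - ut t x)) \<longlongrightarrow> 0)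
                       (at t within {0..T})) \<and>
        (\<forall>v\<in>H20 \<Omega>. \<forall>t\<in>{0..T}. \<exists>d.
            ((\<lambda>s. L2_inner \<Omega> (ut s) v) has_real_derivative d) (at t within {0..T}) \<and>
            d + a_form \<Omega> (u t) v = L2_inner \<Omega> (f t) v) \<and>
        (AE x in lebesgue_on \<Omega>. u 0 x = u0 x) \<and>
        (AE x in lebesgue_on \<Omega>. ut 0 x = v0 x))"

text \<open>
  The values at time zero refer to the continuous representatives of the source and its first two
  time derivatives; hence the continuity requirements.
\<close>

definition admissible_data ::
  "pt set \<Rightarrow> real \<Rightarrow> sfun \<Rightarrow> sfun \<Rightarrow> (real \<Rightarrow> sfun) \<Rightarrow> (real \<Rightarrow> sfun) \<Rightarrow> (real \<Rightarrow> sfun) \<Rightarrow> (real \<Rightarrow> sfun) \<Rightarrow> bool" where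
  "admissible_data \<Omega> T u0 v0 f ft ftt fttt \<longleftrightarrow>
     u0 \<in> dom_A_pow \<Omega> 2 \<and> v0 \<in> dom_A_pow \<Omega> (3/2) \<and>
     time_continuous (L2_enorm \<Omega>) T f \<and> time_continuous (L2_enorm \<Omega>) T ft \<and>
     time_continuous (L2_enorm \<Omega>) T ftt \<and>
     has_time_deriv \<Omega> T 1 f ft \<and> has_time_deriv \<Omega> T 1 ft ftt \<and> has_time_deriv \<Omega> T 1 ftt fttt \<and>
     f 0 \<in> dom_A \<Omega> \<and> ft 0 \<in> dom_A_pow \<Omega> (1/2) \<and> ftt 0 \<in> L2_space \<Omega> \<and>
     L2_time_norm (L2_enorm \<Omega>) T f < \<infinity> \<and> L2_time_norm (L2_enorm \<Omega>) T ft < \<infinity> \<and>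
     L2_time_norm (L2_enorm \<Omega>) T ftt < \<infinity> \<and> L2_time_norm (L2_enorm \<Omega>) T fttt < \<infinity>"

definition L_fu :: "pt set \<Rightarrow> real \<Rightarrow> real \<Rightarrow> (real \<Rightarrow> sfun) \<Rightarrow> (real \<Rightarrow> sfun) \<Rightarrow> ennreal" where
  "L_fu \<Omega> \<gamma> T f u =
     Linf_deriv_norm \<Omega> (L2_enorm \<Omega>) T 0 f + L2_deriv_norm \<Omega> (L2_enorm \<Omega>) T 1 f +
     Linf_deriv_norm \<Omega> (sobolev_norm \<Omega> (2 + \<gamma>)) T 0 u +
     Linf_deriv_norm \<Omega> (sobolev_norm \<Omega> (2 + \<gamma>)) T 1 u +
     Linf_deriv_norm \<Omega> (L2_enorm \<Omega>) T 2 u +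
     L2_deriv_norm \<Omega> (sobolev_norm \<Omega> (2 + \<gamma>)) T 2 u +
     L2_deriv_norm \<Omega> (L2_enorm \<Omega>) T 3 u"

definition M_u :: "pt set \<Rightarrow> real \<Rightarrow> (real \<Rightarrow> sfun) \<Rightarrow> ennreal" where
  "M_u \<Omega> T u = Linf_deriv_norm \<Omega> (L2_enorm \<Omega>) T 3 u + L2_deriv_norm \<Omega> (L2_enorm \<Omega>) T 4 u"

section \<open>Triangulations\<close>

definition triangulation_of :: "pt set \<Rightarrow> pt set set \<Rightarrow> bool" where
  "triangulation_of \<Omega> \<T> \<longleftrightarrow> triangulation \<T> \<and> (\<forall>K\<in>\<T>. 2 simplex K) \<and> \<Union>\<T> = closure \<Omega>"

definition mesh_size :: "pt set set \<Rightarrow> real" where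
  "mesh_size \<T> = Max (diameter ` \<T>)"

definition shape_regular :: "real \<Rightarrow> pt set set \<Rightarrow> bool" where
  "shape_regular \<kappa> \<T> \<longleftrightarrow> \<kappa> > 0 \<and> (\<forall>K\<in>\<T>. \<exists>x. ball x (diameter K / \<kappa>) \<subseteq> K)"

definition quasi_uniform :: "real \<Rightarrow> pt set set \<Rightarrow> bool" where
  "quasi_uniform q \<T> \<longleftrightarrow> q > 0 \<and> (\<forall>K\<in>\<T>. mesh_size \<T> \<le> q * diameter K)"

definition vertices :: "pt set set \<Rightarrow> pt set" where
  "vertices \<T> = {z. \<exists>K\<in>\<T>. z extreme_point_of K}"

definition edges :: "pt set set \<Rightarrow> pt set set" where
  "edges \<T> = {e. \<exists>K\<in>\<T>. e edge_of K}"

definition vertex_patch :: "pt set set \<Rightarrow> pt \<Rightarrow> pt set set" where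
  "vertex_patch \<T> z = {K\<in>\<T>. z \<in> K}"

definition edge_patch :: "pt set set \<Rightarrow> pt set \<Rightarrow> pt set set" where
  "edge_patch \<T> e = {K\<in>\<T>. e \<subseteq> K}"

definition edge_path :: "pt set \<Rightarrow> real \<Rightarrow> pt" where
  "edge_path e = (SOME p. \<exists>a b. e = closed_segment a b \<and> p = linepath a b)"

definition edge_normal :: "pt set \<Rightarrow> pt" where
  "edge_normal e = (SOME n. norm n = 1 \<and> (\<forall>x\<in>e. \<forall>y\<in>e. n \<bullet> (x - y) = 0))"

text \<open>
  The argument \<^term>\<open>g\<close> assigns to each triangle the one-sided quantity on \<^term>\<open>e\<close>. An interior edge
  lies in two triangles, a boundary edge in one.
\<close>

definition edge_jump :: "pt set set \<Rightarrow> pt set \<Rightarrow> (pt set \<Rightarrow> real) \<Rightarrow> real" where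
  "edge_jump \<T> e g =
     (let Kp = (SOME K. K \<in> edge_patch \<T> e) in g Kp - (\<Sum>K\<in>edge_patch \<T> e - {Kp}. g K))"

definition edge_average :: "pt set set \<Rightarrow> pt set \<Rightarrow> (pt set \<Rightarrow> real) \<Rightarrow> real" where
  "edge_average \<T> e g = (\<Sum>K\<in>edge_patch \<T> e. g K) / real (card (edge_patch \<T> e))"

text \<open>One-sided point values and traces of a function from a triangle.\<close>

definition point_value :: "pt set \<Rightarrow> sfun \<Rightarrow> pt \<Rightarrow> real" where
  "point_value K v = (SOME g. continuous_on K g \<and> (AE x in lebesgue_on K. g x = v x))"

definition point_grad :: "pt set \<Rightarrow> sfun \<Rightarrow> pt \<Rightarrow> pt" where
  "point_grad K v z = (\<chi> i. point_value K (wderiv (interior K) [i] v) z)"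

definition has_edge_trace :: "pt set \<Rightarrow> pt set \<Rightarrow> sfun \<Rightarrow> (real \<Rightarrow> real) \<Rightarrow> bool" where
  "has_edge_trace K e w g \<longleftrightarrow> g \<in> L2_space {0..1} \<and>
     (\<exists>\<phi>. (\<forall>j::nat. smooth_fun (\<phi> j)) \<and>
        (\<lambda>j. sobolev_norm (interior K) 1 (\<lambda>x. \<phi> j x - w x)) \<longlonglongrightarrow> 0 \<and>
        (\<lambda>j. L2_norm {0..1} (\<lambda>t. \<phi> j (edge_path e t) - g t)) \<longlonglongrightarrow> 0)"

definition edge_trace :: "pt set \<Rightarrow> pt set \<Rightarrow> sfun \<Rightarrow> real \<Rightarrow> real" where
  "edge_trace K e w = (SOME g. has_edge_trace K e w g)"

definition normal_deriv_integral :: "pt set \<Rightarrow> sfun \<Rightarrow> pt set \<Rightarrow> real" where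
  "normal_deriv_integral e v K =
     diameter e * (LINT t|lebesgue_on {0..1}.
        (\<Sum>i\<in>UNIV. edge_trace K e (wderiv (interior K) [i] v) t * edge_normal e $ i))"

section \<open>Discrete spaces and operators\<close>

definition broken_Hm :: "pt set set \<Rightarrow> nat \<Rightarrow> sfun set" where
  "broken_Hm \<T> m = {v. \<forall>K\<in>\<T>. v \<in> Hm_space (interior K) m}"

definition broken_sobolev_norm :: "pt set set \<Rightarrow> real \<Rightarrow> sfun \<Rightarrow> ennreal" where
  "broken_sobolev_norm \<T> s v = esqrt (\<Sum>K\<in>\<T>. (sobolev_norm (interior K) s v)\<^sup>2)"

definition h_norm :: "pt set set \<Rightarrow> sfun \<Rightarrow> real" where
  "h_norm \<T> v = sqrt (
     (\<Sum>K\<in>\<T>. \<Sum>is | length is = 2. (L2_norm (interior K) (wderiv (interior K) is v))\<^sup>2) +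
     (\<Sum>e\<in>edges \<T>. \<Sum>z | z extreme_point_of e.
        (edge_jump \<T> e (\<lambda>K. point_value K v z))\<^sup>2 / (diameter e)\<^sup>2) +
     (\<Sum>e\<in>edges \<T>. (edge_jump \<T> e (normal_deriv_integral e v) / diameter e)\<^sup>2))"

definition poly_fun :: "nat \<Rightarrow> sfun \<Rightarrow> bool" where
  "poly_fun r p \<longleftrightarrow> (\<exists>c. \<forall>x. p x = (\<Sum>i\<le>r. \<Sum>j\<le>r - i. c i j * (x $ 1) ^ i * (x $ 2) ^ j))"

definition pw_poly :: "nat \<Rightarrow> pt set set \<Rightarrow> sfun set" where
  "pw_poly r \<T> = {v. \<forall>K\<in>\<T>. \<exists>p. poly_fun r p \<and> (AE x in lebesgue_on K. v x = p x)}"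

definition morley_space :: "pt set \<Rightarrow> pt set set \<Rightarrow> sfun set" where
  "morley_space \<Omega> \<T> = {w \<in> pw_poly 2 \<T>.
     (\<forall>z\<in>vertices \<T>. \<forall>K\<in>vertex_patch \<T> z.
        (z \<in> \<Omega> \<longrightarrow> (\<forall>K'\<in>vertex_patch \<T> z. point_value K w z = point_value K' w z)) \<and>
        (z \<in> frontier \<Omega> \<longrightarrow> point_value K w z = 0)) \<and>
     (\<forall>e\<in>edges \<T>. \<forall>K\<in>edge_patch \<T> e. let dn = (\<lambda>K. point_grad K w (edge_path e (1/2)) \<bullet> edge_normal e) in
        (\<not> e \<subseteq> frontier \<Omega> \<longrightarrow> (\<forall>K'\<in>edge_patch \<T> e. dn K = dn K')) \<and>
        (e \<subseteq> frontier \<Omega> \<longrightarrow> dn K = 0))}"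

definition finite_dim_space :: "sfun set \<Rightarrow> bool" where
  "finite_dim_space V \<longleftrightarrow> (\<exists>B. finite B \<and> V = {v. \<exists>c. v = (\<lambda>x. \<Sum>b\<in>B. c b * b x)})"

definition sum_space :: "sfun set \<Rightarrow> sfun set \<Rightarrow> sfun set" where
  "sum_space V W = {\<lambda>x. v x + w x | v w. v \<in> V \<and> w \<in> W}"

definition linear_op_on :: "sfun set \<Rightarrow> (sfun \<Rightarrow> sfun) \<Rightarrow> bool" where
  "linear_op_on V F \<longleftrightarrow> (\<forall>v\<in>V. \<forall>w\<in>V. \<forall>a b. F (\<lambda>x. a * v x + b * w x) = (\<lambda>x. a * F v x + b * F w x))"

definition symmetric_bilinear_on :: "sfun set \<Rightarrow> (sfun \<Rightarrow> sfun \<Rightarrow> real) \<Rightarrow> bool" where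
  "symmetric_bilinear_on V B \<longleftrightarrow>
     (\<forall>v\<in>V. \<forall>w\<in>V. B v w = B w v) \<and>
     (\<forall>v\<in>V. \<forall>v'\<in>V. \<forall>w\<in>V. \<forall>a b. B (\<lambda>x. a * v x + b * v' x) w = a * B v w + b * B v' w)"

definition discrete_form ::
  "pt set \<Rightarrow> pt set set \<Rightarrow> sfun set \<Rightarrow> real \<Rightarrow> real \<Rightarrow> (sfun \<Rightarrow> sfun \<Rightarrow> real) \<Rightarrow> bool" where
  "discrete_form \<Omega> \<T> Vh \<alpha> \<beta> ah \<longleftrightarrow>
     symmetric_bilinear_on (sum_space Vh (morley_space \<Omega> \<T>)) ah \<and>
     (\<forall>w\<in>Vh. \<alpha> * (h_norm \<T> w)\<^sup>2 \<le> ah w w) \<and>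
     (\<forall>w\<in>Vh. \<forall>v\<in>Vh. ah w v \<le> \<beta> * h_norm \<T> w * h_norm \<T> v)"

definition inverse_inequality :: "pt set \<Rightarrow> pt set set \<Rightarrow> sfun set \<Rightarrow> real \<Rightarrow> bool" where
  "inverse_inequality \<Omega> \<T> Vh Cinv \<longleftrightarrow>
     Cinv > 0 \<and> (\<forall>v\<in>Vh. h_norm \<T> v \<le> Cinv * (1 / (mesh_size \<T>)\<^sup>2) * L2_norm \<Omega> v)"

text \<open>
  The degrees of freedom determine the interpolant up to null sets only; linearity fixes a
  consistent choice of representatives.
\<close>

definition morley_interpolation :: "pt set \<Rightarrow> pt set set \<Rightarrow> (sfun \<Rightarrow> sfun) \<Rightarrow> bool" where
  "morley_interpolation \<Omega> \<T> IM \<longleftrightarrow> linear_op_on (broken_Hm \<T> 2) IM \<and>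
     (\<forall>v\<in>broken_Hm \<T> 2. IM v \<in> morley_space \<Omega> \<T> \<and>
        (\<forall>z\<in>vertices \<T> \<inter> \<Omega>. \<forall>K\<in>vertex_patch \<T> z.
           point_value K (IM v) z =
             (\<Sum>K'\<in>vertex_patch \<T> z. point_value K' v z) / real (card (vertex_patch \<T> z))) \<and>
        (\<forall>e\<in>edges \<T>. \<not> e \<subseteq> frontier \<Omega> \<longrightarrow> (\<forall>K\<in>edge_patch \<T> e.
           normal_deriv_integral e (IM v) K = edge_average \<T> e (normal_deriv_integral e v))))"

text \<open>The Hsieh--Clough--Tocher space: piecewise cubics on the barycentric refinement.\<close>

definition centroid :: "pt set \<Rightarrow> pt" where
  "centroid K = (1/3) *\<^sub>R (\<Sum>z | z extreme_point_of K. z)"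

definition hct_space :: "pt set \<Rightarrow> pt set set \<Rightarrow> sfun set" where
  "hct_space \<Omega> \<T> = H20 \<Omega> \<inter> pw_poly 3 {convex hull (insert (centroid K) e) | K e. K \<in> \<T> \<and> e edge_of K}"

definition companion_operator :: "pt set \<Rightarrow> pt set set \<Rightarrow> (sfun \<Rightarrow> sfun) \<Rightarrow> bool" where
  "companion_operator \<Omega> \<T> J \<longleftrightarrow> linear_op_on (morley_space \<Omega> \<T>) J \<and>
     (\<forall>w\<in>morley_space \<Omega> \<T>.
        J w \<in> H20 \<Omega> \<inter> sum_space (hct_space \<Omega> \<T>) (pw_poly 8 \<T>) \<and>
        (\<forall>z\<in>vertices \<T>. \<forall>K\<in>vertex_patch \<T> z. point_value K (J w) z = point_value K w z) \<and>
        (\<forall>z\<in>vertices \<T> \<inter> \<Omega>. \<forall>K\<in>vertex_patch \<T> z.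
           point_grad K (J w) z =
             (1 / real (card (vertex_patch \<T> z))) *\<^sub>R (\<Sum>K'\<in>vertex_patch \<T> z. point_grad K' w z)) \<and>
        (\<forall>e\<in>edges \<T>. \<forall>K\<in>edge_patch \<T> e.
           normal_deriv_integral e (J w) K = normal_deriv_integral e w K))"

text \<open>
  The bound by the minimum over \<^term>\<open>H20 \<Omega>\<close> is stated as a bound for each \<^term>\<open>v\<close>. The constant may
  depend on \<^term>\<open>s\<close>, because unnormalised Slobodeckij seminorms are not uniformly equivalent as
  \<^term>\<open>s\<close> approaches an integer from below.
\<close>

definition smoother_estimate ::
  "pt set \<Rightarrow> pt set set \<Rightarrow> sfun set \<Rightarrow> (real \<Rightarrow> real) \<Rightarrow> (sfun \<Rightarrow> sfun) \<Rightarrow> bool" where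
  "smoother_estimate \<Omega> \<T> Vh C1 Q \<longleftrightarrow>
     (\<forall>vh\<in>Vh. \<forall>s\<in>{0..2}. \<forall>v\<in>H20 \<Omega>.
        broken_sobolev_norm \<T> s (\<lambda>x. vh x - Q vh x)
          \<le> ennreal (C1 s * mesh_size \<T> powr (2 - s) * h_norm \<T> (\<lambda>x. vh x - v x)))"

definition ritz_projection ::
  "pt set \<Rightarrow> sfun set \<Rightarrow> (sfun \<Rightarrow> sfun \<Rightarrow> real) \<Rightarrow> (sfun \<Rightarrow> sfun) \<Rightarrow> (sfun \<Rightarrow> sfun) \<Rightarrow> bool" where
  "ritz_projection \<Omega> Vh ah Q Rh \<longleftrightarrow>
     (\<forall>w\<in>H20 \<Omega>. Rh w \<in> Vh \<and> (\<forall>v\<in>Vh. ah (Rh w) v = a_form \<Omega> w (Q v)))"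

definition ritz_estimate ::
  "pt set \<Rightarrow> pt set set \<Rightarrow> real \<Rightarrow> real \<Rightarrow> (sfun \<Rightarrow> sfun) \<Rightarrow> bool" where
  "ritz_estimate \<Omega> \<T> \<gamma> C2 Rh \<longleftrightarrow>
     (\<forall>v\<in>H20 \<Omega> \<inter> Hs_space \<Omega> (2 + \<gamma>).
        L2_norm \<Omega> (\<lambda>x. v x - Rh v x) + mesh_size \<T> powr \<gamma> * h_norm \<T> (\<lambda>x. v x - Rh v x)
          \<le> C2 * mesh_size \<T> powr (2 * \<gamma>) * enn2real (sobolev_norm \<Omega> (2 + \<gamma>) v))"

section \<open>The explicit scheme\<close>

definition half_avg :: "(nat \<Rightarrow> sfun) \<Rightarrow> nat \<Rightarrow> sfun" where
  "half_avg \<phi> n = (\<lambda>x. (\<phi> (n + 1) x + \<phi> n x) / 2)"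

definition diff_quot :: "real \<Rightarrow> (nat \<Rightarrow> sfun) \<Rightarrow> nat \<Rightarrow> sfun" where
  "diff_quot k \<phi> n = (\<lambda>x. (\<phi> (n + 1) x - \<phi> n x) / k)"

definition diff_quot2 :: "real \<Rightarrow> (nat \<Rightarrow> sfun) \<Rightarrow> nat \<Rightarrow> sfun" where
  "diff_quot2 k \<phi> n = (\<lambda>x. (\<phi> (n + 1) x - 2 * \<phi> n x + \<phi> (n - 1) x) / k\<^sup>2)"

definition explicit_scheme ::
  "pt set \<Rightarrow> sfun set \<Rightarrow> (sfun \<Rightarrow> sfun \<Rightarrow> real) \<Rightarrow> (sfun \<Rightarrow> sfun) \<Rightarrow> real \<Rightarrow> nat \<Rightarrow>
     (real \<Rightarrow> sfun) \<Rightarrow> sfun \<Rightarrow> sfun \<Rightarrow> (nat \<Rightarrow> sfun) \<Rightarrow> bool" where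
  "explicit_scheme \<Omega> Vh ah Rh k N f u0 v0 U \<longleftrightarrow>
     (\<forall>n\<le>N. U n \<in> Vh) \<and> U 0 = Rh u0 \<and>
     (\<forall>v\<in>Vh. 2 / k * L2_inner \<Omega> (diff_quot k U 0) v + ah (half_avg U 0) v =
        L2_inner \<Omega> (\<lambda>x. half_avg (\<lambda>n. f (real n * k)) 0 x + 2 / k * v0 x) v) \<and>
     (\<forall>n\<in>{1..N-1}. \<forall>v\<in>Vh.
        L2_inner \<Omega> (diff_quot2 k U n) v + ah (U n) v = L2_inner \<Omega> (f (real n * k)) v)"

end

theory Submission
  imports Defs
begin

text \<open>
  Split the error into \<open>u\<^sup>n - R\<^sup>n\<close> and \<open>\<theta>\<^sup>n = R\<^sup>n - U\<^sup>n\<close>, where \<open>R\<^sup>n\<close> is a Ritz path of the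
  solution. The first part is controlled by the Ritz estimate applied to the initial value and to
  first and second differences of \<open>u\<close>, which are Bochner integrals of \<open>u\<^sub>t\<close> and \<open>u\<^sub>t\<^sub>t\<close> and hence
  bounded in \<open>H\<^bsup>2+\<gamma>\<^esup>\<close>.

  Since \<open>a\<^sub>h(R\<^sup>n, v) = a(u\<^sup>n, Qv) = (f\<^sup>n - u\<^sub>t\<^sub>t\<^sup>n, Qv)\<close>, the sequence \<open>\<theta>\<close> solves the explicit scheme with
  two residuals: a consistency error, bounded in \<open>L\<^sup>2\<close> by Taylor expansion, and the functional
  \<open>(f\<^sup>n - u\<^sub>t\<^sub>t\<^sup>n, Qv - v)\<close>, which is of order \<open>h\<^sup>2\<close> only in the energy norm of \<open>v\<close>. Testing with
  \<open>\<theta>\<^bsup>n+1\<^esup> - \<theta>\<^bsup>n-1\<^esup>\<close> and summing by parts in time moves the difference in the second functional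
  from \<open>\<theta>\<close> to \<open>f - u\<^sub>t\<^sub>t\<close>. The discrete energy is
  coercive because the CFL condition gives \<open>k\<^sup>2 a\<^sub>h(v, v) \<le> (v, v)\<close>, and its velocity part, summed
  over the time steps, bounds \<open>\<theta>\<close> in \<open>L\<^sup>2\<close>.

  Derivatives in time are distributional: du Bois-Reymond's lemma, applied to the scalar
  functions \<open>(u(t), v)\<close>, produces the classical derivatives that the Taylor expansions need. All
  norms on the right may be assumed finite, since the claim is trivial otherwise.
\<close>

section \<open>Square-integrable functions\<close>

text \<open>Most norms of the solution control it only for almost every time, whereas the scheme
  samples fixed grid points. The remedy is duality: a statement about an \<open>L2\<close>-valued
  path is proved for its pairing with each fixed \<open>v\<close>, with constants proportional to
  the norm of \<open>v\<close>, and returned to \<open>L2\<close> by testing with the function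
  itself. Bounds in H^(2+\<gamma>) are out of reach of \<open>L2\<close> duality; they come from
  Bochner integrals with explicit kernels, constructed from simple paths and completeness of the
  Sobolev space, and identified with difference quotients through \<open>L2\<close> pairings. No
  Gronwall argument occurs: the discrete energy is estimated at its maximum, so the constant is
  polynomial in T and sqrt T. The smoother contributes h^2, which h \<le> diam \<Omega> turns into a
  multiple of h^(2\<gamma>). Norms of derivatives are infima over representatives that need not be
  attained; the bound is therefore proved with a slack \<epsilon>, which then tends to 0.\<close>

lemma esqrt_power2 [simp]: "(esqrt x)\<^sup>2 = x"
  by (cases x) (auto simp: esqrt_def ennreal_power)

lemma esqrt_of_power2 [simp]: "esqrt (x\<^sup>2) = x"
  by (cases x) (auto simp: esqrt_def ennreal_power)

lemma esqrt_0 [simp]: "esqrt 0 = 0"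
  by (simp add: esqrt_def)

lemma ennreal_power2_le_iff: "x\<^sup>2 \<le> y\<^sup>2 \<longleftrightarrow> x \<le> (y::ennreal)"
  by (cases x; cases y) (auto simp: ennreal_power power2_le_iff_abs_le top_unique)

lemma esqrt_le_iff: "esqrt x \<le> y \<longleftrightarrow> x \<le> y\<^sup>2"
  by (metis esqrt_power2 ennreal_power2_le_iff)

lemma esqrt_mono: "x \<le> y \<Longrightarrow> esqrt x \<le> esqrt y"
  by (simp add: esqrt_le_iff)

lemma esqrt_finite_iff [simp]: "esqrt x < \<infinity> \<longleftrightarrow> x < \<infinity>" "esqrt x = top \<longleftrightarrow> x = top"
  by (auto simp: esqrt_def less_top)

lemma esqrt_ennreal: "0 \<le> x \<Longrightarrow> esqrt (ennreal x) = ennreal (sqrt x)"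
  by (simp add: esqrt_def)

lemma esqrt_mult: "esqrt (x * y) = esqrt x * esqrt y"
  by (metis esqrt_of_power2 esqrt_power2 power_mult_distrib)

section \<open>Cauchy-Schwarz and Minkowski inequalities for functions with values in
  [0, \<infinity>]\<close>

lemma nn_integral_mult_le_esqrt:
  assumes [measurable]: "F \<in> borel_measurable M" "G \<in> borel_measurable M"
  shows "(\<integral>\<^sup>+x. F x * G x \<partial>M) \<le> esqrt (\<integral>\<^sup>+x. (F x)\<^sup>2 \<partial>M) * esqrt (\<integral>\<^sup>+x. (G x)\<^sup>2 \<partial>M)"
  using esqrt_mono[OF Cauchy_Schwarz_nn_integral[OF assms]] by (simp only: esqrt_of_power2 esqrt_mult)

text \<open>Expanding the square and applying Cauchy-Schwarz to the mixed term produces the square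
  of the right-hand side. Working in \<open>ennreal\<close> removes every finiteness
  assumption.\<close>

lemma Minkowski_nn_integral:
  assumes [measurable]: "F \<in> borel_measurable M" "G \<in> borel_measurable M"
  shows "esqrt (\<integral>\<^sup>+x. (F x + G x)\<^sup>2 \<partial>M)
    \<le> esqrt (\<integral>\<^sup>+x. (F x)\<^sup>2 \<partial>M) + esqrt (\<integral>\<^sup>+x. (G x)\<^sup>2 \<partial>M)"
proof -
  have "(\<integral>\<^sup>+x. (F x + G x)\<^sup>2 \<partial>M)
      = (\<integral>\<^sup>+x. (F x)\<^sup>2 \<partial>M) + 2 * (\<integral>\<^sup>+x. F x * G x \<partial>M) + (\<integral>\<^sup>+x. (G x)\<^sup>2 \<partial>M)"
    by (simp add: power2_sum nn_integral_add nn_integral_cmult mult.assoc add.assoc add.commute add.left_commute)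
  also have "\<dots> \<le> (esqrt (\<integral>\<^sup>+x. (F x)\<^sup>2 \<partial>M))\<^sup>2
      + 2 * (esqrt (\<integral>\<^sup>+x. (F x)\<^sup>2 \<partial>M) * esqrt (\<integral>\<^sup>+x. (G x)\<^sup>2 \<partial>M)) + (esqrt (\<integral>\<^sup>+x. (G x)\<^sup>2 \<partial>M))\<^sup>2"
    by (intro add_mono mult_left_mono nn_integral_mult_le_esqrt) auto
  also have "\<dots> = (esqrt (\<integral>\<^sup>+x. (F x)\<^sup>2 \<partial>M) + esqrt (\<integral>\<^sup>+x. (G x)\<^sup>2 \<partial>M))\<^sup>2"
    by (simp add: power2_sum algebra_simps)
  finally show ?thesis by (simp add: esqrt_le_iff)
qed

lemma Minkowski_nn_integral_sum:
  fixes n :: nat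
  assumes [measurable]: "\<And>j. F j \<in> borel_measurable M"
  shows "esqrt (\<integral>\<^sup>+x. (\<Sum>j<n. F j x)\<^sup>2 \<partial>M) \<le> (\<Sum>j<n. esqrt (\<integral>\<^sup>+x. (F j x)\<^sup>2 \<partial>M))"
proof (induction n)
  case (Suc n)
  have "esqrt (\<integral>\<^sup>+x. ((\<Sum>j<n. F j x) + F n x)\<^sup>2 \<partial>M)
    \<le> esqrt (\<integral>\<^sup>+x. (\<Sum>j<n. F j x)\<^sup>2 \<partial>M) + esqrt (\<integral>\<^sup>+x. (F n x)\<^sup>2 \<partial>M)"
    by (rule Minkowski_nn_integral) auto
  also have "\<dots> \<le> (\<Sum>j<n. esqrt (\<integral>\<^sup>+x. (F j x)\<^sup>2 \<partial>M)) + esqrt (\<integral>\<^sup>+x. (F n x)\<^sup>2 \<partial>M)"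
    by (intro add_mono Suc.IH) auto
  finally show ?case by simp
qed simp

lemma ennreal_sum_tendsto_suminf: "(\<lambda>n. \<Sum>j<n. f j) \<longlonglongrightarrow> (\<Sum>j. f j :: ennreal)"
  by (simp add: summable_LIMSEQ summableI)

text \<open>Fatou's lemma carries the inequality from partial sums to the series. This countable
  triangle inequality is the source of completeness, both for \<open>L2\<close> and for the
  Slobodeckij seminorms, which are \<open>L2\<close> norms on a product space.\<close>

lemma Minkowski_nn_integral_suminf:
  fixes F :: "nat \<Rightarrow> 'a \<Rightarrow> ennreal"
  assumes [measurable]: "\<And>j. F j \<in> borel_measurable M"
  shows "esqrt (\<integral>\<^sup>+x. (\<Sum>j. F j x)\<^sup>2 \<partial>M) \<le> (\<Sum>j. esqrt (\<integral>\<^sup>+x. (F j x)\<^sup>2 \<partial>M))"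
proof -
  let ?R = "\<Sum>j. esqrt (\<integral>\<^sup>+x. (F j x)\<^sup>2 \<partial>M)"
  have "(\<lambda>n. (\<Sum>j<n. F j x)\<^sup>2) \<longlonglongrightarrow> (\<Sum>j. F j x)\<^sup>2" for x
    unfolding power2_eq_square
    by (rule tendsto_mult_ennreal[OF ennreal_sum_tendsto_suminf ennreal_sum_tendsto_suminf]) auto
  then have "(\<integral>\<^sup>+x. (\<Sum>j. F j x)\<^sup>2 \<partial>M) = (\<integral>\<^sup>+x. liminf (\<lambda>n. (\<Sum>j<n. F j x)\<^sup>2) \<partial>M)"
    by (intro nn_integral_cong lim_imp_Liminf[symmetric]) auto
  also have "\<dots> \<le> liminf (\<lambda>n. \<integral>\<^sup>+x. (\<Sum>j<n. F j x)\<^sup>2 \<partial>M)"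
    by (rule nn_integral_liminf) auto
  also have "\<dots> \<le> limsup (\<lambda>n. \<integral>\<^sup>+x. (\<Sum>j<n. F j x)\<^sup>2 \<partial>M)"
    by (rule Liminf_le_Limsup) simp
  also have "\<dots> \<le> ?R\<^sup>2"
  proof (rule Limsup_bounded, rule always_eventually, rule allI)
    fix n
    have "esqrt (\<integral>\<^sup>+x. (\<Sum>j<n. F j x)\<^sup>2 \<partial>M) \<le> ?R"
      by (rule order_trans[OF Minkowski_nn_integral_sum[OF assms]]) (auto intro: sum_le_suminf)
    then show "(\<integral>\<^sup>+x. (\<Sum>j<n. F j x)\<^sup>2 \<partial>M) \<le> ?R\<^sup>2"
      by (simp add: esqrt_le_iff)
  qed
  finally show ?thesis by (simp add: esqrt_le_iff)
qed

text \<open>The same inequality for counting measure on \<open>I\<close>: a Sobolev norm is the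
  Euclidean norm of finitely many parts of \<open>L2\<close> type, each of which obeys a countable
  triangle inequality.\<close>

lemma Minkowski_sum_suminf:
  fixes a :: "'i \<Rightarrow> nat \<Rightarrow> ennreal"
  assumes "finite I"
  shows "esqrt (\<Sum>i\<in>I. (\<Sum>j. a i j)\<^sup>2) \<le> (\<Sum>j. esqrt (\<Sum>i\<in>I. (a i j)\<^sup>2))"
  using Minkowski_nn_integral_suminf[of "\<lambda>j i. a i j" "count_space I"]
  by (simp only: nn_integral_count_space_finite[OF assms] measurable_count_space_eq1) simp

section \<open>The extended \<open>L2\<close> norm, the inner product and duality\<close>

text \<open>For a measurable function the integral of the square is infinite exactly when the square
  is not integrable, so membership in \<open>L2_space\<close> needs no case distinction of its own.
  Norm inequalities thereby reduce to those for \<open>ennreal\<close> integrals.\<close>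

lemma L2_enorm_eq:
  "L2_enorm S v = (if v \<in> borel_measurable (lebesgue_on S)
     then esqrt (\<integral>\<^sup>+x. (ennreal \<bar>v x\<bar>)\<^sup>2 \<partial>lebesgue_on S) else \<infinity>)"
proof (cases "v \<in> borel_measurable (lebesgue_on S)")
  case [measurable]: True
  have *: "(\<integral>\<^sup>+x. (ennreal \<bar>v x\<bar>)\<^sup>2 \<partial>lebesgue_on S) = (\<integral>\<^sup>+x. ennreal ((v x)\<^sup>2) \<partial>lebesgue_on S)"
    by (simp add: ennreal_power)
  show ?thesis
  proof (cases "integrable (lebesgue_on S) (\<lambda>x. (v x)\<^sup>2)")
    case i: True
    have "(\<integral>\<^sup>+x. ennreal ((v x)\<^sup>2) \<partial>lebesgue_on S) = ennreal (L2_inner S v v)"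
      by (subst nn_integral_eq_integral[OF i]) (auto simp: L2_inner_def power2_eq_square)
    moreover have "0 \<le> L2_inner S v v" by (simp add: L2_inner_def)
    ultimately show ?thesis
      using i True unfolding * by (simp add: L2_enorm_def L2_space_def L2_norm_def esqrt_ennreal)
  next
    case False
    then have "\<not> (\<integral>\<^sup>+x. ennreal ((v x)\<^sup>2) \<partial>lebesgue_on S) < \<infinity>"
      using integrableI_nonneg[of "\<lambda>x. (v x)\<^sup>2" "lebesgue_on S"] by fastforce
    then have "(\<integral>\<^sup>+x. ennreal ((v x)\<^sup>2) \<partial>lebesgue_on S) = \<infinity>"
      by (simp add: not_less top_unique)
    then show ?thesis unfolding * using False by (simp add: L2_enorm_def L2_space_def esqrt_def)
  qed
qed (simp add: L2_enorm_def L2_space_def)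

lemma L2_enorm_finite_iff: "L2_enorm S v < \<infinity> \<longleftrightarrow> v \<in> L2_space S"
  by (simp add: L2_enorm_def)

lemma L2_enorm_eq_norm: "v \<in> L2_space S \<Longrightarrow> L2_enorm S v = ennreal (L2_norm S v)"
  by (simp add: L2_enorm_def)

lemma L2_spaceD [measurable_dest]: "v \<in> L2_space S \<Longrightarrow> v \<in> borel_measurable (lebesgue_on S)"
  by (simp add: L2_space_def)

lemma L2_inner_nonneg [simp]: "0 \<le> L2_inner S v v"
  by (simp add: L2_inner_def)

lemma L2_norm_nonneg [simp]: "0 \<le> L2_norm S v"
  by (simp add: L2_norm_def)

lemma L2_norm_power2: "(L2_norm S v)\<^sup>2 = L2_inner S v v"
  by (simp add: L2_norm_def)

lemma L2_enorm_add: "L2_enorm S (\<lambda>x. v x + w x) \<le> L2_enorm S v + L2_enorm S w"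
proof (cases "v \<in> borel_measurable (lebesgue_on S) \<and> w \<in> borel_measurable (lebesgue_on S)")
  case True
  then have [measurable]: "v \<in> borel_measurable (lebesgue_on S)" "w \<in> borel_measurable (lebesgue_on S)"
    by auto
  have "esqrt (\<integral>\<^sup>+x. (ennreal \<bar>v x + w x\<bar>)\<^sup>2 \<partial>lebesgue_on S)
      \<le> esqrt (\<integral>\<^sup>+x. (ennreal \<bar>v x\<bar> + ennreal \<bar>w x\<bar>)\<^sup>2 \<partial>lebesgue_on S)"
    by (intro esqrt_mono nn_integral_mono)
      (auto simp: ennreal_power2_le_iff abs_triangle_ineq simp flip: ennreal_plus intro!: ennreal_leI)
  also have "\<dots> \<le> esqrt (\<integral>\<^sup>+x. (ennreal \<bar>v x\<bar>)\<^sup>2 \<partial>lebesgue_on S)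
      + esqrt (\<integral>\<^sup>+x. (ennreal \<bar>w x\<bar>)\<^sup>2 \<partial>lebesgue_on S)"
    by (rule Minkowski_nn_integral) auto
  finally show ?thesis using True by (simp add: L2_enorm_eq)
qed (auto simp: L2_enorm_eq)

text \<open>For \<open>c\<close> = 0 both sides vanish even off \<open>L2\<close>, because 0 times
  \<infinity> is 0 in \<open>ennreal\<close>.\<close>

lemma L2_enorm_cmult: "L2_enorm S (\<lambda>x. c * v x) = ennreal \<bar>c\<bar> * L2_enorm S v"
proof (cases "c = 0")
  case False
  have m: "(\<lambda>x. c * v x) \<in> borel_measurable (lebesgue_on S) \<longleftrightarrow> v \<in> borel_measurable (lebesgue_on S)"
  proof
    assume "(\<lambda>x. c * v x) \<in> borel_measurable (lebesgue_on S)"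
    then have "(\<lambda>x. (1/c) * (c * v x)) \<in> borel_measurable (lebesgue_on S)"
      by (rule borel_measurable_times[OF borel_measurable_const])
    then show "v \<in> borel_measurable (lebesgue_on S)" using False by simp
  qed simp
  show ?thesis
  proof (cases "v \<in> borel_measurable (lebesgue_on S)")
    case True
    then have [measurable]: "v \<in> borel_measurable (lebesgue_on S)" .
    show ?thesis using True
      by (simp add: L2_enorm_eq abs_mult ennreal_mult power_mult_distrib nn_integral_cmult esqrt_mult)
  qed (use m False in \<open>simp add: L2_enorm_eq ennreal_mult_top\<close>)
qed (simp add: L2_enorm_eq)

lemma L2_space_add: "v \<in> L2_space S \<Longrightarrow> w \<in> L2_space S \<Longrightarrow> (\<lambda>x. v x + w x) \<in> L2_space S"
  unfolding L2_enorm_finite_iff[symmetric]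
  by (rule order_le_less_trans[OF L2_enorm_add]) simp

lemma L2_space_cmult: "v \<in> L2_space S \<Longrightarrow> (\<lambda>x. c * v x) \<in> L2_space S"
  unfolding L2_enorm_finite_iff[symmetric] L2_enorm_cmult by (simp add: ennreal_mult_less_top)

lemma L2_space_zero: "(\<lambda>x. 0) \<in> L2_space S"
  by (simp add: L2_space_def)

lemma L2_space_diff: "v \<in> L2_space S \<Longrightarrow> w \<in> L2_space S \<Longrightarrow> (\<lambda>x. v x - w x) \<in> L2_space S"
  using L2_space_add[OF _ L2_space_cmult[of w S "-1"], of v] by simp

lemma L2_space_divide: "v \<in> L2_space S \<Longrightarrow> (\<lambda>x. v x / c) \<in> L2_space S"
  using L2_space_cmult[of v S "1/c"] by simp

lemma L2_space_sum: "(\<And>i. i \<in> I \<Longrightarrow> v i \<in> L2_space S) \<Longrightarrow> (\<lambda>x. \<Sum>i\<in>I. v i x) \<in> L2_space S"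
  by (induction I rule: infinite_finite_induct) (auto intro: L2_space_zero L2_space_add)

lemmas L2_space_intros = L2_space_add L2_space_cmult L2_space_zero L2_space_diff L2_space_divide L2_space_sum

lemma L2_mult_nn_integral:
  assumes "v \<in> L2_space S" "w \<in> L2_space S"
  shows "(\<integral>\<^sup>+x. ennreal \<bar>v x * w x\<bar> \<partial>lebesgue_on S) \<le> ennreal (L2_norm S v * L2_norm S w)"
proof -
  have [measurable]: "v \<in> borel_measurable (lebesgue_on S)" "w \<in> borel_measurable (lebesgue_on S)"
    using assms by (auto simp: L2_space_def)
  have "(\<integral>\<^sup>+x. ennreal \<bar>v x\<bar> * ennreal \<bar>w x\<bar> \<partial>lebesgue_on S) \<le> L2_enorm S v * L2_enorm S w"
    using nn_integral_mult_le_esqrt[of "\<lambda>x. ennreal \<bar>v x\<bar>" "lebesgue_on S" "\<lambda>x. ennreal \<bar>w x\<bar>"]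
    by (simp add: L2_enorm_eq)
  then show ?thesis
    by (simp add: L2_enorm_eq_norm assms abs_mult flip: ennreal_mult)
qed

lemma L2_mult_integrable:
  assumes "v \<in> L2_space S" "w \<in> L2_space S"
  shows "integrable (lebesgue_on S) (\<lambda>x. v x * w x)"
proof (rule integrableI_bounded)
  have [measurable]: "v \<in> borel_measurable (lebesgue_on S)" "w \<in> borel_measurable (lebesgue_on S)"
    using assms by (auto simp: L2_space_def)
  show "(\<lambda>x. v x * w x) \<in> borel_measurable (lebesgue_on S)" by simp
  show "(\<integral>\<^sup>+x. ennreal (norm (v x * w x)) \<partial>lebesgue_on S) < \<infinity>"
    using order_le_less_trans[OF L2_mult_nn_integral[OF assms]] by simp
qed

lemma L2_inner_le:
  assumes "v \<in> L2_space S" "w \<in> L2_space S"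
  shows "\<bar>L2_inner S v w\<bar> \<le> L2_norm S v * L2_norm S w"
proof -
  have "ennreal \<bar>L2_inner S v w\<bar> \<le> (\<integral>\<^sup>+x. ennreal (norm (v x * w x)) \<partial>lebesgue_on S)"
    using integral_norm_bound_ennreal[OF L2_mult_integrable[OF assms]] by (simp add: L2_inner_def)
  also have "\<dots> \<le> ennreal (L2_norm S v * L2_norm S w)"
    using L2_mult_nn_integral[OF assms] by simp
  finally show ?thesis by (simp add: ennreal_le_iff)
qed

lemma L2_inner_commute: "L2_inner S v w = L2_inner S w v"
  by (simp add: L2_inner_def mult.commute)

lemma L2_inner_add:
  assumes "v \<in> L2_space S" "v' \<in> L2_space S" "w \<in> L2_space S"
  shows "L2_inner S (\<lambda>x. v x + v' x) w = L2_inner S v w + L2_inner S v' w"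
  unfolding L2_inner_def distrib_right
  by (rule Bochner_Integration.integral_add) (rule L2_mult_integrable; rule assms)+

lemma L2_inner_diff:
  assumes "v \<in> L2_space S" "v' \<in> L2_space S" "w \<in> L2_space S"
  shows "L2_inner S (\<lambda>x. v x - v' x) w = L2_inner S v w - L2_inner S v' w"
  unfolding L2_inner_def left_diff_distrib
  by (rule Bochner_Integration.integral_diff) (rule L2_mult_integrable; rule assms)+

lemma L2_inner_cmult: "L2_inner S (\<lambda>x. c * v x) w = c * L2_inner S v w"
  by (simp add: L2_inner_def mult.assoc)

lemma L2_inner_divide: "L2_inner S (\<lambda>x. v x / c) w = L2_inner S v w / c"
  using L2_inner_cmult[of S "1/c" v w] by simp

lemma L2_inner_sum:
  assumes "\<And>i. i \<in> I \<Longrightarrow> v i \<in> L2_space S" "w \<in> L2_space S"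
  shows "L2_inner S (\<lambda>x. \<Sum>i\<in>I. v i x) w = (\<Sum>i\<in>I. L2_inner S (v i) w)"
  unfolding L2_inner_def sum_distrib_right
  by (rule Bochner_Integration.integral_sum) (rule L2_mult_integrable; simp add: assms)

lemma L2_inner_cong_AE:
  assumes "AE x in lebesgue_on S. v x = v' x" "v \<in> L2_space S" "v' \<in> L2_space S" "w \<in> L2_space S"
  shows "L2_inner S v w = L2_inner S v' w"
proof -
  have [measurable]: "v \<in> borel_measurable (lebesgue_on S)" "v' \<in> borel_measurable (lebesgue_on S)"
    "w \<in> borel_measurable (lebesgue_on S)"
    using assms by (auto simp: L2_space_def)
  show ?thesis unfolding L2_inner_def
    using assms(1) by (intro integral_cong_AE) auto
qed

lemma L2_norm_cmult: "L2_norm S (\<lambda>x. c * v x) = \<bar>c\<bar> * L2_norm S v"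
proof -
  have "L2_inner S (\<lambda>x. c * v x) (\<lambda>x. c * v x) = c\<^sup>2 * L2_inner S v v"
    by (metis L2_inner_cmult L2_inner_commute mult.assoc power2_eq_square)
  then show ?thesis by (simp add: L2_norm_def real_sqrt_mult)
qed

lemma L2_norm_divide: "L2_norm S (\<lambda>x. v x / c) = L2_norm S v / \<bar>c\<bar>"
  using L2_norm_cmult[of S "1/c" v] by simp

lemma L2_norm_add_le:
  assumes "v \<in> L2_space S" "w \<in> L2_space S"
  shows "L2_norm S (\<lambda>x. v x + w x) \<le> L2_norm S v + L2_norm S w"
  using L2_enorm_add[of S v w] assms by (simp add: L2_enorm_eq_norm L2_space_add flip: ennreal_plus)

lemma L2_norm_diff_le:
  assumes "v \<in> L2_space S" "w \<in> L2_space S"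
  shows "L2_norm S (\<lambda>x. v x - w x) \<le> L2_norm S v + L2_norm S w"
  using L2_norm_add_le[OF assms(1) L2_space_cmult[OF assms(2), of "-1"]] L2_norm_cmult[of S "-1" w] by simp

text \<open>The pairing of \<open>v\<close> with itself is the square of its norm, and one factor
  cancels.\<close>

lemma L2_norm_le_dual:
  assumes "v \<in> L2_space S" "\<bar>L2_inner S v v\<bar> \<le> c * L2_norm S v" "0 \<le> c"
  shows "L2_norm S v \<le> c"
proof (cases "L2_norm S v = 0")
  case False
  have "L2_norm S v * L2_norm S v \<le> c * L2_norm S v"
    using assms(2) L2_norm_power2[of S v] by (simp add: power2_eq_square)
  then show ?thesis using False by (simp add: order_less_le mult_le_cancel_right)
qed (use assms in simp)

text \<open>Lebesgue measure is complete, so changes on null sets preserve measurability; extension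
  by zero transfers this from the whole space to \<open>S\<close>.\<close>

lemma borel_measurable_lebesgue_on_AE:
  fixes v w :: "'a::euclidean_space \<Rightarrow> real"
  assumes "AE x in lebesgue_on S. v x = w x" "S \<in> sets lebesgue" "v \<in> borel_measurable (lebesgue_on S)"
  shows "w \<in> borel_measurable (lebesgue_on S)"
proof -
  have "AE x in lebesgue. (if x \<in> S then v x else 0) = (if x \<in> S then w x else 0)"
    using assms(1,2) by (simp add: AE_restrict_space_iff)
  moreover have "(\<lambda>x. if x \<in> S then v x else 0) \<in> borel_measurable lebesgue"
    using assms by (simp add: borel_measurable_if)
  ultimately have "(\<lambda>x. if x \<in> S then w x else 0) \<in> borel_measurable lebesgue"
    by (rule borel_measurable_AE[rotated])
  then show ?thesis using assms(2) by (simp add: borel_measurable_if)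
qed

lemma L2_space_cong_AE:
  assumes "AE x in lebesgue_on S. v x = w x" "S \<in> sets lebesgue" "v \<in> L2_space S"
  shows "w \<in> L2_space S"
proof -
  have [measurable]: "v \<in> borel_measurable (lebesgue_on S)" using assms by (auto simp: L2_space_def)
  have w[measurable]: "w \<in> borel_measurable (lebesgue_on S)"
    by (rule borel_measurable_lebesgue_on_AE) (use assms in auto)
  have "(\<integral>\<^sup>+x. (ennreal \<bar>v x\<bar>)\<^sup>2 \<partial>lebesgue_on S) = (\<integral>\<^sup>+x. (ennreal \<bar>w x\<bar>)\<^sup>2 \<partial>lebesgue_on S)"
    using assms(1) by (intro nn_integral_cong_AE) auto
  then show ?thesis using assms(3) w unfolding L2_enorm_finite_iff[symmetric] L2_enorm_eq by (simp split: if_splits)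
qed

lemma L2_inner_zero_imp_AE:
  assumes "v \<in> L2_space S" "L2_inner S v v = 0"
  shows "AE x in lebesgue_on S. v x = 0"
proof -
  have "AE x in lebesgue_on S. v x * v x = 0"
    using integral_nonneg_eq_0_iff_AE[OF L2_mult_integrable[OF assms(1) assms(1)]] assms(2)
    by (simp add: L2_inner_def)
  then show ?thesis by simp
qed

text \<open>Testing with the difference shows that its norm vanishes. Bochner integrals below are
  known only through their pairings, and this is how they are identified with concrete
  functions.\<close>

lemma L2_AE_eqI:
  assumes "v \<in> L2_space S" "w \<in> L2_space S" "\<And>z. z \<in> L2_space S \<Longrightarrow> L2_inner S v z = L2_inner S w z"
  shows "AE x in lebesgue_on S. v x = w x"
proof -
  let ?d = "\<lambda>x. v x - w x"
  have d: "?d \<in> L2_space S" using assms by (auto intro: L2_space_intros)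
  have "L2_inner S ?d ?d = 0"
    using assms d by (subst L2_inner_diff) auto
  from L2_inner_zero_imp_AE[OF d this] show ?thesis by simp
qed

section \<open>Smooth functions and the fundamental lemma of the calculus of variations\<close>

lemma Ck_SucI:
  assumes "\<And>x. (v has_derivative v' x) (at x)" "\<And>b. b \<in> Basis \<Longrightarrow> Ck m (\<lambda>x. v' x b)"
  shows "Ck (Suc m) v"
proof -
  have "frechet_derivative v (at x) = v' x" for x
    using frechet_derivative_at[OF assms(1)] by simp
  then show ?thesis using assms by (auto simp: differentiable_def)
qed

lemma Ck_SucD:
  "Ck (Suc m) v \<Longrightarrow> (v has_derivative frechet_derivative v (at x)) (at x)"
  by (simp flip: frechet_derivative_works)

lemma Ck_Suc_imp: "Ck (Suc m) v \<Longrightarrow> Ck m v"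
proof (induction m arbitrary: v)
  case 0
  then show ?case
    by (auto intro!: continuous_at_imp_continuous_on differentiable_imp_continuous_within)
next
  case (Suc m)
  then show ?case by (subst Ck.simps(2)) (auto simp del: Ck.simps simp add: Ck.simps(2)[of "Suc m"])
qed

lemma Ck_const: "Ck m (\<lambda>x. c)"
proof (induction m arbitrary: c)
  case (Suc m)
  show ?case by (rule Ck_SucI[where v'="\<lambda>x y. 0"]) (auto intro: Suc)
qed simp

lemma Ck_add: "Ck m v \<Longrightarrow> Ck m w \<Longrightarrow> Ck m (\<lambda>x. v x + w x)"
proof (induction m arbitrary: v w)
  case 0
  then show ?case by (simp add: continuous_on_add)
next
  case (Suc m)
  show ?case
    by (rule Ck_SucI[OF has_derivative_add[OF Ck_SucD[OF Suc.prems(1)] Ck_SucD[OF Suc.prems(2)]]])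
      (use Suc in auto)
qed

lemma Ck_cmult: "Ck m v \<Longrightarrow> Ck m (\<lambda>x. c * v x)"
proof (induction m arbitrary: v)
  case 0
  then show ?case by (simp add: continuous_on_mult_left)
next
  case (Suc m)
  show ?case
    by (rule Ck_SucI[OF has_derivative_mult_right[OF Ck_SucD[OF Suc.prems(1)]]]) (use Suc in auto)
qed

lemma Ck_mult: "Ck m v \<Longrightarrow> Ck m w \<Longrightarrow> Ck m (\<lambda>x. v x * w x)"
proof (induction m arbitrary: v w)
  case 0
  then show ?case by (simp add: continuous_on_mult)
next
  case (Suc m)
  show ?case
    by (rule Ck_SucI[OF has_derivative_mult[OF Ck_SucD[OF Suc.prems(1)] Ck_SucD[OF Suc.prems(2)]]])
      (use Suc in \<open>auto intro!: Ck_add Suc.IH simp del: Ck.simps intro: Ck_Suc_imp simp add: Ck.simps(2)[of m]\<close>)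
qed

lemma Ck_prod: "(\<And>i. i \<in> I \<Longrightarrow> Ck m (v i)) \<Longrightarrow> Ck m (\<lambda>x. \<Prod>i\<in>I. v i x)"
  by (induction I rule: infinite_finite_induct) (auto intro: Ck_const Ck_mult)

lemma Ck_real_SucI:
  fixes g :: "real \<Rightarrow> real"
  assumes "\<And>x. (g has_real_derivative g' x) (at x)" "Ck m g'"
  shows "Ck (Suc m) g"
proof (rule Ck_SucI[where v'="\<lambda>x y. g' x * y"])
  show "(g has_derivative (\<lambda>y. g' x * y)) (at x)" for x
    using assms(1)[of x] by (simp add: has_field_derivative_def)
qed (use assms(2) in simp)

text \<open>A partial derivative is a constant times the composition with the derivative of
  \<open>g\<close>, so the induction has to range over all \<open>g\<close>.\<close>

lemma Ck_compose_affine: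
  fixes g :: "real \<Rightarrow> real" and b :: "'a::euclidean_space"
  shows "Ck m g \<Longrightarrow> Ck m (\<lambda>x. g (s * (x \<bullet> b) + t))"
proof (induction m arbitrary: g)
  case 0
  then show ?case
    by (auto intro!: continuous_intros continuous_on_compose2[of UNIV g])
next
  case (Suc m)
  let ?d = "\<lambda>x. frechet_derivative g (at x)"
  have lin: "?d y z = z * ?d y 1" for y z
    using linear_cmul[OF has_derivative_linear[OF Ck_SucD[OF Suc.prems, of y]], of z 1] by simp
  have d: "((\<lambda>x. g (s * (x \<bullet> b) + t)) has_derivative (\<lambda>z. ?d (s * (x \<bullet> b) + t) (s * (z \<bullet> b)))) (at x)" for x
    by (rule has_derivative_compose[where g=g and f="\<lambda>x. s * (x \<bullet> b) + t" and s=UNIV])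
      (auto intro!: derivative_eq_intros Ck_SucD[OF Suc.prems])
  show ?case
  proof (rule Ck_SucI[OF d])
    fix c :: 'a
    have "Ck m (\<lambda>x. ?d x 1)" using Suc.prems by simp
    from Ck_cmult[OF Suc.IH[OF this], of "s * (c \<bullet> b)"]
    show "Ck m (\<lambda>x. ?d (s * (x \<bullet> b) + t) (s * (c \<bullet> b)))"
      by (subst lin)
  qed
qed

lemma smooth_real_iff_deriv:
  fixes g :: "real \<Rightarrow> real"
  assumes "smooth_fun g"
  shows "(g has_real_derivative deriv g x) (at x)" "smooth_fun (deriv g)"
proof -
  have c: "Ck (Suc m) g" for m using assms unfolding smooth_fun_def by blast
  have lin: "frechet_derivative g (at y) z = frechet_derivative g (at y) 1 * z" for y z
    using linear_cmul[OF has_derivative_linear[OF Ck_SucD[OF c[of 0], of y]], of z 1] by simp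
  have d: "(g has_real_derivative frechet_derivative g (at y) 1) (at y)" for y
    using Ck_SucD[OF c[of 0], of y] unfolding has_field_derivative_def
    by (rule has_derivative_eq_rhs) (rule ext, rule lin)
  then have e: "deriv g = (\<lambda>y. frechet_derivative g (at y) 1)"
    by (auto intro: DERIV_imp_deriv)
  show "(g has_real_derivative deriv g x) (at x)" using d e by simp
  show "smooth_fun (deriv g)" unfolding e smooth_fun_def using c by simp
qed

section \<open>Smooth bump functions on boxes\<close>

text \<open>The powers of 1/x are carried along because differentiation maps the family into itself:
  each derivative is a combination of two other members. Letting \<open>c\<close> tend to 0 makes
  the function with \<open>n\<close> = 0 rise to the indicator of the positive half-line.\<close>

definition exp_bump :: "real \<Rightarrow> nat \<Rightarrow> real \<Rightarrow> real" where
  "exp_bump c n x = (if x > 0 then (1 / x) ^ n * exp (- c / x) else 0)"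

text \<open>With y = c/x this is the decay of y^n / exp y at infinity.\<close>

lemma exp_bump_tendsto_0:
  assumes "c > 0"
  shows "(exp_bump c n \<longlongrightarrow> 0) (at_right 0)"
proof -
  have "filterlim (\<lambda>x. c * inverse x) at_top (at_right (0::real))"
    by (rule filterlim_tendsto_pos_mult_at_top[OF tendsto_const assms filterlim_inverse_at_top_right])
  then have "((\<lambda>x. (c * inverse x) ^ n / exp (c * inverse x)) \<longlongrightarrow> 0) (at_right 0)"
    by (rule filterlim_compose[OF tendsto_power_div_exp_0])
  then have "((\<lambda>x. (1 / c ^ n) * ((c * inverse x) ^ n / exp (c * inverse x))) \<longlongrightarrow> (1 / c ^ n) * 0) (at_right 0)"
    by (rule tendsto_mult_left)
  moreover have "\<forall>\<^sub>F x in at_right 0. (1 / c ^ n) * ((c * inverse x) ^ n / exp (c * inverse x)) = exp_bump c n x"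
    using assms by (auto simp: eventually_at_right_field exp_bump_def exp_minus field_simps intro!: exI[of _ 1])
  ultimately show ?thesis by (simp add: filterlim_cong)
qed

lemma exp_bump_deriv:
  assumes "c > 0"
  shows "(exp_bump c n has_real_derivative (- real n * exp_bump c (n+1) x + c * exp_bump c (n+2) x)) (at x)"
proof -
  consider "x > 0" | "x < 0" | "x = 0" by linarith
  then show ?thesis
  proof cases
    case 1
    have "((\<lambda>x. (1 / x) ^ n * exp (- c / x)) has_real_derivative
       (- real n * exp_bump c (n+1) x + c * exp_bump c (n+2) x)) (at x)"
    proof -
      have "((\<lambda>x. (1 / x) ^ n) has_real_derivative real n * (1 / x) ^ (n - 1) * (- 1 / x\<^sup>2)) (at x)"
        using 1 by (auto intro!: derivative_eq_intros simp: power2_eq_square)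
      moreover have "((\<lambda>x. exp (- c / x)) has_real_derivative exp (- c / x) * (c / x\<^sup>2)) (at x)"
        using 1 by (auto intro!: derivative_eq_intros simp: power2_eq_square)
      ultimately have "((\<lambda>x. (1 / x) ^ n * exp (- c / x)) has_real_derivative
          real n * (1 / x) ^ (n - 1) * (- 1 / x\<^sup>2) * exp (- c / x) + exp (- c / x) * (c / x\<^sup>2) * (1 / x) ^ n) (at x)"
        by (rule DERIV_mult)
      moreover have "real n * (1 / x) ^ (n - 1) * (- 1 / x\<^sup>2) * exp (- c / x) + exp (- c / x) * (c / x\<^sup>2) * (1 / x) ^ n
          = - real n * exp_bump c (n+1) x + c * exp_bump c (n+2) x"
        using 1 by (cases n) (simp_all add: exp_bump_def power2_eq_square field_simps)
      ultimately show ?thesis by simp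
    qed
    then show ?thesis
      by (rule has_field_derivative_transform_within_open[where S="{0<..}"]) (use 1 in \<open>auto simp: exp_bump_def\<close>)
  next
    case 2
    have "((\<lambda>x. 0) has_real_derivative (- real n * exp_bump c (n+1) x + c * exp_bump c (n+2) x)) (at x)"
      using 2 by (simp add: exp_bump_def)
    then show ?thesis
      by (rule has_field_derivative_transform_within_open[where S="{..<0}"]) (use 2 in \<open>auto simp: exp_bump_def\<close>)
  next
    case 3
    \<comment> \<open>At 0 the difference quotient is the member with power \<open>n\<close> + 1 on
      the right and vanishes on the left.\<close>
    have "((\<lambda>h. exp_bump c n h / h) \<longlongrightarrow> 0) (at_right 0)"
    proof (rule Lim_transform_eventually[OF exp_bump_tendsto_0[OF assms, of "n+1"]])
      show "\<forall>\<^sub>F x in at_right 0. exp_bump c (n + 1) x = exp_bump c n x / x"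
        by (auto simp: eventually_at_right_field exp_bump_def intro!: exI[of _ 1])
    qed
    moreover have "((\<lambda>h. exp_bump c n h / h) \<longlongrightarrow> 0) (at_left 0)"
      by (rule Lim_transform_eventually[OF tendsto_const])
        (auto simp: eventually_at_left_field exp_bump_def intro!: exI[of _ "-1"])
    ultimately have "((\<lambda>h. exp_bump c n h / h) \<longlongrightarrow> 0) (at 0)"
      by (simp add: filterlim_split_at)
    then show ?thesis using 3 by (simp add: DERIV_def exp_bump_def[of c _ 0])
  qed
qed

lemma Ck_exp_bump: "c > 0 \<Longrightarrow> Ck m (exp_bump c n)"
proof (induction m arbitrary: n)
  case 0
  then show ?case
    using exp_bump_deriv[of c n] by (auto intro!: continuous_at_imp_continuous_on DERIV_isCont)
next
  case (Suc m)
  show ?case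
    by (rule Ck_real_SucI[OF exp_bump_deriv[OF Suc.prems]]) (intro Ck_add Ck_cmult Suc)
qed

text \<open>One factor for each face of the box, vanishing beyond that face.\<close>

definition box_bump :: "real \<Rightarrow> 'a::euclidean_space \<Rightarrow> 'a \<Rightarrow> 'a \<Rightarrow> real" where
  "box_bump c a b x = (\<Prod>i\<in>Basis. exp_bump c 0 (x \<bullet> i - a \<bullet> i) * exp_bump c 0 (b \<bullet> i - x \<bullet> i))"

lemma box_bump_smooth: "c > 0 \<Longrightarrow> smooth_fun (box_bump c a b)"
  unfolding smooth_fun_def box_bump_def
proof (intro allI Ck_prod Ck_mult)
  fix m i assume "c > 0"
  from Ck_compose_affine[OF Ck_exp_bump[OF this], where s=1 and b=i and t="-(a \<bullet> i)" and m=m]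
  show "Ck m (\<lambda>x. exp_bump c 0 (x \<bullet> i - a \<bullet> i))" by simp
  from Ck_compose_affine[OF Ck_exp_bump[OF \<open>c > 0\<close>], where s="-1" and b=i and t="b \<bullet> i" and m=m]
  show "Ck m (\<lambda>x. exp_bump c 0 (b \<bullet> i - x \<bullet> i))" by simp
qed

lemma box_bump_0: "x \<notin> box a b \<Longrightarrow> box_bump c a b x = 0"
  by (auto simp: box_bump_def box_def exp_bump_def intro!: prod_zero)

lemma exp_bump_bounds: "c > 0 \<Longrightarrow> 0 \<le> exp_bump c 0 x \<and> exp_bump c 0 x \<le> 1"
  by (simp add: exp_bump_def)

lemma box_bump_bounds: "c > 0 \<Longrightarrow> 0 \<le> box_bump c a b x" "c > 0 \<Longrightarrow> box_bump c a b x \<le> 1"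
  unfolding box_bump_def by (auto intro!: prod_nonneg prod_le_1 mult_le_one simp: exp_bump_bounds)

lemma box_bump_test_fun: "c > 0 \<Longrightarrow> cbox a b \<subseteq> S \<Longrightarrow> box_bump c a b \<in> test_fun S"
  unfolding test_fun_def
  by (intro CollectI conjI exI[of _ "cbox a b"] allI impI box_bump_smooth box_bump_0)
    (use box_subset_cbox[of a b] in auto)

text \<open>Inside the box every factor is exp(-c/y) with a fixed y > 0 and tends to 1; outside, the
  function is 0 for every \<open>c\<close>. Indicators of boxes are thus approximated without
  mollification.\<close>

lemma box_bump_tendsto:
  fixes a :: "'a::euclidean_space"
  shows "(\<lambda>j. box_bump (1 / real (Suc j)) a b x) \<longlonglongrightarrow> indicator (box a b) x"
proof (cases "x \<in> box a b")
  case True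
  have e: "(\<lambda>j. exp_bump (1 / real (Suc j)) 0 y) \<longlonglongrightarrow> 1" if "y > 0" for y
  proof -
    have "(\<lambda>j. exp (- (1 / real (Suc j)) / y)) \<longlonglongrightarrow> exp (- 0 / y)"
      by (intro tendsto_intros LIMSEQ_Suc[OF lim_1_over_n]) (use that in auto)
    then show ?thesis using that by (simp add: exp_bump_def)
  qed
  have "(\<lambda>j. box_bump (1 / real (Suc j)) a b x) \<longlonglongrightarrow> (\<Prod>i\<in>(Basis::'a set). 1 * 1)"
    unfolding box_bump_def
    by (intro tendsto_prod tendsto_mult e) (use True in \<open>auto simp: box_def\<close>)
  then show ?thesis using True by simp
qed (simp add: box_bump_0)

section \<open>The fundamental lemma of the calculus of variations\<close>

text \<open>Open boxes form an intersection-stable generator of the Borel sets. The sets over which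
  the integral vanishes are closed under complements and countable disjoint unions, so they include
  all Borel sets, and a function with vanishing integrals over all of them is 0 almost
  everywhere.\<close>

lemma AE_0_if_box_integrals_0:
  fixes F :: "'a::euclidean_space \<Rightarrow> real"
  assumes F: "integrable lebesgue F" and z: "\<And>c d. (LINT x|lebesgue. indicator (box c d) x * F x) = 0"
  shows "AE x in lebesgue. F x = 0"
proof -
  \<comment> \<open>The induction runs over Borel sets and \<open>lborel\<close>, whereas
    \<open>F\<close> is only Lebesgue measurable; a Borel representative takes its place.\<close>
  obtain G where G[measurable]: "G \<in> borel_measurable lborel" and FG: "AE x in lborel. F x = G x"
    using completion_ex_borel_measurable_real[of F lborel] F by auto
  have FG': "AE x in lebesgue. F x = G x" using FG by (rule AE_completion)
  have iG': "integrable lebesgue G"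
    using F FG' integrable_cong_AE[of F lebesgue G] by (simp add: measurable_completion)
  then have iG: "integrable lborel G" by (simp add: integrable_completion)
  have si: "set_integrable lborel A G" if "A \<in> sets borel" for A
    unfolding set_integrable_def by (rule integrable_mult_indicator) (use iG that in auto)
  have zb: "(LINT x:box c d|lborel. G x) = 0" for c d
  proof -
    have "(LINT x:box c d|lborel. G x) = (LINT x|lebesgue. indicator (box c d) x * G x)"
      unfolding set_lebesgue_integral_def by (simp add: integral_completion)
    also have "\<dots> = (LINT x|lebesgue. indicator (box c d) x * F x)"
    proof (rule integral_cong_AE)
      have i: "(\<lambda>x. indicator (box c d) x) \<in> borel_measurable lebesgue" by (simp add: measurable_completion)
      show "(\<lambda>x. indicator (box c d) x * G x) \<in> borel_measurable lebesgue"
        "(\<lambda>x. indicator (box c d) x * F x) \<in> borel_measurable lebesgue"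
        by (intro borel_measurable_times i borel_measurable_integrable F iG')+
    qed (use FG' in auto)
    finally show ?thesis using z by simp
  qed
  \<comment> \<open>Complements require the integral over the whole space, obtained by exhausting it
    with growing boxes.\<close>
  have zU: "(LINT x|lborel. G x) = 0"
  proof -
    let ?A = "\<lambda>n::nat. box (- (real n *\<^sub>R One)) (real n *\<^sub>R One) :: 'a set"
    have "(\<lambda>n. LINT x|lborel. indicator (?A n) x *\<^sub>R G x) \<longlonglongrightarrow> (LINT x|lborel. G x)"
    proof (rule integral_dominated_convergence[where w="\<lambda>x. norm (G x)"])
      show "AE x in lborel. (\<lambda>n. indicator (?A n) x *\<^sub>R G x) \<longlonglongrightarrow> G x"
      proof (rule AE_I2)
        fix x :: 'a
        obtain n0 where n0: "x \<in> ?A n0" using UN_box_eq_UNIV by blast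
        have "x \<in> ?A n" if "n \<ge> n0" for n
        proof -
          have "?A n0 \<subseteq> ?A n" using that by (intro subset_box_imp) (auto simp: inner_Basis)
          then show ?thesis using n0 by blast
        qed
        then have "\<forall>\<^sub>F n in sequentially. indicator (?A n) x *\<^sub>R G x = G x"
          unfolding eventually_sequentially by (intro exI[of _ n0]) simp
        then show "(\<lambda>n. indicator (?A n) x *\<^sub>R G x) \<longlonglongrightarrow> G x" by (rule tendsto_eventually)
      qed
    qed (use iG in \<open>auto simp: indicator_def\<close>)
    then show ?thesis using zb LIMSEQ_unique[OF _ tendsto_const, of "\<lambda>_. 0"]
      by (simp add: set_lebesgue_integral_def LIMSEQ_const_iff)
  qed
  have "(LINT x:A|lborel. G x) = 0" if A: "A \<in> sets lborel" for A
  proof -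
    have A': "A \<in> sigma_sets UNIV (range (\<lambda>(a, b). box a b :: 'a set))"
      using A by (simp add: borel_eq_box)
    have sb: "B \<in> sigma_sets UNIV (range (\<lambda>(a, b). box a b :: 'a set)) \<Longrightarrow> B \<in> sets borel" for B
      by (simp add: borel_eq_box)
    have I: "Int_stable (range (\<lambda>(a, b). box a b :: 'a set))"
      by (auto simp: Int_stable_def Int_interval box_Int_box)
    show ?thesis
    proof (rule sigma_sets_induct_disjoint[OF I _ A'])
      fix B assume "B \<in> sigma_sets UNIV (range (\<lambda>(a, b). box a b :: 'a set))" and e: "(LINT x:B|lborel. G x) = 0"
      then have B: "B \<in> sets borel" using sb by blast
      have "(LINT x:UNIV - B|lborel. G x) = (LINT x|lborel. G x - indicator B x *\<^sub>R G x)"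
        unfolding set_lebesgue_integral_def by (rule Bochner_Integration.integral_cong) (auto simp: indicator_def)
      also have "\<dots> = 0"
        using e zU iG si[OF B] by (subst Bochner_Integration.integral_diff)
          (auto simp: set_lebesgue_integral_def set_integrable_def)
      finally show "(LINT x:UNIV - B|lborel. G x) = 0" .
    next
      fix B :: "nat \<Rightarrow> 'a set"
      assume d: "disjoint_family B" and r: "range B \<subseteq> sigma_sets UNIV (range (\<lambda>(a, b). box a b :: 'a set))"
        and e: "\<And>i. (LINT x:B i|lborel. G x) = 0"
      have Bi: "B i \<in> sets borel" for i using r sb by blast
      have "(LINT x:(\<Union>i. B i)|lborel. G x) = (\<Sum>i. (LINT x:B i|lborel. G x))"
        by (rule lebesgue_integral_countable_add) (use Bi d in \<open>auto intro!: si simp: disjoint_family_on_def\<close>)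
      then show "(LINT x:\<Union>(range B)|lborel. G x) = 0" using e by simp
    qed (use zb in \<open>auto simp: set_lebesgue_integral_def\<close>)
  qed
  from sigma_finite_measure.density_zero[OF sigma_finite_lborel iG this] have "AE x in lborel. G x = 0" .
  then have "AE x in lebesgue. G x = 0" by (rule AE_completion)
  with FG' show ?thesis by eventually_elim simp
qed

text \<open>Bump functions tending to the indicator of a box show that the integral of
  \<open>w\<close> vanishes over every box whose closure lies in \<open>S\<close>; |w| on the closed
  box is the dominating function. Countably many closed boxes cover \<open>S\<close>.\<close>

lemma fundamental_lemma_calculus_of_variations:
  fixes w :: "'a::euclidean_space \<Rightarrow> real"
  assumes S: "open S" and loc: "\<And>K. compact K \<Longrightarrow> K \<subseteq> S \<Longrightarrow> integrable (lebesgue_on K) w"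
    and test: "\<And>\<phi>. \<phi> \<in> test_fun S \<Longrightarrow> (LINT x|lebesgue_on S. w x * \<phi> x) = 0"
  shows "AE x in lebesgue_on S. w x = 0"
proof -
  have Sl: "S \<in> sets lebesgue" using S by auto
  have int: "integrable lebesgue (\<lambda>x. indicator (cbox a b) x * w x)" if "cbox a b \<subseteq> S" for a b
    using loc[of "cbox a b"] that by (simp add: integrable_restrict_space)
  have box0: "(LINT x|lebesgue. indicator (box a b) x * w x) = 0" if ab: "cbox a b \<subseteq> S" for a b
  proof -
    let ?c = "\<lambda>j. 1 / real (Suc j)"
    have z: "(LINT x|lebesgue. (indicator (cbox a b) x * w x) * box_bump (?c j) a b x) = 0" for j
    proof -
      have "(LINT x|lebesgue. (indicator (cbox a b) x * w x) * box_bump (?c j) a b x)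
          = (LINT x|lebesgue. indicator S x *\<^sub>R (w x * box_bump (?c j) a b x))"
        using ab box_subset_cbox[of a b] box_bump_0[of _ a b "?c j"]
        by (intro Bochner_Integration.integral_cong refl) (auto simp: indicator_def)
      also have "\<dots> = (LINT x|lebesgue_on S. w x * box_bump (?c j) a b x)"
        using Sl by (subst integral_restrict_space) auto
      also have "\<dots> = 0" by (rule test[OF box_bump_test_fun[OF _ ab]]) simp
      finally show ?thesis .
    qed
    have "(\<lambda>j. LINT x|lebesgue. (indicator (cbox a b) x * w x) * box_bump (?c j) a b x)
       \<longlonglongrightarrow> (LINT x|lebesgue. (indicator (cbox a b) x * w x) * indicator (box a b) x)"
    proof (rule integral_dominated_convergence[where w="\<lambda>x. norm (indicator (cbox a b) x * w x)"])
      have "box_bump (?c j) a b \<in> borel_measurable lebesgue" for j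
      proof -
        have "Ck 0 (box_bump (?c j) a b)"
          using box_bump_smooth[of "?c j" a b] unfolding smooth_fun_def by simp
        then show ?thesis by (simp add: borel_measurable_continuous_onI measurable_completion)
      qed
      then show "(\<lambda>x. (indicator (cbox a b) x * w x) * box_bump (?c j) a b x) \<in> borel_measurable lebesgue" for j
        using int[OF ab] by auto
      show "AE x in lebesgue. norm ((indicator (cbox a b) x * w x) * box_bump (?c j) a b x) \<le> norm (indicator (cbox a b) x * w x)" for j
        using box_bump_bounds[of "?c j" a b] by (auto simp: abs_mult intro!: mult_right_le_one_le)
      show "(\<lambda>x. (indicator (cbox a b) x * w x) * indicator (box a b) x) \<in> borel_measurable lebesgue"
        by (rule borel_measurable_times[OF borel_measurable_integrable[OF int[OF ab]]]) (simp add: measurable_completion)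
      show "AE x in lebesgue. (\<lambda>j. (indicator (cbox a b) x * w x) * box_bump (?c j) a b x)
          \<longlonglongrightarrow> (indicator (cbox a b) x * w x) * indicator (box a b) x"
        by (intro AE_I2 tendsto_mult_left box_bump_tendsto)
    qed (use int[OF ab] in auto)
    then have "(LINT x|lebesgue. (indicator (cbox a b) x * w x) * indicator (box a b) x) = 0"
      by (simp only: z LIMSEQ_const_iff)
    moreover have "(LINT x|lebesgue. (indicator (cbox a b) x * w x) * indicator (box a b) x)
        = (LINT x|lebesgue. indicator (box a b) x * w x)"
      using box_subset_cbox[of a b] by (intro Bochner_Integration.integral_cong refl) (auto simp: indicator_def)
    ultimately show ?thesis by simp
  qed
  have AEb: "AE x in lebesgue. x \<in> cbox a b \<longrightarrow> w x = 0" if ab: "cbox a b \<subseteq> S" for a b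
  proof -
    have "AE x in lebesgue. indicator (box a b) x * w x = 0"
    proof (rule AE_0_if_box_integrals_0)
      have "integrable lebesgue (\<lambda>x. indicator (box a b) x *\<^sub>R (indicator (cbox a b) x * w x))"
        by (rule integrable_mult_indicator[OF _ int[OF ab]]) auto
      moreover have "(\<lambda>x. indicator (box a b) x *\<^sub>R (indicator (cbox a b) x * w x)) = (\<lambda>x. indicator (box a b) x * w x)"
        using box_subset_cbox[of a b] by (intro ext) (auto simp: indicator_def)
      ultimately show "integrable lebesgue (\<lambda>x. indicator (box a b) x * w x)" by simp
      fix c d
      obtain c' d' where cd: "box a b \<inter> box c d = box c' d'" "cbox a b \<inter> cbox c d = cbox c' d'"
        by (rule that[OF box_Int_box Int_interval])
      have "(LINT x|lebesgue. indicator (box c d) x * (indicator (box a b) x * w x))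
          = (LINT x|lebesgue. indicator (box c' d') x * w x)"
        unfolding cd(1)[symmetric] by (intro Bochner_Integration.integral_cong refl) (auto simp: indicator_def)
      also have "\<dots> = 0" using cd(2) ab by (intro box0) blast
      finally show "(LINT x|lebesgue. indicator (box c d) x * (indicator (box a b) x * w x)) = 0" .
    qed
    \<comment> \<open>The integral argument gives \<open>w\<close> = 0 on the open box; the cover
      consists of closed boxes, whose boundaries are null sets.\<close>
    moreover have "AE x in lebesgue. x \<notin> cbox a b - box a b"
      using negligible_frontier_interval[of a b] unfolding negligible_iff_null_sets by (rule AE_not_in)
    ultimately show ?thesis by eventually_elim (auto simp: indicator_def split: if_splits)
  qed
  obtain D where D: "countable D" "D \<subseteq> Pow S" "\<And>X. X \<in> D \<Longrightarrow> \<exists>a b. X = cbox a b" "\<Union>D = S"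
    using open_countable_Union_open_cbox[OF S] by metis
  have "AE x in lebesgue. \<forall>X\<in>D. x \<in> X \<longrightarrow> w x = 0"
    unfolding AE_ball_countable[OF D(1)] using AEb D(2,3) by blast
  then have "AE x in lebesgue. x \<in> S \<longrightarrow> w x = 0"
    by eventually_elim (use D(4) in auto)
  then show ?thesis using Sl by (simp add: AE_restrict_space_iff)
qed

section \<open>Weak derivatives and completeness of Sobolev spaces\<close>

text \<open>Balls of natural radius exhaust the space. Tonelli's theorem for the double integral in
  the Slobodeckij seminorm rests on this.\<close>

lemma sigma_finite_lebesgue_on:
  "S \<in> sets lebesgue \<Longrightarrow> sigma_finite_measure (lebesgue_on (S :: 'a::euclidean_space set))"
proof (rule sigma_finite_measure_restrict_space)
  let ?A = "\<lambda>n::nat. cball (0::'a) (real n)"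
  show "sigma_finite_measure (lebesgue :: 'a measure)"
  proof
    show "\<exists>A. countable A \<and> A \<subseteq> sets (lebesgue :: 'a measure) \<and> \<Union> A = space lebesgue \<and> (\<forall>a\<in>A. emeasure lebesgue a \<noteq> \<infinity>)"
    proof (intro exI[of _ "range ?A"] conjI)
      show "\<Union> (range ?A) = space lebesgue"
        by (auto intro: real_arch_simple)
      show "\<forall>a\<in>range ?A. emeasure lebesgue a \<noteq> \<infinity>"
        using emeasure_bounded_finite[of "cball (0::'a) _"] by (auto simp: emeasure_lborel_cball_finite less_top)
    qed auto
  qed
qed

lemma integrable_lebesgue_on_subset:
  fixes f :: "'a::euclidean_space \<Rightarrow> real"
  assumes "integrable (lebesgue_on S) f" "K \<subseteq> S" "K \<in> sets lebesgue" "S \<in> sets lebesgue"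
  shows "integrable (lebesgue_on K) f"
proof -
  have "integrable lebesgue (\<lambda>x. indicator S x *\<^sub>R f x)"
    using assms by (simp add: integrable_restrict_space)
  from integrable_mult_indicator[OF assms(3) this]
  have "integrable lebesgue (\<lambda>x. indicator K x *\<^sub>R f x)"
    by (rule Bochner_Integration.integrable_cong[THEN iffD1, rotated -1]) (use assms(2) in \<open>auto simp: indicator_def\<close>)
  then show ?thesis using assms(3) by (simp add: integrable_restrict_space)
qed

lemma test_funE:
  assumes "\<phi> \<in> test_fun S"
  obtains K B where "compact K" "K \<subseteq> S" "\<And>x. x \<notin> K \<Longrightarrow> \<phi> x = 0" "\<And>x. \<bar>\<phi> x\<bar> \<le> B" "continuous_on UNIV \<phi>"
proof -
  obtain K where K: "compact K" "K \<subseteq> S" "\<And>x. x \<notin> K \<Longrightarrow> \<phi> x = 0" "smooth_fun \<phi>"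
    using assms by (auto simp: test_fun_def)
  have c: "continuous_on UNIV \<phi>" using K(4) unfolding smooth_fun_def by (metis Ck.simps(1))
  have "bounded (\<phi> ` K)"
    by (intro compact_imp_bounded compact_continuous_image continuous_on_subset[OF c] K) auto
  then obtain B where B: "\<And>x. x \<in> K \<Longrightarrow> norm (\<phi> x) \<le> B" "B > 0" unfolding bounded_pos by auto
  have "\<bar>\<phi> x\<bar> \<le> B" for x using B K(3)[of x] by (cases "x \<in> K") auto
  with K c that show thesis by blast
qed

lemma test_fun_borel_measurable: "\<phi> \<in> test_fun S \<Longrightarrow> \<phi> \<in> borel_measurable borel"
  by (elim test_funE) (simp add: borel_measurable_continuous_onI)

lemma test_fun_measurable_lebesgue_on: "\<phi> \<in> test_fun S \<Longrightarrow> \<phi> \<in> borel_measurable (lebesgue_on A)"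
  using test_fun_borel_measurable[of \<phi> S]
  by (simp add: measurable_restrict_space1 measurable_completion)

lemma integrable_mult_bounded:
  fixes f \<phi> :: "'a \<Rightarrow> real"
  assumes "integrable M f" "\<phi> \<in> borel_measurable M" "\<And>x. \<bar>\<phi> x\<bar> \<le> B"
  shows "integrable M (\<lambda>x. f x * \<phi> x)"
proof (rule Bochner_Integration.integrable_bound)
  show "integrable M (\<lambda>x. B * norm (f x))" using assms by auto
  have "norm (f x * \<phi> x) \<le> norm (B * norm (f x))" for x
    using assms(3)[of x] by (simp add: abs_mult mult.commute) (meson abs_ge_self abs_ge_zero mult_right_mono order_trans)
  then show "AE x in M. norm (f x * \<phi> x) \<le> norm (B * norm (f x))" by simp
qed (use assms in auto)

lemma integrable_mult_test_fun:
  fixes g :: "'a::euclidean_space \<Rightarrow> real"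
  assumes "\<phi> \<in> test_fun S" "\<And>K. compact K \<Longrightarrow> K \<subseteq> S \<Longrightarrow> integrable (lebesgue_on K) g" "S \<in> sets lebesgue"
  shows "integrable (lebesgue_on S) (\<lambda>x. g x * \<phi> x)"
proof -
  obtain K B where K: "compact K" "K \<subseteq> S" "\<And>x. x \<notin> K \<Longrightarrow> \<phi> x = 0" "\<And>x. \<bar>\<phi> x\<bar> \<le> B" "continuous_on UNIV \<phi>"
    by (rule test_funE[OF assms(1)]) blast
  have Kl: "K \<in> sets lebesgue" using K(1) by (simp add: borel_compact)
  have "integrable lebesgue (\<lambda>x. indicator K x * g x)"
    using assms(2)[OF K(1,2)] Kl by (simp add: integrable_restrict_space)
  then have "integrable lebesgue (\<lambda>x. (indicator K x * g x) * \<phi> x)"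
    by (rule integrable_mult_bounded[OF _ _ K(4)])
      (use test_fun_borel_measurable[OF assms(1)] in \<open>simp add: measurable_completion\<close>)
  moreover have "(\<lambda>x. (indicator K x * g x) * \<phi> x) = (\<lambda>x. indicator S x *\<^sub>R (g x * \<phi> x))"
    using K(2,3) by (intro ext) (auto simp: indicator_def)
  ultimately show ?thesis using assms(3) by (simp add: integrable_restrict_space)
qed

lemma test_fun_locally_integrable:
  assumes "\<phi> \<in> test_fun S" "compact K"
  shows "integrable (lebesgue_on K) \<phi>"
proof -
  obtain B where B: "\<And>x. \<bar>\<phi> x\<bar> \<le> B" by (rule test_funE[OF assms(1)]) blast
  have "finite_measure (lebesgue_on K)"
    using assms(2) emeasure_bounded_finite[OF compact_imp_bounded[OF assms(2)]]
    by (intro finite_measureI) (auto simp: emeasure_restrict_space borel_compact space_restrict_space)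
  then show ?thesis
    by (rule finite_measure.integrable_const_bound[where B=B])
      (use B test_fun_measurable_lebesgue_on[OF assms(1)] in auto)
qed

lemma test_fun_L2_space: "\<phi> \<in> test_fun S \<Longrightarrow> S \<in> sets lebesgue \<Longrightarrow> \<phi> \<in> L2_space S"
  using integrable_mult_test_fun[of \<phi> S \<phi>] test_fun_locally_integrable[of \<phi> S] test_fun_measurable_lebesgue_on[of \<phi> S S]
  by (simp add: L2_space_def power2_eq_square)

text \<open>The complement of the compact support is open and the function vanishes there, so the
  derivative vanishes there too and the same compact set serves.\<close>

lemma test_fun_frechet_derivative:
  assumes "\<phi> \<in> test_fun S" "b \<in> Basis"
  shows "(\<lambda>x. frechet_derivative \<phi> (at x) b) \<in> test_fun S"
proof -
  obtain K where K: "compact K" "K \<subseteq> S" "\<And>x. x \<notin> K \<Longrightarrow> \<phi> x = 0" and s: "smooth_fun \<phi>"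
    using assms(1) by (auto simp: test_fun_def)
  have "Ck (Suc m) \<phi>" for m using s unfolding smooth_fun_def by blast
  then have "smooth_fun (\<lambda>x. frechet_derivative \<phi> (at x) b)"
    unfolding smooth_fun_def using assms(2) by simp
  moreover have "frechet_derivative \<phi> (at x) b = 0" if "x \<notin> K" for x
  proof -
    have "(\<phi> has_derivative (\<lambda>_. 0)) (at x)"
      by (rule has_derivative_transform_within_open[OF has_derivative_const[of 0], where s="-K"])
        (use K that in \<open>auto simp: compact_imp_closed open_Compl\<close>)
    from frechet_derivative_at[OF this] show ?thesis by metis
  qed
  ultimately show ?thesis using K by (auto simp: test_fun_def)
qed

lemma pderivs_test_fun: "\<phi> \<in> test_fun S \<Longrightarrow> pderivs il \<phi> \<in> test_fun S"
  by (induction il) (auto intro!: test_fun_frechet_derivative simp: Basis_vec_def)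

lemma test_fun_linear:
  assumes "\<phi> \<in> test_fun S" "\<psi> \<in> test_fun S"
  shows "(\<lambda>x. a * \<phi> x + b * \<psi> x) \<in> test_fun S"
proof -
  obtain K where K: "compact K" "K \<subseteq> S" "\<And>x. x \<notin> K \<Longrightarrow> \<phi> x = 0" and s: "smooth_fun \<phi>"
    using assms(1) by (auto simp: test_fun_def)
  obtain K' where K': "compact K'" "K' \<subseteq> S" "\<And>x. x \<notin> K' \<Longrightarrow> \<psi> x = 0" and s': "smooth_fun \<psi>"
    using assms(2) by (auto simp: test_fun_def)
  have "smooth_fun (\<lambda>x. a * \<phi> x + b * \<psi> x)"
    using s s' unfolding smooth_fun_def by (intro allI Ck_add Ck_cmult) blast+
  moreover have "compact (K \<union> K')" "K \<union> K' \<subseteq> S" using K K' by auto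
  ultimately show ?thesis unfolding test_fun_def using K(3) K'(3)
    by (intro CollectI conjI exI[of _ "K \<union> K'"]) auto
qed

lemma zero_test_fun: "(\<lambda>x. 0) \<in> test_fun S"
  unfolding test_fun_def smooth_fun_def by (auto intro!: Ck_const exI[of _ "{}"])

lemma L2_space_subset:
  assumes "v \<in> L2_space S" "K \<subseteq> S" "K \<in> sets lebesgue" "S \<in> sets lebesgue"
  shows "v \<in> L2_space K"
  using integrable_lebesgue_on_subset[OF _ assms(2-4)] measurable_restrict_mono[OF _ assms(2)] assms(1)
  unfolding L2_space_def by blast

text \<open>On a compact set the constant 1 is square integrable, so Cauchy-Schwarz gives
  integrability.\<close>

lemma L2_locally_integrable:
  assumes "v \<in> L2_space S" "S \<in> sets lebesgue"
  shows "locally_integrable S v"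
  unfolding locally_integrable_def
proof (intro allI impI)
  fix K assume K: "compact K \<and> K \<subseteq> S"
  then have Kl: "K \<in> sets lebesgue" by (simp add: borel_compact)
  have v: "v \<in> L2_space K" using L2_space_subset assms K Kl by blast
  have "finite_measure (lebesgue_on K)"
    using K emeasure_bounded_finite[OF compact_imp_bounded, of K]
    by (intro finite_measureI) (auto simp: emeasure_restrict_space borel_compact space_restrict_space)
  then have "(\<lambda>x. 1) \<in> L2_space K" by (simp add: L2_space_def finite_measure.integrable_const)
  from L2_mult_integrable[OF v this] show "integrable (lebesgue_on K) v" by simp
qed

section \<open>Absolutely convergent series in \<open>L2\<close>\<close>

text \<open>Riesz-Fischer in series form: by Minkowski the sum of the absolute values is square
  integrable, hence finite almost everywhere. The limit is the concrete pointwise sum, which makes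
  series of functions and of their derivatives directly comparable. Pairings are summed termwise
  because Cauchy-Schwarz makes the \<open>L1\<close> norms of the products summable.\<close>

lemma L2_suminf:
  fixes w :: "nat \<Rightarrow> 'a::euclidean_space \<Rightarrow> real"
  assumes w: "\<And>j. w j \<in> L2_space S" and fin: "(\<Sum>j. L2_enorm S (w j)) < \<infinity>"
  defines "W \<equiv> \<lambda>x. \<Sum>j. w j x"
  shows "AE x in lebesgue_on S. summable (\<lambda>j. \<bar>w j x\<bar>)" and "W \<in> L2_space S"
    and "L2_enorm S W \<le> (\<Sum>j. L2_enorm S (w j))"
    and "\<And>v. v \<in> L2_space S \<Longrightarrow> (\<lambda>j. L2_inner S (w j) v) sums L2_inner S W v"
proof -
  have [measurable]: "w j \<in> borel_measurable (lebesgue_on S)" for j using w by (simp add: L2_space_def)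
  let ?F = "\<lambda>x. \<Sum>j. ennreal \<bar>w j x\<bar>"
  have le: "esqrt (\<integral>\<^sup>+x. (?F x)\<^sup>2 \<partial>lebesgue_on S) \<le> (\<Sum>j. L2_enorm S (w j))"
  proof -
    have "L2_enorm S (w j) = esqrt (\<integral>\<^sup>+x. (ennreal \<bar>w j x\<bar>)\<^sup>2 \<partial>lebesgue_on S)" for j
      using w[of j] by (simp add: L2_enorm_eq L2_space_def)
    then show ?thesis
      using Minkowski_nn_integral_suminf[of "\<lambda>j x. ennreal \<bar>w j x\<bar>" "lebesgue_on S"] by (simp del: suminf_ennreal)
  qed
  then have "esqrt (\<integral>\<^sup>+x. (?F x)\<^sup>2 \<partial>lebesgue_on S) < \<infinity>" using fin by (rule order_le_less_trans)
  then have "(\<integral>\<^sup>+x. (?F x)\<^sup>2 \<partial>lebesgue_on S) \<noteq> \<infinity>" unfolding esqrt_finite_iff(1) by (rule less_imp_neq)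
  then have "AE x in lebesgue_on S. (?F x)\<^sup>2 \<noteq> \<infinity>"
    by (rule nn_integral_PInf_AE[rotated]) measurable
  then show s: "AE x in lebesgue_on S. summable (\<lambda>j. \<bar>w j x\<bar>)"
  proof eventually_elim
    case (elim x)
    then have "?F x \<noteq> \<infinity>" by (auto simp: power2_eq_square ennreal_mult_eq_top_iff simp del: suminf_ennreal)
    then show ?case by (intro summable_suminf_not_top) (auto simp del: suminf_ennreal)
  qed
  have [measurable]: "W \<in> borel_measurable (lebesgue_on S)" unfolding W_def by measurable
  have "AE x in lebesgue_on S. ennreal \<bar>W x\<bar> \<le> ?F x"
    using s
  proof eventually_elim
    case (elim x)
    have "?F x = ennreal (\<Sum>j. \<bar>w j x\<bar>)" by (intro suminf_ennreal2) (use elim in auto)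
    then show ?case unfolding W_def using summable_rabs[OF elim] by (simp add: ennreal_leI del: suminf_ennreal)
  qed
  then have "(\<integral>\<^sup>+x. (ennreal \<bar>W x\<bar>)\<^sup>2 \<partial>lebesgue_on S) \<le> (\<integral>\<^sup>+x. (?F x)\<^sup>2 \<partial>lebesgue_on S)"
    by (intro nn_integral_mono_AE) (simp add: ennreal_power2_le_iff del: suminf_ennreal)
  from order_trans[OF esqrt_mono[OF this] le] show leW: "L2_enorm S W \<le> (\<Sum>j. L2_enorm S (w j))"
    by (simp add: L2_enorm_eq[of S W])
  then show W: "W \<in> L2_space S" using fin unfolding L2_enorm_finite_iff[symmetric] by (rule order_le_less_trans)
  fix v assume v: "v \<in> L2_space S"
  then have [measurable]: "v \<in> borel_measurable (lebesgue_on S)" by (simp add: L2_space_def)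
  have sn: "summable (\<lambda>j. L2_norm S (w j))"
    using fin w by (intro summable_suminf_not_top) (auto simp: L2_enorm_eq_norm simp del: suminf_ennreal)
  have "(\<lambda>j. LINT x|lebesgue_on S. w j x * v x) sums (LINT x|lebesgue_on S. (\<Sum>j. w j x * v x))"
  proof (rule sums_integral)
    show "integrable (lebesgue_on S) (\<lambda>x. w j x * v x)" for j by (rule L2_mult_integrable[OF w v])
    show "AE x in lebesgue_on S. summable (\<lambda>i. norm (w i x * v x))"
      using s by eventually_elim (simp add: abs_mult summable_mult2)
    show "summable (\<lambda>i. LINT x|lebesgue_on S. norm (w i x * v x))"
    proof (rule summable_comparison_test'[OF summable_mult2[OF sn, of "L2_norm S v"], where N=0])
      fix j :: nat
      have "ennreal (LINT x|lebesgue_on S. norm (w j x * v x)) = (\<integral>\<^sup>+x. ennreal \<bar>w j x * v x\<bar> \<partial>lebesgue_on S)"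
        using L2_mult_integrable[OF w v] by (subst nn_integral_eq_integral[symmetric]) auto
      also have "\<dots> \<le> ennreal (L2_norm S (w j) * L2_norm S v)" by (rule L2_mult_nn_integral[OF w v])
      finally show "norm (LINT x|lebesgue_on S. norm (w j x * v x)) \<le> L2_norm S (w j) * L2_norm S v"
        by (simp add: ennreal_le_iff)
    qed
  qed
  moreover have "(LINT x|lebesgue_on S. (\<Sum>j. w j x * v x)) = (LINT x|lebesgue_on S. W x * v x)"
    using s by (intro integral_cong_AE) (auto elim!: eventually_mono simp: W_def suminf_mult2 summable_rabs_cancel)
  ultimately show "(\<lambda>j. L2_inner S (w j) v) sums L2_inner S W v" by (simp add: L2_inner_def)
qed

section \<open>Weak derivatives and their behaviour under changes on null sets\<close>

lemma locally_integrable_linear: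
  "locally_integrable S v \<Longrightarrow> locally_integrable S w \<Longrightarrow> locally_integrable S (\<lambda>x. a * v x + b * w x)"
  by (simp add: locally_integrable_def)

lemma locally_integrable_mult_test_fun:
  "locally_integrable S g \<Longrightarrow> \<phi> \<in> test_fun S \<Longrightarrow> open S \<Longrightarrow> integrable (lebesgue_on S) (\<lambda>x. g x * \<phi> x)"
  by (rule integrable_mult_test_fun) (auto simp: locally_integrable_def)

lemma L2_inner_linear_test_fun:
  assumes "locally_integrable S v" "locally_integrable S w" "\<phi> \<in> test_fun S" "open S"
  shows "L2_inner S (\<lambda>x. a * v x + b * w x) \<phi> = a * L2_inner S v \<phi> + b * L2_inner S w \<phi>"
  using locally_integrable_mult_test_fun[OF assms(1,3,4)] locally_integrable_mult_test_fun[OF assms(2-4)]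
  by (simp add: L2_inner_def distrib_right mult.assoc)

lemma has_weak_deriv_linear:
  assumes "has_weak_deriv S il v g" "has_weak_deriv S il w h" "open S"
  shows "has_weak_deriv S il (\<lambda>x. a * v x + b * w x) (\<lambda>x. a * g x + b * h x)"
  using assms(1,2)
  by (simp add: has_weak_deriv_def locally_integrable_linear L2_inner_linear_test_fun[OF _ _ _ assms(3)]
      pderivs_test_fun distrib_left mult.left_commute)

text \<open>The fundamental lemma applies to the difference of the two candidates, which integrates
  to 0 against every test function.\<close>

lemma has_weak_deriv_unique:
  assumes "has_weak_deriv S il v g" "has_weak_deriv S il v h" "open S"
  shows "AE x in lebesgue_on S. g x = h x"
proof -
  have l: "locally_integrable S g" "locally_integrable S h" using assms by (auto simp: has_weak_deriv_def)
  have "AE x in lebesgue_on S. g x - h x = 0"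
  proof (rule fundamental_lemma_calculus_of_variations[OF assms(3)])
    show "integrable (lebesgue_on K) (\<lambda>x. g x - h x)" if "compact K" "K \<subseteq> S" for K
      using l that by (auto simp: locally_integrable_def)
    fix \<phi> assume \<phi>: "\<phi> \<in> test_fun S"
    have "L2_inner S g \<phi> = L2_inner S h \<phi>"
      using assms \<phi> by (auto simp: has_weak_deriv_def)
    then show "(LINT x|lebesgue_on S. (g x - h x) * \<phi> x) = 0"
      using L2_inner_linear_test_fun[OF l \<phi> assms(3), of 1 "-1"] by (simp add: L2_inner_def)
  qed
  then show ?thesis by simp
qed

lemma has_weak_deriv_Nil: "locally_integrable S v \<Longrightarrow> has_weak_deriv S [] v v"
  by (simp add: has_weak_deriv_def)

lemma locally_integrable_cong_AE:
  assumes "AE x in lebesgue_on S. v x = w x" "locally_integrable S v" "open S"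
  shows "locally_integrable S w"
  unfolding locally_integrable_def
proof (intro allI impI)
  fix K assume K: "compact K \<and> K \<subseteq> S"
  then have Kl: "K \<in> sets lebesgue" by (simp add: borel_compact)
  have iv: "integrable (lebesgue_on K) v" using assms(2) K by (simp add: locally_integrable_def)
  have ae: "AE x in lebesgue_on K. v x = w x"
    using assms(1,3) K Kl by (auto simp: AE_restrict_space_iff elim!: eventually_mono)
  have "w \<in> borel_measurable (lebesgue_on K)"
    by (rule borel_measurable_lebesgue_on_AE[OF ae Kl]) (use iv in auto)
  then show "integrable (lebesgue_on K) w"
    using iv ae integrable_cong_AE[of v "lebesgue_on K" w] by auto
qed

lemma has_weak_deriv_cong_AE_imp:
  assumes "AE x in lebesgue_on S. v x = w x" "has_weak_deriv S il v g" "open S"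
  shows "has_weak_deriv S il w g"
proof -
  have lv: "locally_integrable S v" using assms by (simp add: has_weak_deriv_def)
  have lw: "locally_integrable S w" by (rule locally_integrable_cong_AE[OF assms(1) lv assms(3)])
  have "L2_inner S w \<phi> = L2_inner S v \<phi>" if "\<phi> \<in> test_fun S" for \<phi>
    unfolding L2_inner_def
    using locally_integrable_mult_test_fun[OF lv that assms(3)] locally_integrable_mult_test_fun[OF lw that assms(3)] assms(1)
    by (intro integral_cong_AE) auto
  then show ?thesis using assms(2) lw pderivs_test_fun by (auto simp: has_weak_deriv_def)
qed

lemma has_weak_deriv_cong_AE:
  assumes "AE x in lebesgue_on S. v x = w x" "open S"
  shows "has_weak_deriv S il v = has_weak_deriv S il w"
proof
  have "AE x in lebesgue_on S. w x = v x" using assms(1) by eventually_elim simp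
  then show "has_weak_deriv S il v g = has_weak_deriv S il w g" for g
    using has_weak_deriv_cong_AE_imp assms by blast
qed

text \<open>The two functions have the same set of weak derivatives, so the choice operator returns
  literally the same function, not merely one equal almost everywhere.\<close>

lemma wderiv_cong_AE:
  "AE x in lebesgue_on S. v x = w x \<Longrightarrow> open S \<Longrightarrow> wderiv S il v = wderiv S il w"
  by (simp add: wderiv_def has_weak_deriv_cong_AE)

lemma Hm_space_cong_AE:
  "AE x in lebesgue_on S. v x = w x \<Longrightarrow> open S \<Longrightarrow> v \<in> Hm_space S m \<longleftrightarrow> w \<in> Hm_space S m"
  by (simp add: Hm_space_def has_weak_deriv_cong_AE)

lemma sobolev_norm_cong_AE:
  assumes "AE x in lebesgue_on S. v x = w x" "open S"
  shows "sobolev_norm S s v = sobolev_norm S s w"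
  unfolding sobolev_norm_def Hm_space_cong_AE[OF assms] wderiv_cong_AE[OF assms] ..

lemma wderiv_weak_deriv:
  assumes "v \<in> Hm_space S m" "length il \<le> m"
  shows "has_weak_deriv S il v (wderiv S il v)"
proof -
  obtain g where "has_weak_deriv S il v g" using assms by (auto simp: Hm_space_def)
  then show ?thesis unfolding wderiv_def by (rule someI[of "has_weak_deriv S il v"])
qed

text \<open>The choice in \<open>wderiv\<close> is arbitrary, but weak derivatives are unique up to
  null sets.\<close>

lemma wderiv_AE_eq:
  assumes "has_weak_deriv S il v g" "open S"
  shows "AE x in lebesgue_on S. wderiv S il v x = g x"
proof -
  have "has_weak_deriv S il v (wderiv S il v)" using assms(1) unfolding wderiv_def by (rule someI[of "has_weak_deriv S il v"])
  then show ?thesis using assms by (rule has_weak_deriv_unique)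
qed

lemma wderiv_L2_space:
  assumes "v \<in> Hm_space S m" "length il \<le> m" "open S"
  shows "wderiv S il v \<in> L2_space S"
proof -
  obtain g where g: "has_weak_deriv S il v g" "g \<in> L2_space S" using assms by (auto simp: Hm_space_def)
  have "AE x in lebesgue_on S. g x = wderiv S il v x"
    using wderiv_AE_eq[OF g(1) assms(3)] by eventually_elim simp
  then show ?thesis by (rule L2_space_cong_AE) (use assms g in auto)
qed

lemma Hm_space_linear:
  assumes "v \<in> Hm_space S m" "w \<in> Hm_space S m" "open S"
  shows "(\<lambda>x. a * v x + b * w x) \<in> Hm_space S m"
  unfolding Hm_space_def
proof (intro CollectI allI impI)
  fix il :: "2 list" assume l: "length il \<le> m"
  show "\<exists>g\<in>L2_space S. has_weak_deriv S il (\<lambda>x. a * v x + b * w x) g"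
    by (intro bexI[where x="\<lambda>x. a * wderiv S il v x + b * wderiv S il w x"]
        has_weak_deriv_linear[OF wderiv_weak_deriv[OF assms(1) l] wderiv_weak_deriv[OF assms(2) l] assms(3)]
        L2_space_add L2_space_cmult wderiv_L2_space[OF assms(1) l assms(3)] wderiv_L2_space[OF assms(2) l assms(3)])
qed

lemma wderiv_linear:
  assumes "v \<in> Hm_space S m" "w \<in> Hm_space S m" "open S" "length il \<le> m"
  shows "AE x in lebesgue_on S. wderiv S il (\<lambda>x. a * v x + b * w x) x = a * wderiv S il v x + b * wderiv S il w x"
  by (rule wderiv_AE_eq[OF has_weak_deriv_linear[OF wderiv_weak_deriv[OF assms(1,4)] wderiv_weak_deriv[OF assms(2,4)] assms(3)] assms(3)])

lemma zero_Hm_space: "open S \<Longrightarrow> (\<lambda>x. 0) \<in> Hm_space S m"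
  unfolding Hm_space_def has_weak_deriv_def locally_integrable_def
  by (auto intro!: bexI[of _ "\<lambda>x. 0"] L2_space_zero simp: L2_inner_def)

lemma Hm_space_wderiv_Nil:
  assumes "v \<in> Hm_space S m" "open S"
  shows "AE x in lebesgue_on S. wderiv S [] v x = v x"
proof -
  have "locally_integrable S v" using wderiv_weak_deriv[OF assms(1), of "[]"] by (simp add: has_weak_deriv_def)
  then show ?thesis by (intro wderiv_AE_eq has_weak_deriv_Nil assms)
qed

lemma Hm_space_L2:
  assumes "v \<in> Hm_space S m" "open S"
  shows "v \<in> L2_space S"
  by (rule L2_space_cong_AE[OF Hm_space_wderiv_Nil[OF assms] _ wderiv_L2_space[OF assms(1) _ assms(2)]])
    (use assms in auto)

lemma L2_enorm_cong_AE:
  assumes "AE x in lebesgue_on S. v x = w x" "S \<in> sets lebesgue"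
  shows "L2_enorm S v = L2_enorm S w"
proof -
  have ae: "AE x in lebesgue_on S. w x = v x" using assms(1) by eventually_elim simp
  have "v \<in> borel_measurable (lebesgue_on S) \<longleftrightarrow> w \<in> borel_measurable (lebesgue_on S)"
    using borel_measurable_lebesgue_on_AE[OF assms] borel_measurable_lebesgue_on_AE[OF ae assms(2)] by blast
  moreover have "(\<integral>\<^sup>+x. (ennreal \<bar>v x\<bar>)\<^sup>2 \<partial>lebesgue_on S) = (\<integral>\<^sup>+x. (ennreal \<bar>w x\<bar>)\<^sup>2 \<partial>lebesgue_on S)"
    using assms(1) by (intro nn_integral_cong_AE) auto
  ultimately show ?thesis by (simp add: L2_enorm_eq)
qed

section \<open>The Sobolev-Slobodeckij norm as a Euclidean norm of \<open>L2\<close> parts\<close>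

text \<open>The square root of the Slobodeckij integrand, as a function on the product: the seminorm
  is its \<open>L2\<close> norm there. The exponent 1 + \<sigma> is half of 2 + 2\<sigma>.\<close>

definition slob_quot :: "real \<Rightarrow> sfun \<Rightarrow> pt \<times> pt \<Rightarrow> ennreal" where
  "slob_quot \<sigma> g = (\<lambda>(x, y). ennreal (\<bar>g x - g y\<bar> / norm (x - y) powr (1 + \<sigma>)))"

lemma slob_quot_power2: "(slob_quot \<sigma> g (x, y))\<^sup>2 = ennreal ((g x - g y)\<^sup>2 / norm (x - y) powr (2 + 2 * \<sigma>))"
proof -
  have "norm (x - y) powr (2 + 2 * \<sigma>) = (norm (x - y) powr (1 + \<sigma>))\<^sup>2"
    by (simp add: power2_eq_square flip: powr_add)
  then show ?thesis by (simp add: slob_quot_def ennreal_power power_divide)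
qed

lemma slob_quot_measurable:
  assumes "g \<in> borel_measurable (lebesgue_on S)"
  shows "slob_quot \<sigma> g \<in> borel_measurable (lebesgue_on S \<Otimes>\<^sub>M lebesgue_on S)"
proof -
  have [measurable]: "g \<in> borel_measurable (lebesgue_on S)" by fact
  have i: "(\<lambda>x. x) \<in> borel_measurable (lebesgue_on S)"
    by (simp add: measurable_restrict_space1 measurable_completion)
  have [measurable]: "fst \<in> borel_measurable (lebesgue_on S \<Otimes>\<^sub>M lebesgue_on S)"
    "snd \<in> borel_measurable (lebesgue_on S \<Otimes>\<^sub>M lebesgue_on S)"
    using measurable_compose[OF measurable_fst i] measurable_compose[OF measurable_snd i] by auto
  show ?thesis unfolding slob_quot_def case_prod_beta by measurable
qed

lemma slobodeckij_sq_eq: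
  assumes "g \<in> borel_measurable (lebesgue_on S)" "S \<in> sets lebesgue"
  shows "slobodeckij_sq S \<sigma> g = (\<integral>\<^sup>+z. (slob_quot \<sigma> g z)\<^sup>2 \<partial>(lebesgue_on S \<Otimes>\<^sub>M lebesgue_on S))"
proof -
  have [measurable]: "slob_quot \<sigma> g \<in> borel_measurable (lebesgue_on S \<Otimes>\<^sub>M lebesgue_on S)"
    by (rule slob_quot_measurable[OF assms(1)])
  show ?thesis unfolding slobodeckij_sq_def slob_quot_power2[symmetric]
    by (rule sigma_finite_measure.nn_integral_fst[OF sigma_finite_lebesgue_on[OF assms(2)]]) measurable
qed

lemma slobodeckij_sq_cong_AE:
  assumes "AE x in lebesgue_on S. g x = h x"
  shows "slobodeckij_sq S \<sigma> g = slobodeckij_sq S \<sigma> h"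
  unfolding slobodeckij_sq_def
proof (rule nn_integral_cong_AE)
  show "AE x in lebesgue_on S.
    (\<integral>\<^sup>+y. ennreal ((g x - g y)\<^sup>2 / norm (x - y) powr (2 + 2 * \<sigma>)) \<partial>lebesgue_on S) =
    (\<integral>\<^sup>+y. ennreal ((h x - h y)\<^sup>2 / norm (x - y) powr (2 + 2 * \<sigma>)) \<partial>lebesgue_on S)"
    using assms
  proof eventually_elim
    case (elim x)
    show ?case using assms by (intro nn_integral_cong_AE) (auto simp: elim)
  qed
qed

text \<open>Where the series converges absolutely at both points, the quotient of the sum is bounded
  by the sum of the quotients; Minkowski on the product measure then gives the claim.\<close>

lemma slobodeckij_suminf:
  fixes g :: "nat \<Rightarrow> sfun"
  assumes g: "\<And>j. g j \<in> borel_measurable (lebesgue_on S)" and S: "S \<in> sets lebesgue"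
    and s: "AE x in lebesgue_on S. summable (\<lambda>j. \<bar>g j x\<bar>)"
  shows "esqrt (slobodeckij_sq S \<sigma> (\<lambda>x. \<Sum>j. g j x)) \<le> (\<Sum>j. esqrt (slobodeckij_sq S \<sigma> (g j)))"
proof -
  let ?P = "lebesgue_on S \<Otimes>\<^sub>M lebesgue_on S" and ?G = "\<lambda>x. \<Sum>j. g j x"
  have q[measurable]: "slob_quot \<sigma> (g j) \<in> borel_measurable ?P" for j
    by (rule slob_quot_measurable[OF g])
  have le: "slob_quot \<sigma> ?G (x, y) \<le> (\<Sum>j. slob_quot \<sigma> (g j) (x, y))"
    if sx: "summable (\<lambda>j. \<bar>g j x\<bar>)" and sy: "summable (\<lambda>j. \<bar>g j y\<bar>)" for x y
  proof -
    let ?n = "norm (x - y) powr (1 + \<sigma>)"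
    have sd: "summable (\<lambda>j. \<bar>g j x - g j y\<bar>)"
      by (rule summable_comparison_test'[OF summable_add[OF sx sy], where N=0]) simp
    have "\<bar>?G x - ?G y\<bar> = \<bar>\<Sum>j. g j x - g j y\<bar>"
      using sx sy by (simp add: suminf_diff summable_rabs_cancel)
    also have "\<dots> \<le> (\<Sum>j. \<bar>g j x - g j y\<bar>)" by (rule summable_rabs[OF sd])
    finally have "\<bar>?G x - ?G y\<bar> / ?n \<le> (\<Sum>j. \<bar>g j x - g j y\<bar>) / ?n" by (simp add: divide_right_mono)
    also have "\<dots> = (\<Sum>j. \<bar>g j x - g j y\<bar> / ?n)" by (rule suminf_divide[OF sd, symmetric])
    finally have "ennreal (\<bar>?G x - ?G y\<bar> / ?n) \<le> ennreal (\<Sum>j. \<bar>g j x - g j y\<bar> / ?n)" by (rule ennreal_leI)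
    also have "\<dots> = (\<Sum>j. ennreal (\<bar>g j x - g j y\<bar> / ?n))"
      by (rule suminf_ennreal2[symmetric]) (auto intro: summable_divide sd)
    finally show ?thesis by (simp add: slob_quot_def)
  qed
  \<comment> \<open>Convergence is known for almost every point of \<open>S\<close> rather than for
    almost every pair, so the comparison is made inside the iterated integral and only its upper
    bound is moved to the product measure.\<close>
  have "slobodeckij_sq S \<sigma> ?G \<le> (\<integral>\<^sup>+x. (\<integral>\<^sup>+y. (\<Sum>j. slob_quot \<sigma> (g j) (x, y))\<^sup>2 \<partial>lebesgue_on S) \<partial>lebesgue_on S)"
  proof -
    have "slobodeckij_sq S \<sigma> ?G = (\<integral>\<^sup>+x. (\<integral>\<^sup>+y. (slob_quot \<sigma> ?G (x, y))\<^sup>2 \<partial>lebesgue_on S) \<partial>lebesgue_on S)"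
      by (simp only: slobodeckij_sq_def slob_quot_power2)
    also have "\<dots> \<le> (\<integral>\<^sup>+x. (\<integral>\<^sup>+y. (\<Sum>j. slob_quot \<sigma> (g j) (x, y))\<^sup>2 \<partial>lebesgue_on S) \<partial>lebesgue_on S)"
  proof (rule nn_integral_mono_AE)
    show "AE x in lebesgue_on S. (\<integral>\<^sup>+y. (slob_quot \<sigma> ?G (x, y))\<^sup>2 \<partial>lebesgue_on S)
        \<le> (\<integral>\<^sup>+y. (\<Sum>j. slob_quot \<sigma> (g j) (x, y))\<^sup>2 \<partial>lebesgue_on S)"
      using s
    proof eventually_elim
      case (elim x)
      show ?case
        using s by (intro nn_integral_mono_AE) (auto elim!: eventually_mono simp: ennreal_power2_le_iff intro!: le[OF elim])
    qed
  qed
    finally show ?thesis .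
  qed
  also have "\<dots> = (\<integral>\<^sup>+z. (\<Sum>j. slob_quot \<sigma> (g j) z)\<^sup>2 \<partial>?P)"
    by (rule sigma_finite_measure.nn_integral_fst[OF sigma_finite_lebesgue_on[OF S]]) measurable
  finally have "esqrt (slobodeckij_sq S \<sigma> ?G) \<le> esqrt \<dots>" by (rule esqrt_mono)
  also have "\<dots> \<le> (\<Sum>j. esqrt (\<integral>\<^sup>+z. (slob_quot \<sigma> (g j) z)\<^sup>2 \<partial>?P))"
    by (rule Minkowski_nn_integral_suminf) measurable
  also have "\<dots> = (\<Sum>j. esqrt (slobodeckij_sq S \<sigma> (g j)))"
    by (simp add: slobodeckij_sq_eq[OF g S])
  finally show ?thesis .
qed

text \<open>The left summand indexes the \<open>L2\<close> norms of all derivatives up to order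
  \<open>m\<close>, the right one the fractional seminorms of those of top order, absent for integer
  order. \<open>sob_part\<close> lists the corresponding contributions.\<close>

definition sob_index :: "nat \<Rightarrow> real \<Rightarrow> (2 list + 2 list) set" where
  "sob_index m \<sigma> = {il. length il \<le> m} <+> (if \<sigma> = 0 then {} else {il. length il = m})"

definition sob_part :: "pt set \<Rightarrow> real \<Rightarrow> sfun \<Rightarrow> 2 list + 2 list \<Rightarrow> ennreal" where
  "sob_part S \<sigma> v = case_sum (\<lambda>il. L2_enorm S (wderiv S il v)) (\<lambda>il. esqrt (slobodeckij_sq S \<sigma> (wderiv S il v)))"

lemma finite_multi_index: "finite {il :: 2 list. length il \<le> m}" "finite {il :: 2 list. length il = m}"
  using finite_lists_length_le[of "UNIV :: 2 set" m] finite_lists_length_eq[of "UNIV :: 2 set" m] by auto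

lemma finite_sob_index: "finite (sob_index m \<sigma>)"
  by (auto simp: sob_index_def finite_multi_index)

lemma sobolev_norm_eq:
  assumes "open S" "v \<in> Hm_space S (nat \<lfloor>s\<rfloor>)"
  defines "\<sigma> \<equiv> s - real (nat \<lfloor>s\<rfloor>)"
  shows "sobolev_norm S s v = esqrt (\<Sum>i\<in>sob_index (nat \<lfloor>s\<rfloor>) \<sigma>. (sob_part S \<sigma> v i)\<^sup>2)"
proof -
  have *: "(\<Sum>il | length il \<le> nat \<lfloor>s\<rfloor>. ennreal ((L2_norm S (wderiv S il v))\<^sup>2))
      = (\<Sum>il | length il \<le> nat \<lfloor>s\<rfloor>. (L2_enorm S (wderiv S il v))\<^sup>2)"
    by (intro sum.cong refl) (simp add: L2_enorm_eq_norm wderiv_L2_space[OF assms(2) _ assms(1)] ennreal_power)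
  show ?thesis
    unfolding sobolev_norm_def sob_index_def Let_def \<sigma>_def[symmetric] *
    using assms(2)
    by (subst sum.Plus) (auto simp: finite_multi_index sob_part_def)
qed

lemma sobolev_norm_finite_Hm: "sobolev_norm S s v < \<infinity> \<Longrightarrow> v \<in> Hm_space S (nat \<lfloor>s\<rfloor>)"
  by (auto simp: sobolev_norm_def Let_def split: if_splits)

lemma sob_part_le:
  assumes "open S" "v \<in> Hm_space S (nat \<lfloor>s\<rfloor>)" "i \<in> sob_index (nat \<lfloor>s\<rfloor>) (s - real (nat \<lfloor>s\<rfloor>))"
  shows "sob_part S (s - real (nat \<lfloor>s\<rfloor>)) v i \<le> sobolev_norm S s v"
proof -
  have "(sob_part S (s - real (nat \<lfloor>s\<rfloor>)) v i)\<^sup>2 \<le> (sobolev_norm S s v)\<^sup>2"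
    unfolding sobolev_norm_eq[OF assms(1,2)] esqrt_power2
    by (rule member_le_sum[OF assms(3)]) (auto simp: finite_sob_index)
  then show ?thesis by (simp add: ennreal_power2_le_iff)
qed

text \<open>The empty list of directions belongs to every index set, so the \<open>L2\<close> norm
  is one of the parts.\<close>

lemma L2_enorm_le_sobolev_norm:
  assumes "open S"
  shows "L2_enorm S v \<le> sobolev_norm S s v"
proof (cases "sobolev_norm S s v < \<infinity>")
  case True
  note H = sobolev_norm_finite_Hm[OF True]
  have "L2_enorm S v = L2_enorm S (wderiv S [] v)"
    using Hm_space_wderiv_Nil[OF H assms] by (intro L2_enorm_cong_AE) (use assms in \<open>auto elim!: eventually_mono\<close>)
  also have "\<dots> \<le> sobolev_norm S s v"
    using sob_part_le[OF assms H, of "Inl []"] by (simp add: sob_part_def sob_index_def InlI)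
  finally show ?thesis .
qed (simp add: not_less top_unique)

text \<open>Completeness of the Sobolev space: the series of each derivative converges in
  \<open>L2\<close>, and its sum is the weak derivative of the sum because pairings with test
  functions pass to the limit. The countable triangle inequalities of the parts are combined by
  \<open>Minkowski_sum_suminf\<close>.\<close>

lemma sobolev_norm_suminf:
  fixes w :: "nat \<Rightarrow> sfun"
  assumes S: "open S" and fin: "(\<Sum>j. sobolev_norm S s (w j)) < \<infinity>"
  shows "sobolev_norm S s (\<lambda>x. \<Sum>j. w j x) \<le> (\<Sum>j. sobolev_norm S s (w j))"
    and "v \<in> L2_space S \<Longrightarrow> (\<lambda>j. L2_inner S (w j) v) sums L2_inner S (\<lambda>x. \<Sum>j. w j x) v"
proof -
  let ?m = "nat \<lfloor>s\<rfloor>" and ?W = "\<lambda>x. \<Sum>j. w j x"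
  let ?\<sigma> = "s - real ?m"
  let ?g = "\<lambda>il j. wderiv S il (w j)"
  let ?G = "\<lambda>il x. \<Sum>j. ?g il j x"
  have Sl: "S \<in> sets lebesgue" using S by auto
  have finj: "sobolev_norm S s (w j) < \<infinity>" for j
  proof -
    have "sobolev_norm S s (w j) = (\<Sum>i\<in>{j}. sobolev_norm S s (w i))" by simp
    also have "\<dots> \<le> (\<Sum>j. sobolev_norm S s (w j))" by (rule sum_le_suminf) auto
    finally show ?thesis using fin by (rule order_le_less_trans)
  qed
  have H: "w j \<in> Hm_space S ?m" for j by (rule sobolev_norm_finite_Hm[OF finj])
  have w: "w j \<in> L2_space S" for j by (rule Hm_space_L2[OF H S])
  have finw: "(\<Sum>j. L2_enorm S (w j)) < \<infinity>"
    by (rule order_le_less_trans[OF suminf_le fin]) (auto intro: L2_enorm_le_sobolev_norm[OF S])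
  note L2W = L2_suminf[OF w finw]
  show "v \<in> L2_space S \<Longrightarrow> (\<lambda>j. L2_inner S (w j) v) sums L2_inner S ?W v" by (rule L2W(4))
  have g: "?g il j \<in> L2_space S" if "length il \<le> ?m" for il j
    by (rule wderiv_L2_space[OF H that S])
  have fing: "(\<Sum>j. L2_enorm S (?g il j)) < \<infinity>" if l: "length il \<le> ?m" for il
  proof (rule order_le_less_trans[OF suminf_le fin])
    show "L2_enorm S (?g il j) \<le> sobolev_norm S s (w j)" for j
      using sob_part_le[OF S H, of "Inl il"] l by (simp add: sob_part_def sob_index_def InlI)
  qed auto
  have wd: "has_weak_deriv S il ?W (?G il)" if l: "length il \<le> ?m" for il
    unfolding has_weak_deriv_def
  proof (intro conjI ballI)
    note L2G = L2_suminf[OF g[OF l] fing[OF l]]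
    show "locally_integrable S ?W" "locally_integrable S (?G il)"
      using L2W(2) L2G(2) Sl by (auto intro: L2_locally_integrable)
    fix \<phi> assume \<phi>: "\<phi> \<in> test_fun S"
    have "(\<lambda>j. (-1) ^ length il * L2_inner S (?g il j) \<phi>) sums ((-1) ^ length il * L2_inner S (?G il) \<phi>)"
      by (intro sums_mult L2G(4) test_fun_L2_space[OF \<phi> Sl])
    moreover have "(-1) ^ length il * L2_inner S (?g il j) \<phi> = L2_inner S (w j) (pderivs il \<phi>)" for j
      using wderiv_weak_deriv[OF H l] \<phi> by (simp add: has_weak_deriv_def)
    ultimately have "(\<lambda>j. L2_inner S (w j) (pderivs il \<phi>)) sums ((-1) ^ length il * L2_inner S (?G il) \<phi>)" by simp
    moreover have "(\<lambda>j. L2_inner S (w j) (pderivs il \<phi>)) sums L2_inner S ?W (pderivs il \<phi>)"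
      by (intro L2W(4) test_fun_L2_space[OF pderivs_test_fun[OF \<phi>] Sl])
    ultimately show "L2_inner S ?W (pderivs il \<phi>) = (-1) ^ length il * L2_inner S (?G il) \<phi>"
      using sums_unique2 by blast
  qed
  have HW: "?W \<in> Hm_space S ?m"
    unfolding Hm_space_def using wd L2_suminf(2)[OF g fing] by blast
  have "sob_part S ?\<sigma> ?W i \<le> (\<Sum>j. sob_part S ?\<sigma> (w j) i)" if i: "i \<in> sob_index ?m ?\<sigma>" for i
  proof (cases i)
    case (Inl il)
    then have l: "length il \<le> ?m" using i by (auto simp: sob_index_def)
    have "L2_enorm S (wderiv S il ?W) = L2_enorm S (?G il)"
      by (rule L2_enorm_cong_AE[OF wderiv_AE_eq[OF wd[OF l] S] Sl])
    also have "\<dots> \<le> (\<Sum>j. L2_enorm S (?g il j))" by (rule L2_suminf(3)[OF g[OF l] fing[OF l]])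
    finally show ?thesis by (simp add: Inl sob_part_def)
  next
    case (Inr il)
    then have l: "length il \<le> ?m" using i by (auto simp: sob_index_def split: if_splits)
    have "esqrt (slobodeckij_sq S ?\<sigma> (wderiv S il ?W)) = esqrt (slobodeckij_sq S ?\<sigma> (?G il))"
      using slobodeckij_sq_cong_AE[OF wderiv_AE_eq[OF wd[OF l] S]] by simp
    also have "\<dots> \<le> (\<Sum>j. esqrt (slobodeckij_sq S ?\<sigma> (?g il j)))"
      by (rule slobodeckij_suminf[OF L2_spaceD[OF g[OF l]] Sl L2_suminf(1)[OF g[OF l] fing[OF l]]])
    finally show ?thesis by (simp add: Inr sob_part_def)
  qed
  then have "sobolev_norm S s ?W \<le> esqrt (\<Sum>i\<in>sob_index ?m ?\<sigma>. (\<Sum>j. sob_part S ?\<sigma> (w j) i)\<^sup>2)"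
    unfolding sobolev_norm_eq[OF S HW] by (intro esqrt_mono sum_mono) (simp add: ennreal_power2_le_iff)
  also have "\<dots> \<le> (\<Sum>j. esqrt (\<Sum>i\<in>sob_index ?m ?\<sigma>. (sob_part S ?\<sigma> (w j) i)\<^sup>2))"
    by (rule Minkowski_sum_suminf[OF finite_sob_index])
  also have "\<dots> = (\<Sum>j. sobolev_norm S s (w j))" by (simp add: sobolev_norm_eq[OF S H])
  finally show "sobolev_norm S s ?W \<le> (\<Sum>j. sobolev_norm S s (w j))" .
qed

lemma slobodeckij_sq_cmult:
  assumes "g \<in> borel_measurable (lebesgue_on S)" "S \<in> sets lebesgue"
  shows "slobodeckij_sq S \<sigma> (\<lambda>x. c * g x) = (ennreal \<bar>c\<bar>)\<^sup>2 * slobodeckij_sq S \<sigma> g"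
proof -
  have [measurable]: "slob_quot \<sigma> g \<in> borel_measurable (lebesgue_on S \<Otimes>\<^sub>M lebesgue_on S)"
    by (rule slob_quot_measurable[OF assms(1)])
  have "slob_quot \<sigma> (\<lambda>x. c * g x) z = ennreal \<bar>c\<bar> * slob_quot \<sigma> g z" for z
    by (auto simp: slob_quot_def case_prod_beta abs_mult simp flip: right_diff_distrib ennreal_mult)
  then show ?thesis using assms
    by (simp add: slobodeckij_sq_eq power_mult_distrib nn_integral_cmult)
qed

lemma sobolev_norm_cmult:
  assumes S: "open S"
  shows "sobolev_norm S s (\<lambda>x. c * v x) = ennreal \<bar>c\<bar> * sobolev_norm S s v"
proof -
  let ?m = "nat \<lfloor>s\<rfloor>"
  let ?\<sigma> = "s - real ?m"
  have Sl: "S \<in> sets lebesgue" using S by auto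
  have H: "(\<lambda>x. a * w x) \<in> Hm_space S ?m" if "w \<in> Hm_space S ?m" for a w
    using Hm_space_linear[OF that that S, of a 0] by simp
  have eq: "sobolev_norm S s (\<lambda>x. c * v x) = ennreal \<bar>c\<bar> * sobolev_norm S s v" if v: "v \<in> Hm_space S ?m"
  proof -
    have "sob_part S ?\<sigma> (\<lambda>x. c * v x) i = ennreal \<bar>c\<bar> * sob_part S ?\<sigma> v i" if i: "i \<in> sob_index ?m ?\<sigma>" for i
    proof -
      obtain il where il: "i = Inl il \<or> i = Inr il" by (cases i) auto
      then have l: "length il \<le> ?m" using i by (auto simp: sob_index_def split: if_splits)
      have ae: "AE x in lebesgue_on S. wderiv S il (\<lambda>x. c * v x) x = c * wderiv S il v x"
        using wderiv_linear[OF v v S l, of c 0] by simp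
      show ?thesis
        using il L2_spaceD[OF wderiv_L2_space[OF v l S]]
        by (auto simp: sob_part_def L2_enorm_cong_AE[OF ae Sl] L2_enorm_cmult
            slobodeckij_sq_cong_AE[OF ae] slobodeckij_sq_cmult[OF _ Sl] esqrt_mult)
    qed
    then show ?thesis
      by (simp add: sobolev_norm_eq[OF S v] sobolev_norm_eq[OF S H[OF v]] power_mult_distrib
          esqrt_mult flip: sum_distrib_left)
  qed
  show ?thesis
  proof (cases "v \<in> Hm_space S ?m")
    case False
    show ?thesis
    proof (cases "c = 0")
      case True
      \<comment> \<open>For \<open>c\<close> = 0 and \<open>v\<close> outside the space the
        right-hand side is 0 times \<infinity>, which is 0, so the norm of the zero function has to
        be computed.\<close>
      have "sobolev_norm S s (\<lambda>x. 0 * (0::real)) = ennreal \<bar>0\<bar> * sobolev_norm S s (\<lambda>x. 0)"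
      proof -
        have z: "(\<lambda>x. 0) \<in> Hm_space S ?m" by (rule zero_Hm_space[OF S])
        have ae: "AE x in lebesgue_on S. wderiv S il (\<lambda>x. 0) x = 0 * wderiv S il (\<lambda>x. 0) x" if "length il \<le> ?m" for il
          using wderiv_linear[OF z z S that, of 0 0] by simp
        have "sob_part S ?\<sigma> (\<lambda>x. 0) i = 0" if i: "i \<in> sob_index ?m ?\<sigma>" for i
        proof -
          obtain il where il: "i = Inl il \<or> i = Inr il" by (cases i) auto
          then have l: "length il \<le> ?m" using i by (auto simp: sob_index_def split: if_splits)
          have "L2_enorm S (wderiv S il (\<lambda>x. 0)) = 0" "slobodeckij_sq S ?\<sigma> (wderiv S il (\<lambda>x. 0)) = 0"
            using L2_enorm_cong_AE[OF ae[OF l] Sl] slobodeckij_sq_cong_AE[OF ae[OF l], of ?\<sigma>]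
            by (simp_all add: L2_enorm_eq[of S "\<lambda>x. 0"] slobodeckij_sq_def[of S _ "\<lambda>x. 0"])
          then show ?thesis using il by (auto simp: sob_part_def)
        qed
        then show ?thesis by (simp add: sobolev_norm_eq[OF S z])
      qed
      then show ?thesis using True by simp
    next
      case c: False
      have "(\<lambda>x. c * v x) \<notin> Hm_space S ?m"
        using H[of "\<lambda>x. c * v x" "1 / c"] c False by auto
      then show ?thesis using False c by (simp add: sobolev_norm_def Let_def ennreal_mult_top)
    qed
  qed (rule eq)
qed

lemma sobolev_norm_zero: "open S \<Longrightarrow> sobolev_norm S s (\<lambda>x. 0) = 0"
  using sobolev_norm_cmult[of S s 0 "\<lambda>x. 0"] by simp

text \<open>A series with at most two nonzero terms turns the countable triangle inequality into the
  finite one.\<close>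

lemma sobolev_norm_add:
  assumes S: "open S"
  shows "sobolev_norm S s (\<lambda>x. v x + w x) \<le> sobolev_norm S s v + sobolev_norm S s w"
proof (cases "sobolev_norm S s v + sobolev_norm S s w < \<infinity>")
  case True
  let ?w = "\<lambda>j x. if j = (0::nat) then v x else if j = 1 then w x else 0"
  have *: "(\<lambda>j. f j) sums (f 0 + f 1)" if "\<And>j. j \<ge> 2 \<Longrightarrow> f j = 0" for f :: "nat \<Rightarrow> 'b::{comm_monoid_add,t2_space}"
    using sums_finite[of "{0,1}" f] that by (auto simp: numeral_2_eq_2 less_Suc_eq not_le Suc_le_eq)
  have 1: "(\<Sum>j. sobolev_norm S s (?w j)) = sobolev_norm S s v + sobolev_norm S s w"
    using *[of "\<lambda>j. sobolev_norm S s (?w j)"] by (auto simp: sobolev_norm_zero[OF S] intro: sums_unique[symmetric])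
  have 2: "(\<Sum>j. ?w j x) = v x + w x" for x
    using *[of "\<lambda>j. ?w j x"] by (auto intro: sums_unique[symmetric])
  show ?thesis using sobolev_norm_suminf(1)[OF S, of s ?w] True unfolding 1 2 .
qed (auto simp: not_less top_unique)

section \<open>Bochner integrals of paths in function spaces\<close>

lemma finite_measure_lebesgue_on_Icc: "finite_measure (lebesgue_on {a..b::real})"
  by (intro finite_measureI) (cases "a \<le> b"; simp add: emeasure_restrict_space space_restrict_space)

lemma real_tendsto_measurable_lebesgue_on:
  fixes f :: "real \<Rightarrow> real"
  assumes "\<And>j. F j \<in> borel_measurable (lebesgue_on {0..T})" "AE t in lebesgue_on {0..T}. (\<lambda>j. F j t) \<longlonglongrightarrow> f t"
  shows "f \<in> borel_measurable (lebesgue_on {0..T})"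
proof (rule borel_measurable_lebesgue_on_AE)
  show "(\<lambda>t. lim (\<lambda>j. F j t)) \<in> borel_measurable (lebesgue_on {0..T})"
    using assms(1) by measurable
  show "AE t in lebesgue_on {0..T}. lim (\<lambda>j. F j t) = f t"
    using assms(2) by eventually_elim (rule limI)
qed auto

text \<open>
  An extended norm that dominates the \<open>L\<^sup>2\<close> norm and for which absolutely convergent series converge;
  the sum is identified through its \<open>L\<^sup>2\<close> pairings.
\<close>

locale bochner_norm =
  fixes \<Omega> :: "pt set" and X :: "sfun \<Rightarrow> ennreal"
  assumes domain_measurable: "\<Omega> \<in> sets lebesgue"
    and norm_add: "X (\<lambda>x. v x + w x) \<le> X v + X w"
    and norm_cmult: "X (\<lambda>x. c * v x) = ennreal \<bar>c\<bar> * X v"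
    and L2_enorm_le: "L2_enorm \<Omega> v \<le> X v"
    and norm_cong_AE: "AE x in lebesgue_on \<Omega>. v x = w x \<Longrightarrow> X v = X w"
    and norm_complete: "(\<Sum>j. X (z j)) < \<infinity> \<Longrightarrow>
      \<exists>W. X W \<le> (\<Sum>j. X (z j)) \<and> (\<forall>v\<in>L2_space \<Omega>. (\<lambda>j. L2_inner \<Omega> (z j) v) sums L2_inner \<Omega> W v)"
begin

lemma norm_zero: "X (\<lambda>x. 0) = 0"
  using norm_cmult[of 0 "\<lambda>x. 0"] by simp

lemma norm_minus_commute: "X (\<lambda>x. v x - w x) = X (\<lambda>x. w x - v x)"
  using norm_cmult[of "-1" "\<lambda>x. v x - w x"] by simp

lemma norm_triangle_sub: "X v \<le> X w + X (\<lambda>x. v x - w x)"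
  using norm_add[of w "\<lambda>x. v x - w x"] by simp

lemma norm_diff_le: "X (\<lambda>x. v x - w x) \<le> X v + X w"
  using norm_add[of v "\<lambda>x. - 1 * w x"] norm_cmult[of "-1" w] by simp

lemma norm_sum_le: "X (\<lambda>x. \<Sum>i\<in>I. v i x) \<le> (\<Sum>i\<in>I. X (v i))"
proof (induction I rule: infinite_finite_induct)
  case (insert i I)
  then show ?case using order_trans[OF norm_add[of "v i" "\<lambda>x. \<Sum>i\<in>I. v i x"] add_left_mono[OF insert.IH]] by simp
qed (auto simp: norm_zero)

lemma finite_norm_L2: "X v < \<infinity> \<Longrightarrow> v \<in> L2_space \<Omega>"
  using L2_enorm_le[of v] unfolding L2_enorm_finite_iff[symmetric] by (rule order_le_less_trans)

lemma L2_norm_le: "X v < \<infinity> \<Longrightarrow> L2_norm \<Omega> v \<le> enn2real (X v)"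
  using L2_enorm_le[of v] finite_norm_L2[of v]
  by (cases "X v") (auto simp: L2_enorm_eq_norm top_unique)

lemma pairing_le: "X v < \<infinity> \<Longrightarrow> w \<in> L2_space \<Omega> \<Longrightarrow> \<bar>L2_inner \<Omega> v w\<bar> \<le> enn2real (X v) * L2_norm \<Omega> w"
  using L2_inner_le[OF finite_norm_L2, of v w] L2_norm_le[of v]
  by (meson L2_norm_nonneg mult_right_mono order_trans)

text \<open>The approximants of \<open>strongly_measurable\<close>, restated with
  \<open>simple_function\<close> so that differences, truncations and compositions are again
  simple.\<close>

definition simple_path :: "real \<Rightarrow> (real \<Rightarrow> sfun) \<Rightarrow> bool" where
  "simple_path T s \<longleftrightarrow> simple_function (lebesgue_on {0..T}) s \<and> (\<forall>t\<in>{0..T}. X (s t) < \<infinity>)"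

lemma strongly_measurable_iff:
  "strongly_measurable X T g \<longleftrightarrow> (\<exists>s. (\<forall>j. simple_path T (s j)) \<and>
     (AE t in lebesgue_on {0..T}. (\<lambda>j::nat. X (\<lambda>x. s j t x - g t x)) \<longlonglongrightarrow> 0))"
proof -
  have "simple_path T s \<longleftrightarrow> finite (s ` {0..T}) \<and> (\<forall>c. {t \<in> {0..T}. s t = c} \<in> sets lebesgue) \<and>
      (\<forall>t\<in>{0..T}. X (s t) < \<infinity>)" for s
  proof -
    have *: "{t \<in> {0..T}. s t = c} = s -` {c} \<inter> {0..T}" for c by auto
    have "s -` {c} \<inter> {0..T} = {}" if "c \<notin> s ` {0..T}" for c using that by auto
    then show ?thesis unfolding simple_path_def simple_function_def *
      by (auto simp: sets_restrict_space_iff) (metis sets.empty_sets image_iff)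
  qed
  then show ?thesis unfolding strongly_measurable_def by simp
qed

lemma simple_path_diff:
  "simple_path T s \<Longrightarrow> simple_path T s' \<Longrightarrow> simple_path T (\<lambda>t x. s t x - s' t x)"
  unfolding simple_path_def
  using simple_function_compose2[of "lebesgue_on {0..T}" s s' "\<lambda>v w x. v x - w x"]
  by (auto intro: order_le_less_trans[OF norm_diff_le])

lemma simple_path_measurable:
  "simple_path T s \<Longrightarrow> (\<lambda>t. F (s t)) \<in> borel_measurable (lebesgue_on {0..T})"
  unfolding simple_path_def
  by (elim conjE) (rule borel_measurable_simple_function[OF simple_function_compose1[where g=F]])

text \<open>For an abstract extended norm \<open>X\<close>, measurability of its composition with a
  path is not given; it is inherited from the simple approximants through the reverse triangle
  inequality. Values may be infinite on a null set, hence the passage to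
  \<open>enn2real\<close>.\<close>

lemma
  assumes "strongly_measurable X T g"
  shows norm_path_measurable: "(\<lambda>t. enn2real (X (g t))) \<in> borel_measurable (lebesgue_on {0..T})"
    and norm_path_finite: "AE t in lebesgue_on {0..T}. X (g t) < \<infinity>"
    and pairing_measurable: "v \<in> L2_space \<Omega> \<Longrightarrow>
      (\<lambda>t. L2_inner \<Omega> (g t) v) \<in> borel_measurable (lebesgue_on {0..T})"
proof -
  let ?M = "lebesgue_on {0..T}"
  obtain s where s: "\<And>j::nat. simple_path T (s j)"
    and lim: "AE t in ?M. (\<lambda>j. X (\<lambda>x. s j t x - g t x)) \<longlonglongrightarrow> 0"
    using assms unfolding strongly_measurable_iff by blast
  have sp: "AE t in ?M. t \<in> {0..T}" using AE_space[of ?M] by simp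
  have fs: "X (s j t) < \<infinity>" if "t \<in> {0..T}" for j t using s[of j] that by (auto simp: simple_path_def)
  have fin: "X (g t) < \<infinity>" if t: "t \<in> {0..T}" and l: "(\<lambda>j. X (\<lambda>x. s j t x - g t x)) \<longlonglongrightarrow> 0" for t
  proof -
    have "\<forall>\<^sub>F j in sequentially. X (\<lambda>x. s j t x - g t x) < 1" using l by (rule order_tendstoD) simp
    then obtain j where j: "X (\<lambda>x. s j t x - g t x) < 1" by (auto simp: eventually_sequentially)
    have "X (g t) \<le> X (s j t) + X (\<lambda>x. g t x - s j t x)" by (rule norm_triangle_sub)
    also have "\<dots> < \<infinity>" using fs[OF t, of j] j norm_minus_commute[of "g t"] by (auto simp: less_top[symmetric])
    finally show ?thesis .
  qed
  show "AE t in ?M. X (g t) < \<infinity>" using sp lim by eventually_elim (rule fin)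
  show "(\<lambda>t. enn2real (X (g t))) \<in> borel_measurable ?M"
  proof (rule real_tendsto_measurable_lebesgue_on[where F="\<lambda>j t. enn2real (X (s j t))"])
    show "(\<lambda>t. enn2real (X (s j t))) \<in> borel_measurable ?M" for j
      by (rule simple_path_measurable[OF s])
    show "AE t in ?M. (\<lambda>j. enn2real (X (s j t))) \<longlonglongrightarrow> enn2real (X (g t))"
      using sp lim
    proof eventually_elim
      case (elim t)
      note f = fin[OF elim]
      let ?d = "\<lambda>j. X (\<lambda>x. s j t x - g t x)"
      have "(\<lambda>j. X (s j t)) \<longlonglongrightarrow> X (g t)"
      proof (rule tendsto_sandwich)
        show "\<forall>\<^sub>F j in sequentially. X (g t) - ?d j \<le> X (s j t)"
          using norm_triangle_sub[of "g t" "s _ t"] norm_minus_commute[of "g t"] f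
          by (intro always_eventually allI) (auto simp: ennreal_minus_le_iff add.commute)
        show "\<forall>\<^sub>F j in sequentially. X (s j t) \<le> X (g t) + ?d j"
          using norm_triangle_sub by (intro always_eventually allI)
        show "(\<lambda>j. X (g t) - ?d j) \<longlonglongrightarrow> X (g t)"
          using tendsto_diff_ennreal_general[OF tendsto_const elim(2), of "X (g t)"] by simp
        show "(\<lambda>j. X (g t) + ?d j) \<longlonglongrightarrow> X (g t)"
          using tendsto_add[OF tendsto_const elim(2), of "X (g t)"] by simp
      qed
      then show ?case using f by (intro tendsto_enn2real) auto
    qed
  qed
  assume v: "v \<in> L2_space \<Omega>"
  show "(\<lambda>t. L2_inner \<Omega> (g t) v) \<in> borel_measurable ?M"
  proof (rule real_tendsto_measurable_lebesgue_on[where F="\<lambda>j t. L2_inner \<Omega> (s j t) v"])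
    show "(\<lambda>t. L2_inner \<Omega> (s j t) v) \<in> borel_measurable ?M" for j
      by (rule simple_path_measurable[OF s])
    show "AE t in ?M. (\<lambda>j. L2_inner \<Omega> (s j t) v) \<longlonglongrightarrow> L2_inner \<Omega> (g t) v"
      using sp lim
    proof eventually_elim
      case (elim t)
      note f = fin[OF elim]
      have d: "\<bar>L2_inner \<Omega> (s j t) v - L2_inner \<Omega> (g t) v\<bar> \<le> enn2real (X (\<lambda>x. s j t x - g t x)) * L2_norm \<Omega> v" for j
        using pairing_le[OF order_le_less_trans[OF norm_diff_le] v, of "s j t" "g t"] f fs[OF elim(1), of j]
        by (simp add: L2_inner_diff finite_norm_L2 v)
      have "(\<lambda>j. enn2real (X (\<lambda>x. s j t x - g t x)) * L2_norm \<Omega> v) \<longlonglongrightarrow> 0 * L2_norm \<Omega> v"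
        by (intro tendsto_mult_right tendsto_enn2real[where l=0, simplified]) (use elim(2) in auto)
      then have "(\<lambda>j. L2_inner \<Omega> (s j t) v - L2_inner \<Omega> (g t) v) \<longlonglongrightarrow> 0"
        unfolding mult_zero_left
        by (rule Lim_null_comparison[rotated]) (simp only: real_norm_def d eventually_True)
      then show ?case by (simp add: LIM_zero_iff)
    qed
  qed
qed

lemma strongly_measurable_diff:
  assumes "simple_path T s" "strongly_measurable X T g"
  shows "strongly_measurable X T (\<lambda>t x. s t x - g t x)"
proof -
  obtain r where r: "\<And>j::nat. simple_path T (r j)"
    and lim: "AE t in lebesgue_on {0..T}. (\<lambda>j. X (\<lambda>x. r j t x - g t x)) \<longlonglongrightarrow> 0"
    using assms unfolding strongly_measurable_iff by blast
  have "AE t in lebesgue_on {0..T}. (\<lambda>j. X (\<lambda>x. (s t x - r j t x) - (s t x - g t x))) \<longlonglongrightarrow> 0"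
    using lim by (simp add: norm_minus_commute[of "r _ _"])
  then show ?thesis unfolding strongly_measurable_iff
    using simple_path_diff[OF assms(1) r] by (intro exI[of _ "\<lambda>j t x. s t x - r j t x"]) simp
qed

section \<open>Approximation in the mean by simple paths\<close>

text \<open>Pointwise approximants need not be dominated. They are replaced by 0 wherever their norm
  exceeds twice that of \<open>g\<close>; three times the norm of \<open>g\<close> then dominates
  the error, and the truncation is eventually inactive wherever \<open>g\<close> has nonzero
  norm.\<close>

lemma simple_path_approx:
  assumes sm: "strongly_measurable X T g" and fin: "(\<integral>\<^sup>+t. X (g t) \<partial>lebesgue_on {0..T}) < \<infinity>" and e: "0 < e"
  shows "\<exists>s. simple_path T s \<and> (\<integral>\<^sup>+t. X (\<lambda>x. s t x - g t x) \<partial>lebesgue_on {0..T}) < e"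
proof -
  let ?M = "lebesgue_on {0..T}"
  obtain r where r: "\<And>j::nat. simple_path T (r j)"
    and lim: "AE t in ?M. (\<lambda>j. X (\<lambda>x. r j t x - g t x)) \<longlonglongrightarrow> 0"
    using sm unfolding strongly_measurable_iff by blast
  \<comment> \<open>A measurable substitute for the norm of \<open>g\<close>, equal to it almost
    everywhere.\<close>
  define n where "n t = ennreal (enn2real (X (g t)))" for t
  have n[measurable]: "n \<in> borel_measurable ?M" unfolding n_def using norm_path_measurable[OF sm] by measurable
  have Xn: "AE t in ?M. X (g t) = n t \<and> n t < \<infinity>"
    using norm_path_finite[OF sm] by eventually_elim (auto simp: n_def)
  define s where "s j t = (if X (r j t) \<le> 2 * n t then r j t else (\<lambda>x. 0))" for j t
  have s: "simple_path T (s j)" for j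
  proof -
    have [measurable]: "(\<lambda>t. X (r j t)) \<in> borel_measurable ?M" by (rule simple_path_measurable[OF r])
    have "{t \<in> space ?M. X (r j t) \<le> 2 * n t} \<in> sets ?M" by measurable
    then have "simple_function ?M (s j)" unfolding s_def
      using r[of j] by (intro simple_function_If) (auto simp: simple_path_def)
    then show ?thesis using r[of j] by (auto simp: simple_path_def s_def norm_zero)
  qed
  define d where "d j t = ennreal (enn2real (X (\<lambda>x. s j t x - g t x)))" for j t
  have dsm: "strongly_measurable X T (\<lambda>t x. s j t x - g t x)" for j by (rule strongly_measurable_diff[OF s sm])
  have dm[measurable]: "d j \<in> borel_measurable ?M" for j unfolding d_def using norm_path_measurable[OF dsm] by measurable
  have dX: "AE t in ?M. d j t = X (\<lambda>x. s j t x - g t x)" for j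
    using norm_path_finite[OF dsm[of j]] by eventually_elim (auto simp: d_def)
  have "(\<lambda>j. \<integral>\<^sup>+t. d j t \<partial>?M) \<longlonglongrightarrow> (\<integral>\<^sup>+t. 0 \<partial>?M)"
  proof (rule nn_integral_dominated_convergence)
    show "AE t in ?M. d j t \<le> 3 * n t" for j
      using Xn dX[of j]
    proof eventually_elim
      case (elim t)
      have "X (s j t) \<le> 2 * n t" by (auto simp: s_def norm_zero)
      then have "X (\<lambda>x. s j t x - g t x) \<le> 2 * n t + n t" 
        using elim by (intro order_trans[OF norm_diff_le] add_mono) auto
      also have "\<dots> = (2 + 1) * n t" by (simp only: distrib_right mult_1_left)
      also have "\<dots> = 3 * n t" by simp
      finally show ?case using elim by simp
    qed
    have "(\<integral>\<^sup>+t. n t \<partial>?M) = (\<integral>\<^sup>+t. X (g t) \<partial>?M)" using Xn by (intro nn_integral_cong_AE) auto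
    then show "(\<integral>\<^sup>+t. 3 * n t \<partial>?M) < \<infinity>" using fin by (simp add: nn_integral_cmult ennreal_mult_less_top)
    have "AE t in ?M. \<forall>j. d j t = X (\<lambda>x. s j t x - g t x)" using dX by (simp add: AE_all_countable)
    then show "AE t in ?M. (\<lambda>j. d j t) \<longlonglongrightarrow> 0"
      using Xn lim
    proof eventually_elim
      case (elim t)
      show ?case
      proof (cases "n t = 0")
        case True
        have "X (s j t) = 0" for j using True by (auto simp: s_def norm_zero)
        then have "X (\<lambda>x. s j t x - g t x) = 0" for j
          using norm_diff_le[of "s j t" "g t"] elim True by simp
        then show ?thesis using elim by simp
      next
        case False
        have "\<forall>\<^sub>F j in sequentially. X (\<lambda>x. r j t x - g t x) < n t"
          using elim(3) by (rule order_tendstoD) (use False in \<open>simp add: zero_less_iff_neq_zero\<close>)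
        then have "\<forall>\<^sub>F j in sequentially. X (\<lambda>x. r j t x - g t x) = d j t"
        proof eventually_elim
          case e2: (elim j)
          have "X (r j t) \<le> n t + X (\<lambda>x. r j t x - g t x)" using norm_triangle_sub[of "r j t" "g t"] elim by simp
          also have "\<dots> \<le> n t + n t" using e2 by (intro add_left_mono) simp
          finally have "s j t = r j t" by (simp add: s_def mult_2)
          then show ?case using elim by simp
        qed
        then show ?thesis by (rule Lim_transform_eventually[OF elim(3)])
      qed
    qed
  qed auto
  then have "\<forall>\<^sub>F j in sequentially. (\<integral>\<^sup>+t. d j t \<partial>?M) < e" by (rule order_tendstoD) (use e in simp)
  then obtain j where "(\<integral>\<^sup>+t. d j t \<partial>?M) < e" by (auto simp: eventually_sequentially)
  moreover have "(\<integral>\<^sup>+t. d j t \<partial>?M) = (\<integral>\<^sup>+t. X (\<lambda>x. s j t x - g t x) \<partial>?M)"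
    using dX by (intro nn_integral_cong_AE) auto
  ultimately show ?thesis using s by auto
qed

section \<open>Weighted Bochner integrals\<close>

text \<open>A simple path takes finitely many values \<open>c\<close>, so the integral is the finite
  sum of the values, each weighted by the integral of \<open>B\<close> over its level set;
  disjointness of the level sets reassembles the integral in the norm bound.\<close>

lemma simple_path_integral:
  assumes s: "simple_path T s" and B: "B \<in> borel_measurable (lebesgue_on {0..T})" "\<And>t. \<bar>B t\<bar> \<le> b"
  shows "\<exists>w. X w \<le> (\<integral>\<^sup>+t. ennreal \<bar>B t\<bar> * X (s t) \<partial>lebesgue_on {0..T}) \<and> X w < \<infinity> \<and>
    (\<forall>v\<in>L2_space \<Omega>. L2_inner \<Omega> w v = (LINT t|lebesgue_on {0..T}. B t * L2_inner \<Omega> (s t) v))"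
proof -
  let ?M = "lebesgue_on {0..T}"
  let ?C = "s ` {0..T}"
  define A where "A c = s -` {c} \<inter> {0..T}" for c
  have finC: "finite ?C" using s by (simp add: simple_path_def simple_function_def)
  have XC: "X c < \<infinity>" if "c \<in> ?C" for c using s that by (auto simp: simple_path_def)
  have A[measurable]: "A c \<in> sets ?M" for c
    using simple_functionD(2)[of ?M s "{c}"] s by (simp add: simple_path_def A_def)
  have [measurable]: "B \<in> borel_measurable ?M" by fact
  have fm: "finite_measure ?M"
    by (rule finite_measure_lebesgue_on_Icc)
  have Bi: "integrable ?M (\<lambda>t. indicator (A c) t * B t)" for c
  proof (rule finite_measure.integrable_const_bound[OF fm, where B=b])
    have "\<bar>indicator (A c) t * B t\<bar> \<le> b" for t using B(2)[of t] by (auto simp: indicator_def)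
    then show "AE t in ?M. norm (indicator (A c) t * B t) \<le> b" by simp
    show "(\<lambda>t. indicator (A c) t * B t) \<in> borel_measurable ?M" by measurable
  qed
  define \<beta> where "\<beta> c = (LINT t|?M. indicator (A c) t * B t)" for c
  define w where "w = (\<lambda>x. \<Sum>c\<in>?C. \<beta> c * c x)"
  have "X w \<le> (\<Sum>c\<in>?C. ennreal \<bar>\<beta> c\<bar> * X c)"
    unfolding w_def using norm_sum_le[of "\<lambda>c x. \<beta> c * c x" ?C] by (simp add: norm_cmult)
  also have w1: "\<dots> \<le> (\<Sum>c\<in>?C. (\<integral>\<^sup>+t. indicator (A c) t * ennreal \<bar>B t\<bar> \<partial>?M) * X c)"
  proof (intro sum_mono mult_right_mono)
    fix c
    have "ennreal \<bar>\<beta> c\<bar> \<le> (\<integral>\<^sup>+t. ennreal (norm (indicator (A c) t * B t)) \<partial>?M)"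
      unfolding \<beta>_def using integral_norm_bound_ennreal[OF Bi] by simp
    also have "\<dots> = (\<integral>\<^sup>+t. indicator (A c) t * ennreal \<bar>B t\<bar> \<partial>?M)"
      by (intro nn_integral_cong) (auto simp: indicator_def)
    finally show "ennreal \<bar>\<beta> c\<bar> \<le> \<dots>" .
  qed simp
  also have "\<dots> = (\<Sum>c\<in>?C. (\<integral>\<^sup>+t. indicator (A c) t * ennreal \<bar>B t\<bar> * X c \<partial>?M))"
    by (intro sum.cong refl nn_integral_multc[symmetric]) measurable
  also have "\<dots> = (\<integral>\<^sup>+t. (\<Sum>c\<in>?C. indicator (A c) t * ennreal \<bar>B t\<bar> * X c) \<partial>?M)"
    by (intro nn_integral_sum[symmetric]) measurable
  also have "\<dots> = (\<integral>\<^sup>+t. ennreal \<bar>B t\<bar> * X (s t) \<partial>?M)"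
  proof (intro nn_integral_cong)
    fix t assume "t \<in> space ?M"
    then have t: "t \<in> {0..T}" by simp
    have "(\<Sum>c\<in>?C. indicator (A c) t * ennreal \<bar>B t\<bar> * X c) = (\<Sum>c\<in>{s t}. indicator (A c) t * ennreal \<bar>B t\<bar> * X c)"
      by (rule sum.mono_neutral_right) (use finC t in \<open>auto simp: A_def\<close>)
    then show "(\<Sum>c\<in>?C. indicator (A c) t * ennreal \<bar>B t\<bar> * X c) = ennreal \<bar>B t\<bar> * X (s t)"
      using t by (simp add: A_def)
  qed
  finally have 1: "X w \<le> (\<integral>\<^sup>+t. ennreal \<bar>B t\<bar> * X (s t) \<partial>?M)" .
  have "X w \<le> (\<Sum>c\<in>?C. ennreal \<bar>\<beta> c\<bar> * X c)"
    unfolding w_def using norm_sum_le[of "\<lambda>c x. \<beta> c * c x" ?C] by (simp add: norm_cmult)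
  also have "\<dots> < \<infinity>" using finC XC by (auto simp: ennreal_mult_less_top less_top)
  finally have 2: "X w < \<infinity>" .
  have 3: "L2_inner \<Omega> w v = (LINT t|?M. B t * L2_inner \<Omega> (s t) v)" if v: "v \<in> L2_space \<Omega>" for v
  proof -
    have "L2_inner \<Omega> w v = (\<Sum>c\<in>?C. \<beta> c * L2_inner \<Omega> c v)"
      unfolding w_def
      by (subst L2_inner_sum[OF L2_space_cmult[OF finite_norm_L2[OF XC]] v]) (auto simp: L2_inner_cmult)
    also have "\<dots> = (\<Sum>c\<in>?C. (LINT t|?M. (indicator (A c) t * B t) * L2_inner \<Omega> c v))"
      by (simp add: \<beta>_def)
    also have "\<dots> = (LINT t|?M. (\<Sum>c\<in>?C. (indicator (A c) t * B t) * L2_inner \<Omega> c v))"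
      by (rule Bochner_Integration.integral_sum[symmetric]) (rule integrable_mult_left[OF Bi])
    also have "\<dots> = (LINT t|?M. B t * L2_inner \<Omega> (s t) v)"
    proof (intro Bochner_Integration.integral_cong refl)
      fix t assume "t \<in> space ?M"
      then have t: "t \<in> {0..T}" by simp
      have "(\<Sum>c\<in>?C. (indicator (A c) t * B t) * L2_inner \<Omega> c v) = (\<Sum>c\<in>{s t}. (indicator (A c) t * B t) * L2_inner \<Omega> c v)"
        by (rule sum.mono_neutral_right) (use finC t in \<open>auto simp: A_def\<close>)
      then show "(\<Sum>c\<in>?C. (indicator (A c) t * B t) * L2_inner \<Omega> c v) = B t * L2_inner \<Omega> (s t) v"
        using t by (simp add: A_def)
    qed
    finally show ?thesis .
  qed
  from 1 2 3 show ?thesis by blast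
qed

lemma pairing_ennreal_le:
  assumes "v \<in> L2_space \<Omega>" "X w < \<infinity>"
  shows "ennreal \<bar>L2_inner \<Omega> w v\<bar> \<le> X w * ennreal (L2_norm \<Omega> v)"
  using ennreal_leI[OF pairing_le[OF assms(2,1)]] assms(2) by (simp add: ennreal_mult)

lemma pairing_integrable:
  assumes sm: "strongly_measurable X T g" and fin: "(\<integral>\<^sup>+t. X (g t) \<partial>lebesgue_on {0..T}) < \<infinity>" and v: "v \<in> L2_space \<Omega>"
  shows "integrable (lebesgue_on {0..T}) (\<lambda>t. L2_inner \<Omega> (g t) v)"
proof (rule integrableI_bounded)
  let ?M = "lebesgue_on {0..T}"
  define n where "n t = ennreal (enn2real (X (g t)))" for t
  have [measurable]: "n \<in> borel_measurable ?M" unfolding n_def using norm_path_measurable[OF sm] by measurable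
  have Xn: "AE t in ?M. X (g t) = n t" using norm_path_finite[OF sm] by eventually_elim (auto simp: n_def)
  show "(\<lambda>t. L2_inner \<Omega> (g t) v) \<in> borel_measurable ?M" by (rule pairing_measurable[OF sm v])
  have "(\<integral>\<^sup>+t. ennreal (norm (L2_inner \<Omega> (g t) v)) \<partial>?M) \<le> (\<integral>\<^sup>+t. n t * ennreal (L2_norm \<Omega> v) \<partial>?M)"
  proof (rule nn_integral_mono_AE, use norm_path_finite[OF sm] Xn in eventually_elim)
    case (elim t)
    from pairing_ennreal_le[OF v elim(1)] show ?case unfolding elim(2) by simp
  qed
  also have "\<dots> = (\<integral>\<^sup>+t. X (g t) \<partial>?M) * ennreal (L2_norm \<Omega> v)"
    using Xn by (subst nn_integral_multc) (auto intro!: arg_cong2[where f=times] nn_integral_cong_AE)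
  also have "\<dots> < \<infinity>" using fin by (simp add: ennreal_mult_less_top)
  finally show "(\<integral>\<^sup>+t. ennreal (norm (L2_inner \<Omega> (g t) v)) \<partial>?M) < \<infinity>" .
qed

lemma simple_path_pairing_integrable:
  assumes "simple_path T s" "v \<in> L2_space \<Omega>" "B \<in> borel_measurable (lebesgue_on {0..T})" "\<And>t. \<bar>B t\<bar> \<le> b"
  shows "integrable (lebesgue_on {0..T}) (\<lambda>t. B t * L2_inner \<Omega> (s t) v)"
proof -
  interpret M: finite_measure "lebesgue_on {0..T}" by (rule finite_measure_lebesgue_on_Icc)
  have "simple_function (lebesgue_on {0..T}) (\<lambda>t. L2_inner \<Omega> (s t) v)"
    using assms(1) unfolding simple_path_def by (blast intro: simple_function_compose1[where g="\<lambda>c. L2_inner \<Omega> c v"])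
  then have "integrable (lebesgue_on {0..T}) (\<lambda>t. L2_inner \<Omega> (s t) v)"
    by (rule integrable_simple_function) simp
  from integrable_mult_bounded[OF this assms(3,4)] show ?thesis by (simp add: mult.commute)
qed

text \<open>Simple paths within e/2^l of \<open>g\<close> in the mean have summable differences. The
  integrals of these differences form an absolutely convergent series, whose sum exists by
  \<open>norm_complete\<close> and has the pairings of the integral of \<open>g\<close>. The
  additional term in the norm bound is the price of the first approximation.\<close>

lemma bochner_integral_approx:
  assumes sm: "strongly_measurable X T g" and fin: "(\<integral>\<^sup>+t. X (g t) \<partial>lebesgue_on {0..T}) < \<infinity>"
    and B: "B \<in> borel_measurable (lebesgue_on {0..T})" "\<And>t. \<bar>B t\<bar> \<le> b" and e: "0 < (e::real)"
  shows "\<exists>W. X W \<le> (\<integral>\<^sup>+t. ennreal \<bar>B t\<bar> * X (g t) \<partial>lebesgue_on {0..T}) + ennreal (5 * b * e) \<and>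
    (\<forall>v\<in>L2_space \<Omega>. L2_inner \<Omega> W v = (LINT t|lebesgue_on {0..T}. B t * L2_inner \<Omega> (g t) v))"
proof -
  let ?M = "lebesgue_on {0..T}"
  have [measurable]: "B \<in> borel_measurable ?M" by fact
  have b: "0 \<le> b" using B(2)[of 0] by linarith
  have "\<forall>l. \<exists>s. simple_path T s \<and> (\<integral>\<^sup>+t. X (\<lambda>x. s t x - g t x) \<partial>?M) < ennreal (e / 2 ^ l)"
    using e by (intro allI simple_path_approx[OF sm fin]) simp
  then obtain s where s: "\<And>l::nat. simple_path T (s l)"
    and se: "\<And>l. (\<integral>\<^sup>+t. X (\<lambda>x. s l t x - g t x) \<partial>?M) < ennreal (e / 2 ^ l)" by metis
  define n where "n t = ennreal (enn2real (X (g t)))" for t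
  define d where "d l t = ennreal (enn2real (X (\<lambda>x. s l t x - g t x)))" for l t
  have dsm: "strongly_measurable X T (\<lambda>t x. s l t x - g t x)" for l by (rule strongly_measurable_diff[OF s sm])
  have [measurable]: "n \<in> borel_measurable ?M" unfolding n_def using norm_path_measurable[OF sm] by measurable
  have [measurable]: "d l \<in> borel_measurable ?M" for l unfolding d_def using norm_path_measurable[OF dsm] by measurable
  have Xn: "AE t in ?M. X (g t) = n t" using norm_path_finite[OF sm] by eventually_elim (auto simp: n_def)
  have dX: "AE t in ?M. X (\<lambda>x. s l t x - g t x) = d l t" for l
    using norm_path_finite[OF dsm[of l]] by eventually_elim (auto simp: d_def)
  have dint: "(\<integral>\<^sup>+t. d l t \<partial>?M) \<le> ennreal (e / 2 ^ l)" for l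
  proof -
    have "(\<integral>\<^sup>+t. d l t \<partial>?M) = (\<integral>\<^sup>+t. X (\<lambda>x. s l t x - g t x) \<partial>?M)"
      using dX[of l] by (intro nn_integral_cong_AE) auto
    then show ?thesis using se[of l] by simp
  qed
  \<comment> \<open>Telescoping: the partial sums of the \<open>\<delta>\<close> are the simple
    paths themselves.\<close>
  define \<delta> where "\<delta> l = (case l of 0 \<Rightarrow> s 0 | Suc l \<Rightarrow> (\<lambda>t x. s (Suc l) t x - s l t x))" for l
  have \<delta>: "simple_path T (\<delta> l)" for l unfolding \<delta>_def using s by (cases l) (auto intro: simple_path_diff)
  have "\<forall>l. \<exists>w. X w \<le> (\<integral>\<^sup>+t. ennreal \<bar>B t\<bar> * X (\<delta> l t) \<partial>?M) \<and> X w < \<infinity> \<and>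
    (\<forall>v\<in>L2_space \<Omega>. L2_inner \<Omega> w v = (LINT t|?M. B t * L2_inner \<Omega> (\<delta> l t) v))"
    by (intro allI simple_path_integral[OF \<delta> B])
  from choice[OF this] obtain w where w: "\<forall>l. X (w l) \<le> (\<integral>\<^sup>+t. ennreal \<bar>B t\<bar> * X (\<delta> l t) \<partial>?M) \<and> X (w l) < \<infinity> \<and>
    (\<forall>v\<in>L2_space \<Omega>. L2_inner \<Omega> (w l) v = (LINT t|?M. B t * L2_inner \<Omega> (\<delta> l t) v))" ..
  have wX: "X (w l) \<le> (\<integral>\<^sup>+t. ennreal \<bar>B t\<bar> * X (\<delta> l t) \<partial>?M)" for l using w by blast
  have wv: "L2_inner \<Omega> (w l) v = (LINT t|?M. B t * L2_inner \<Omega> (\<delta> l t) v)" if "v \<in> L2_space \<Omega>" for l v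
    using w that by blast
  let ?I = "\<integral>\<^sup>+t. ennreal \<bar>B t\<bar> * X (g t) \<partial>?M"
  have In: "?I = (\<integral>\<^sup>+t. ennreal \<bar>B t\<bar> * n t \<partial>?M)" using Xn by (intro nn_integral_cong_AE) auto
  have Bb: "ennreal \<bar>B t\<bar> \<le> ennreal b" for t using B(2) by (simp add: ennreal_leI)
  have w0: "X (w 0) \<le> ?I + ennreal (b * e)"
  proof -
    have "X (w 0) \<le> (\<integral>\<^sup>+t. ennreal \<bar>B t\<bar> * X (s 0 t) \<partial>?M)" using wX[of 0] by (simp add: \<delta>_def)
    also have "\<dots> \<le> (\<integral>\<^sup>+t. ennreal \<bar>B t\<bar> * n t + ennreal b * d 0 t \<partial>?M)"
    proof (rule nn_integral_mono_AE, use Xn dX[of 0] in eventually_elim)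
      case (elim t)
      have "ennreal \<bar>B t\<bar> * X (s 0 t) \<le> ennreal \<bar>B t\<bar> * (n t + d 0 t)"
        using norm_triangle_sub[of "s 0 t" "g t"] elim by (intro mult_left_mono) auto
      also have "\<dots> \<le> ennreal \<bar>B t\<bar> * n t + ennreal b * d 0 t"
        unfolding distrib_left by (intro add_left_mono mult_right_mono Bb) simp
      finally show ?case .
    qed
    also have "\<dots> = ?I + ennreal b * (\<integral>\<^sup>+t. d 0 t \<partial>?M)" by (simp add: In nn_integral_add nn_integral_cmult)
    also have "\<dots> \<le> ?I + ennreal b * ennreal e" using dint[of 0] by (intro add_left_mono mult_left_mono) auto
    finally show ?thesis using b e by (simp add: ennreal_mult)
  qed
  have wSuc: "X (w (Suc l)) \<le> ennreal (2 * b * e * (1/2) ^ l)" for l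
  proof -
    have "X (w (Suc l)) \<le> (\<integral>\<^sup>+t. ennreal \<bar>B t\<bar> * X (\<lambda>x. s (Suc l) t x - s l t x) \<partial>?M)"
      using wX[of "Suc l"] by (simp add: \<delta>_def)
    also have "\<dots> \<le> (\<integral>\<^sup>+t. ennreal b * (d (Suc l) t + d l t) \<partial>?M)"
    proof (rule nn_integral_mono_AE, use dX[of "Suc l"] dX[of l] in eventually_elim)
      case (elim t)
      have "X (\<lambda>x. s (Suc l) t x - s l t x) \<le> d (Suc l) t + d l t"
        using norm_diff_le[of "\<lambda>x. s (Suc l) t x - g t x" "\<lambda>x. s l t x - g t x"] elim by simp
      then show ?case by (intro mult_mono Bb) auto
    qed
    also have "\<dots> = ennreal b * ((\<integral>\<^sup>+t. d (Suc l) t \<partial>?M) + (\<integral>\<^sup>+t. d l t \<partial>?M))"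
      by (simp add: nn_integral_add nn_integral_cmult)
    also have "\<dots> \<le> ennreal b * (ennreal (e / 2 ^ Suc l) + ennreal (e / 2 ^ l))"
      by (intro mult_left_mono add_mono dint) simp
    also have "\<dots> = ennreal (b * (e / 2 ^ Suc l + e / 2 ^ l))" 
      using b e by (subst ennreal_plus[symmetric]; (subst ennreal_mult[symmetric])?; simp)
    also have "\<dots> \<le> ennreal (2 * b * e * (1/2) ^ l)" using b e by (intro ennreal_leI) (simp add: field_simps)
    finally show ?thesis .
  qed
  \<comment> \<open>The first path costs b e and the increments cost 2 b e / 2^l, which sum to 4 b
    e.\<close>
  have sumX: "(\<Sum>l. X (w l)) \<le> ?I + ennreal (5 * b * e)"
  proof -
    define c where "c l = (case l of 0 \<Rightarrow> ?I + ennreal (b * e) | Suc l \<Rightarrow> ennreal (2 * b * e * (1/2) ^ l))" for l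
    have "(\<lambda>l. 2 * b * e * (1/2) ^ l) sums (2 * b * e * (1 / (1 - 1/2)))"
      by (intro sums_mult geometric_sums) simp
    then have "(\<lambda>l. c (Suc l)) sums ennreal (4 * b * e)"
      using b e unfolding c_def by (simp add: algebra_simps)
    from sums_Suc[OF this] have "c sums (ennreal (4 * b * e) + (?I + ennreal (b * e)))" by (simp add: c_def[of 0])
    then have "(\<Sum>l. c l) = ?I + (ennreal (4 * b * e) + ennreal (b * e))" by (simp add: sums_iff add.left_commute)
    also have "ennreal (4 * b * e) + ennreal (b * e) = ennreal (5 * b * e)" using b e by (simp flip: ennreal_plus)
    finally have "(\<Sum>l. c l) = ?I + ennreal (5 * b * e)" .
    moreover have "X (w l) \<le> c l" for l using w0 wSuc by (cases l) (auto simp: c_def)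
    ultimately show ?thesis using suminf_le[of "\<lambda>l. X (w l)" c] by (simp add: summableI)
  qed
  have Ifin: "?I < \<infinity>"
  proof -
    have "?I \<le> (\<integral>\<^sup>+t. ennreal b * n t \<partial>?M)" unfolding In by (intro nn_integral_mono mult_right_mono Bb) simp
    also have "\<dots> = ennreal b * (\<integral>\<^sup>+t. X (g t) \<partial>?M)"
      using Xn by (subst nn_integral_cmult) (auto intro!: arg_cong2[where f=times] nn_integral_cong_AE)
    also have "\<dots> < \<infinity>" using fin by (simp add: ennreal_mult_less_top)
    finally show ?thesis .
  qed
  have "(\<Sum>l. X (w l)) < \<infinity>" by (rule order_le_less_trans[OF sumX]) (use Ifin in simp)
  from norm_complete[OF this] obtain W where W: "X W \<le> (\<Sum>l. X (w l))"
    and Wv: "\<And>v. v \<in> L2_space \<Omega> \<Longrightarrow> (\<lambda>l. L2_inner \<Omega> (w l) v) sums L2_inner \<Omega> W v" by blast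
  have "L2_inner \<Omega> W v = (LINT t|?M. B t * L2_inner \<Omega> (g t) v)" if v: "v \<in> L2_space \<Omega>" for v
  proof -
    let ?J = "\<lambda>l. LINT t|?M. B t * L2_inner \<Omega> (s l t) v"
    let ?L = "LINT t|?M. B t * L2_inner \<Omega> (g t) v"
    have isl: "integrable ?M (\<lambda>t. B t * L2_inner \<Omega> (s l t) v)" for l
      by (rule simple_path_pairing_integrable[OF s v B])
    have ig: "integrable ?M (\<lambda>t. B t * L2_inner \<Omega> (g t) v)"
      using integrable_mult_bounded[OF pairing_integrable[OF sm fin v] B] by (simp add: mult.commute)
    have part: "(\<Sum>l<Suc L. L2_inner \<Omega> (w l) v) = ?J L" for L
    proof (induction L)
      case 0
      show ?case by (simp add: wv[OF v] \<delta>_def)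
    next
      case (Suc L)
      have "L2_inner \<Omega> (w (Suc L)) v = (LINT t|?M. B t * L2_inner \<Omega> (s (Suc L) t) v - B t * L2_inner \<Omega> (s L t) v)"
        unfolding wv[OF v]
      proof (intro Bochner_Integration.integral_cong refl)
        fix t assume "t \<in> space ?M"
        then have "s (Suc L) t \<in> L2_space \<Omega>" "s L t \<in> L2_space \<Omega>"
          using s[of L] s[of "Suc L"] by (auto simp: simple_path_def intro!: finite_norm_L2)
        then show "B t * L2_inner \<Omega> (\<delta> (Suc L) t) v = B t * L2_inner \<Omega> (s (Suc L) t) v - B t * L2_inner \<Omega> (s L t) v"
          by (simp add: \<delta>_def L2_inner_diff v right_diff_distrib)
      qed
      also have "\<dots> = ?J (Suc L) - ?J L" by (rule Bochner_Integration.integral_diff[OF isl isl])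
      finally show ?case using Suc by simp
    qed
    have "(\<lambda>L. ?J L) \<longlonglongrightarrow> L2_inner \<Omega> W v"
      using LIMSEQ_Suc[OF Wv[OF v, unfolded sums_def]] unfolding part .
    moreover have "(\<lambda>L. ?J L) \<longlonglongrightarrow> ?L"
    proof -
      have le: "\<bar>?J L - ?L\<bar> \<le> b * L2_norm \<Omega> v * e * (1/2) ^ L" for L
      proof -
        have "?J L - ?L = (LINT t|?M. B t * L2_inner \<Omega> (s L t) v - B t * L2_inner \<Omega> (g t) v)"
          by (rule Bochner_Integration.integral_diff[OF isl ig, symmetric])
        then have "ennreal \<bar>?J L - ?L\<bar> \<le> (\<integral>\<^sup>+t. ennreal (norm (B t * L2_inner \<Omega> (s L t) v - B t * L2_inner \<Omega> (g t) v)) \<partial>?M)"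
          using integral_norm_bound_ennreal[OF Bochner_Integration.integrable_diff[OF isl[of L] ig]] by simp
        also have "\<dots> \<le> (\<integral>\<^sup>+t. ennreal (b * L2_norm \<Omega> v) * d L t \<partial>?M)"
        proof (rule nn_integral_mono_AE, use dX[of L] norm_path_finite[OF sm] AE_space[of ?M] in eventually_elim)
          case (elim t)
          have fs: "X (s L t) < \<infinity>" using s[of L] elim by (auto simp: simple_path_def)
          have fd: "X (\<lambda>x. s L t x - g t x) < \<infinity>" by (rule order_le_less_trans[OF norm_diff_le]) (use fs elim in simp)
          have "B t * L2_inner \<Omega> (s L t) v - B t * L2_inner \<Omega> (g t) v = B t * L2_inner \<Omega> (\<lambda>x. s L t x - g t x) v"
            using finite_norm_L2[OF fs] finite_norm_L2[OF elim(2)] v by (simp add: L2_inner_diff right_diff_distrib)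
          then have "ennreal (norm (B t * L2_inner \<Omega> (s L t) v - B t * L2_inner \<Omega> (g t) v))
              = ennreal \<bar>B t\<bar> * ennreal \<bar>L2_inner \<Omega> (\<lambda>x. s L t x - g t x) v\<bar>" by (simp add: abs_mult ennreal_mult)
          also have "\<dots> \<le> ennreal b * (d L t * ennreal (L2_norm \<Omega> v))"
            using pairing_ennreal_le[OF v fd] elim(1) by (intro mult_mono Bb) auto
          finally show ?case using b by (simp add: ennreal_mult ac_simps)
        qed
        also have "\<dots> = ennreal (b * L2_norm \<Omega> v) * (\<integral>\<^sup>+t. d L t \<partial>?M)" by (simp add: nn_integral_cmult)
        also have "\<dots> \<le> ennreal (b * L2_norm \<Omega> v) * ennreal (e / 2 ^ L)" by (intro mult_left_mono dint) simp
        also have "\<dots> = ennreal (b * L2_norm \<Omega> v * e * (1/2) ^ L)" using b e by (simp add: power_divide flip: ennreal_mult)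
        finally show ?thesis using b e by (simp add: ennreal_le_iff)
      qed
      have "(\<lambda>L. b * L2_norm \<Omega> v * e * (1/2) ^ L) \<longlonglongrightarrow> b * L2_norm \<Omega> v * e * 0"
        by (intro tendsto_mult_left LIMSEQ_power_zero) simp
      then have "(\<lambda>L. ?J L - ?L) \<longlonglongrightarrow> 0"
        unfolding mult_zero_right by (rule Lim_null_comparison[rotated]) (simp only: real_norm_def le eventually_True)
      then show ?thesis by (simp add: LIM_zero_iff)
    qed
    ultimately show ?thesis by (rule LIMSEQ_unique)
  qed
  with order_trans[OF W sumX] show ?thesis by blast
qed

text \<open>All approximate integrals have the same pairings, so they coincide almost everywhere and
  share one norm; letting the error parameter tend to 0 removes the additional term for a single
  \<open>W\<close>.\<close>

lemma bochner_integral_exists: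
  assumes sm: "strongly_measurable X T g" and fin: "(\<integral>\<^sup>+t. X (g t) \<partial>lebesgue_on {0..T}) < \<infinity>"
    and B: "B \<in> borel_measurable (lebesgue_on {0..T})" "\<And>t. \<bar>B t\<bar> \<le> b"
  shows "\<exists>W. X W \<le> (\<integral>\<^sup>+t. ennreal \<bar>B t\<bar> * X (g t) \<partial>lebesgue_on {0..T}) \<and> W \<in> L2_space \<Omega> \<and>
    (\<forall>v\<in>L2_space \<Omega>. L2_inner \<Omega> W v = (LINT t|lebesgue_on {0..T}. B t * L2_inner \<Omega> (g t) v))"
proof -
  let ?M = "lebesgue_on {0..T}"
  let ?I = "\<integral>\<^sup>+t. ennreal \<bar>B t\<bar> * X (g t) \<partial>?M"
  have b: "0 \<le> b" using B(2)[of 0] by linarith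
  have Ifin: "?I < \<infinity>"
  proof -
    define n where "n t = ennreal (enn2real (X (g t)))" for t
    have [measurable]: "n \<in> borel_measurable ?M" unfolding n_def using norm_path_measurable[OF sm] by measurable
    have Xn: "AE t in ?M. X (g t) = n t" using norm_path_finite[OF sm] by eventually_elim (auto simp: n_def)
    have "?I \<le> (\<integral>\<^sup>+t. ennreal b * n t \<partial>?M)"
    proof (rule nn_integral_mono_AE, use Xn in eventually_elim)
      case (elim t)
      show ?case unfolding elim by (intro mult_right_mono ennreal_leI B(2)) simp
    qed
    also have "\<dots> = ennreal b * (\<integral>\<^sup>+t. X (g t) \<partial>?M)"
      using Xn by (subst nn_integral_cmult) (auto intro!: arg_cong2[where f=times] nn_integral_cong_AE)
    also have "\<dots> < \<infinity>" using fin by (simp add: ennreal_mult_less_top)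
    finally show ?thesis .
  qed
  let ?P = "\<lambda>W. \<forall>v\<in>L2_space \<Omega>. L2_inner \<Omega> W v = (LINT t|?M. B t * L2_inner \<Omega> (g t) v)"
  obtain W where W: "X W \<le> ?I + ennreal (5 * b * 1)" "?P W"
    using bochner_integral_approx[OF sm fin B, of 1] by auto
  have L2: "V \<in> L2_space \<Omega>" if "X V \<le> ?I + ennreal r" for V r
    by (rule finite_norm_L2, rule order_le_less_trans[OF that]) (use Ifin in simp)
  have "X W \<le> ?I"
  proof (rule ennreal_le_epsilon)
    fix e :: real assume e: "0 < e"
    \<comment> \<open>Dividing by 5 b + 1 instead of 5 b covers the case \<open>b\<close> =
      0.\<close>
    obtain V where V: "X V \<le> ?I + ennreal (5 * b * (e / (5 * b + 1)))" "?P V"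
      using bochner_integral_approx[OF sm fin B, of "e / (5 * b + 1)"] b e by auto
    have "AE x in lebesgue_on \<Omega>. W x = V x"
      using W V L2[OF W(1)] L2[OF V(1)] by (intro L2_AE_eqI) auto
    then have "X W = X V" by (rule norm_cong_AE)
    also have "\<dots> \<le> ?I + ennreal (5 * b * (e / (5 * b + 1)))" by (rule V)
    also have "\<dots> \<le> ?I + ennreal e"
      using b e by (intro add_left_mono ennreal_leI) (simp add: field_simps)
    finally show "X W \<le> ?I + ennreal e" .
  qed
  then show ?thesis using W(2) L2[OF W(1)] by blast
qed

end

lemma bochner_norm_L2:
  assumes "\<Omega> \<in> sets lebesgue"
  shows "bochner_norm \<Omega> (L2_enorm \<Omega>)"
proof
  fix z :: "nat \<Rightarrow> sfun" assume fin: "(\<Sum>j. L2_enorm \<Omega> (z j)) < \<infinity>"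
  have z: "z j \<in> L2_space \<Omega>" for j
  proof -
    have "(\<Sum>i\<in>{j}. L2_enorm \<Omega> (z i)) \<le> (\<Sum>j. L2_enorm \<Omega> (z j))" by (rule sum_le_suminf) auto
    then have "L2_enorm \<Omega> (z j) \<le> (\<Sum>j. L2_enorm \<Omega> (z j))" by simp
    then show ?thesis using fin unfolding L2_enorm_finite_iff[symmetric] by (rule order_le_less_trans)
  qed
  show "\<exists>W. L2_enorm \<Omega> W \<le> (\<Sum>j. L2_enorm \<Omega> (z j)) \<and>
      (\<forall>v\<in>L2_space \<Omega>. (\<lambda>j. L2_inner \<Omega> (z j) v) sums L2_inner \<Omega> W v)"
    using L2_suminf(3,4)[OF z fin] by blast
qed (use assms in \<open>auto simp: L2_enorm_add L2_enorm_cmult intro: L2_enorm_cong_AE\<close>)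

lemma bochner_norm_sobolev:
  assumes "open \<Omega>"
  shows "bochner_norm \<Omega> (sobolev_norm \<Omega> s)"
proof
  fix z :: "nat \<Rightarrow> sfun" assume fin: "(\<Sum>j. sobolev_norm \<Omega> s (z j)) < \<infinity>"
  show "\<exists>W. sobolev_norm \<Omega> s W \<le> (\<Sum>j. sobolev_norm \<Omega> s (z j)) \<and>
      (\<forall>v\<in>L2_space \<Omega>. (\<lambda>j. L2_inner \<Omega> (z j) v) sums L2_inner \<Omega> W v)"
    using sobolev_norm_suminf[OF assms fin] by blast
qed (use assms in \<open>auto simp: sobolev_norm_add sobolev_norm_cmult L2_enorm_le_sobolev_norm intro: sobolev_norm_cong_AE\<close>)

section \<open>Distributional derivatives of scalar functions of time\<close>

text \<open>Kernels enter as indicator weights over the full time interval, while calculus uses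
  \<open>integral\<close> over subintervals; this translates between the two.\<close>

lemma LINT_indicator_Icc:
  fixes f :: "real \<Rightarrow> real"
  assumes "integrable (lebesgue_on {0..T}) f" "0 \<le> a" "b \<le> T"
  shows "(LINT t|lebesgue_on {0..T}. indicator {a..b} t * f t) = integral {a..b} f"
    and "integrable (lebesgue_on {a..b}) f"
proof -
  show i: "integrable (lebesgue_on {a..b}) f"
    by (rule integrable_lebesgue_on_subset[OF assms(1)]) (use assms in auto)
  have "(LINT t|lebesgue_on {0..T}. indicator {a..b} t * f t) = (LINT t|lebesgue. indicator {0..T} t *\<^sub>R (indicator {a..b} t * f t))"
    by (subst integral_restrict_space) auto
  also have "\<dots> = (LINT t|lebesgue. indicator {a..b} t *\<^sub>R f t)"
    using assms(2,3) by (intro Bochner_Integration.integral_cong refl) (auto simp: indicator_def)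
  also have "\<dots> = (LINT t|lebesgue_on {a..b}. f t)" by (subst integral_restrict_space) auto
  also have "\<dots> = integral {a..b} f" by (rule lebesgue_integral_eq_integral[OF i]) auto
  finally show "(LINT t|lebesgue_on {0..T}. indicator {a..b} t * f t) = integral {a..b} f" .
qed

lemma continuous_integrable_Icc:
  "continuous_on {a..b} f \<Longrightarrow> integrable (lebesgue_on {a..b::real}) (f :: real \<Rightarrow> real)"
  using absolutely_integrable_continuous_real[of a b f] by (intro absolutely_integrable_imp_integrable) auto

text \<open>The fundamental lemma is stated on open sets; the two endpoints form a null set, and
  test functions vanish there.\<close>

lemma fundamental_lemma_Icc:
  fixes h :: "real \<Rightarrow> real"
  assumes "integrable (lebesgue_on {0..T}) h"
    and "\<And>\<phi>. \<phi> \<in> test_fun {0<..<T} \<Longrightarrow> (LINT t|lebesgue_on {0..T}. h t * \<phi> t) = 0"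
  shows "AE t in lebesgue_on {0..T}. h t = 0"
proof -
  have "AE t in lebesgue_on {0<..<T}. h t = 0"
  proof (rule fundamental_lemma_calculus_of_variations)
    show "integrable (lebesgue_on K) h" if "compact K" "K \<subseteq> {0<..<T}" for K
      using that by (intro integrable_lebesgue_on_subset[OF assms(1)]) (auto simp: borel_compact)
    fix \<phi> :: "real \<Rightarrow> real" assume \<phi>: "\<phi> \<in> test_fun {0<..<T}"
    then have z: "\<phi> t = 0" if "t \<notin> {0<..<T}" for t using that by (auto simp: test_fun_def)
    have "(LINT t|lebesgue_on {0<..<T}. h t * \<phi> t) = (LINT t|lebesgue. indicator {0<..<T} t *\<^sub>R (h t * \<phi> t))"
      by (subst integral_restrict_space) auto
    also have "\<dots> = (LINT t|lebesgue. indicator {0..T} t *\<^sub>R (h t * \<phi> t))"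
      using z by (intro Bochner_Integration.integral_cong refl) (auto simp: indicator_def)
    also have "\<dots> = (LINT t|lebesgue_on {0..T}. h t * \<phi> t)" by (subst integral_restrict_space) auto
    finally show "(LINT t|lebesgue_on {0<..<T}. h t * \<phi> t) = 0" using assms(2)[OF \<phi>] by simp
  qed simp
  then have "AE t in lebesgue. t \<in> {0<..<T} \<longrightarrow> h t = 0" by (simp add: AE_restrict_space_iff)
  moreover have "AE t in lebesgue. t \<notin> {0, T}"
    by (rule AE_not_in) (simp add: negligible_iff_null_sets[symmetric])
  ultimately have "AE t in lebesgue. t \<in> {0..T} \<longrightarrow> h t = 0" by eventually_elim auto
  then show ?thesis by (simp add: AE_restrict_space_iff)
qed

lemma test_fun_deriv:
  fixes \<phi> :: "real \<Rightarrow> real"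
  assumes "\<phi> \<in> test_fun S"
  shows "deriv \<phi> \<in> test_fun S" and "(\<phi> has_real_derivative deriv \<phi> t) (at t)"
proof -
  have s: "smooth_fun \<phi>" using assms by (simp add: test_fun_def)
  show d: "(\<phi> has_real_derivative deriv \<phi> t) (at t)" for t by (rule smooth_real_iff_deriv[OF s])
  have "(\<phi> has_derivative (\<lambda>h. deriv \<phi> t * h)) (at t)" for t using d by (simp add: has_field_derivative_def)
  from frechet_derivative_at[OF this] have "deriv \<phi> = (\<lambda>t. frechet_derivative \<phi> (at t) 1)" by (metis mult.right_neutral)
  then show "deriv \<phi> \<in> test_fun S" using test_fun_frechet_derivative[OF assms, of 1] by simp
qed

lemma test_fun_integrable:
  "\<phi> \<in> test_fun S \<Longrightarrow> integrable (lebesgue_on {0..T}) h \<Longrightarrow> integrable (lebesgue_on {0..T::real}) (\<lambda>t. h t * \<phi> t)"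
  by (erule test_funE, rule integrable_mult_bounded)
    (auto intro: test_fun_measurable_lebesgue_on[of \<phi> S] simp: borel_measurable_continuous_onI measurable_restrict_space1 measurable_completion)

text \<open>The primitive vanishes to the left of the support, and the zero mean makes it vanish to
  the right as well.\<close>

lemma test_fun_antiderivative:
  fixes \<psi> :: "real \<Rightarrow> real"
  assumes \<psi>: "\<psi> \<in> test_fun {0<..<T}" and z: "integral {0..T} \<psi> = 0"
  shows "\<exists>\<phi>\<in>test_fun {0<..<T}. deriv \<phi> = \<psi>"
proof -
  obtain K where K: "compact K" "K \<subseteq> {0<..<T}" "\<And>t. t \<notin> K \<Longrightarrow> \<psi> t = 0" and s: "smooth_fun \<psi>"
    using \<psi> by (auto simp: test_fun_def)
  show ?thesis
  proof (cases "K = {}")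
    case True
    then have "\<psi> = (\<lambda>t. 0)" using K(3) by auto
    then show ?thesis by (intro bexI[of _ "\<lambda>t. 0"] zero_test_fun) auto
  next
    case False
    obtain a where a: "a \<in> K" "\<And>t. t \<in> K \<Longrightarrow> a \<le> t" using compact_attains_inf[OF K(1) False] by blast
    obtain b where b: "b \<in> K" "\<And>t. t \<in> K \<Longrightarrow> t \<le> b" using compact_attains_sup[OF K(1) False] by blast
    have ab: "0 < a" "a \<le> b" "b < T" using a b K(2) by auto
    have \<psi>0: "\<psi> t = 0" if "t < a \<or> t > b" for t using K(3)[of t] a b that by force
    have c: "continuous_on UNIV \<psi>" by (rule test_funE[OF \<psi>])
    have int: "\<psi> integrable_on {x..y}" for x y by (intro integrable_continuous_real continuous_on_subset[OF c]) simp
    \<comment> \<open>The base point -1 lies strictly to the left of the support; for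
      \<open>t\<close> below it the interval is empty and the integral 0, as required.\<close>
    define \<phi> where "\<phi> t = integral {-1..t} \<psi>" for t
    have lo: "\<phi> t = 0" if "t < a" for t
    proof -
      have "integral {-1..t} \<psi> = integral {-1..t} (\<lambda>_. 0)"
        by (rule Henstock_Kurzweil_Integration.integral_cong) (use that \<psi>0 in auto)
      then show ?thesis by (simp add: \<phi>_def)
    qed
    have hi: "\<phi> t = 0" if "t > b" for t
    proof -
      have "integral {0..T} \<psi> = integral {-1..t} \<psi>"
      proof -
        have *: "integral {x..y} \<psi> = integral {a..b} \<psi>" if "x < a" "b < y" for x y
        proof -
          have "integral {x..a} \<psi> + integral {a..y} \<psi> = integral {x..y} \<psi>"
            by (rule Henstock_Kurzweil_Integration.integral_combine) (use that ab int in auto)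
          moreover have "integral {a..b} \<psi> + integral {b..y} \<psi> = integral {a..y} \<psi>"
            by (rule Henstock_Kurzweil_Integration.integral_combine) (use that ab int in auto)
          moreover have "integral {x..a} \<psi> = 0"
            using integral_spike[of "{a}" "{x..a}" "\<lambda>_. 0" \<psi>] \<psi>0 by auto
          moreover have "integral {b..y} \<psi> = 0"
            using integral_spike[of "{b}" "{b..y}" "\<lambda>_. 0" \<psi>] \<psi>0 by auto
          ultimately show ?thesis by simp
        qed
        show ?thesis using *[of 0 T] *[of "-1" t] ab that by simp
      qed
      then show ?thesis using z by (simp add: \<phi>_def)
    qed
    have d: "(\<phi> has_real_derivative \<psi> t) (at t)" for t
    proof -
      consider "t < a" | "t > b" | "-1 < t \<and> t < T + 1" using ab by linarith
      then show ?thesis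
      proof cases
        case 1
        have "((\<lambda>_. 0) has_real_derivative \<psi> t) (at t)" using \<psi>0 1 by simp
        then show ?thesis
          by (rule has_field_derivative_transform_within_open[where S="{..<a}"]) (use 1 lo in auto)
      next
        case 2
        have "((\<lambda>_. 0) has_real_derivative \<psi> t) (at t)" using \<psi>0 2 by simp
        then show ?thesis
          by (rule has_field_derivative_transform_within_open[where S="{b<..}"]) (use 2 hi in auto)
      next
        case 3
        have "(\<phi> has_real_derivative \<psi> t) (at t within {-1..T+1})"
          unfolding \<phi>_def by (rule integral_has_real_derivative[OF continuous_on_subset[OF c]]) (use 3 in simp_all)
        then show ?thesis using at_within_Icc_at[of "-1" t "T+1"] 3 by (simp only:)
      qed
    qed
    have "Ck (Suc m) \<phi>" for m 
      by (rule Ck_real_SucI[OF d]) (use s in \<open>simp add: smooth_fun_def\<close>)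
    then have "smooth_fun \<phi>" unfolding smooth_fun_def using Ck_Suc_imp by blast
    then have "\<phi> \<in> test_fun {0<..<T}"
      unfolding test_fun_def using lo hi ab by (intro CollectI conjI exI[of _ "{a..b}"]) (auto simp: not_le)
    moreover have "deriv \<phi> = \<psi>" using d by (auto intro!: ext DERIV_imp_deriv)
    ultimately show ?thesis by blast
  qed
qed

section \<open>From distributional to classical derivatives\<close>

text \<open>Subtracting a multiple of a fixed \<open>\<eta>\<close> with nonzero integral gives any
  test function mean zero and hence makes it a derivative. The constant is the mean of
  \<open>h\<close> weighted by \<open>\<eta>\<close>.\<close>

lemma du_Bois_Reymond:
  fixes h :: "real \<Rightarrow> real"
  assumes T: "0 < T" and h: "integrable (lebesgue_on {0..T}) h"
    and z: "\<And>\<phi>. \<phi> \<in> test_fun {0<..<T} \<Longrightarrow> (LINT t|lebesgue_on {0..T}. h t * deriv \<phi> t) = 0"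
  shows "\<exists>c. AE t in lebesgue_on {0..T}. h t = c"
proof -
  let ?M = "lebesgue_on {0..T}"
  interpret finite_measure ?M by (rule finite_measure_lebesgue_on_Icc)
  have one: "integrable ?M (\<lambda>t. 1::real)" by simp
  have I: "integral {0..T} \<psi> = (LINT t|?M. \<psi> t)" if "\<psi> \<in> test_fun {0<..<T}" for \<psi>
    using test_fun_integrable[OF that one] by (simp add: lebesgue_integral_eq_integral)
  \<comment> \<open>If every test function had integral 0, the fundamental lemma would force 1 = 0
    almost everywhere.\<close>
  have "\<exists>\<eta>\<in>test_fun {0<..<T}. (LINT t|?M. \<eta> t) \<noteq> 0"
  proof (rule ccontr)
    assume "\<not> (\<exists>\<eta>\<in>test_fun {0<..<T}. (LINT t|?M. \<eta> t) \<noteq> 0)"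
    then have "(LINT t|?M. 1 * \<phi> t) = 0" if "\<phi> \<in> test_fun {0<..<T}" for \<phi> using that by auto
    then have "AE t in ?M. (1::real) = 0" by (rule fundamental_lemma_Icc[OF one])
    then have "AE t in ?M. \<not> True" by simp
    from emeasure_eq_0_AE[OF this] have "emeasure ?M {t \<in> space ?M. True} = 0" .
    moreover have "{t \<in> space ?M. True} = space ?M" by blast
    ultimately have "emeasure ?M (space ?M) = 0" by (simp only:)
    then show False using T by (simp add: emeasure_restrict_space space_restrict_space)
  qed
  then obtain \<eta> where \<eta>: "\<eta> \<in> test_fun {0<..<T}" "(LINT t|?M. \<eta> t) \<noteq> 0" by blast
  define c where "c = (LINT t|?M. h t * \<eta> t) / (LINT t|?M. \<eta> t)"
  have "AE t in ?M. h t - c = 0"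
  proof (rule fundamental_lemma_Icc)
    show "integrable ?M (\<lambda>t. h t - c)" using h by simp
    fix \<psi> :: "real \<Rightarrow> real" assume \<psi>: "\<psi> \<in> test_fun {0<..<T}"
    define r where "r = (LINT t|?M. \<psi> t) / (LINT t|?M. \<eta> t)"
    have m: "(\<lambda>t. 1 * \<psi> t + (-r) * \<eta> t) \<in> test_fun {0<..<T}" by (rule test_fun_linear[OF \<psi> \<eta>(1)])
    have i\<psi>: "integrable ?M \<psi>" and i\<eta>: "integrable ?M \<eta>"
      using test_fun_integrable[OF \<psi> one] test_fun_integrable[OF \<eta>(1) one] by auto
    have "integral {0..T} (\<lambda>t. 1 * \<psi> t + (-r) * \<eta> t) = 0"
      unfolding I[OF m] using i\<psi> i\<eta> \<eta>(2) by (simp add: r_def)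
    from test_fun_antiderivative[OF m this] obtain \<phi> where "\<phi> \<in> test_fun {0<..<T}" "deriv \<phi> = (\<lambda>t. 1 * \<psi> t + (-r) * \<eta> t)" by blast
    from z[OF this(1)] this(2) have "(LINT t|?M. h t * \<psi> t - r * (h t * \<eta> t)) = 0"
      by (simp add: algebra_simps)
    then have 1: "(LINT t|?M. h t * \<psi> t) = r * (LINT t|?M. h t * \<eta> t)"
      using test_fun_integrable[OF \<psi> h] test_fun_integrable[OF \<eta>(1) h] by simp
    have "(LINT t|?M. (h t - c) * \<psi> t) = (LINT t|?M. h t * \<psi> t - c * \<psi> t)" by (simp add: left_diff_distrib)
    also have "\<dots> = r * (LINT t|?M. h t * \<eta> t) - c * (LINT t|?M. \<psi> t)"
      using test_fun_integrable[OF \<psi> h] i\<psi> 1 by simp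
    also have "\<dots> = 0" using \<eta>(2) by (simp add: r_def c_def)
    finally show "(LINT t|?M. (h t - c) * \<psi> t) = 0" .
  qed
  then show ?thesis by (intro exI[of _ c]) simp
qed

text \<open>Fubini on the triangle s \<le> t; the inner integral of the derivative of
  \<open>\<phi>\<close> from s to T is -\<phi>(s), because \<open>\<phi>\<close> vanishes at
  T.\<close>

lemma integral_test_fun_by_parts:
  fixes z :: "real \<Rightarrow> real"
  assumes z: "integrable (lebesgue_on {0..T}) z" and \<phi>: "\<phi> \<in> test_fun {0<..<T}"
  shows "(LINT t|lebesgue_on {0..T}. integral {0..t} z * deriv \<phi> t) = - (LINT t|lebesgue_on {0..T}. z t * \<phi> t)"
proof -
  let ?M = "lebesgue_on {0..T}"
  interpret M: finite_measure ?M by (rule finite_measure_lebesgue_on_Icc)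
  interpret P: pair_sigma_finite ?M ?M ..
  note D = test_fun_deriv[OF \<phi>]
  obtain B where B: "\<And>t. \<bar>deriv \<phi> t\<bar> \<le> B" by (rule test_funE[OF D(1)]) blast
  have [measurable]: "z \<in> borel_measurable ?M" "deriv \<phi> \<in> borel_measurable ?M"
    using z test_fun_measurable_lebesgue_on[OF D(1)] by auto
  have i: "(\<lambda>x::real. x) \<in> borel_measurable ?M" by (simp add: measurable_restrict_space1 measurable_completion)
  have [measurable]: "fst \<in> borel_measurable (?M \<Otimes>\<^sub>M ?M)" "snd \<in> borel_measurable (?M \<Otimes>\<^sub>M ?M)"
    using measurable_compose[OF measurable_fst i] measurable_compose[OF measurable_snd i] by auto
  let ?f = "\<lambda>s t. (if s \<le> t then z s * deriv \<phi> t else 0)"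
  have int: "integrable (?M \<Otimes>\<^sub>M ?M) (case_prod ?f)"
  proof (rule integrableI_bounded)
    show m: "case_prod ?f \<in> borel_measurable (?M \<Otimes>\<^sub>M ?M)" unfolding case_prod_beta by measurable
    have "(\<integral>\<^sup>+x. ennreal (norm (case_prod ?f x)) \<partial>(?M \<Otimes>\<^sub>M ?M)) = (\<integral>\<^sup>+s. \<integral>\<^sup>+t. ennreal (norm (?f s t)) \<partial>?M \<partial>?M)"
      using M.nn_integral_fst[of "\<lambda>x. ennreal (norm (case_prod ?f x))" ?M] m by simp
    also have "\<dots> \<le> (\<integral>\<^sup>+s. \<integral>\<^sup>+t. ennreal \<bar>z s\<bar> * ennreal B \<partial>?M \<partial>?M)"
      using B by (intro nn_integral_mono) (auto simp: abs_mult intro!: mult_left_mono ennreal_leI simp flip: ennreal_mult')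
    also have "\<dots> = (\<integral>\<^sup>+s. ennreal \<bar>z s\<bar> \<partial>?M) * (ennreal B * emeasure ?M (space ?M))"
      by (simp add: nn_integral_multc mult.assoc)
    also have "\<dots> < \<infinity>"
    proof -
      have "emeasure ?M (space ?M) < \<infinity>" by (simp flip: top.not_eq_extremum)
      then show ?thesis using z by (auto simp: integrable_iff_bounded ennreal_mult_less_top)
    qed
    finally show "(\<integral>\<^sup>+x. ennreal (norm (case_prod ?f x)) \<partial>(?M \<Otimes>\<^sub>M ?M)) < \<infinity>" .
  qed
  have 1: "(LINT s|?M. ?f s t) = integral {0..t} z * deriv \<phi> t" if "t \<in> {0..T}" for t
  proof -
    have "(LINT s|?M. ?f s t) = (LINT s|?M. (indicator {0..t} s * z s) * deriv \<phi> t)"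
      by (intro Bochner_Integration.integral_cong refl) (auto simp: indicator_def)
    then show ?thesis using LINT_indicator_Icc(1)[OF z, of 0 t] that by simp
  qed
  have 2: "(LINT t|?M. ?f s t) = - (z s * \<phi> s)" if s: "s \<in> {0..T}" for s
  proof -
    have iD: "integrable ?M (deriv \<phi>)" using test_fun_integrable[OF D(1), of T "\<lambda>_. 1"] by simp
    have "(LINT t|?M. ?f s t) = (LINT t|?M. z s * (indicator {s..T} t * deriv \<phi> t))"
      by (intro Bochner_Integration.integral_cong refl) (auto simp: indicator_def)
    also have "\<dots> = z s * integral {s..T} (deriv \<phi>)"
      using LINT_indicator_Icc(1)[OF iD, of s T] s by simp
    also have "integral {s..T} (deriv \<phi>) = \<phi> T - \<phi> s"
      using s D(2) by (intro integral_unique fundamental_theorem_of_calculus)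
        (auto intro: has_field_derivative_at_within simp flip: has_real_derivative_iff_has_vector_derivative)
    also have "\<phi> T = 0" using \<phi> by (auto simp: test_fun_def)
    finally show ?thesis by simp
  qed
  have "(LINT t|?M. integral {0..t} z * deriv \<phi> t) = (LINT t|?M. (LINT s|?M. ?f s t))"
    by (intro Bochner_Integration.integral_cong refl) (simp add: 1)
  also have "\<dots> = (LINT s|?M. (LINT t|?M. ?f s t))" by (rule P.Fubini_integral[OF int])
  also have "\<dots> = (LINT s|?M. - (z s * \<phi> s))"
    by (intro Bochner_Integration.integral_cong refl) (simp add: 2)
  finally show ?thesis by simp
qed

lemma indefinite_integral_continuous:
  fixes z :: "real \<Rightarrow> real"
  assumes "integrable (lebesgue_on {0..T}) z"
  shows "continuous_on {0..T} (\<lambda>t. integral {0..t} z)"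
  by (intro indefinite_integral_continuous_1 integrable_on_lebesgue_on[OF assms]) auto

text \<open>\<open>y\<close> minus the primitive of \<open>z\<close> has distributional derivative
  0, so du Bois-Reymond applies.\<close>

lemma distributional_deriv_integral:
  fixes y z :: "real \<Rightarrow> real"
  assumes T: "0 < T" and y: "integrable (lebesgue_on {0..T}) y" and z: "integrable (lebesgue_on {0..T}) z"
    and d: "\<And>\<phi>. \<phi> \<in> test_fun {0<..<T} \<Longrightarrow>
      (LINT t|lebesgue_on {0..T}. y t * deriv \<phi> t) = - (LINT t|lebesgue_on {0..T}. z t * \<phi> t)"
  shows "\<exists>c. AE t in lebesgue_on {0..T}. y t = c + integral {0..t} z"
proof -
  let ?G = "\<lambda>t. integral {0..t} z"
  have G: "integrable (lebesgue_on {0..T}) ?G"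
    by (rule continuous_integrable_Icc[OF indefinite_integral_continuous[OF z]])
  have "\<exists>c. AE t in lebesgue_on {0..T}. y t - ?G t = c"
  proof (rule du_Bois_Reymond[OF T])
    show "integrable (lebesgue_on {0..T}) (\<lambda>t. y t - ?G t)" using y G by simp
    fix \<phi> :: "real \<Rightarrow> real" assume \<phi>: "\<phi> \<in> test_fun {0<..<T}"
    show "(LINT t|lebesgue_on {0..T}. (y t - ?G t) * deriv \<phi> t) = 0"
      using test_fun_integrable[OF test_fun_deriv(1)[OF \<phi>] y] test_fun_integrable[OF test_fun_deriv(1)[OF \<phi>] G]
        d[OF \<phi>] integral_test_fun_by_parts[OF z \<phi>] by (simp add: left_diff_distrib)
  qed
  then obtain c where "AE t in lebesgue_on {0..T}. y t - ?G t = c" by blast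
  then have "AE t in lebesgue_on {0..T}. y t = c + ?G t" by eventually_elim simp
  then show ?thesis by blast
qed

lemma continuous_AE_eq:
  fixes f g :: "real \<Rightarrow> real"
  assumes T: "0 < T" and c: "continuous_on {0..T} f" "continuous_on {0..T} g"
    and ae: "AE t in lebesgue_on {0..T}. f t = g t" and t: "t \<in> {0..T}"
  shows "f t = g t"
proof -
  let ?h = "\<lambda>t. \<bar>f t - g t\<bar>"
  have ch: "continuous_on {0..T} ?h" by (intro continuous_intros c)
  have "integral {0..T} ?h = (LINT t|lebesgue_on {0..T}. ?h t)"
    by (rule lebesgue_integral_eq_integral[OF continuous_integrable_Icc[OF ch], symmetric]) auto
  also have "\<dots> = 0" using ae by (intro integral_eq_zero_AE) auto
  finally have "\<forall>t\<in>{0..T}. ?h t = 0" using integral_eq_0_iff[OF ch T] by simp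
  then show ?thesis using t by auto
qed

text \<open>The continuous function max |f| m equals m almost everywhere, hence everywhere.\<close>

lemma continuous_AE_bound:
  fixes f :: "real \<Rightarrow> real"
  assumes "0 < T" "continuous_on {0..T} f" "AE t in lebesgue_on {0..T}. \<bar>f t\<bar> \<le> m" "t \<in> {0..T}"
  shows "\<bar>f t\<bar> \<le> m"
proof -
  have "max \<bar>f t\<bar> m = m"
    by (rule continuous_AE_eq[where f="\<lambda>t. max \<bar>f t\<bar> m" and g="\<lambda>_. m", OF assms(1) _ _ _ assms(4)])
      (use assms in \<open>auto intro!: continuous_intros elim!: eventually_mono\<close>)
  then show ?thesis by linarith
qed

lemma integral_cong_AE_Icc:
  fixes f g :: "real \<Rightarrow> real"
  assumes "AE t in lebesgue_on {0..T}. f t = g t" "integrable (lebesgue_on {0..T}) f" "integrable (lebesgue_on {0..T}) g"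
    "0 \<le> a" "b \<le> T"
  shows "integral {a..b} f = integral {a..b} g"
  unfolding LINT_indicator_Icc(1)[OF assms(2,4,5), symmetric] LINT_indicator_Icc(1)[OF assms(3,4,5), symmetric]
proof (rule integral_cong_AE)
  have [measurable]: "f \<in> borel_measurable (lebesgue_on {0..T})" "g \<in> borel_measurable (lebesgue_on {0..T})" using assms by auto
  have [measurable]: "indicat_real {a..b} \<in> borel_measurable (lebesgue_on {0..T})"
    by (simp add: measurable_restrict_space1 measurable_completion)
  show "(\<lambda>t. indicat_real {a..b} t * f t) \<in> borel_measurable (lebesgue_on {0..T})"
    "(\<lambda>t. indicat_real {a..b} t * g t) \<in> borel_measurable (lebesgue_on {0..T})" by measurable
qed (use assms(1) in auto)

lemma has_real_derivative_transform_within: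
  assumes "t \<in> S" "\<And>s. s \<in> S \<Longrightarrow> g s = f s" "(f has_real_derivative d) (at t within S)"
  shows "(g has_real_derivative d) (at t within S)"
  using assms has_derivative_transform[of t S g f] by (simp add: has_field_derivative_def)

lemma C1_test_fun_by_parts:
  fixes y y1 :: "real \<Rightarrow> real"
  assumes T: "0 < T" and cy1: "continuous_on {0..T} y1"
    and dy: "\<And>t. t \<in> {0..T} \<Longrightarrow> (y has_real_derivative y1 t) (at t within {0..T})"
    and \<phi>: "\<phi> \<in> test_fun {0<..<T}"
  shows "(LINT t|lebesgue_on {0..T}. y1 t * \<phi> t) = - (LINT t|lebesgue_on {0..T}. y t * deriv \<phi> t)"
proof -
  let ?M = "lebesgue_on {0..T}"
  have cy: "continuous_on {0..T} y" using dy DERIV_continuous continuous_on_eq_continuous_within by blast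
  note D = test_fun_deriv[OF \<phi>]
  let ?f = "\<lambda>t. y1 t * \<phi> t + y t * deriv \<phi> t"
  have if1: "integrable ?M (\<lambda>t. y1 t * \<phi> t)" by (rule test_fun_integrable[OF \<phi> continuous_integrable_Icc[OF cy1]])
  have if2: "integrable ?M (\<lambda>t. y t * deriv \<phi> t)" by (rule test_fun_integrable[OF D(1) continuous_integrable_Icc[OF cy]])
  have "(?f has_integral (y T * \<phi> T - y 0 * \<phi> 0)) {0..T}"
  proof (rule fundamental_theorem_of_calculus)
    fix t assume t: "t \<in> {0..T}"
    have "((\<lambda>t. y t * \<phi> t) has_real_derivative ?f t) (at t within {0..T})"
      using DERIV_mult[OF dy[OF t] has_field_derivative_at_within[OF D(2)]] by (simp add: mult.commute)
    then show "((\<lambda>t. y t * \<phi> t) has_vector_derivative ?f t) (at t within {0..T})"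
      by (simp add: has_real_derivative_iff_has_vector_derivative)
  qed (use T in simp)
  moreover have "\<phi> T = 0" "\<phi> 0 = 0" using \<phi> by (auto simp: test_fun_def)
  ultimately have "integral {0..T} ?f = 0" by (simp add: integral_unique)
  then have "(LINT t|?M. ?f t) = 0" using if1 if2 by (subst lebesgue_integral_eq_integral) auto
  then show ?thesis using if1 if2 by simp
qed

text \<open>Orders two to four are given as distributional derivatives of \<open>y\<close> itself.
  Inserting the derivative of a test function shows that each of \<open>y1\<close>,
  \<open>y2\<close>, \<open>y3\<close> has the next one as its distributional derivative and is
  therefore a primitive of it. Since \<open>y1\<close> is continuous, its formula holds everywhere;
  \<open>Y2\<close> and \<open>Y3\<close> are the continuous versions of \<open>y2\<close> and
  \<open>y3\<close>.\<close>

lemma distributional_C3: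
  fixes y y1 y2 y3 y4 :: "real \<Rightarrow> real"
  assumes T: "0 < T" and cy1: "continuous_on {0..T} y1"
    and dy: "\<And>t. t \<in> {0..T} \<Longrightarrow> (y has_real_derivative y1 t) (at t within {0..T})"
    and i2: "integrable (lebesgue_on {0..T}) y2" and i3: "integrable (lebesgue_on {0..T}) y3" and i4: "integrable (lebesgue_on {0..T}) y4"
    and d2: "\<And>\<phi>. \<phi> \<in> test_fun {0<..<T} \<Longrightarrow> (LINT t|lebesgue_on {0..T}. y t * (deriv ^^ 2) \<phi> t) = (LINT t|lebesgue_on {0..T}. y2 t * \<phi> t)"
    and d3: "\<And>\<phi>. \<phi> \<in> test_fun {0<..<T} \<Longrightarrow> (LINT t|lebesgue_on {0..T}. y t * (deriv ^^ 3) \<phi> t) = - (LINT t|lebesgue_on {0..T}. y3 t * \<phi> t)"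
    and d4: "\<And>\<phi>. \<phi> \<in> test_fun {0<..<T} \<Longrightarrow> (LINT t|lebesgue_on {0..T}. y t * (deriv ^^ 4) \<phi> t) = (LINT t|lebesgue_on {0..T}. y4 t * \<phi> t)"
  shows "\<exists>Y2 Y3. continuous_on {0..T} Y2 \<and> continuous_on {0..T} Y3 \<and>
    (\<forall>t\<in>{0..T}. (y1 has_real_derivative Y2 t) (at t within {0..T})) \<and>
    (\<forall>t\<in>{0..T}. (Y2 has_real_derivative Y3 t) (at t within {0..T})) \<and>
    (AE t in lebesgue_on {0..T}. y2 t = Y2 t) \<and> (AE t in lebesgue_on {0..T}. y3 t = Y3 t) \<and>
    (\<forall>a b. 0 \<le> a \<and> a \<le> b \<and> b \<le> T \<longrightarrow> Y3 b - Y3 a = integral {a..b} y4)"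
proof -
  let ?M = "lebesgue_on {0..T}"
  have cy: "continuous_on {0..T} y" using dy DERIV_continuous continuous_on_eq_continuous_within by blast
  have iy: "integrable ?M y" and iy1: "integrable ?M y1" using cy cy1 by (auto intro: continuous_integrable_Icc)
  have nat_simps: "deriv (deriv \<phi>) = (deriv ^^ 2) \<phi>" "(deriv ^^ 2) (deriv \<phi>) = (deriv ^^ 3) \<phi>" "(deriv ^^ 3) (deriv \<phi>) = (deriv ^^ 4) \<phi>"
    for \<phi> :: "real \<Rightarrow> real" by (simp_all add: numeral_eq_Suc)
  have e1: "(LINT t|?M. y1 t * deriv \<phi> t) = - (LINT t|?M. y2 t * \<phi> t)" if \<phi>: "\<phi> \<in> test_fun {0<..<T}" for \<phi>
    using C1_test_fun_by_parts[OF T cy1 dy test_fun_deriv(1)[OF \<phi>]] d2[OF \<phi>] by (simp add: nat_simps)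
  obtain c1 where c1: "AE t in ?M. y1 t = c1 + integral {0..t} y2"
    using distributional_deriv_integral[OF T iy1 i2 e1] by blast
  have "(LINT t|?M. y2 t * deriv \<phi> t) = - (LINT t|?M. y3 t * \<phi> t)" if \<phi>: "\<phi> \<in> test_fun {0<..<T}" for \<phi>
    using d2[OF test_fun_deriv(1)[OF \<phi>]] d3[OF \<phi>] by (simp add: nat_simps)
  then obtain c2 where c2: "AE t in ?M. y2 t = c2 + integral {0..t} y3"
    using distributional_deriv_integral[OF T i2 i3] by blast
  have "(LINT t|?M. y3 t * deriv \<phi> t) = - (LINT t|?M. y4 t * \<phi> t)" if \<phi>: "\<phi> \<in> test_fun {0<..<T}" for \<phi>
    using d3[OF test_fun_deriv(1)[OF \<phi>]] d4[OF \<phi>] by (simp add: nat_simps)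
  then obtain c3 where c3: "AE t in ?M. y3 t = c3 + integral {0..t} y4"
    using distributional_deriv_integral[OF T i3 i4] by blast
  define Y2 where "Y2 t = c2 + integral {0..t} y3" for t
  define Y3 where "Y3 t = c3 + integral {0..t} y4" for t
  have cY2: "continuous_on {0..T} Y2" and cY3: "continuous_on {0..T} Y3"
    unfolding Y2_def Y3_def using i3 i4 by (auto intro!: continuous_intros indefinite_integral_continuous)
  have a2: "AE t in ?M. y2 t = Y2 t" and a3: "AE t in ?M. y3 t = Y3 t" using c2 c3 by (simp_all add: Y2_def Y3_def)
  have y1_eq: "y1 t = c1 + integral {0..t} Y2" if t: "t \<in> {0..T}" for t
  proof -
    have "y1 t = c1 + integral {0..t} y2"
      by (rule continuous_AE_eq[OF T cy1 _ c1 t]) (intro continuous_intros indefinite_integral_continuous i2)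
    then show ?thesis
      using integral_cong_AE_Icc[OF a2 i2 continuous_integrable_Icc[OF cY2], of 0 t] t by simp
  qed
  have Y2_eq: "Y2 t = c2 + integral {0..t} Y3" if t: "t \<in> {0..T}" for t
    using integral_cong_AE_Icc[OF a3 i3 continuous_integrable_Icc[OF cY3], of 0 t] t by (simp add: Y2_def)
  have int_deriv: "((\<lambda>t. c + integral {0..t} F) has_real_derivative F t) (at t within {0..T})"
    if "continuous_on {0..T} F" "t \<in> {0..T}" for F :: "real \<Rightarrow> real" and c t
    using integral_has_real_derivative[OF that] by (auto intro!: derivative_eq_intros)
  have "(y1 has_real_derivative Y2 t) (at t within {0..T})" if t: "t \<in> {0..T}" for t
    by (rule has_real_derivative_transform_within[OF t _ int_deriv[OF cY2 t, of c1]]) (simp add: y1_eq)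
  moreover have "(Y2 has_real_derivative Y3 t) (at t within {0..T})" if t: "t \<in> {0..T}" for t
    by (rule has_real_derivative_transform_within[OF t _ int_deriv[OF cY3 t, of c2]]) (simp add: Y2_eq)
  moreover have "Y3 b - Y3 a = integral {a..b} y4" if "0 \<le> a" "a \<le> b" "b \<le> T" for a b
    using Henstock_Kurzweil_Integration.integral_combine[OF that(1,2), of y4] that
      integrable_on_lebesgue_on[OF LINT_indicator_Icc(2)[OF i4, of 0 b]] by (simp add: Y3_def)
  ultimately show ?thesis using cY2 cY3 a2 a3 by blast
qed

section \<open>Taylor remainders of the difference quotients\<close>

lemma deriv_bound_imp_bound:
  fixes f f' :: "real \<Rightarrow> real"
  assumes "\<And>s. s \<in> {0..k} \<Longrightarrow> (f has_real_derivative f' s) (at s within {0..k})"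
    "\<And>s. s \<in> {0..k} \<Longrightarrow> \<bar>f' s\<bar> \<le> c" "f 0 = 0" "s \<in> {0..k}"
  shows "\<bar>f s\<bar> \<le> k * c"
proof -
  have c: "0 \<le> c" using assms(2)[OF assms(4)] by linarith
  have "norm (f s - f 0) \<le> c * norm (s - 0)"
    by (rule field_differentiable_bound[where S="{0..k}" and f'=f']) (use assms in auto)
  also have "\<dots> \<le> c * k" using assms(4) c by (intro mult_left_mono) auto
  finally show ?thesis using assms(3) by (simp add: mult.commute)
qed

lemma has_real_derivative_shift:
  fixes f :: "real \<Rightarrow> real"
  assumes d: "\<And>t. t \<in> S \<Longrightarrow> (f has_real_derivative f' t) (at t within S)" and i: "\<And>s. s \<in> R \<Longrightarrow> t + c * s \<in> S" and s: "s \<in> R"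
  shows "((\<lambda>s. f (t + c * s)) has_real_derivative c * f' (t + c * s)) (at s within R)"
proof -
  have "(f has_real_derivative f' (t + c * s)) (at (t + c * s) within (\<lambda>s. t + c * s) ` R)"
    by (rule has_field_derivative_subset[OF d[OF i[OF s]]]) (use i in auto)
  moreover have "((\<lambda>s. t + c * s) has_real_derivative c) (at s within R)" by (auto intro!: derivative_eq_intros)
  ultimately have "(f \<circ> (\<lambda>s. t + c * s) has_real_derivative f' (t + c * s) * c) (at s within R)" by (rule DERIV_image_chain)
  then show ?thesis by (simp add: o_def mult.commute)
qed

text \<open>As functions of the step s, the remainder and its first two derivatives vanish at 0, and
  the third derivative is Y3(t+s) - Y3(t-s); three integrations gain k^3. Only this increment of
  \<open>Y3\<close> enters, which an integral of the fourth derivative controls.\<close>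

lemma second_difference_error:
  fixes y y1 Y2 Y3 :: "real \<Rightarrow> real"
  assumes dy: "\<And>t. t \<in> {0..T} \<Longrightarrow> (y has_real_derivative y1 t) (at t within {0..T})"
    and dy1: "\<And>t. t \<in> {0..T} \<Longrightarrow> (y1 has_real_derivative Y2 t) (at t within {0..T})"
    and dY2: "\<And>t. t \<in> {0..T} \<Longrightarrow> (Y2 has_real_derivative Y3 t) (at t within {0..T})"
    and k: "0 \<le> k" "k \<le> t" "t + k \<le> T"
    and A: "\<And>s. s \<in> {0..k} \<Longrightarrow> \<bar>Y3 (t + s) - Y3 (t - s)\<bar> \<le> A"
  shows "\<bar>y (t + k) - 2 * y t + y (t - k) - k\<^sup>2 * Y2 t\<bar> \<le> k ^ 3 * A"
proof -
  have p: "t + 1 * s \<in> {0..T}" and q: "t + (-1) * s \<in> {0..T}" if "s \<in> {0..k}" for s using that k by auto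
  let ?E2 = "\<lambda>s. Y2 (t + s) - 2 * Y2 t + Y2 (t - s)"
  let ?E1 = "\<lambda>s. y1 (t + s) - y1 (t - s) - 2 * s * Y2 t"
  let ?E = "\<lambda>s. y (t + s) - 2 * y t + y (t - s) - s\<^sup>2 * Y2 t"
  have sh: "((\<lambda>s. g (t + s)) has_real_derivative g' (t + s)) (at s within {0..k})"
    "((\<lambda>s. g (t - s)) has_real_derivative - g' (t - s)) (at s within {0..k})"
    if "\<And>t. t \<in> {0..T} \<Longrightarrow> (g has_real_derivative g' t) (at t within {0..T})" "s \<in> {0..k}" for g g' :: "real \<Rightarrow> real" and s
    using has_real_derivative_shift[OF that(1) p that(2)] has_real_derivative_shift[OF that(1) q that(2)] by simp_all
  have b2: "\<bar>?E2 s\<bar> \<le> k * A" if "s \<in> {0..k}" for s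
    by (rule deriv_bound_imp_bound[where f'="\<lambda>s. Y3 (t + s) - Y3 (t - s)", OF _ A _ that])
      (auto intro!: derivative_eq_intros sh[OF dY2])
  have b1: "\<bar>?E1 s\<bar> \<le> k * (k * A)" if "s \<in> {0..k}" for s
    by (rule deriv_bound_imp_bound[where f'="?E2", OF _ b2 _ that])
      (auto intro!: derivative_eq_intros sh[OF dy1])
  have "\<bar>?E k\<bar> \<le> k * (k * (k * A))"
    by (rule deriv_bound_imp_bound[where f'="?E1", OF _ b1])
      (use k in \<open>auto intro!: derivative_eq_intros sh[OF dy]\<close>)
  then show ?thesis by (simp add: power3_eq_cube mult.assoc)
qed

text \<open>The starting step has no centred cancellation. The average of \<open>Y2\<close> at the
  two ends differs from \<open>Y2\<close> in between by a Lipschitz bound, and this is where the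
  uniform bound on the third derivative enters.\<close>

lemma first_step_error:
  fixes y y1 Y2 Y3 :: "real \<Rightarrow> real"
  assumes dy: "\<And>t. t \<in> {0..T} \<Longrightarrow> (y has_real_derivative y1 t) (at t within {0..T})"
    and dy1: "\<And>t. t \<in> {0..T} \<Longrightarrow> (y1 has_real_derivative Y2 t) (at t within {0..T})"
    and dY2: "\<And>t. t \<in> {0..T} \<Longrightarrow> (Y2 has_real_derivative Y3 t) (at t within {0..T})"
    and k: "0 \<le> k" "k \<le> T" and m: "\<And>t. t \<in> {0..T} \<Longrightarrow> \<bar>Y3 t\<bar> \<le> m"
  shows "\<bar>2 * (y k - y 0 - k * y1 0) - k\<^sup>2 * ((Y2 0 + Y2 k) / 2)\<bar> \<le> 2 * k ^ 3 * m"
proof -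
  have p: "0 + 1 * s \<in> {0..T}" if "s \<in> {0..k}" for s using that k by auto
  have m0: "0 \<le> m" using m[of 0] k by force
  have lip: "\<bar>Y2 s - Y2 r\<bar> \<le> m * k" if "s \<in> {0..k}" "r \<in> {0..k}" for s r
  proof -
    have "norm (Y2 s - Y2 r) \<le> m * norm (s - r)"
      by (rule field_differentiable_bound[where S="{0..T}" and f'=Y3]) (use dY2 m that k in auto)
    also have "\<dots> \<le> m * k" using that m0 by (intro mult_left_mono) auto
    finally show ?thesis by simp
  qed
  let ?E2 = "\<lambda>s. 2 * Y2 s - (Y2 0 + Y2 k)"
  let ?E1 = "\<lambda>s. 2 * (y1 s - y1 0) - s * (Y2 0 + Y2 k)"
  let ?E = "\<lambda>s. 2 * (y s - y 0 - s * y1 0) - s\<^sup>2 * ((Y2 0 + Y2 k) / 2)"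
  have b2: "\<bar>?E2 s\<bar> \<le> 2 * m * k" if "s \<in> {0..k}" for s
    using lip[OF that, of 0] lip[OF that, of k] k(1) by auto
  have sh: "(g has_real_derivative g' s) (at s within {0..k})"
    if "\<And>t. t \<in> {0..T} \<Longrightarrow> (g has_real_derivative g' t) (at t within {0..T})" "s \<in> {0..k}" for g g' :: "real \<Rightarrow> real" and s
    using has_real_derivative_shift[OF that(1) p that(2)] by simp
  have b1: "\<bar>?E1 s\<bar> \<le> k * (2 * m * k)" if "s \<in> {0..k}" for s
    by (rule deriv_bound_imp_bound[where f'="?E2", OF _ b2 _ that])
      (auto intro!: derivative_eq_intros sh[OF dy1])
  have "\<bar>?E k\<bar> \<le> k * (k * (2 * m * k))"
    by (rule deriv_bound_imp_bound[where f'="?E1", OF _ b1])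
      (use k in \<open>auto intro!: derivative_eq_intros sh[OF dy]\<close>)
  then show ?thesis by (simp add: power3_eq_cube ac_simps)
qed

section \<open>Stability of the explicit scheme\<close>

text \<open>Instantiated both by the discrete form on \<open>Vh\<close> and by the inner product on
  \<open>L2\<close>, so that the algebra of differences and averages is done once.\<close>

locale sym_bilinear_space =
  fixes V :: "sfun set" and B :: "sfun \<Rightarrow> sfun \<Rightarrow> real"
  assumes lin_comb: "v \<in> V \<Longrightarrow> w \<in> V \<Longrightarrow> (\<lambda>x. a * v x + b * w x) \<in> V"
    and sym: "v \<in> V \<Longrightarrow> w \<in> V \<Longrightarrow> B v w = B w v"
    and linear: "v \<in> V \<Longrightarrow> w \<in> V \<Longrightarrow> z \<in> V \<Longrightarrow> B (\<lambda>x. a * v x + b * w x) z = a * B v z + b * B w z"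
begin

lemma closed:
  "v \<in> V \<Longrightarrow> w \<in> V \<Longrightarrow> (\<lambda>x. v x + w x) \<in> V"
  "v \<in> V \<Longrightarrow> w \<in> V \<Longrightarrow> (\<lambda>x. v x - w x) \<in> V"
  "v \<in> V \<Longrightarrow> (\<lambda>x. c * v x) \<in> V"
  "v \<in> V \<Longrightarrow> (\<lambda>x. v x / c) \<in> V"
  using lin_comb[of v w 1 1] lin_comb[of v w 1 "-1"] lin_comb[of v v c 0] lin_comb[of v v "1 / c" 0] by simp_all

lemma left:
  "v \<in> V \<Longrightarrow> w \<in> V \<Longrightarrow> z \<in> V \<Longrightarrow> B (\<lambda>x. v x + w x) z = B v z + B w z"
  "v \<in> V \<Longrightarrow> w \<in> V \<Longrightarrow> z \<in> V \<Longrightarrow> B (\<lambda>x. v x - w x) z = B v z - B w z"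
  "v \<in> V \<Longrightarrow> z \<in> V \<Longrightarrow> B (\<lambda>x. c * v x) z = c * B v z"
  "v \<in> V \<Longrightarrow> z \<in> V \<Longrightarrow> B (\<lambda>x. v x / c) z = B v z / c"
  using linear[of v w z 1 1] linear[of v w z 1 "-1"] linear[of v v z c 0] linear[of v v z "1 / c" 0] by simp_all

lemma right:
  "v \<in> V \<Longrightarrow> w \<in> V \<Longrightarrow> z \<in> V \<Longrightarrow> B z (\<lambda>x. v x + w x) = B z v + B z w"
  "v \<in> V \<Longrightarrow> w \<in> V \<Longrightarrow> z \<in> V \<Longrightarrow> B z (\<lambda>x. v x - w x) = B z v - B z w"
  "v \<in> V \<Longrightarrow> z \<in> V \<Longrightarrow> B z (\<lambda>x. c * v x) = c * B z v"
  "v \<in> V \<Longrightarrow> z \<in> V \<Longrightarrow> B z (\<lambda>x. v x / c) = B z v / c"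
  by (simp_all add: sym[of z] closed left)

text \<open>With a = p - q and b = q - r the pairing is that of a - b with a + b. For three
  consecutive time levels it is an increment of kinetic energy.\<close>

lemma second_difference_pairing:
  assumes "p \<in> V" "q \<in> V" "r \<in> V"
  shows "B (\<lambda>x. (p x - 2 * q x + r x) / c) (\<lambda>x. p x - r x)
    = (B (\<lambda>x. p x - q x) (\<lambda>x. p x - q x) - B (\<lambda>x. q x - r x) (\<lambda>x. q x - r x)) / c"
proof -
  have "B (\<lambda>x. p x - 2 * q x + r x) (\<lambda>x. p x - r x)
    = B (\<lambda>x. p x - q x) (\<lambda>x. p x - q x) - B (\<lambda>x. q x - r x) (\<lambda>x. q x - r x)"
    using assms sym[of q p] sym[of r p] sym[of r q] by (simp add: closed left right)
  then show ?thesis using assms by (subst left(4)) (simp_all add: closed)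
qed

text \<open>The potential energy of the scheme couples neighbouring time levels and has no sign;
  this isolates its positive part, the energy of the average, from the part that the CFL condition
  has to absorb.\<close>

lemma staggered_product:
  assumes "p \<in> V" "q \<in> V"
  shows "B q p = B (\<lambda>x. (p x + q x) / 2) (\<lambda>x. (p x + q x) / 2) - B (\<lambda>x. p x - q x) (\<lambda>x. p x - q x) / 4"
  using assms sym[of q p] by (simp add: closed left right field_simps)

end

lemma sym_bilinear_L2: "sym_bilinear_space (L2_space \<Omega>) (L2_inner \<Omega>)"
proof
  fix v w z :: sfun and a b :: real
  assume "v \<in> L2_space \<Omega>" "w \<in> L2_space \<Omega>" "z \<in> L2_space \<Omega>"
  then show "L2_inner \<Omega> (\<lambda>x. a * v x + b * w x) z = a * L2_inner \<Omega> v z + b * L2_inner \<Omega> w z"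
    by (simp add: L2_inner_add L2_space_cmult L2_inner_cmult)
qed (auto intro: L2_space_intros L2_inner_commute)

section \<open>The energy argument for the two-step recursion\<close>

text \<open>In the application \<open>I\<close> n j pairs datum n with the average at step j, so the
  time difference moves from the unknown to the datum.\<close>

lemma summation_by_parts:
  fixes I :: "nat \<Rightarrow> nat \<Rightarrow> real"
  assumes "1 \<le> m"
  shows "(\<Sum>n=1..m. I n n - I n (n-1)) = I m m - I 1 0 - (\<Sum>n=1..<m. I (n+1) n - I n n)"
  using assms
proof (induction m rule: dec_induct)
  case (step m)
  then show ?case by (simp add: algebra_simps)
qed simp

text \<open>Completing the square removes \<open>y\<close> and leaves x^2 \<le> a x + b^2/4.\<close>

lemma quadratic_start:
  fixes x y a b :: real
  assumes "0 \<le> x" "0 \<le> a" "0 \<le> b" "x\<^sup>2 + y\<^sup>2 \<le> a * x + b * y"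
  shows "x \<le> a + b"
proof (rule ccontr)
  assume "\<not> x \<le> a + b"
  then have x: "x > a + b" by simp
  have "b * y \<le> y\<^sup>2 + b\<^sup>2 / 4" using zero_le_power2[of "y - b / 2"] by (simp add: power2_diff power_divide algebra_simps)
  then have "x\<^sup>2 \<le> a * x + b\<^sup>2 / 4" using assms(4) by simp
  moreover have "x\<^sup>2 \<ge> (a + b) * x" using x assms by (simp add: power2_eq_square mult_right_mono)
  moreover have "b * x \<ge> b * b" using x assms by (intro mult_left_mono) auto
  ultimately have "b\<^sup>2 \<le> b\<^sup>2 / 4" by (simp add: algebra_simps power2_eq_square)
  then have "b = 0" by (simp add: field_simps)
  then have "x * x \<le> a * x" using \<open>x\<^sup>2 \<le> a * x + b\<^sup>2 / 4\<close> by (simp add: power2_eq_square)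
  then show False using x assms \<open>b = 0\<close> by (simp add: mult_le_cancel_right)
qed

text \<open>At the index where \<open>z\<close> is largest, Z^2 \<le> d^2 + S Z forces Z \<le> d +
  S. This takes the place of a Gronwall argument and avoids its exponential factor.\<close>

lemma quadratic_growth:
  fixes z :: "nat \<Rightarrow> real"
  assumes z: "\<And>n. 0 \<le> z n" and d: "0 \<le> d" and S: "0 \<le> S"
    and le: "\<And>n Z. n \<le> m \<Longrightarrow> (\<And>j. j \<le> m \<Longrightarrow> z j \<le> Z) \<Longrightarrow> (z n)\<^sup>2 \<le> d\<^sup>2 + S * Z"
    and n: "n \<le> m"
  shows "z n \<le> d + S"
proof -
  define Z where "Z = Max (z ` {..m})"
  have ub: "z j \<le> Z" if "j \<le> m" for j using that unfolding Z_def by (intro Max_ge) auto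
  have "Z \<in> z ` {..m}" unfolding Z_def by (rule Max_in) auto
  then obtain j where j: "j \<le> m" "z j = Z" by (metis (no_types, lifting) atMost_iff imageE)
  have Z0: "0 \<le> Z" using z[of j] j by simp
  have sq: "Z\<^sup>2 \<le> d\<^sup>2 + S * Z" using le[OF j(1) ub] j(2) by simp
  have "Z \<le> d + S"
  proof (rule ccontr)
    assume "\<not> Z \<le> d + S"
    then have gt: "d + S < Z" by simp
    have "d * d \<le> d * Z" using gt d S by (intro mult_left_mono) auto
    moreover have "(d + S) * Z < Z * Z" using gt d S by (intro mult_strict_right_mono) auto
    ultimately show False using sq by (simp add: power2_eq_square algebra_simps)
  qed
  then show ?thesis using ub[OF n] by simp
qed

text \<open>Testing with \<theta>(n+1) - \<theta>(n-1) makes the left-hand side an increment of the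
  energy \<open>En\<close>. The error \<open>E\<close> is bounded in \<open>L2\<close> and paid for
  by the velocities. The functional through \<open>P\<close> is bounded only by the energy norm of
  the averages, which gives no control of their increments; summation by parts therefore puts the
  difference on \<open>g\<close> and produces the terms \<open>\<gamma>\<close>.\<close>

lemma discrete_stability:
  fixes \<theta> g :: "nat \<Rightarrow> sfun" and E :: "nat \<Rightarrow> sfun \<Rightarrow> real" and e \<gamma> :: "nat \<Rightarrow> real" and P :: "sfun \<Rightarrow> sfun"
  assumes V: "sym_bilinear_space Vh ah" "Vh \<subseteq> L2_space \<Omega>"
    and psd: "\<And>v. v \<in> Vh \<Longrightarrow> 0 \<le> ah v v"
    and k: "0 < k" and cfl: "\<And>v. v \<in> Vh \<Longrightarrow> k\<^sup>2 * ah v v \<le> (L2_norm \<Omega> v)\<^sup>2"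
    and P: "\<And>v. v \<in> Vh \<Longrightarrow> P v \<in> L2_space \<Omega>"
      "\<And>v w a b. v \<in> Vh \<Longrightarrow> w \<in> Vh \<Longrightarrow> P (\<lambda>x. a * v x + b * w x) = (\<lambda>x. a * P v x + b * P w x)"
      "\<And>v. v \<in> Vh \<Longrightarrow> L2_norm \<Omega> (P v) \<le> \<eta> * sqrt (ah v v)" and \<eta>: "0 \<le> \<eta>"
    and \<theta>: "\<And>n. n \<le> m + 1 \<Longrightarrow> \<theta> n \<in> Vh" "\<theta> 0 = (\<lambda>x. 0)"
    and g: "\<And>n. n \<le> m \<Longrightarrow> g n \<in> L2_space \<Omega>" "\<And>n. n \<le> m \<Longrightarrow> L2_norm \<Omega> (g n) \<le> G"
    and \<gamma>: "\<And>n. 1 \<le> n \<Longrightarrow> n < m \<Longrightarrow> L2_norm \<Omega> (\<lambda>x. g (n+1) x - g n x) \<le> \<gamma> n"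
    and E: "\<And>n v. n \<le> m \<Longrightarrow> v \<in> Vh \<Longrightarrow> \<bar>E n v\<bar> \<le> e n * L2_norm \<Omega> v" and e: "\<And>n. n \<le> m \<Longrightarrow> 0 \<le> e n"
    and start: "\<And>v. v \<in> Vh \<Longrightarrow> 2 / k * L2_inner \<Omega> (\<lambda>x. \<theta> 1 x / k) v + ah (\<lambda>x. \<theta> 1 x / 2) v
        = E 0 v + L2_inner \<Omega> (\<lambda>x. (g 1 x + g 0 x) / 2) (P v)"
    and step: "\<And>n v. 1 \<le> n \<Longrightarrow> n \<le> m \<Longrightarrow> v \<in> Vh \<Longrightarrow>
        L2_inner \<Omega> (\<lambda>x. (\<theta> (n+1) x - 2 * \<theta> n x + \<theta> (n-1) x) / k\<^sup>2) v + ah (\<theta> n) v = E n v + L2_inner \<Omega> (g n) (P v)"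
    and m: "1 \<le> m"
  shows "L2_norm \<Omega> (\<theta> (m+1)) \<le> 2 * (real (m+1) * k) *
    (k * e 0 + 5 * (G * \<eta>) + 4 * k * (\<Sum>n=1..m. e n) + 2 * \<eta> * (\<Sum>n=1..<m. \<gamma> n))"
proof -
  interpret A: sym_bilinear_space Vh ah by fact
  interpret L: sym_bilinear_space "L2_space \<Omega>" "L2_inner \<Omega>" by (rule sym_bilinear_L2)
  have L2: "v \<in> L2_space \<Omega>" if "v \<in> Vh" for v using that V(2) by blast
  define \<delta> where "\<delta> n = (\<lambda>x. \<theta> (n+1) x - \<theta> n x)" for n
  define h where "h n = (\<lambda>x. (\<theta> (n+1) x + \<theta> n x) / 2)" for n
  define D where "D n = L2_norm \<Omega> (\<delta> n) / k" for n
  define A where "A n = sqrt (ah (h n) (h n))" for n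
  \<comment> \<open>The factor 3/4 is what remains of the kinetic energy after a quarter of it has
    absorbed the negative part of the potential energy, by \<open>cfl\<close>.\<close>
  define z where "z n = sqrt (3/4 * (D n)\<^sup>2 + (A n)\<^sup>2)" for n
  define En where "En n = (D n)\<^sup>2 + ah (\<theta> n) (\<theta> (n+1))" for n
  have \<delta>V: "\<delta> n \<in> Vh" and hV: "h n \<in> Vh" if "n \<le> m" for n
    unfolding \<delta>_def h_def using \<theta>(1)[of n] \<theta>(1)[of "n+1"] that by (auto intro: A.closed)
  have D0: "0 \<le> D n" for n using k by (simp add: D_def)
  have G0: "0 \<le> G" using g(2)[of 0] L2_norm_nonneg[of \<Omega> "g 0"] by linarith
  have A2: "(A n)\<^sup>2 = ah (h n) (h n)" and A0: "0 \<le> A n" if "n \<le> m" for n using psd[OF hV[OF that]] by (auto simp: A_def)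
  have D2: "(D n)\<^sup>2 = L2_inner \<Omega> (\<delta> n) (\<delta> n) / k\<^sup>2" for n by (simp add: D_def power_divide L2_norm_power2)
  have z0: "0 \<le> z n" for n by (auto simp: z_def intro!: real_sqrt_ge_zero)
  have z2: "(z n)\<^sup>2 = 3/4 * (D n)\<^sup>2 + (A n)\<^sup>2" for n by (simp add: z_def)
  have Az: "A n \<le> z n" for n unfolding z_def by (rule real_le_rsqrt) simp
  \<comment> \<open>The sharp factor is 2 / sqrt 3; the larger value 2 is convenient.\<close>
  have Dz: "D n \<le> 2 * z n" for n
  proof (rule power2_le_imp_le)
    show "(D n)\<^sup>2 \<le> (2 * z n)\<^sup>2" by (simp add: power_mult_distrib z2)
  qed (use z0[of n] in simp)
  have Ez: "(z n)\<^sup>2 \<le> En n" if n: "n \<le> m" for n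
  proof -
    have "k\<^sup>2 * ah (\<delta> n) (\<delta> n) \<le> k\<^sup>2 * (D n)\<^sup>2"
      using cfl[OF \<delta>V[OF n]] k by (simp add: D_def power_divide)
    then have "ah (\<delta> n) (\<delta> n) \<le> (D n)\<^sup>2" using k by simp
    moreover have "ah (\<theta> n) (\<theta> (n+1)) = ah (h n) (h n) - ah (\<delta> n) (\<delta> n) / 4"
      unfolding h_def \<delta>_def by (rule A.staggered_product) (use \<theta>(1) n in auto)
    ultimately show ?thesis using z2[of n] A2[OF n] by (simp add: En_def)
  qed
  let ?I = "\<lambda>n j. L2_inner \<Omega> (g n) (P (h j))"
  have diff: "En n - En (n-1) = E n (\<lambda>x. \<theta> (n+1) x - \<theta> (n-1) x) + 2 * (?I n n - ?I n (n-1))"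
    if n: "1 \<le> n" "n \<le> m" for n
  proof -
    have V3: "\<theta> (n+1) \<in> Vh" "\<theta> n \<in> Vh" "\<theta> (n-1) \<in> Vh" using \<theta>(1) n by auto
    let ?v = "\<lambda>x. \<theta> (n+1) x - \<theta> (n-1) x"
    have v: "?v \<in> Vh" by (rule A.closed(2)[OF V3(1,3)])
    have n1: "n - 1 + 1 = n" using n by simp
    have "L2_inner \<Omega> (\<lambda>x. (\<theta> (n+1) x - 2 * \<theta> n x + \<theta> (n-1) x) / k\<^sup>2) ?v = (D n)\<^sup>2 - (D (n-1))\<^sup>2"
      unfolding D2 \<delta>_def n1 diff_divide_distrib[symmetric]
      by (rule L.second_difference_pairing[OF L2[OF V3(1)] L2[OF V3(2)] L2[OF V3(3)]])
    moreover have "ah (\<theta> n) ?v = ah (\<theta> n) (\<theta> (n+1)) - ah (\<theta> (n-1)) (\<theta> n)"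
      using V3 A.sym[of "\<theta> n" "\<theta> (n-1)"] by (simp add: A.right)
    \<comment> \<open>The test function is twice the increment of the averages \<open>h\<close>, the
      quantities whose energy norm is controlled.\<close>
    moreover have "P ?v = (\<lambda>x. 2 * P (h n) x + (-2) * P (h (n-1)) x)"
    proof -
      have "?v = (\<lambda>x. 2 * h n x + (-2) * h (n-1) x)" unfolding h_def n1 by (auto simp: field_simps)
      then show ?thesis using P(2)[of "h n" "h (n-1)" 2 "-2"] hV[of n] hV[of "n-1"] n by simp
    qed
    then have "L2_inner \<Omega> (g n) (P ?v) = 2 * (?I n n - ?I n (n-1))"
      using L.linear[of "P (h n)" "P (h (n-1))" "g n" 2 "-2"] P(1) hV[of n] hV[of "n-1"] g(1)[of n] n
      by (simp add: L2_inner_commute[of \<Omega> "g n"])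
    ultimately show ?thesis using step[OF n v] n1 by (simp add: En_def)
  qed
  \<comment> \<open>Each velocity is at most 2 Z, so a test function has \<open>L2\<close> norm at
    most 4 k Z. The two boundary terms and the interior differences of the summation by parts carry
    the factor 2 of the test function.\<close>
  let ?S = "\<lambda>m. 4 * k * (\<Sum>n=1..m. e n) + 4 * (G * \<eta>) + 2 * \<eta> * (\<Sum>n=1..<m. \<gamma> n)"
  have \<gamma>0: "0 \<le> \<gamma> n" if "1 \<le> n" "n < m" for n using \<gamma>[OF that] L2_norm_nonneg[of \<Omega>] order_trans by blast
  have IP: "\<bar>L2_inner \<Omega> w (P (h j))\<bar> \<le> c * \<eta> * A j" if "w \<in> L2_space \<Omega>" "L2_norm \<Omega> w \<le> c" "j \<le> m" for w c j
  proof -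
    have c0: "0 \<le> c" using that(2) L2_norm_nonneg[of \<Omega> w] by linarith
    have "\<bar>L2_inner \<Omega> w (P (h j))\<bar> \<le> L2_norm \<Omega> w * L2_norm \<Omega> (P (h j))"
      by (rule L2_inner_le[OF that(1) P(1)[OF hV[OF that(3)]]])
    also have "\<dots> \<le> c * (\<eta> * A j)"
      unfolding A_def by (intro mult_mono P(3) hV that c0) simp
    finally show ?thesis by (simp add: mult.assoc)
  qed
  have growth: "En n \<le> (D 0)\<^sup>2 + ?S m * Z" if n: "n \<le> m" and Z: "\<And>j. j \<le> m \<Longrightarrow> z j \<le> Z" for n Z
  proof (cases "n = 0")
    case True
    have "ah (\<theta> 0) (\<theta> 1) = 0" using A.left(3)[of "\<theta> 1" "\<theta> 1" 0] \<theta> m by simp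
    moreover have "0 \<le> ?S m * Z"
      using Z[of 0] z0[of 0] G0 \<eta> k e \<gamma>0 by (intro mult_nonneg_nonneg add_nonneg_nonneg sum_nonneg) auto
    ultimately show ?thesis using True by (simp add: En_def)
  next
    case False
    have Z0: "0 \<le> Z" using Z[of 0] z0[of 0] by linarith
    have n1: "1 \<le> n" using False by simp
    have "En n - En 0 = (\<Sum>j=1..n. En j - En (j-1))"
      using n1 by (induction n rule: dec_induct) auto
    also have "\<dots> = (\<Sum>j=1..n. E j (\<lambda>x. \<theta> (j+1) x - \<theta> (j-1) x)) + 2 * (\<Sum>j=1..n. ?I j j - ?I j (j-1))"
      unfolding sum_distrib_left sum.distrib[symmetric]
      by (intro sum.cong refl diff) (use n in auto)
    also have "(\<Sum>j=1..n. ?I j j - ?I j (j-1)) = ?I n n - ?I 1 0 - (\<Sum>j=1..<n. ?I (j+1) j - ?I j j)"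
      by (rule summation_by_parts[OF n1])
    finally have eq: "En n = En 0 + (\<Sum>j=1..n. E j (\<lambda>x. \<theta> (j+1) x - \<theta> (j-1) x))
      + 2 * (?I n n - ?I 1 0 - (\<Sum>j=1..<n. ?I (j+1) j - ?I j j))" by simp
    have t1: "(\<Sum>j=1..n. E j (\<lambda>x. \<theta> (j+1) x - \<theta> (j-1) x)) \<le> 4 * k * (\<Sum>j=1..m. e j) * Z"
    proof -
      have "E j (\<lambda>x. \<theta> (j+1) x - \<theta> (j-1) x) \<le> 4 * k * e j * Z" if j: "j \<in> {1..n}" for j
      proof -
        have V3: "\<theta> (j+1) \<in> Vh" "\<theta> j \<in> Vh" "\<theta> (j-1) \<in> Vh" using \<theta>(1) j n by auto
        have j1: "j - 1 + 1 = j" using j by simp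
        have "L2_norm \<Omega> (\<lambda>x. \<theta> (j+1) x - \<theta> (j-1) x) = L2_norm \<Omega> (\<lambda>x. \<delta> j x + \<delta> (j-1) x)"
          unfolding \<delta>_def j1 by simp
        also have "\<dots> \<le> L2_norm \<Omega> (\<delta> j) + L2_norm \<Omega> (\<delta> (j-1))"
          by (rule L2_norm_add_le; rule L2, rule \<delta>V) (use j n in auto)
        also have "\<dots> = k * (D j + D (j-1))" using k by (simp add: D_def field_simps)
        also have "\<dots> \<le> k * (2 * Z + 2 * Z)"
        proof -
          have "j \<le> m" "j - 1 \<le> m" using j n by auto
          then have "D j \<le> 2 * Z" "D (j-1) \<le> 2 * Z" using Dz[of j] Dz[of "j-1"] Z[of j] Z[of "j-1"] by linarith+
          then show ?thesis using k by (intro mult_left_mono add_mono) auto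
        qed
        finally have *: "L2_norm \<Omega> (\<lambda>x. \<theta> (j+1) x - \<theta> (j-1) x) \<le> 4 * k * Z" by simp
        have "E j (\<lambda>x. \<theta> (j+1) x - \<theta> (j-1) x) \<le> e j * L2_norm \<Omega> (\<lambda>x. \<theta> (j+1) x - \<theta> (j-1) x)"
          using E[of j, OF _ A.closed(2)[OF V3(1,3)]] j n by (auto simp: abs_le_iff)
        also have "\<dots> \<le> e j * (4 * k * Z)" using e[of j] j n by (intro mult_left_mono *) auto
        finally show ?thesis by (simp add: ac_simps)
      qed
      then have "(\<Sum>j=1..n. E j (\<lambda>x. \<theta> (j+1) x - \<theta> (j-1) x)) \<le> (\<Sum>j=1..n. 4 * k * e j * Z)" by (rule sum_mono)
      also have "\<dots> \<le> (\<Sum>j=1..m. 4 * k * e j * Z)"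
        using n k e Z0 by (intro sum_mono2) auto
      finally show ?thesis by (simp add: sum_distrib_left sum_distrib_right)
    qed
    have mul: "c * \<eta> * A j \<le> c * \<eta> * Z" if "0 \<le> c" "j \<le> m" for c j
      using that \<eta> Az[of j] Z[of j] by (intro mult_left_mono) auto
    have t2: "?I n n \<le> G * \<eta> * Z"
      using IP[OF g(1)[OF n] g(2)[OF n] n] mul[OF G0 n] by linarith
    have t3: "- ?I 1 0 \<le> G * \<eta> * Z"
      using IP[OF g(1)[of 1] g(2)[of 1], of 0] mul[OF G0, of 0] m by (simp add: abs_le_iff)
    have t4: "- (\<Sum>j=1..<n. ?I (j+1) j - ?I j j) \<le> \<eta> * (\<Sum>j=1..<m. \<gamma> j) * Z"
    proof -
      have "- (?I (j+1) j - ?I j j) \<le> \<gamma> j * \<eta> * Z" if j: "j \<in> {1..<n}" for j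
      proof -
        have gj: "g (j+1) \<in> L2_space \<Omega>" "g j \<in> L2_space \<Omega>" "P (h j) \<in> L2_space \<Omega>"
          using g(1) P(1)[OF hV] j n by auto
        have "?I (j+1) j - ?I j j = L2_inner \<Omega> (\<lambda>x. g (j+1) x - g j x) (P (h j))"
          by (rule L.left(2)[OF gj, symmetric])
        moreover have "\<bar>\<dots>\<bar> \<le> \<gamma> j * \<eta> * A j"
          by (rule IP[OF L.closed(2)[OF gj(1,2)]]) (use \<gamma>[of j] j n in auto)
        ultimately show ?thesis using mul[OF \<gamma>0, of j j] j n by (auto simp: abs_le_iff)
      qed
      then have "(\<Sum>j=1..<n. - (?I (j+1) j - ?I j j)) \<le> (\<Sum>j=1..<n. \<gamma> j * \<eta> * Z)" by (rule sum_mono)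
      also have "\<dots> \<le> (\<Sum>j=1..<m. \<gamma> j * \<eta> * Z)"
        using n \<eta> Z0 \<gamma>0 by (intro sum_mono2) auto
      also have "\<dots> = \<eta> * (\<Sum>j=1..<m. \<gamma> j) * Z" by (simp add: sum_distrib_left sum_distrib_right mult.commute)
      finally show ?thesis by (simp only: sum_negf)
    qed
    have arith: "E \<le> d + x1 + 2 * (x2 + x2 + x4)"
      if "E = e0 + s + 2 * (p - q - r)" "e0 = d" "s \<le> x1" "p \<le> x2" "- q \<le> x2" "- r \<le> x4" for E e0 s p q r d x1 x2 x4 :: real
    proof -
      have "2 * (p - q - r) \<le> 2 * (x2 + x2 + x4)" using that(4-6) by (intro mult_left_mono) auto
      then show ?thesis using that(1-3) by linarith
    qed
    have "En 0 = (D 0)\<^sup>2" using A.left(3)[of "\<theta> 1" "\<theta> 1" 0] \<theta> m by (simp add: En_def)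
    from arith[OF eq this t1 t2 t3 t4] have "En n \<le> (D 0)\<^sup>2 + 4 * k * (\<Sum>j=1..m. e j) * Z + 2 * (G * \<eta> * Z + G * \<eta> * Z + \<eta> * (\<Sum>j=1..<m. \<gamma> j) * Z)"
      .
    also have "\<dots> = (D 0)\<^sup>2 + ?S m * Z" by (simp add: algebra_simps)
    finally show ?thesis .
  qed
  have S0: "0 \<le> ?S m" using G0 \<eta> k e \<gamma>0 by (intro add_nonneg_nonneg mult_nonneg_nonneg sum_nonneg) auto
  have zb: "z n \<le> D 0 + ?S m" if "n \<le> m" for n
  proof (rule quadratic_growth[where z=z, OF z0 D0 S0 _ that])
    fix n Z assume a: "n \<le> m" and b: "\<And>j. j \<le> m \<Longrightarrow> z j \<le> Z"
    show "(z n)\<^sup>2 \<le> (D 0)\<^sup>2 + ?S m * Z" by (rule order_trans[OF Ez[OF a] growth[OF a b]])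
  qed
  \<comment> \<open>Since \<theta>(0) = 0, the first increment is \<theta>(1) and the first average
    is half of it; testing the starting equation with \<theta>(1) gives a quadratic inequality
    between velocity and energy.\<close>
  have D0b: "D 0 \<le> k * e 0 + G * \<eta>"
  proof -
    have V1: "\<theta> 1 \<in> Vh" using \<theta>(1) m by simp
    have \<delta>0: "\<delta> 0 = \<theta> 1" by (simp add: \<delta>_def \<theta>(2))
    have h0: "h 0 = (\<lambda>x. \<theta> 1 x / 2)" by (simp add: h_def \<theta>(2))
    have "2 / k * L2_inner \<Omega> (\<lambda>x. \<theta> 1 x / k) (\<theta> 1) = 2 * (D 0)\<^sup>2"
      unfolding D2 \<delta>0 L2_inner_divide by (simp add: power2_eq_square)
    moreover have a0: "ah (\<lambda>x. \<theta> 1 x / 2) (\<theta> 1) = 2 * (A 0)\<^sup>2" "ah (\<theta> 1) (\<theta> 1) = 4 * (A 0)\<^sup>2"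
      using V1 by (simp_all add: A2 h0 A.left A.right A.closed)
    moreover have "E 0 (\<theta> 1) \<le> e 0 * (k * D 0)"
      using E[OF _ V1, of 0] k by (simp add: D_def \<delta>0 abs_le_iff)
    moreover have "L2_inner \<Omega> (\<lambda>x. (g 1 x + g 0 x) / 2) (P (\<theta> 1)) \<le> G * (\<eta> * (2 * A 0))"
    proof -
      have g01: "g 1 \<in> L2_space \<Omega>" "g 0 \<in> L2_space \<Omega>" using g(1) m by auto
      have "L2_norm \<Omega> (\<lambda>x. (g 1 x + g 0 x) / 2) \<le> G"
        using L2_norm_add_le[OF g01] g(2)[of 0] g(2)[of 1] m by (simp add: L2_norm_divide)
      moreover have "L2_norm \<Omega> (P (\<theta> 1)) \<le> \<eta> * (2 * A 0)"
        using P(3)[OF V1] A0[of 0] unfolding a0 by (simp add: real_sqrt_mult)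
      ultimately have "L2_norm \<Omega> (\<lambda>x. (g 1 x + g 0 x) / 2) * L2_norm \<Omega> (P (\<theta> 1)) \<le> G * (\<eta> * (2 * A 0))"
        by (intro mult_mono G0) auto
      then show ?thesis using L2_inner_le[OF L.closed(4)[OF L.closed(1)[OF g01]] P(1)[OF V1], of 2] by (simp add: abs_le_iff)
    qed
    ultimately have "2 * (D 0)\<^sup>2 + 2 * (A 0)\<^sup>2 \<le> e 0 * (k * D 0) + G * (\<eta> * (2 * A 0))"
      using start[OF V1] by simp
    then have "(D 0)\<^sup>2 + (A 0)\<^sup>2 \<le> (k * e 0 / 2) * D 0 + (G * \<eta>) * A 0" by (simp add: algebra_simps)
    from quadratic_start[OF D0 _ _ this] have "D 0 \<le> k * e 0 / 2 + G * \<eta>" using k e[of 0] G0 \<eta> by simp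
    also have "\<dots> \<le> k * e 0 + G * \<eta>" using k e[of 0] by simp
    finally show ?thesis .
  qed
  \<comment> \<open>The bound on the velocities is turned into one on \<theta> by summing
    increments; the number of steps times k becomes the prefactor of the final estimate.\<close>
  have nb: "L2_norm \<Omega> (\<theta> n) \<le> (\<Sum>j<n. k * D j)" if "n \<le> m + 1" for n
    using that
  proof (induction n)
    case 0
    show ?case by (simp add: \<theta>(2) L2_norm_def L2_inner_def)
  next
    case (Suc n)
    have "\<theta> (Suc n) = (\<lambda>x. \<theta> n x + \<delta> n x)" by (simp add: \<delta>_def)
    then have "L2_norm \<Omega> (\<theta> (Suc n)) \<le> L2_norm \<Omega> (\<theta> n) + L2_norm \<Omega> (\<delta> n)"
      using L2_norm_add_le[OF L2[OF \<theta>(1)] L2[OF \<delta>V], of n n] Suc.prems by simp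
    then show ?case using Suc k by (simp add: D_def)
  qed
  have "L2_norm \<Omega> (\<theta> (m+1)) \<le> (\<Sum>j<m+1. k * D j)" by (rule nb[OF order_refl])
  also have "\<dots> \<le> (\<Sum>j<m+1. k * (2 * (D 0 + ?S m)))"
  proof (intro sum_mono mult_left_mono)
    fix j assume "j \<in> {..<m+1}"
    then have "z j \<le> D 0 + ?S m" by (intro zb) auto
    then have "2 * z j \<le> 2 * (D 0 + ?S m)" by (rule mult_left_mono) simp
    then show "D j \<le> 2 * (D 0 + ?S m)" by (rule order_trans[OF Dz])
  qed (use k in simp)
  also have "\<dots> = 2 * (real (m+1) * k) * (D 0 + ?S m)" by simp
  also have "\<dots> \<le> 2 * (real (m+1) * k) * ((k * e 0 + G * \<eta>) + ?S m)"
    using k D0b by (intro mult_left_mono add_right_mono) auto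
  also have "(k * e 0 + G * \<eta>) + ?S m = k * e 0 + 5 * (G * \<eta>) + 4 * k * (\<Sum>n=1..m. e n) + 2 * \<eta> * (\<Sum>n=1..<m. \<gamma> n)"
    by (simp add: algebra_simps)
  finally show ?thesis .
qed

section \<open>Time derivatives in function spaces\<close>

lemma Linf_time_norm_bound:
  assumes "Linf_time_norm X T g \<le> ennreal c"
  shows "strongly_measurable X T g" and "AE t in lebesgue_on {0..T}. X (g t) \<le> ennreal c"
proof -
  show sm: "strongly_measurable X T g"
    using assms by (auto simp: Linf_time_norm_def top_unique split: if_splits)
  then have le: "esssup (lebesgue_on {0..T}) (\<lambda>t. X (g t)) \<le> ennreal c" using assms by (simp add: Linf_time_norm_def)
  from esssup_AE[of "\<lambda>t. X (g t)" "lebesgue_on {0..T}"]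
  show "AE t in lebesgue_on {0..T}. X (g t) \<le> ennreal c" by eventually_elim (rule order_trans[OF _ le])
qed

lemma emeasure_lebesgue_on_Icc: "0 \<le> T \<Longrightarrow> emeasure (lebesgue_on {0..T}) (space (lebesgue_on {0..T})) = ennreal T"
  by (simp add: emeasure_restrict_space space_restrict_space)

context bochner_norm
begin

lemma Linf_bound_nn_integral:
  assumes "AE t in lebesgue_on {0..T}. X (g t) \<le> ennreal c" "0 \<le> T"
  shows "(\<integral>\<^sup>+t. X (g t) \<partial>lebesgue_on {0..T}) \<le> ennreal c * ennreal T"
proof -
  have "(\<integral>\<^sup>+t. X (g t) \<partial>lebesgue_on {0..T}) \<le> (\<integral>\<^sup>+t. ennreal c \<partial>lebesgue_on {0..T})"
    by (rule nn_integral_mono_AE[OF assms(1)])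
  then show ?thesis using emeasure_lebesgue_on_Icc[OF assms(2)] by simp
qed

text \<open>Cauchy-Schwarz against the constant 1 produces the factor sqrt T.\<close>

lemma L2_time_norm_bound:
  assumes "L2_time_norm X T g \<le> ennreal c" "0 \<le> T" "0 \<le> c"
  shows "strongly_measurable X T g" and "(\<integral>\<^sup>+t. X (g t) \<partial>lebesgue_on {0..T}) \<le> ennreal (sqrt T * c)"
proof -
  let ?M = "lebesgue_on {0..T}"
  show sm: "strongly_measurable X T g"
    using assms by (auto simp: L2_time_norm_def top_unique split: if_splits)
  then have le: "esqrt (\<integral>\<^sup>+t. (X (g t))\<^sup>2 \<partial>?M) \<le> ennreal c" using assms by (simp add: L2_time_norm_def)
  define n where "n t = ennreal (enn2real (X (g t)))" for t
  have [measurable]: "n \<in> borel_measurable ?M" unfolding n_def using norm_path_measurable[OF sm] by measurable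
  have Xn: "AE t in ?M. X (g t) = n t" using norm_path_finite[OF sm] by eventually_elim (auto simp: n_def)
  have "(\<integral>\<^sup>+t. X (g t) \<partial>?M) = (\<integral>\<^sup>+t. 1 * n t \<partial>?M)" using Xn by (intro nn_integral_cong_AE) auto
  also have "\<dots> \<le> esqrt (\<integral>\<^sup>+t. 1\<^sup>2 \<partial>?M) * esqrt (\<integral>\<^sup>+t. (n t)\<^sup>2 \<partial>?M)"
    by (rule nn_integral_mult_le_esqrt) auto
  also have "(\<integral>\<^sup>+t. (n t)\<^sup>2 \<partial>?M) = (\<integral>\<^sup>+t. (X (g t))\<^sup>2 \<partial>?M)" using Xn by (intro nn_integral_cong_AE) auto
  also have "esqrt (\<integral>\<^sup>+t. 1\<^sup>2 \<partial>?M) = ennreal (sqrt T)"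
    using emeasure_lebesgue_on_Icc[OF assms(2)] assms(2) by (simp add: esqrt_ennreal)
  also have "ennreal (sqrt T) * esqrt (\<integral>\<^sup>+t. (X (g t))\<^sup>2 \<partial>?M) \<le> ennreal (sqrt T) * ennreal c"
    by (rule mult_left_mono[OF le]) simp
  finally show "(\<integral>\<^sup>+t. X (g t) \<partial>?M) \<le> ennreal (sqrt T * c)" using assms by (simp add: ennreal_mult)
qed

lemma norm_path_integrable:
  assumes "strongly_measurable X T g" "(\<integral>\<^sup>+t. X (g t) \<partial>lebesgue_on {0..T}) \<le> ennreal c" "0 \<le> c"
  shows "integrable (lebesgue_on {0..T}) (\<lambda>t. enn2real (X (g t)))"
    and "integral {0..T} (\<lambda>t. enn2real (X (g t))) \<le> c"
proof -
  let ?M = "lebesgue_on {0..T}" and ?n = "\<lambda>t. enn2real (X (g t))"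
  have e: "(\<integral>\<^sup>+t. ennreal (?n t) \<partial>?M) = (\<integral>\<^sup>+t. X (g t) \<partial>?M)"
    using norm_path_finite[OF assms(1)] by (intro nn_integral_cong_AE) (auto elim!: eventually_mono)
  show i: "integrable ?M ?n"
    by (rule integrableI_nonneg[OF norm_path_measurable[OF assms(1)]])
      (use assms(2) in \<open>auto simp: e intro: order_le_less_trans\<close>)
  have "ennreal (integral {0..T} ?n) = ennreal (LINT t|?M. ?n t)"
    using lebesgue_integral_eq_integral[OF i] by simp
  also have "\<dots> = (\<integral>\<^sup>+t. ennreal (?n t) \<partial>?M)" by (rule nn_integral_eq_integral[OF i, symmetric]) auto
  also have "\<dots> \<le> ennreal c" using assms(2) by (simp only: e)
  finally show "integral {0..T} ?n \<le> c" using assms(3) by (simp add: ennreal_le_iff)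
qed

lemma pairing_integral_le:
  assumes sm: "strongly_measurable X T g" and i: "integrable (lebesgue_on {0..T}) (\<lambda>t. enn2real (X (g t)))"
    and v: "v \<in> L2_space \<Omega>" and iv: "integrable (lebesgue_on {0..T}) (\<lambda>t. L2_inner \<Omega> (g t) v)" and ab: "0 \<le> a" "b \<le> T"
  shows "\<bar>integral {a..b} (\<lambda>t. L2_inner \<Omega> (g t) v)\<bar> \<le> integral {a..b} (\<lambda>t. enn2real (X (g t))) * L2_norm \<Omega> v"
proof -
  let ?n = "\<lambda>t. enn2real (X (g t))" and ?p = "\<lambda>t. L2_inner \<Omega> (g t) v" and ?A = "lebesgue_on {a..b}"
  have ia: "integrable ?A ?n" and ip: "integrable ?A ?p" using LINT_indicator_Icc(2) i iv ab by blast+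
  have "AE t in lebesgue. t \<in> {0..T} \<longrightarrow> X (g t) < \<infinity>"
    using norm_path_finite[OF sm] by (simp add: AE_restrict_space_iff)
  then have ae: "AE t in ?A. \<bar>?p t\<bar> \<le> ?n t * L2_norm \<Omega> v"
    using pairing_le[OF _ v] ab by (auto simp: AE_restrict_space_iff elim!: eventually_mono)
  have "\<bar>LINT t|?A. ?p t\<bar> \<le> (LINT t|?A. \<bar>?p t\<bar>)" using integral_norm_bound[of ?A ?p] by simp
  also have "\<dots> \<le> (LINT t|?A. ?n t * L2_norm \<Omega> v)" using ia ip ae by (intro integral_mono_AE) auto
  also have "\<dots> = (LINT t|?A. ?n t) * L2_norm \<Omega> v" by simp
  finally show ?thesis using ia ip by (simp add: lebesgue_integral_eq_integral)
qed

text \<open>Keeps the estimate local in time: a kernel supported in one window costs only the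
  integral over that window, so that summing over the grid remains bounded by the integral over
  [0, T].\<close>

lemma indicator_kernel_nn_integral_le:
  assumes sm: "strongly_measurable X T g" and i: "integrable (lebesgue_on {0..T}) (\<lambda>t. enn2real (X (g t)))"
    and B: "\<And>t. \<bar>B t\<bar> \<le> c * indicator {a..b} t" and ab: "0 \<le> a" "b \<le> T" and c: "0 \<le> c"
  shows "(\<integral>\<^sup>+t. ennreal \<bar>B t\<bar> * X (g t) \<partial>lebesgue_on {0..T}) \<le> ennreal (c * integral {a..b} (\<lambda>t. enn2real (X (g t))))"
proof -
  let ?M = "lebesgue_on {0..T}" and ?n = "\<lambda>t. enn2real (X (g t))"
  have "(\<integral>\<^sup>+t. ennreal \<bar>B t\<bar> * X (g t) \<partial>?M) \<le> (\<integral>\<^sup>+t. ennreal (c * (indicator {a..b} t * ?n t)) \<partial>?M)"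
  proof (rule nn_integral_mono_AE, use norm_path_finite[OF sm] in eventually_elim)
    case (elim t)
    have "ennreal \<bar>B t\<bar> * X (g t) \<le> ennreal (c * indicator {a..b} t) * X (g t)"
      by (intro mult_right_mono ennreal_leI B) simp
    also have "\<dots> = ennreal (c * indicator {a..b} t) * ennreal (?n t)" using elim by simp
    also have "\<dots> = ennreal (c * (indicator {a..b} t * ?n t))" using c by (simp add: mult.assoc flip: ennreal_mult)
    finally show ?case .
  qed
  also have "\<dots> = ennreal (LINT t|?M. c * (indicator {a..b} t * ?n t))"
  proof (rule nn_integral_eq_integral)
    have "(\<lambda>t. indicat_real {a..b} t) \<in> borel_measurable ?M" by (simp add: measurable_restrict_space1 measurable_completion)
    from integrable_mult_bounded[OF i this, of 1] show "integrable ?M (\<lambda>t. c * (indicator {a..b} t * ?n t))"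
      by (simp add: mult.commute indicator_def)
  qed (use c in auto)
  also have "(LINT t|?M. c * (indicator {a..b} t * ?n t)) = c * integral {a..b} ?n"
    using LINT_indicator_Icc(1)[OF i ab] by simp
  finally show ?thesis .
qed

end

lemma has_time_deriv_pairing:
  assumes "has_time_deriv \<Omega> T j w g" "\<Omega> \<in> sets lebesgue" "v \<in> L2_space \<Omega>"
  shows "integrable (lebesgue_on {0..T}) (\<lambda>t. L2_inner \<Omega> (g t) v)"
    and "\<phi> \<in> test_fun {0<..<T} \<Longrightarrow> (LINT t|lebesgue_on {0..T}. L2_inner \<Omega> (w t) v * (deriv ^^ j) \<phi> t) =
        (-1) ^ j * (LINT t|lebesgue_on {0..T}. L2_inner \<Omega> (g t) v * \<phi> t)"
proof -
  interpret bochner_norm \<Omega> "L2_enorm \<Omega>" by (rule bochner_norm_L2[OF assms(2)])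
  show "integrable (lebesgue_on {0..T}) (\<lambda>t. L2_inner \<Omega> (g t) v)"
    using assms(1,3) unfolding has_time_deriv_def bochner_integrable_def by (intro pairing_integrable) auto
qed (use assms in \<open>auto simp: has_time_deriv_def\<close>)

text \<open>Both pairings have the same integrals against test functions. The exceptional null set
  may depend on \<open>v\<close>; every use fixes \<open>v\<close> beforehand.\<close>

lemma has_time_deriv_unique:
  assumes "has_time_deriv \<Omega> T j w g" "has_time_deriv \<Omega> T j w h" "\<Omega> \<in> sets lebesgue" "v \<in> L2_space \<Omega>"
  shows "AE t in lebesgue_on {0..T}. L2_inner \<Omega> (g t) v = L2_inner \<Omega> (h t) v"
proof -
  note g = has_time_deriv_pairing[OF assms(1,3,4)] and h = has_time_deriv_pairing[OF assms(2-4)]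
  have "AE t in lebesgue_on {0..T}. L2_inner \<Omega> (g t) v - L2_inner \<Omega> (h t) v = 0"
  proof (rule fundamental_lemma_Icc)
    fix \<phi> :: "real \<Rightarrow> real" assume \<phi>: "\<phi> \<in> test_fun {0<..<T}"
    have "(LINT t|lebesgue_on {0..T}. L2_inner \<Omega> (g t) v * \<phi> t) = (LINT t|lebesgue_on {0..T}. L2_inner \<Omega> (h t) v * \<phi> t)"
      using g(2)[OF \<phi>] h(2)[OF \<phi>] by simp
    then show "(LINT t|lebesgue_on {0..T}. (L2_inner \<Omega> (g t) v - L2_inner \<Omega> (h t) v) * \<phi> t) = 0"
      using test_fun_integrable[OF \<phi> g(1)] test_fun_integrable[OF \<phi> h(1)] by (simp add: left_diff_distrib)
  qed (use g(1) h(1) in simp)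
  then show ?thesis by simp
qed

lemma time_continuous_L2_pairing:
  assumes "time_continuous (L2_enorm \<Omega>) T w" "v \<in> L2_space \<Omega>"
  shows "\<And>t. t \<in> {0..T} \<Longrightarrow> w t \<in> L2_space \<Omega>" and "continuous_on {0..T} (\<lambda>t. L2_inner \<Omega> (w t) v)"
proof -
  show L2: "w t \<in> L2_space \<Omega>" if "t \<in> {0..T}" for t
    using assms(1) that unfolding time_continuous_def L2_enorm_finite_iff[symmetric] by blast
  show "continuous_on {0..T} (\<lambda>t. L2_inner \<Omega> (w t) v)"
    unfolding continuous_on_def
  proof
    fix t assume t: "t \<in> {0..T}"
    have "((\<lambda>s. L2_enorm \<Omega> (\<lambda>x. w s x - w t x)) \<longlongrightarrow> 0) (at t within {0..T})"
      using assms(1) t by (simp add: time_continuous_def)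
    then have "((\<lambda>s. enn2real (L2_enorm \<Omega> (\<lambda>x. w s x - w t x)) * L2_norm \<Omega> v) \<longlongrightarrow> 0 * L2_norm \<Omega> v) (at t within {0..T})"
      by (intro tendsto_mult_right tendsto_enn2real[where l=0, simplified]) auto
    moreover have "\<forall>\<^sub>F s in at t within {0..T}. norm (L2_inner \<Omega> (w s) v - L2_inner \<Omega> (w t) v)
        \<le> enn2real (L2_enorm \<Omega> (\<lambda>x. w s x - w t x)) * L2_norm \<Omega> v"
      unfolding eventually_at_filter
    proof (intro always_eventually allI impI)
      fix s assume "s \<noteq> t" and s: "s \<in> {0..T}"
      have d: "(\<lambda>x. w s x - w t x) \<in> L2_space \<Omega>" using L2[OF s] L2[OF t] by (rule L2_space_diff)
      show "norm (L2_inner \<Omega> (w s) v - L2_inner \<Omega> (w t) v) \<le> enn2real (L2_enorm \<Omega> (\<lambda>x. w s x - w t x)) * L2_norm \<Omega> v"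
        using L2_inner_le[OF d assms(2)] by (simp add: L2_inner_diff[OF L2[OF s] L2[OF t] assms(2)] L2_enorm_eq_norm[OF d])
    qed
    ultimately have "((\<lambda>s. L2_inner \<Omega> (w s) v - L2_inner \<Omega> (w t) v) \<longlongrightarrow> 0) (at t within {0..T})"
      unfolding mult_zero_left by (rule Lim_null_comparison[rotated])
    then show "((\<lambda>s. L2_inner \<Omega> (w s) v) \<longlongrightarrow> L2_inner \<Omega> (w t) v) (at t within {0..T})"
      by (simp add: LIM_zero_iff)
  qed
qed

lemma L2_time_derivative_pairing:
  assumes u: "\<And>t. t \<in> {0..T} \<Longrightarrow> u t \<in> L2_space \<Omega>" and ut: "ut t \<in> L2_space \<Omega>" and v: "v \<in> L2_space \<Omega>" and t: "t \<in> {0..T}"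
    and d: "((\<lambda>s. L2_enorm \<Omega> (\<lambda>x. (u s x - u t x) / (s - t) - ut t x)) \<longlongrightarrow> 0) (at t within {0..T})"
  shows "((\<lambda>s. L2_inner \<Omega> (u s) v) has_real_derivative L2_inner \<Omega> (ut t) v) (at t within {0..T})"
  unfolding has_field_derivative_iff
proof -
  let ?q = "\<lambda>s x. (u s x - u t x) / (s - t) - ut t x"
  have "((\<lambda>s. enn2real (L2_enorm \<Omega> (?q s)) * L2_norm \<Omega> v) \<longlongrightarrow> 0 * L2_norm \<Omega> v) (at t within {0..T})"
    using d by (intro tendsto_mult_right tendsto_enn2real[where l=0, simplified]) auto
  moreover have "\<forall>\<^sub>F s in at t within {0..T}. norm ((L2_inner \<Omega> (u s) v - L2_inner \<Omega> (u t) v) / (s - t) - L2_inner \<Omega> (ut t) v)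
      \<le> enn2real (L2_enorm \<Omega> (?q s)) * L2_norm \<Omega> v"
    unfolding eventually_at_filter
  proof (intro always_eventually allI impI)
    fix s assume "s \<noteq> t" and s: "s \<in> {0..T}"
    have q1: "(\<lambda>x. (u s x - u t x) / (s - t)) \<in> L2_space \<Omega>" using u[OF s] u[OF t] by (intro L2_space_divide L2_space_diff)
    have q: "?q s \<in> L2_space \<Omega>" using q1 ut by (rule L2_space_diff)
    have "L2_inner \<Omega> (?q s) v = (L2_inner \<Omega> (u s) v - L2_inner \<Omega> (u t) v) / (s - t) - L2_inner \<Omega> (ut t) v"
      using L2_inner_diff[OF q1 ut v] L2_inner_diff[OF u[OF s] u[OF t] v] by (simp add: L2_inner_divide)
    then show "norm ((L2_inner \<Omega> (u s) v - L2_inner \<Omega> (u t) v) / (s - t) - L2_inner \<Omega> (ut t) v)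
      \<le> enn2real (L2_enorm \<Omega> (?q s)) * L2_norm \<Omega> v"
      using L2_inner_le[OF q v] by (simp add: L2_enorm_eq_norm[OF q])
  qed
  ultimately have "((\<lambda>s. (L2_inner \<Omega> (u s) v - L2_inner \<Omega> (u t) v) / (s - t) - L2_inner \<Omega> (ut t) v) \<longlongrightarrow> 0) (at t within {0..T})"
    unfolding mult_zero_left by (rule Lim_null_comparison[rotated])
  then show "((\<lambda>s. (L2_inner \<Omega> (u s) v - L2_inner \<Omega> (u t) v) / (s - t)) \<longlongrightarrow> L2_inner \<Omega> (ut t) v) (at t within {0..T})"
    by (simp add: LIM_zero_iff)
qed

text \<open>
  The kernels are those of the Taylor formulas; since they are tested against all of \<open>L\<^sup>2\<close>, the
  corresponding Bochner integrals represent the difference quotients themselves.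
\<close>

lemma FTC_kernel:
  fixes F F' :: "real \<Rightarrow> real"
  assumes "\<And>t. t \<in> {0..T} \<Longrightarrow> (F has_real_derivative F' t) (at t within {0..T})" "0 \<le> a" "a \<le> b" "b \<le> T"
  shows "integral {a..b} F' = F b - F a"
proof (rule integral_unique, rule fundamental_theorem_of_calculus[OF assms(3)])
  fix t assume t: "t \<in> {a..b}"
  have "(F has_real_derivative F' t) (at t within {a..b})"
    by (rule has_field_derivative_subset[OF assms(1)]) (use t assms in auto)
  then show "(F has_vector_derivative F' t) (at t within {a..b})"
    by (simp add: has_real_derivative_iff_has_vector_derivative)
qed

text \<open>Integration by parts with weight s on [0, t] and weight s - T on [t, T]. It recovers the
  value at a single time from integrals over [0, T], for which bounds at almost every time
  suffice.\<close>

lemma mean_value_kernel: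
  fixes F F' :: "real \<Rightarrow> real"
  assumes d: "\<And>t. t \<in> {0..T} \<Longrightarrow> (F has_real_derivative F' t) (at t within {0..T})" and c: "continuous_on {0..T} F'"
    and t: "t \<in> {0..T}"
  shows "T * F t = (LINT s|lebesgue_on {0..T}. F s)
    + (LINT s|lebesgue_on {0..T}. (indicator {0..t} s * s - indicator {t..T} s * (T - s)) * F' s)"
proof -
  let ?M = "lebesgue_on {0..T}"
  have cF: "continuous_on {0..T} F" using d DERIV_continuous continuous_on_eq_continuous_within by blast
  have i1: "integrable ?M (\<lambda>s. s * F' s)" and i2: "integrable ?M (\<lambda>s. (T - s) * F' s)" and iF: "integrable ?M F"
    using c cF by (auto intro!: continuous_integrable_Icc continuous_intros)
  have ind: "(\<lambda>s. indicat_real A s) \<in> borel_measurable ?M" if "A \<in> sets borel" for A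
    using that by (simp add: measurable_restrict_space1 measurable_completion)
  have ii: "integrable ?M (\<lambda>s. indicator A s * G s)" if "A \<in> sets borel" "integrable ?M G" for A and G :: "real \<Rightarrow> real"
    using integrable_mult_bounded[OF that(2) ind[OF that(1)], of 1] by (simp add: mult.commute indicator_def)
  have "(LINT s|?M. (indicator {0..t} s * s - indicator {t..T} s * (T - s)) * F' s)
      = (LINT s|?M. indicator {0..t} s * (s * F' s) - indicator {t..T} s * ((T - s) * F' s))"
    by (simp add: algebra_simps)
  also have "\<dots> = integral {0..t} (\<lambda>s. s * F' s) - integral {t..T} (\<lambda>s. (T - s) * F' s)"
    using LINT_indicator_Icc(1)[OF i1, of 0 t] LINT_indicator_Icc(1)[OF i2, of t T] t ii[OF _ i1] ii[OF _ i2] by simp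
  finally have 1: "(LINT s|?M. (indicator {0..t} s * s - indicator {t..T} s * (T - s)) * F' s)
      = integral {0..t} (\<lambda>s. s * F' s) - integral {t..T} (\<lambda>s. (T - s) * F' s)" .
  have on: "f integrable_on {a..b}" if "integrable ?M f" "0 \<le> a" "b \<le> T" for f :: "real \<Rightarrow> real" and a b
    by (rule integrable_on_lebesgue_on[OF LINT_indicator_Icc(2)[OF that]]) auto
  have t': "0 \<le> t" "t \<le> T" using t by auto
  have "integral {0..t} (\<lambda>s. F s + s * F' s) = t * F t - 0 * F 0"
    by (rule FTC_kernel[where T=T]) (use t' in \<open>auto intro!: derivative_eq_intros d\<close>)
  then have 2: "integral {0..t} (\<lambda>s. s * F' s) = t * F t - integral {0..t} F"
    using on[OF iF, of 0 t] on[OF i1, of 0 t] t' by (simp add: Henstock_Kurzweil_Integration.integral_add)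
  have "integral {t..T} (\<lambda>s. - F s + (T - s) * F' s) = (T - T) * F T - (T - t) * F t"
    by (rule FTC_kernel[where T=T]) (use t' in \<open>auto intro!: derivative_eq_intros d\<close>)
  then have 3: "integral {t..T} (\<lambda>s. (T - s) * F' s) = integral {t..T} F - (T - t) * F t"
    using on[OF iF, of t T] on[OF i2, of t T] t' Henstock_Kurzweil_Integration.integral_add[of "\<lambda>s. - F s" "{t..T}" "\<lambda>s. (T - s) * F' s"]
    by (simp add: integrable_neg)
  have "(LINT s|?M. F s) = integral {0..T} F" by (rule lebesgue_integral_eq_integral[OF iF]) auto
  also have "\<dots> = integral {0..t} F + integral {t..T} F"
    using on[OF iF, of 0 T] t' by (simp add: Henstock_Kurzweil_Integration.integral_combine)
  finally show ?thesis unfolding 1 2 3 by (simp add: algebra_simps)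
qed

text \<open>The kernel is the hat function centred at \<open>t\<close> with half-width
  \<open>k\<close>. At the point \<open>t\<close> itself both halves are active, which does not
  affect the integral.\<close>

lemma second_difference_kernel:
  fixes y y1 Y2 :: "real \<Rightarrow> real"
  assumes dy: "\<And>t. t \<in> {0..T} \<Longrightarrow> (y has_real_derivative y1 t) (at t within {0..T})"
    and dy1: "\<And>t. t \<in> {0..T} \<Longrightarrow> (y1 has_real_derivative Y2 t) (at t within {0..T})" and c: "continuous_on {0..T} Y2"
    and k: "0 \<le> k" "k \<le> t" "t + k \<le> T"
  shows "y (t + k) - 2 * y t + y (t - k)
    = (LINT s|lebesgue_on {0..T}. (indicator {t-k..t} s * (s - (t - k)) + indicator {t..t+k} s * (t + k - s)) * Y2 s)"
proof -
  let ?M = "lebesgue_on {0..T}"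
  have i1: "integrable ?M (\<lambda>s. (s - (t - k)) * Y2 s)" and i2: "integrable ?M (\<lambda>s. (t + k - s) * Y2 s)"
    using c by (auto intro!: continuous_integrable_Icc continuous_intros)
  have ind: "(\<lambda>s. indicat_real A s) \<in> borel_measurable ?M" if "A \<in> sets borel" for A
    using that by (simp add: measurable_restrict_space1 measurable_completion)
  have ii: "integrable ?M (\<lambda>s. indicator A s * G s)" if "A \<in> sets borel" "integrable ?M G" for A and G :: "real \<Rightarrow> real"
    using integrable_mult_bounded[OF that(2) ind[OF that(1)], of 1] by (simp add: mult.commute indicator_def)
  have "integral {t-k..t} (\<lambda>s. (s - (t - k)) * Y2 s) = ((t - (t - k)) * y1 t - y t) - ((t - k - (t - k)) * y1 (t - k) - y (t - k))"
    by (rule FTC_kernel[where T=T]) (use k in \<open>auto intro!: derivative_eq_intros dy dy1\<close>)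
  moreover have "integral {t..t+k} (\<lambda>s. (t + k - s) * Y2 s) = ((t + k - (t + k)) * y1 (t + k) + y (t + k)) - ((t + k - t) * y1 t + y t)"
    by (rule FTC_kernel[where T=T]) (use k in \<open>auto intro!: derivative_eq_intros dy dy1\<close>)
  moreover have "(LINT s|?M. (indicator {t-k..t} s * (s - (t - k)) + indicator {t..t+k} s * (t + k - s)) * Y2 s)
      = (LINT s|?M. indicator {t-k..t} s * ((s - (t - k)) * Y2 s) + indicator {t..t+k} s * ((t + k - s) * Y2 s))"
    by (simp add: algebra_simps)
  moreover have "\<dots> = integral {t-k..t} (\<lambda>s. (s - (t - k)) * Y2 s) + integral {t..t+k} (\<lambda>s. (t + k - s) * Y2 s)"
    using LINT_indicator_Icc(1)[OF i1, of "t-k" t] LINT_indicator_Icc(1)[OF i2, of t "t+k"] k ii[OF _ i1] ii[OF _ i2] by simp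
  ultimately show ?thesis by simp
qed

text \<open>The classical derivatives found for each pairing depend on \<open>v\<close>. To obtain
  one element of \<open>L2\<close> at each time, the mean value formula is read as the sum of two
  Bochner integrals, of \<open>g2\<close> with weight 1 and of \<open>g3\<close> with the kernel,
  divided by T.\<close>

lemma second_time_derivative_representative:
  assumes \<Omega>: "\<Omega> \<in> sets lebesgue" and T: "0 < T"
    and u: "\<And>t. t \<in> {0..T} \<Longrightarrow> u t \<in> L2_space \<Omega>" and ut: "time_continuous (L2_enorm \<Omega>) T ut"
    and d: "\<And>t. t \<in> {0..T} \<Longrightarrow> ((\<lambda>s. L2_enorm \<Omega> (\<lambda>x. (u s x - u t x) / (s - t) - ut t x)) \<longlongrightarrow> 0) (at t within {0..T})"
    and g2: "has_time_deriv \<Omega> T 2 u g2" and g3: "has_time_deriv \<Omega> T 3 u g3" and g4: "has_time_deriv \<Omega> T 4 u g4"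
  obtains W where "\<And>t. t \<in> {0..T} \<Longrightarrow> W t \<in> L2_space \<Omega>"
    "\<And>v. v \<in> L2_space \<Omega> \<Longrightarrow> \<exists>Y3. continuous_on {0..T} Y3 \<and> continuous_on {0..T} (\<lambda>t. L2_inner \<Omega> (W t) v) \<and>
      (\<forall>t\<in>{0..T}. ((\<lambda>t. L2_inner \<Omega> (u t) v) has_real_derivative L2_inner \<Omega> (ut t) v) (at t within {0..T})) \<and>
      (\<forall>t\<in>{0..T}. ((\<lambda>t. L2_inner \<Omega> (ut t) v) has_real_derivative L2_inner \<Omega> (W t) v) (at t within {0..T})) \<and>
      (\<forall>t\<in>{0..T}. ((\<lambda>t. L2_inner \<Omega> (W t) v) has_real_derivative Y3 t) (at t within {0..T})) \<and>
      (AE t in lebesgue_on {0..T}. L2_inner \<Omega> (g2 t) v = L2_inner \<Omega> (W t) v) \<and>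
      (AE t in lebesgue_on {0..T}. L2_inner \<Omega> (g3 t) v = Y3 t) \<and>
      (\<forall>a b. 0 \<le> a \<and> a \<le> b \<and> b \<le> T \<longrightarrow> Y3 b - Y3 a = integral {a..b} (\<lambda>t. L2_inner \<Omega> (g4 t) v))"
proof -
  interpret bochner_norm \<Omega> "L2_enorm \<Omega>" by (rule bochner_norm_L2[OF \<Omega>])
  let ?M = "lebesgue_on {0..T}"
  \<comment> \<open>All that \<open>distributional_C3\<close> provides for one \<open>v\<close>.
    Several pairs might satisfy it, but \<open>W\<close> is shown to fit each of them.\<close>
  define reg where "reg v Y2 Y3 \<longleftrightarrow> continuous_on {0..T} Y2 \<and> continuous_on {0..T} Y3 \<and>
      (\<forall>t\<in>{0..T}. ((\<lambda>t. L2_inner \<Omega> (ut t) v) has_real_derivative Y2 t) (at t within {0..T})) \<and>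
      (\<forall>t\<in>{0..T}. (Y2 has_real_derivative Y3 t) (at t within {0..T})) \<and>
      (AE t in ?M. L2_inner \<Omega> (g2 t) v = Y2 t) \<and> (AE t in ?M. L2_inner \<Omega> (g3 t) v = Y3 t) \<and>
      (\<forall>a b. 0 \<le> a \<and> a \<le> b \<and> b \<le> T \<longrightarrow> Y3 b - Y3 a = integral {a..b} (\<lambda>t. L2_inner \<Omega> (g4 t) v))" for v Y2 Y3
  have utL2: "ut t \<in> L2_space \<Omega>" if "t \<in> {0..T}" for t
    by (rule time_continuous_L2_pairing(1)[OF ut L2_space_zero that])
  have dy: "((\<lambda>t. L2_inner \<Omega> (u t) v) has_real_derivative L2_inner \<Omega> (ut t) v) (at t within {0..T})"
    if "v \<in> L2_space \<Omega>" "t \<in> {0..T}" for v t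
    by (rule L2_time_derivative_pairing[where u=u and ut=ut and t=t, OF u utL2[OF that(2)] that(1) that(2) d[OF that(2)]])
  have ex: "\<exists>Y2 Y3. reg v Y2 Y3" if v: "v \<in> L2_space \<Omega>" for v
    unfolding reg_def
  proof (rule distributional_C3[OF T time_continuous_L2_pairing(2)[OF ut v] dy[OF v]
        has_time_deriv_pairing(1)[OF g2 \<Omega> v] has_time_deriv_pairing(1)[OF g3 \<Omega> v] has_time_deriv_pairing(1)[OF g4 \<Omega> v]])
  qed (use has_time_deriv_pairing(2)[OF g2 \<Omega> v] has_time_deriv_pairing(2)[OF g3 \<Omega> v] has_time_deriv_pairing(2)[OF g4 \<Omega> v] in simp_all)
  have sm: "strongly_measurable (L2_enorm \<Omega>) T g2" "strongly_measurable (L2_enorm \<Omega>) T g3"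
    and fin: "(\<integral>\<^sup>+t. L2_enorm \<Omega> (g2 t) \<partial>?M) < \<infinity>" "(\<integral>\<^sup>+t. L2_enorm \<Omega> (g3 t) \<partial>?M) < \<infinity>"
    using g2 g3 by (auto simp: has_time_deriv_def bochner_integrable_def)
  have "\<exists>W. W \<in> L2_space \<Omega> \<and> (\<forall>v\<in>L2_space \<Omega>. \<forall>Y2 Y3. reg v Y2 Y3 \<longrightarrow> L2_inner \<Omega> W v = Y2 t)" if t: "t \<in> {0..T}" for t
  proof -
    let ?K = "\<lambda>s. indicator {0..t} s * s - indicator {t..T} s * (T - s)"
    have K: "?K \<in> borel_measurable ?M" "\<And>s. \<bar>?K s\<bar> \<le> 2 * T"
      using t by (auto simp: indicator_def measurable_restrict_space1 measurable_completion)
    \<comment> \<open>\<open>Wa\<close> supplies the time integral of u_tt, \<open>Wb\<close> the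
      correction that turns the mean into the value at \<open>t\<close>.\<close>
    obtain Wa where Wa: "Wa \<in> L2_space \<Omega>" "\<forall>v\<in>L2_space \<Omega>. L2_inner \<Omega> Wa v = (LINT t|?M. 1 * L2_inner \<Omega> (g2 t) v)"
      using bochner_integral_exists[OF sm(1) fin(1), of "\<lambda>_. 1" 1] by auto
    obtain Wb where Wb: "Wb \<in> L2_space \<Omega>" "\<forall>v\<in>L2_space \<Omega>. L2_inner \<Omega> Wb v = (LINT t|?M. ?K t * L2_inner \<Omega> (g3 t) v)"
      using bochner_integral_exists[OF sm(2) fin(2) K] by auto
    let ?W = "\<lambda>x. (Wa x + Wb x) / T"
    have "L2_inner \<Omega> ?W v = Y2 t" if v: "v \<in> L2_space \<Omega>" and r: "reg v Y2 Y3" for v Y2 Y3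
    proof -
      have c3: "continuous_on {0..T} Y3" and c2: "continuous_on {0..T} Y2" and dY: "\<And>t. t \<in> {0..T} \<Longrightarrow> (Y2 has_real_derivative Y3 t) (at t within {0..T})"
        and a2: "AE t in ?M. L2_inner \<Omega> (g2 t) v = Y2 t" and a3: "AE t in ?M. L2_inner \<Omega> (g3 t) v = Y3 t"
        using r by (auto simp: reg_def)
      have [measurable]: "(\<lambda>t. L2_inner \<Omega> (g2 t) v) \<in> borel_measurable ?M" "(\<lambda>t. L2_inner \<Omega> (g3 t) v) \<in> borel_measurable ?M"
        "Y2 \<in> borel_measurable ?M" "Y3 \<in> borel_measurable ?M" "?K \<in> borel_measurable ?M"
        using pairing_measurable[OF sm(1) v] pairing_measurable[OF sm(2) v] continuous_integrable_Icc[OF c2] continuous_integrable_Icc[OF c3] K(1) by auto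
      have "L2_inner \<Omega> Wa v = (LINT s|?M. Y2 s)"
        using Wa(2) v a2 by (auto intro!: integral_cong_AE)
      moreover have "L2_inner \<Omega> Wb v = (LINT s|?M. ?K s * Y3 s)"
        using Wb(2) v a3 by (auto intro!: integral_cong_AE elim!: eventually_mono)
      ultimately have "T * Y2 t = L2_inner \<Omega> Wa v + L2_inner \<Omega> Wb v" using mean_value_kernel[OF dY c3 t] by simp
      then show ?thesis using T by (simp add: L2_inner_divide L2_inner_add Wa(1) Wb(1) v field_simps)
    qed
    moreover have "?W \<in> L2_space \<Omega>" using Wa(1) Wb(1) by (intro L2_space_divide L2_space_add)
    ultimately show ?thesis by blast
  qed
  then obtain W where W: "\<And>t. t \<in> {0..T} \<Longrightarrow> W t \<in> L2_space \<Omega>"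
    and WY: "\<And>t v Y2 Y3. t \<in> {0..T} \<Longrightarrow> v \<in> L2_space \<Omega> \<Longrightarrow> reg v Y2 Y3 \<Longrightarrow> L2_inner \<Omega> (W t) v = Y2 t"
    by metis
  show thesis
  proof (rule that[OF W])
    fix v assume v: "v \<in> L2_space \<Omega>"
    obtain Y2 Y3 where r: "reg v Y2 Y3" using ex[OF v] by blast
    have WY2: "L2_inner \<Omega> (W t) v = Y2 t" if "t \<in> {0..T}" for t by (rule WY[OF that v r])
    have "continuous_on {0..T} (\<lambda>t. L2_inner \<Omega> (W t) v)"
      using continuous_on_cong[of "{0..T}" "{0..T}" "\<lambda>t. L2_inner \<Omega> (W t) v" Y2] WY2 r
      unfolding reg_def by blast
    moreover have "((\<lambda>t. L2_inner \<Omega> (W t) v) has_real_derivative Y3 t) (at t within {0..T})" if t: "t \<in> {0..T}" for t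
      by (rule has_real_derivative_transform_within[where f=Y2, OF t WY2]) (use r t in \<open>auto simp: reg_def\<close>)
    moreover have "AE t in ?M. L2_inner \<Omega> (g2 t) v = L2_inner \<Omega> (W t) v"
    proof -
      have "AE t in ?M. L2_inner \<Omega> (g2 t) v = Y2 t" using r by (simp add: reg_def)
      with AE_space[of ?M] show ?thesis by eventually_elim (use WY2 in auto)
    qed
    ultimately show "\<exists>Y3. continuous_on {0..T} Y3 \<and> continuous_on {0..T} (\<lambda>t. L2_inner \<Omega> (W t) v) \<and>
      (\<forall>t\<in>{0..T}. ((\<lambda>t. L2_inner \<Omega> (u t) v) has_real_derivative L2_inner \<Omega> (ut t) v) (at t within {0..T})) \<and>
      (\<forall>t\<in>{0..T}. ((\<lambda>t. L2_inner \<Omega> (ut t) v) has_real_derivative L2_inner \<Omega> (W t) v) (at t within {0..T})) \<and>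
      (\<forall>t\<in>{0..T}. ((\<lambda>t. L2_inner \<Omega> (W t) v) has_real_derivative Y3 t) (at t within {0..T})) \<and>
      (AE t in ?M. L2_inner \<Omega> (g2 t) v = L2_inner \<Omega> (W t) v) \<and>
      (AE t in ?M. L2_inner \<Omega> (g3 t) v = Y3 t) \<and>
      (\<forall>a b. 0 \<le> a \<and> a \<le> b \<and> b \<le> T \<longrightarrow> Y3 b - Y3 a = integral {a..b} (\<lambda>t. L2_inner \<Omega> (g4 t) v))"
      using r WY2 dy[OF v] by (intro exI[of _ Y3] conjI) (auto simp: reg_def)
  qed
qed

lemma L2_norm_le_of_pairing_bound:
  assumes "w \<in> L2_space \<Omega>" "\<And>v. v \<in> L2_space \<Omega> \<Longrightarrow> \<bar>L2_inner \<Omega> w v\<bar> \<le> c * L2_norm \<Omega> v" "0 \<le> c"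
  shows "L2_norm \<Omega> w \<le> c"
  by (rule L2_norm_le_dual[OF assms(1) assms(2)[OF assms(1)] assms(3)])

lemma AE_pairing_bound:
  assumes "AE t in M. L2_enorm \<Omega> (g t) \<le> ennreal c" "v \<in> L2_space \<Omega>" "0 \<le> c"
  shows "AE t in M. \<bar>L2_inner \<Omega> (g t) v\<bar> \<le> c * L2_norm \<Omega> v"
  using assms(1)
proof eventually_elim
  case (elim t)
  have g: "g t \<in> L2_space \<Omega>" unfolding L2_enorm_finite_iff[symmetric] by (rule order_le_less_trans[OF elim]) simp
  then have "L2_norm \<Omega> (g t) \<le> c" using elim assms(3) by (simp add: L2_enorm_eq_norm ennreal_le_iff)
  then have "L2_norm \<Omega> (g t) * L2_norm \<Omega> v \<le> c * L2_norm \<Omega> v" by (intro mult_right_mono) auto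
  then show ?case using L2_inner_le[OF g assms(2)] by linarith
qed

text \<open>\<open>w\<close> is continuous in time, so a bound at almost every time holds at every
  time; its pairings are primitives of those of \<open>p1\<close>, which bounds increments. The
  representatives \<open>p0\<close> and \<open>p1\<close> come from the infima in the norms and need
  not be continuous themselves.\<close>

lemma continuous_rep_bounds:
  assumes \<Omega>: "\<Omega> \<in> sets lebesgue" and T: "0 < T" and w: "time_continuous (L2_enorm \<Omega>) T w"
    and p0: "has_time_deriv \<Omega> T 0 w p0" "Linf_time_norm (L2_enorm \<Omega>) T p0 \<le> ennreal c" and c: "0 \<le> c"
    and p1: "has_time_deriv \<Omega> T 1 w p1" "L2_time_norm (L2_enorm \<Omega>) T p1 \<le> ennreal c1" and c1: "0 \<le> c1"
  shows "\<And>t. t \<in> {0..T} \<Longrightarrow> L2_norm \<Omega> (w t) \<le> c"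
    and "\<And>a b. 0 \<le> a \<Longrightarrow> a \<le> b \<Longrightarrow> b \<le> T \<Longrightarrow> L2_norm \<Omega> (\<lambda>x. w b x - w a x) \<le> integral {a..b} (\<lambda>t. enn2real (L2_enorm \<Omega> (p1 t)))"
proof -
  interpret bochner_norm \<Omega> "L2_enorm \<Omega>" by (rule bochner_norm_L2[OF \<Omega>])
  let ?M = "lebesgue_on {0..T}"
  note wL2 = time_continuous_L2_pairing(1)[OF w L2_space_zero]
  have wc: "continuous_on {0..T} (\<lambda>t. L2_inner \<Omega> (w t) v)" if "v \<in> L2_space \<Omega>" for v
    by (rule time_continuous_L2_pairing(2)[OF w that])
  have iw: "integrable ?M (\<lambda>t. L2_inner \<Omega> (w t) v)" if "v \<in> L2_space \<Omega>" for v
    by (rule continuous_integrable_Icc[OF wc[OF that]])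
  show "L2_norm \<Omega> (w t) \<le> c" if t: "t \<in> {0..T}" for t
  proof (rule L2_norm_le_of_pairing_bound[OF wL2[OF t] _ c])
    fix v assume v: "v \<in> L2_space \<Omega>"
    have "AE t in ?M. L2_inner \<Omega> (w t) v - L2_inner \<Omega> (p0 t) v = 0"
    proof (rule fundamental_lemma_Icc)
      fix \<phi> :: "real \<Rightarrow> real" assume \<phi>: "\<phi> \<in> test_fun {0<..<T}"
      show "(LINT t|?M. (L2_inner \<Omega> (w t) v - L2_inner \<Omega> (p0 t) v) * \<phi> t) = 0"
        using has_time_deriv_pairing(2)[OF p0(1) \<Omega> v \<phi>] test_fun_integrable[OF \<phi> iw[OF v]]
          test_fun_integrable[OF \<phi> has_time_deriv_pairing(1)[OF p0(1) \<Omega> v]] by (simp add: left_diff_distrib)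
    qed (use iw[OF v] has_time_deriv_pairing(1)[OF p0(1) \<Omega> v] in simp)
    with AE_pairing_bound[OF Linf_time_norm_bound(2)[OF p0(2)] v c]
    have "AE t in ?M. \<bar>L2_inner \<Omega> (w t) v\<bar> \<le> c * L2_norm \<Omega> v" by eventually_elim auto
    from continuous_AE_bound[OF T wc[OF v] this t] show "\<bar>L2_inner \<Omega> (w t) v\<bar> \<le> c * L2_norm \<Omega> v" .
  qed
  have T0: "0 \<le> T" using T by simp
  have sc: "0 \<le> sqrt T * c1" using c1 T0 by simp
  note sm = L2_time_norm_bound(1)[OF p1(2) T0 c1]
  note ni = norm_path_integrable(1)[OF sm L2_time_norm_bound(2)[OF p1(2) T0 c1] sc]
  fix a b assume ab: "0 \<le> a" "a \<le> b" "b \<le> T"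
  have n0: "0 \<le> integral {a..b} (\<lambda>t. enn2real (L2_enorm \<Omega> (p1 t)))"
    by (rule Henstock_Kurzweil_Integration.integral_nonneg) (use integrable_on_lebesgue_on[OF LINT_indicator_Icc(2)[OF ni]] ab in auto)
  show "L2_norm \<Omega> (\<lambda>x. w b x - w a x) \<le> integral {a..b} (\<lambda>t. enn2real (L2_enorm \<Omega> (p1 t)))"
  proof (rule L2_norm_le_of_pairing_bound[OF _ _ n0])
    have wab: "w b \<in> L2_space \<Omega>" "w a \<in> L2_space \<Omega>" using wL2 ab by auto
    then show "(\<lambda>x. w b x - w a x) \<in> L2_space \<Omega>" by (rule L2_space_diff)
    fix v assume v: "v \<in> L2_space \<Omega>"
    have i1: "integrable ?M (\<lambda>t. L2_inner \<Omega> (p1 t) v)" by (rule has_time_deriv_pairing(1)[OF p1(1) \<Omega> v])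
    have "(LINT t|?M. L2_inner \<Omega> (w t) v * deriv \<phi> t) = - (LINT t|?M. L2_inner \<Omega> (p1 t) v * \<phi> t)" if "\<phi> \<in> test_fun {0<..<T}" for \<phi>
      using has_time_deriv_pairing(2)[OF p1(1) \<Omega> v that] by simp
    from distributional_deriv_integral[OF T iw[OF v] i1 this]
    obtain e where "AE t in ?M. L2_inner \<Omega> (w t) v = e + integral {0..t} (\<lambda>t. L2_inner \<Omega> (p1 t) v)" by blast
    from continuous_AE_eq[OF T wc[OF v] _ this]
    have eq: "L2_inner \<Omega> (w t) v = e + integral {0..t} (\<lambda>t. L2_inner \<Omega> (p1 t) v)" if "t \<in> {0..T}" for t
      using that by (simp add: continuous_on_add indefinite_integral_continuous[OF i1])
    have "L2_inner \<Omega> (\<lambda>x. w b x - w a x) v = integral {a..b} (\<lambda>t. L2_inner \<Omega> (p1 t) v)"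
      using Henstock_Kurzweil_Integration.integral_combine[OF ab(1,2), of "\<lambda>t. L2_inner \<Omega> (p1 t) v"] ab
        integrable_on_lebesgue_on[OF LINT_indicator_Icc(2)[OF i1, of 0 b]] eq[of a] eq[of b]
      by (simp add: L2_inner_diff wab v)
    then show "\<bar>L2_inner \<Omega> (\<lambda>x. w b x - w a x) v\<bar> \<le> integral {a..b} (\<lambda>t. enn2real (L2_enorm \<Omega> (p1 t))) * L2_norm \<Omega> v"
      using pairing_integral_le[OF sm ni v i1 ab(1,3)] by simp
  qed
qed

section \<open>Difference quotients of the solution\<close>

text \<open>The Bochner integral has the same \<open>L2\<close> pairings as \<open>z\<close>, hence
  equals it almost everywhere and passes on its bound in \<open>X\<close>. Identities between
  pairings thus yield estimates in the stronger norm.\<close>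

lemma (in bochner_norm) norm_le_kernel_integral:
  assumes "strongly_measurable X T g" "(\<integral>\<^sup>+t. X (g t) \<partial>lebesgue_on {0..T}) < \<infinity>"
    and "B \<in> borel_measurable (lebesgue_on {0..T})" "\<And>t. \<bar>B t\<bar> \<le> b"
    and "z \<in> L2_space \<Omega>"
    and "\<And>v. v \<in> L2_space \<Omega> \<Longrightarrow> L2_inner \<Omega> z v = (LINT t|lebesgue_on {0..T}. B t * L2_inner \<Omega> (g t) v)"
  shows "X z \<le> (\<integral>\<^sup>+t. ennreal \<bar>B t\<bar> * X (g t) \<partial>lebesgue_on {0..T})"
proof -
  obtain W where W: "X W \<le> (\<integral>\<^sup>+t. ennreal \<bar>B t\<bar> * X (g t) \<partial>lebesgue_on {0..T})" "W \<in> L2_space \<Omega>"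
    "\<forall>v\<in>L2_space \<Omega>. L2_inner \<Omega> W v = (LINT t|lebesgue_on {0..T}. B t * L2_inner \<Omega> (g t) v)"
    using bochner_integral_exists[OF assms(1-4)] by blast
  have "AE x in lebesgue_on \<Omega>. z x = W x"
    by (rule L2_AE_eqI) (use assms(5,6) W(2,3) in auto)
  then show ?thesis using norm_cong_AE W(1) by simp
qed

text \<open>The infima in the norms may be approached by different representatives, hence two
  candidates each for the second and the third derivative. Constants \<open>a\<close> bound Sobolev
  norms uniformly in time, constants \<open>b\<close> do so for \<open>L2\<close> norms, and
  constants \<open>c\<close> refer to norms that are square integrable in time.\<close>

locale regular_solution =
  fixes \<Omega> :: "pt set" and T s :: real and u ut f :: "real \<Rightarrow> sfun"
    and g0 g1 g2 h2 g3 h3 g4 :: "real \<Rightarrow> sfun" and a0 a1 b2 c2 c3 b3 c4 :: real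
  assumes open_dom: "open \<Omega>" and T: "0 < T"
    and u: "\<And>t. t \<in> {0..T} \<Longrightarrow> u t \<in> H20 \<Omega>" and ut: "time_continuous (L2_enorm \<Omega>) T ut"
    and d: "\<And>t. t \<in> {0..T} \<Longrightarrow> ((\<lambda>s. L2_enorm \<Omega> (\<lambda>x. (u s x - u t x) / (s - t) - ut t x)) \<longlongrightarrow> 0) (at t within {0..T})"
    and weak: "\<And>v t. v \<in> H20 \<Omega> \<Longrightarrow> t \<in> {0..T} \<Longrightarrow>
      \<exists>d. ((\<lambda>s. L2_inner \<Omega> (ut s) v) has_real_derivative d) (at t within {0..T}) \<and> d + a_form \<Omega> (u t) v = L2_inner \<Omega> (f t) v"
    and g0: "has_time_deriv \<Omega> T 0 u g0" "Linf_time_norm (sobolev_norm \<Omega> s) T g0 \<le> ennreal a0"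
    and g1: "has_time_deriv \<Omega> T 1 u g1" "Linf_time_norm (sobolev_norm \<Omega> s) T g1 \<le> ennreal a1"
    and g2: "has_time_deriv \<Omega> T 2 u g2" "Linf_time_norm (L2_enorm \<Omega>) T g2 \<le> ennreal b2"
    and h2: "has_time_deriv \<Omega> T 2 u h2" "L2_time_norm (sobolev_norm \<Omega> s) T h2 \<le> ennreal c2"
    and g3: "has_time_deriv \<Omega> T 3 u g3" "L2_time_norm (L2_enorm \<Omega>) T g3 \<le> ennreal c3"
    and h3: "has_time_deriv \<Omega> T 3 u h3" "Linf_time_norm (L2_enorm \<Omega>) T h3 \<le> ennreal b3"
    and g4: "has_time_deriv \<Omega> T 4 u g4" "L2_time_norm (L2_enorm \<Omega>) T g4 \<le> ennreal c4"
    and nonneg: "0 \<le> a0" "0 \<le> a1" "0 \<le> b2" "0 \<le> c2" "0 \<le> c3" "0 \<le> b3" "0 \<le> c4"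
begin

sublocale N: bochner_norm \<Omega> "L2_enorm \<Omega>" using open_dom by (intro bochner_norm_L2) auto
sublocale S: bochner_norm \<Omega> "sobolev_norm \<Omega> s" using open_dom by (rule bochner_norm_sobolev)

abbreviation "M \<equiv> lebesgue_on {0..T}"
text \<open>Scalar densities in time: changes over a subinterval are bounded by integrals of these
  functions over it, so that sums over the grid are controlled by one integral.\<close>

definition "\<nu>2 = (\<lambda>t. enn2real (sobolev_norm \<Omega> s (h2 t)))"
definition "\<nu>3 = (\<lambda>t. enn2real (L2_enorm \<Omega> (g3 t)))"
definition "\<nu>4 = (\<lambda>t. enn2real (L2_enorm \<Omega> (g4 t)))"

lemma u_L2: "t \<in> {0..T} \<Longrightarrow> u t \<in> L2_space \<Omega>"
  using u[of t] Hm_space_L2[OF _ open_dom] by (auto simp: H20_def)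

lemma T0: "0 \<le> T" using T by simp

lemma sqrtT: "0 \<le> c \<Longrightarrow> 0 \<le> sqrt T * c" using T by simp

lemma \<nu>_integrable: "integrable M \<nu>2" "integrable M \<nu>3" "integrable M \<nu>4"
  unfolding \<nu>2_def \<nu>3_def \<nu>4_def
  using S.norm_path_integrable(1)[OF S.L2_time_norm_bound[OF h2(2) T0 nonneg(4)] sqrtT[OF nonneg(4)]]
    N.norm_path_integrable(1)[OF N.L2_time_norm_bound[OF g3(2) T0 nonneg(5)] sqrtT[OF nonneg(5)]]
    N.norm_path_integrable(1)[OF N.L2_time_norm_bound[OF g4(2) T0 nonneg(7)] sqrtT[OF nonneg(7)]] by auto

lemma \<nu>_total: "integral {0..T} \<nu>2 \<le> sqrt T * c2" "integral {0..T} \<nu>3 \<le> sqrt T * c3" "integral {0..T} \<nu>4 \<le> sqrt T * c4"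
  unfolding \<nu>2_def \<nu>3_def \<nu>4_def
  using S.norm_path_integrable(2)[OF S.L2_time_norm_bound[OF h2(2) T0 nonneg(4)] sqrtT[OF nonneg(4)]]
    N.norm_path_integrable(2)[OF N.L2_time_norm_bound[OF g3(2) T0 nonneg(5)] sqrtT[OF nonneg(5)]]
    N.norm_path_integrable(2)[OF N.L2_time_norm_bound[OF g4(2) T0 nonneg(7)] sqrtT[OF nonneg(7)]] by auto

lemma \<nu>_nonneg: "0 \<le> \<nu>2 t" "0 \<le> \<nu>3 t" "0 \<le> \<nu>4 t"
  by (simp_all add: \<nu>2_def \<nu>3_def \<nu>4_def)

lemma y_deriv:
  assumes v: "v \<in> L2_space \<Omega>" and t: "t \<in> {0..T}"
  shows "((\<lambda>t. L2_inner \<Omega> (u t) v) has_real_derivative L2_inner \<Omega> (ut t) v) (at t within {0..T})"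
  by (rule L2_time_derivative_pairing[where u=u and ut=ut and t=t,
        OF u_L2 time_continuous_L2_pairing(1)[OF ut v t] v t d[OF t]])

text \<open>\<open>ut\<close> is the classical derivative and \<open>g1\<close> a representative
  from the norm; their pairings have the same integrals against test functions.\<close>

lemma first_derivative_AE:
  assumes v: "v \<in> L2_space \<Omega>"
  shows "AE t in M. L2_inner \<Omega> (g1 t) v = L2_inner \<Omega> (ut t) v"
proof -
  note c = time_continuous_L2_pairing(2)[OF ut v]
  have ig: "integrable M (\<lambda>t. L2_inner \<Omega> (g1 t) v)"
    by (rule has_time_deriv_pairing(1)[OF g1(1) N.domain_measurable v])
  have iu: "integrable M (\<lambda>t. L2_inner \<Omega> (ut t) v)" by (rule continuous_integrable_Icc[OF c])
  have "AE t in M. L2_inner \<Omega> (g1 t) v - L2_inner \<Omega> (ut t) v = 0"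
  proof (rule fundamental_lemma_Icc)
    fix \<phi> :: "real \<Rightarrow> real" assume \<phi>: "\<phi> \<in> test_fun {0<..<T}"
    show "(LINT t|M. (L2_inner \<Omega> (g1 t) v - L2_inner \<Omega> (ut t) v) * \<phi> t) = 0"
      using has_time_deriv_pairing(2)[OF g1(1) N.domain_measurable v \<phi>] C1_test_fun_by_parts[OF T c y_deriv[OF v] \<phi>]
        test_fun_integrable[OF \<phi> ig] test_fun_integrable[OF \<phi> iu] by (simp add: left_diff_distrib)
  qed (use ig iu in simp)
  then show ?thesis by simp
qed

lemma zeroth_derivative_AE:
  assumes v: "v \<in> L2_space \<Omega>"
  shows "AE t in M. L2_inner \<Omega> (g0 t) v = L2_inner \<Omega> (u t) v"
proof -
  have ig: "integrable M (\<lambda>t. L2_inner \<Omega> (g0 t) v)"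
    by (rule has_time_deriv_pairing(1)[OF g0(1) N.domain_measurable v])
  have iu: "integrable M (\<lambda>t. L2_inner \<Omega> (u t) v)"
    by (rule continuous_integrable_Icc) (use y_deriv[OF v] DERIV_continuous continuous_on_eq_continuous_within in blast)
  have "AE t in M. L2_inner \<Omega> (g0 t) v - L2_inner \<Omega> (u t) v = 0"
  proof (rule fundamental_lemma_Icc)
    fix \<phi> :: "real \<Rightarrow> real" assume \<phi>: "\<phi> \<in> test_fun {0<..<T}"
    show "(LINT t|M. (L2_inner \<Omega> (g0 t) v - L2_inner \<Omega> (u t) v) * \<phi> t) = 0"
      using has_time_deriv_pairing(2)[OF g0(1) N.domain_measurable v \<phi>]
        test_fun_integrable[OF \<phi> ig] test_fun_integrable[OF \<phi> iu] by (simp add: left_diff_distrib)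
  qed (use ig iu in simp)
  then show ?thesis by simp
qed

lemma indicator_measurable: "A \<in> sets borel \<Longrightarrow> (\<lambda>t. indicat_real A t) \<in> borel_measurable M"
  by (simp add: measurable_restrict_space1 measurable_completion)

lemma id_measurable: "(\<lambda>t. t) \<in> borel_measurable M"
  by (simp add: measurable_restrict_space1 measurable_completion)

lemma Linf_finite:
  assumes "AE t in M. X (g t) \<le> ennreal c" "bochner_norm \<Omega> X"
  shows "(\<integral>\<^sup>+t. X (g t) \<partial>M) < \<infinity>"
  by (rule order_le_less_trans[OF bochner_norm.Linf_bound_nn_integral[OF assms(2,1) T0]])
    (simp add: ennreal_mult_less_top)

text \<open>The increment is the Bochner integral of \<open>g1\<close> with an indicator kernel; the
  fundamental theorem of calculus is needed for scalar pairings only.\<close>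

lemma sobolev_first_difference:
  assumes k: "0 \<le> k" "k \<le> T"
  shows "sobolev_norm \<Omega> s (\<lambda>x. u k x - u 0 x) \<le> ennreal (k * a1)"
proof -
  note b = Linf_time_norm_bound[OF g1(2)]
  let ?B = "\<lambda>t. indicat_real {0..k} t"
  have uk: "u k \<in> L2_space \<Omega>" "u 0 \<in> L2_space \<Omega>" using u_L2 k T by auto
  have "sobolev_norm \<Omega> s (\<lambda>x. u k x - u 0 x) \<le> (\<integral>\<^sup>+t. ennreal \<bar>?B t\<bar> * sobolev_norm \<Omega> s (g1 t) \<partial>M)"
  proof (rule S.norm_le_kernel_integral[OF b(1) Linf_finite[OF b(2) S.bochner_norm_axioms], where b=1])
    show "?B \<in> borel_measurable M" by (rule indicator_measurable) simp
    show "(\<lambda>x. u k x - u 0 x) \<in> L2_space \<Omega>" by (rule L2_space_diff[OF uk])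
    fix v assume v: "v \<in> L2_space \<Omega>"
    note c = time_continuous_L2_pairing(2)[OF ut v]
    have i1: "integrable M (\<lambda>t. L2_inner \<Omega> (g1 t) v)" by (rule has_time_deriv_pairing(1)[OF g1(1) N.domain_measurable v])
    have "(LINT t|M. ?B t * L2_inner \<Omega> (g1 t) v) = integral {0..k} (\<lambda>t. L2_inner \<Omega> (g1 t) v)"
      using LINT_indicator_Icc(1)[OF i1, of 0 k] k by simp
    also have "\<dots> = integral {0..k} (\<lambda>t. L2_inner \<Omega> (ut t) v)"
      by (rule integral_cong_AE_Icc[OF first_derivative_AE[OF v] i1 continuous_integrable_Icc[OF c]]) (use k in auto)
    also have "\<dots> = L2_inner \<Omega> (u k) v - L2_inner \<Omega> (u 0) v"
      by (rule FTC_kernel[OF y_deriv[OF v]]) (use k in auto)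
    finally show "L2_inner \<Omega> (\<lambda>x. u k x - u 0 x) v = (LINT t|M. ?B t * L2_inner \<Omega> (g1 t) v)"
      by (simp add: L2_inner_diff[OF uk v])
  qed (auto simp: indicator_def)
  also have "\<dots> \<le> (\<integral>\<^sup>+t. ennreal a1 * indicator {0..k} t \<partial>M)"
    by (rule nn_integral_mono_AE, use b(2) in eventually_elim) (auto simp: indicator_def)
  also have "\<dots> = ennreal a1 * emeasure M {0..k}"
    using k by (intro nn_integral_cmult_indicator) (auto simp: sets_restrict_space_iff)
  also have "emeasure M {0..k} = ennreal k" using k by (subst emeasure_restrict_space) auto
  finally show ?thesis using k nonneg by (simp add: mult.commute flip: ennreal_mult)
qed

text \<open>Essential bounds in time ignore single instants, so the value at 0 is reconstructed from
  integrals over [0, T]: the mean of \<open>g0\<close> contributes \<open>a0\<close>, and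
  \<open>g1\<close> with a kernel bounded by T contributes T times \<open>a1\<close>.\<close>

lemma sobolev_initial: "sobolev_norm \<Omega> s (u 0) \<le> ennreal (a0 + T * a1)"
proof -
  note b0 = Linf_time_norm_bound[OF g0(2)] and b1 = Linf_time_norm_bound[OF g1(2)]
  \<comment> \<open>The mean value kernel at time 0, kept in the literal form of
    \<open>mean_value_kernel\<close>; its first part lives on a single point.\<close>
  let ?K = "\<lambda>t. indicator {0..0} t * t - indicator {0..T} t * (T - t)"
  have K: "?K \<in> borel_measurable M"
    by (intro borel_measurable_diff borel_measurable_times indicator_measurable id_measurable borel_measurable_const) auto
  have K_le: "\<bar>?K t\<bar> \<le> T" for t using T by (auto simp: indicator_def)
  note f0 = Linf_finite[OF b0(2) S.bochner_norm_axioms] and f1 = Linf_finite[OF b1(2) S.bochner_norm_axioms]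
  obtain Wa where Wa: "sobolev_norm \<Omega> s Wa \<le> (\<integral>\<^sup>+t. ennreal \<bar>1::real\<bar> * sobolev_norm \<Omega> s (g0 t) \<partial>M)" "Wa \<in> L2_space \<Omega>"
    "\<forall>v\<in>L2_space \<Omega>. L2_inner \<Omega> Wa v = (LINT t|M. 1 * L2_inner \<Omega> (g0 t) v)"
    using S.bochner_integral_exists[OF b0(1) f0, of "\<lambda>_. 1" 1] by auto
  obtain Wb where Wb: "sobolev_norm \<Omega> s Wb \<le> (\<integral>\<^sup>+t. ennreal \<bar>?K t\<bar> * sobolev_norm \<Omega> s (g1 t) \<partial>M)" "Wb \<in> L2_space \<Omega>"
    "\<forall>v\<in>L2_space \<Omega>. L2_inner \<Omega> Wb v = (LINT t|M. ?K t * L2_inner \<Omega> (g1 t) v)"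
    using S.bochner_integral_exists[OF b1(1) f1 K K_le] by blast
  let ?W = "\<lambda>x. (1 / T) * (Wa x + Wb x)"
  have u0: "u 0 \<in> L2_space \<Omega>" using u_L2 T by simp
  have "AE x in lebesgue_on \<Omega>. u 0 x = ?W x"
  proof (rule L2_AE_eqI[OF u0])
    show "?W \<in> L2_space \<Omega>" using Wa(2) Wb(2) by (intro L2_space_cmult L2_space_add)
    fix v assume v: "v \<in> L2_space \<Omega>"
    note c = time_continuous_L2_pairing(2)[OF ut v]
    have cy: "continuous_on {0..T} (\<lambda>t. L2_inner \<Omega> (u t) v)"
      using y_deriv[OF v] DERIV_continuous continuous_on_eq_continuous_within by blast
    have [measurable]: "(\<lambda>t. L2_inner \<Omega> (g0 t) v) \<in> borel_measurable M" "(\<lambda>t. L2_inner \<Omega> (u t) v) \<in> borel_measurable M"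
      using has_time_deriv_pairing(1)[OF g0(1) N.domain_measurable v] continuous_integrable_Icc[OF cy] by auto
    have "L2_inner \<Omega> Wa v = (LINT t|M. L2_inner \<Omega> (u t) v)"
      using Wa(3) v zeroth_derivative_AE[OF v] by (auto intro!: integral_cong_AE)
    moreover have "L2_inner \<Omega> Wb v = (LINT t|M. ?K t * L2_inner \<Omega> (ut t) v)"
      unfolding bspec[OF Wb(3) v]
    proof (rule integral_cong_AE)
      show "(\<lambda>t. ?K t * L2_inner \<Omega> (g1 t) v) \<in> borel_measurable M"
        by (rule borel_measurable_times[OF K borel_measurable_integrable[OF has_time_deriv_pairing(1)[OF g1(1) N.domain_measurable v]]])
      show "(\<lambda>t. ?K t * L2_inner \<Omega> (ut t) v) \<in> borel_measurable M"
        by (rule borel_measurable_times[OF K borel_measurable_integrable[OF continuous_integrable_Icc[OF c]]])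
      show "AE t in M. ?K t * L2_inner \<Omega> (g1 t) v = ?K t * L2_inner \<Omega> (ut t) v"
        using first_derivative_AE[OF v] by eventually_elim simp
    qed
    ultimately have "T * L2_inner \<Omega> (u 0) v = L2_inner \<Omega> Wa v + L2_inner \<Omega> Wb v"
      using mean_value_kernel[OF y_deriv[OF v] c, of 0] T by simp
    then show "L2_inner \<Omega> (u 0) v = L2_inner \<Omega> ?W v"
      using T by (simp add: L2_inner_cmult L2_inner_add Wa(2) Wb(2) v L2_inner_divide field_simps)
  qed
  then have "sobolev_norm \<Omega> s (u 0) = ennreal (1 / T) * sobolev_norm \<Omega> s (\<lambda>x. Wa x + Wb x)"
    using T by (simp add: S.norm_cong_AE S.norm_cmult[of "1 / T" "\<lambda>x. Wa x + Wb x", simplified])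
  also have "\<dots> \<le> ennreal (1 / T) * (ennreal (a0 * T) + ennreal (T * (a1 * T)))"
  proof (intro mult_left_mono order_trans[OF S.norm_add] add_mono)
    show "sobolev_norm \<Omega> s Wa \<le> ennreal (a0 * T)"
      using order_trans[OF Wa(1)] S.Linf_bound_nn_integral[OF b0(2) T0] nonneg T by (simp add: ennreal_mult)
    have "(\<integral>\<^sup>+t. ennreal \<bar>?K t\<bar> * sobolev_norm \<Omega> s (g1 t) \<partial>M) \<le> (\<integral>\<^sup>+t. ennreal T * ennreal a1 \<partial>M)"
      by (rule nn_integral_mono_AE, use b1(2) in eventually_elim) (intro mult_mono ennreal_leI K_le, auto)
    also have "\<dots> = ennreal (T * (a1 * T))"
      using emeasure_lebesgue_on_Icc[OF T0] T nonneg by (simp add: ennreal_mult mult.assoc)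
    finally show "sobolev_norm \<Omega> s Wb \<le> ennreal (T * (a1 * T))" using Wb(1) by (rule order_trans[rotated])
  qed simp
  also have "\<dots> = ennreal ((1 / T) * (a0 * T + T * (a1 * T)))"
    using T nonneg by (subst ennreal_plus[symmetric]; (subst ennreal_mult[symmetric])?; simp)
  also have "(1 / T) * (a0 * T + T * (a1 * T)) = a0 + T * a1" using T by (simp add: field_simps)
  finally show ?thesis .
qed

text \<open>\<open>W\<close> represents u_tt at every time and not only at almost every one; only so
  can the equation be used at the grid points. The second difference is bounded in the Sobolev norm
  for the Ritz error and in \<open>L2\<close> pairings for the truncation error.\<close>

lemma second_derivative:
  obtains W where "\<And>t. t \<in> {0..T} \<Longrightarrow> W t \<in> L2_space \<Omega>"
    "\<And>w t. w \<in> H20 \<Omega> \<Longrightarrow> t \<in> {0..T} \<Longrightarrow> L2_inner \<Omega> (W t) w + a_form \<Omega> (u t) w = L2_inner \<Omega> (f t) w"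
    "\<And>t. t \<in> {0..T} \<Longrightarrow> L2_norm \<Omega> (W t) \<le> b2"
    "\<And>a b. 0 \<le> a \<Longrightarrow> a \<le> b \<Longrightarrow> b \<le> T \<Longrightarrow> L2_norm \<Omega> (\<lambda>x. W b x - W a x) \<le> integral {a..b} \<nu>3"
    "\<And>t k. 0 \<le> k \<Longrightarrow> k \<le> t \<Longrightarrow> t + k \<le> T \<Longrightarrow>
      sobolev_norm \<Omega> s (\<lambda>x. u (t + k) x - 2 * u t x + u (t - k) x) \<le> ennreal (2 * k * integral {t-k..t+k} \<nu>2)"
    "\<And>v t k. v \<in> L2_space \<Omega> \<Longrightarrow> 0 \<le> k \<Longrightarrow> k \<le> t \<Longrightarrow> t + k \<le> T \<Longrightarrow>
      \<bar>L2_inner \<Omega> (u (t + k)) v - 2 * L2_inner \<Omega> (u t) v + L2_inner \<Omega> (u (t - k)) v - k\<^sup>2 * L2_inner \<Omega> (W t) v\<bar>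
        \<le> k ^ 3 * (integral {t-k..t+k} \<nu>4 * L2_norm \<Omega> v)"
    "\<And>v k. v \<in> L2_space \<Omega> \<Longrightarrow> 0 \<le> k \<Longrightarrow> k \<le> T \<Longrightarrow>
      \<bar>2 * (L2_inner \<Omega> (u k) v - L2_inner \<Omega> (u 0) v - k * L2_inner \<Omega> (ut 0) v)
        - k\<^sup>2 * ((L2_inner \<Omega> (W 0) v + L2_inner \<Omega> (W k) v) / 2)\<bar> \<le> 2 * k ^ 3 * (b3 * L2_norm \<Omega> v)"
proof -
  obtain W where WL2: "\<And>t. t \<in> {0..T} \<Longrightarrow> W t \<in> L2_space \<Omega>"
    and Wex: "\<And>v. v \<in> L2_space \<Omega> \<Longrightarrow> \<exists>Y3. continuous_on {0..T} Y3 \<and> continuous_on {0..T} (\<lambda>t. L2_inner \<Omega> (W t) v) \<and>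
      (\<forall>t\<in>{0..T}. ((\<lambda>t. L2_inner \<Omega> (u t) v) has_real_derivative L2_inner \<Omega> (ut t) v) (at t within {0..T})) \<and>
      (\<forall>t\<in>{0..T}. ((\<lambda>t. L2_inner \<Omega> (ut t) v) has_real_derivative L2_inner \<Omega> (W t) v) (at t within {0..T})) \<and>
      (\<forall>t\<in>{0..T}. ((\<lambda>t. L2_inner \<Omega> (W t) v) has_real_derivative Y3 t) (at t within {0..T})) \<and>
      (AE t in M. L2_inner \<Omega> (g2 t) v = L2_inner \<Omega> (W t) v) \<and>
      (AE t in M. L2_inner \<Omega> (g3 t) v = Y3 t) \<and>
      (\<forall>a b. 0 \<le> a \<and> a \<le> b \<and> b \<le> T \<longrightarrow> Y3 b - Y3 a = integral {a..b} (\<lambda>t. L2_inner \<Omega> (g4 t) v))"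
    using second_time_derivative_representative[OF N.domain_measurable T u_L2 ut d g2(1) g3(1) g4(1)] by blast
  have on: "F integrable_on {a..b}" if "integrable M F" "0 \<le> a" "b \<le> T" for F :: "real \<Rightarrow> real" and a b
    by (rule integrable_on_lebesgue_on[OF LINT_indicator_Icc(2)[OF that]]) auto
  have dy1: "((\<lambda>t. L2_inner \<Omega> (ut t) v) has_real_derivative L2_inner \<Omega> (W t) v) (at t within {0..T})"
    if "v \<in> L2_space \<Omega>" "t \<in> {0..T}" for v t using Wex[OF that(1)] that(2) by blast
  have cW: "continuous_on {0..T} (\<lambda>t. L2_inner \<Omega> (W t) v)" if "v \<in> L2_space \<Omega>" for v using Wex[OF that] by blast
  have aW: "AE t in M. L2_inner \<Omega> (g2 t) v = L2_inner \<Omega> (W t) v" if "v \<in> L2_space \<Omega>" for v using Wex[OF that] by blast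
  show thesis
  proof (rule that[of W])
    show "W t \<in> L2_space \<Omega>" if "t \<in> {0..T}" for t by (rule WL2[OF that])
    show "L2_inner \<Omega> (W t) w + a_form \<Omega> (u t) w = L2_inner \<Omega> (f t) w" if w: "w \<in> H20 \<Omega>" and t: "t \<in> {0..T}" for w t
    proof -
      have wL2: "w \<in> L2_space \<Omega>" using w Hm_space_L2[OF _ open_dom] by (auto simp: H20_def)
      obtain e where e: "((\<lambda>s. L2_inner \<Omega> (ut s) w) has_real_derivative e) (at t within {0..T})"
        "e + a_form \<Omega> (u t) w = L2_inner \<Omega> (f t) w" using weak[OF w t] by blast
      \<comment> \<open>A derivative within a nondegenerate interval is unique, endpoints included,
        so the time derivative in the weak equation is the pairing with \<open>W\<close>.\<close>
      have "e = L2_inner \<Omega> (W t) w"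
        using vector_derivative_unique_within_closed_interval[of 0 T t] T t e(1) dy1[OF wL2 t]
        by (simp add: has_real_derivative_iff_has_vector_derivative box_real)
      then show ?thesis using e(2) by simp
    qed
    show "L2_norm \<Omega> (W t) \<le> b2" if t: "t \<in> {0..T}" for t
    proof (rule L2_norm_le_of_pairing_bound[OF WL2[OF t] _ nonneg(3)])
      fix v assume v: "v \<in> L2_space \<Omega>"
      have "AE t in M. \<bar>L2_inner \<Omega> (W t) v\<bar> \<le> b2 * L2_norm \<Omega> v"
        using AE_pairing_bound[OF Linf_time_norm_bound(2)[OF g2(2)] v nonneg(3)] aW[OF v] by eventually_elim simp
      from continuous_AE_bound[OF T cW[OF v] this t] show "\<bar>L2_inner \<Omega> (W t) v\<bar> \<le> b2 * L2_norm \<Omega> v" .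
    qed
    show "L2_norm \<Omega> (\<lambda>x. W b x - W a x) \<le> integral {a..b} \<nu>3" if ab: "0 \<le> a" "a \<le> b" "b \<le> T" for a b
    proof (rule L2_norm_le_of_pairing_bound)
      have Wab: "W b \<in> L2_space \<Omega>" "W a \<in> L2_space \<Omega>" using WL2 ab by auto
      then show "(\<lambda>x. W b x - W a x) \<in> L2_space \<Omega>" by (rule L2_space_diff)
      show "0 \<le> integral {a..b} \<nu>3"
        using on[OF \<nu>_integrable(2)] ab by (intro Henstock_Kurzweil_Integration.integral_nonneg) (auto simp: \<nu>_nonneg)
      fix v assume v: "v \<in> L2_space \<Omega>"
      obtain Y3 where Y3: "continuous_on {0..T} Y3" "\<And>t. t \<in> {0..T} \<Longrightarrow> ((\<lambda>t. L2_inner \<Omega> (W t) v) has_real_derivative Y3 t) (at t within {0..T})"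
        "AE t in M. L2_inner \<Omega> (g3 t) v = Y3 t" using Wex[OF v] by blast
      have i3: "integrable M (\<lambda>t. L2_inner \<Omega> (g3 t) v)" by (rule has_time_deriv_pairing(1)[OF g3(1) N.domain_measurable v])
      have "L2_inner \<Omega> (\<lambda>x. W b x - W a x) v = integral {a..b} Y3"
        using FTC_kernel[OF Y3(2) ab] by (simp add: L2_inner_diff[OF Wab v])
      also have "\<dots> = integral {a..b} (\<lambda>t. L2_inner \<Omega> (g3 t) v)"
        by (rule integral_cong_AE_Icc[OF Y3(3) i3 continuous_integrable_Icc[OF Y3(1)] ab(1,3), symmetric])
      finally show "\<bar>L2_inner \<Omega> (\<lambda>x. W b x - W a x) v\<bar> \<le> integral {a..b} \<nu>3 * L2_norm \<Omega> v"
        using N.pairing_integral_le[OF N.L2_time_norm_bound(1)[OF g3(2) T0 nonneg(5)] \<nu>_integrable(2)[unfolded \<nu>3_def] v i3 ab(1,3)]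
        by (simp add: \<nu>3_def)
    qed
    show "sobolev_norm \<Omega> s (\<lambda>x. u (t + k) x - 2 * u t x + u (t - k) x) \<le> ennreal (2 * k * integral {t-k..t+k} \<nu>2)"
      if k: "0 \<le> k" "k \<le> t" "t + k \<le> T" for t k
    proof -
      let ?B = "\<lambda>s. indicator {t-k..t} s * (s - (t - k)) + indicator {t..t+k} s * (t + k - s)"
      have Bm: "?B \<in> borel_measurable M"
        by (intro borel_measurable_add borel_measurable_times borel_measurable_diff indicator_measurable id_measurable borel_measurable_const) auto
      \<comment> \<open>At the centre both halves of the hat are active, hence the bound 2 k where k
        holds elsewhere.\<close>
      have Bb: "\<bar>?B r\<bar> \<le> 2 * k * indicator {t-k..t+k} r" for r using k by (auto simp: indicator_def)
      have Bb': "\<bar>?B r\<bar> \<le> 2 * k" for r using Bb[of r] k by (auto simp: indicator_def split: if_splits)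
      note sm = S.L2_time_norm_bound[OF h2(2) T0 nonneg(4)]
      have fin: "(\<integral>\<^sup>+t. sobolev_norm \<Omega> s (h2 t) \<partial>M) < \<infinity>" by (rule order_le_less_trans[OF sm(2)]) simp
      have u3: "u (t + k) \<in> L2_space \<Omega>" "u t \<in> L2_space \<Omega>" "u (t - k) \<in> L2_space \<Omega>" using u_L2 k by auto
      have "sobolev_norm \<Omega> s (\<lambda>x. u (t + k) x - 2 * u t x + u (t - k) x) \<le> (\<integral>\<^sup>+r. ennreal \<bar>?B r\<bar> * sobolev_norm \<Omega> s (h2 r) \<partial>M)"
      proof (rule S.norm_le_kernel_integral[OF sm(1) fin Bm Bb'])
        show "(\<lambda>x. u (t + k) x - 2 * u t x + u (t - k) x) \<in> L2_space \<Omega>" using u3 by (intro L2_space_add L2_space_diff L2_space_cmult)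
        fix v assume v: "v \<in> L2_space \<Omega>"
        have "L2_inner \<Omega> (\<lambda>x. u (t + k) x - 2 * u t x + u (t - k) x) v = L2_inner \<Omega> (u (t + k)) v - 2 * L2_inner \<Omega> (u t) v + L2_inner \<Omega> (u (t - k)) v"
          using u3 v by (simp add: L2_inner_add L2_inner_diff L2_inner_cmult L2_space_intros)
        also have "\<dots> = (LINT r|M. ?B r * L2_inner \<Omega> (W r) v)"
          by (rule second_difference_kernel[OF y_deriv[OF v] dy1[OF v] cW[OF v] k])
        \<comment> \<open>\<open>g2\<close> and \<open>h2\<close> represent the same distributional
          derivative, so the Sobolev bound on \<open>h2\<close> becomes available for a kernel
          formula derived from \<open>W\<close>.\<close>
        also have "\<dots> = (LINT r|M. ?B r * L2_inner \<Omega> (h2 r) v)"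
        proof (rule integral_cong_AE)
          show "(\<lambda>r. ?B r * L2_inner \<Omega> (W r) v) \<in> borel_measurable M"
            by (rule borel_measurable_times[OF Bm borel_measurable_integrable[OF continuous_integrable_Icc[OF cW[OF v]]]])
          show "(\<lambda>r. ?B r * L2_inner \<Omega> (h2 r) v) \<in> borel_measurable M"
            by (rule borel_measurable_times[OF Bm borel_measurable_integrable[OF has_time_deriv_pairing(1)[OF h2(1) N.domain_measurable v]]])
          show "AE r in M. ?B r * L2_inner \<Omega> (W r) v = ?B r * L2_inner \<Omega> (h2 r) v"
            using aW[OF v] has_time_deriv_unique[OF g2(1) h2(1) N.domain_measurable v] by eventually_elim simp
        qed
        finally show "L2_inner \<Omega> (\<lambda>x. u (t + k) x - 2 * u t x + u (t - k) x) v = (LINT r|M. ?B r * L2_inner \<Omega> (h2 r) v)" .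
      qed
      also have "\<dots> \<le> ennreal (2 * k * integral {t-k..t+k} \<nu>2)"
        unfolding \<nu>2_def by (rule S.indicator_kernel_nn_integral_le[OF sm(1) \<nu>_integrable(1)[unfolded \<nu>2_def] Bb]) (use k in auto)
      finally show ?thesis .
    qed
    show "\<bar>L2_inner \<Omega> (u (t + k)) v - 2 * L2_inner \<Omega> (u t) v + L2_inner \<Omega> (u (t - k)) v - k\<^sup>2 * L2_inner \<Omega> (W t) v\<bar>
        \<le> k ^ 3 * (integral {t-k..t+k} \<nu>4 * L2_norm \<Omega> v)"
      if v: "v \<in> L2_space \<Omega>" and k: "0 \<le> k" "k \<le> t" "t + k \<le> T" for v t k
    proof -
      obtain Y3 where Y3: "\<And>t. t \<in> {0..T} \<Longrightarrow> ((\<lambda>t. L2_inner \<Omega> (W t) v) has_real_derivative Y3 t) (at t within {0..T})"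
        "\<And>a b. 0 \<le> a \<Longrightarrow> a \<le> b \<Longrightarrow> b \<le> T \<Longrightarrow> Y3 b - Y3 a = integral {a..b} (\<lambda>t. L2_inner \<Omega> (g4 t) v)" using Wex[OF v] by blast
      have i4: "integrable M (\<lambda>t. L2_inner \<Omega> (g4 t) v)" by (rule has_time_deriv_pairing(1)[OF g4(1) N.domain_measurable v])
      show ?thesis
      proof (rule second_difference_error[OF y_deriv[OF v] dy1[OF v] Y3(1) k])
        fix r assume r: "r \<in> {0..k}"
        have "\<bar>Y3 (t + r) - Y3 (t - r)\<bar> = \<bar>integral {t-r..t+r} (\<lambda>t. L2_inner \<Omega> (g4 t) v)\<bar>"
          using Y3(2)[of "t - r" "t + r"] r k by simp
        also have "\<dots> \<le> integral {t-r..t+r} \<nu>4 * L2_norm \<Omega> v"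
          unfolding \<nu>4_def
          by (rule N.pairing_integral_le[OF N.L2_time_norm_bound(1)[OF g4(2) T0 nonneg(7)] \<nu>_integrable(3)[unfolded \<nu>4_def] v i4]) (use r k in auto)
        also have "integral {t-r..t+r} \<nu>4 \<le> integral {t-k..t+k} \<nu>4"
          using r k on[OF \<nu>_integrable(3)] by (intro integral_subset_le) (auto simp: \<nu>_nonneg)
        finally show "\<bar>Y3 (t + r) - Y3 (t - r)\<bar> \<le> integral {t-k..t+k} \<nu>4 * L2_norm \<Omega> v" by (simp add: mult_right_mono)
      qed
    qed
    show "\<bar>2 * (L2_inner \<Omega> (u k) v - L2_inner \<Omega> (u 0) v - k * L2_inner \<Omega> (ut 0) v)
        - k\<^sup>2 * ((L2_inner \<Omega> (W 0) v + L2_inner \<Omega> (W k) v) / 2)\<bar> \<le> 2 * k ^ 3 * (b3 * L2_norm \<Omega> v)"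
      if v: "v \<in> L2_space \<Omega>" and k: "0 \<le> k" "k \<le> T" for v k
    proof -
      obtain Y3 where Y3: "continuous_on {0..T} Y3" "\<And>t. t \<in> {0..T} \<Longrightarrow> ((\<lambda>t. L2_inner \<Omega> (W t) v) has_real_derivative Y3 t) (at t within {0..T})"
        "AE t in M. L2_inner \<Omega> (g3 t) v = Y3 t" using Wex[OF v] by blast
      \<comment> \<open>The bound on \<open>h3\<close> holds almost everywhere and extends to every
        time because \<open>Y3\<close> is continuous.\<close>
      have "AE t in M. \<bar>Y3 t\<bar> \<le> b3 * L2_norm \<Omega> v"
        using AE_pairing_bound[OF Linf_time_norm_bound(2)[OF h3(2)] v nonneg(6)] Y3(3)
          has_time_deriv_unique[OF g3(1) h3(1) N.domain_measurable v] by eventually_elim simp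
      then have "\<bar>Y3 t\<bar> \<le> b3 * L2_norm \<Omega> v" if "t \<in> {0..T}" for t by (rule continuous_AE_bound[OF T Y3(1) _ that])
      from first_step_error[OF y_deriv[OF v] dy1[OF v] Y3(2) k this] show ?thesis .
    qed
  qed
qed

end

section \<open>Discrete spaces and forms\<close>

text \<open>A 2-simplex is spanned by three points and so has positive diameter; the triangles lie
  in the closure of \<Omega>, which bounds the mesh size.\<close>

lemma triangulation_mesh:
  assumes \<Omega>: "bounded \<Omega>" "\<Omega> \<noteq> {}" and \<T>: "triangulation_of \<Omega> \<T>"
  shows "finite \<T>" and "0 < mesh_size \<T>" and "mesh_size \<T> \<le> diameter \<Omega>"
    and "\<And>K. K \<in> \<T> \<Longrightarrow> convex K \<and> compact K"
proof -
  show fin: "finite \<T>" using \<T> by (simp add: triangulation_of_def triangulation_def)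
  have ne: "\<T> \<noteq> {}" using \<T> \<Omega>(2) closure_eq_empty[of \<Omega>] unfolding triangulation_of_def by (metis Union_empty)
  have K: "convex K \<and> compact K \<and> 0 < diameter K" if "K \<in> \<T>" for K
  proof -
    have "2 simplex K" using \<T> that by (simp add: triangulation_of_def)
    then obtain C where C: "int (card C) = 2 + 1" "K = convex hull C"
      unfolding simplex_def by (elim exE conjE)
    then have fC: "finite C" using card.infinite by fastforce
    then have cK: "compact K" using C(2) by (simp add: compact_convex_hull finite_imp_compact)
    have "card C > 1" using C(1) by simp
    then obtain x y where xy: "x \<in> C" "y \<in> C" "x \<noteq> y"
      using card_le_Suc0_iff_eq[OF fC] by (auto simp: not_le[symmetric])
    have "dist x y \<le> diameter K"
      using diameter_bounded_bound[OF compact_imp_bounded[OF cK], of x y] xy C(2) hull_subset[of C convex] by auto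
    moreover have "0 < dist x y" using xy(3) by simp
    ultimately have "0 < diameter K" by linarith
    then show ?thesis using cK C(2) by auto
  qed
  then show "convex K \<and> compact K" if "K \<in> \<T>" for K using that by blast
  have le: "diameter K \<le> diameter \<Omega>" if "K \<in> \<T>" for K
  proof -
    have "K \<subseteq> closure \<Omega>" using \<T> that by (auto simp: triangulation_of_def)
    then show ?thesis using diameter_subset[of K "closure \<Omega>"] \<Omega>(1) by (simp add: diameter_closure bounded_closure)
  qed
  have "mesh_size \<T> \<in> diameter ` \<T>" unfolding mesh_size_def by (rule Max_in) (use fin ne in auto)
  then obtain K0 where "K0 \<in> \<T>" "mesh_size \<T> = diameter K0" by blast
  then show "0 < mesh_size \<T>" "mesh_size \<T> \<le> diameter \<Omega>" using K[of K0] le[of K0] by auto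
qed

text \<open>The interiors of the triangles cover \<Omega> up to the frontiers of finitely many
  convex sets, which are null sets.\<close>

lemma L2_enorm_le_pieces:
  assumes \<Omega>: "bounded \<Omega>" "\<Omega> \<noteq> {}" "open \<Omega>" and \<T>: "triangulation_of \<Omega> \<T>"
    and w: "\<And>K. K \<in> \<T> \<Longrightarrow> w \<in> L2_space (interior K)"
  shows "(L2_enorm \<Omega> w)\<^sup>2 \<le> (\<Sum>K\<in>\<T>. (L2_enorm (interior K) w)\<^sup>2)"
proof -
  note tri = triangulation_mesh[OF \<Omega>(1,2) \<T>]
  let ?S = "\<Union>(interior ` \<T>)"
  have oS: "open ?S" by auto
  have "AE x in lebesgue. \<forall>K\<in>\<T>. x \<notin> frontier K"
  proof (subst AE_ball_countable[OF countable_finite[OF tri(1)]], intro ballI)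
    fix K assume "K \<in> \<T>"
    then have "negligible (frontier K)" using tri(4) negligible_convex_frontier by blast
    then show "AE x in lebesgue. x \<notin> frontier K" unfolding negligible_iff_null_sets by (rule AE_not_in)
  qed
  then have ae: "AE x in lebesgue. x \<in> \<Omega> \<longrightarrow> x \<in> ?S"
  proof eventually_elim
    case (elim x)
    show ?case
    proof
      assume "x \<in> \<Omega>"
      then have "x \<in> \<Union>\<T>" using \<T> closure_subset[of \<Omega>] by (auto simp: triangulation_of_def)
      then obtain K where K: "K \<in> \<T>" "x \<in> K" by blast
      then have "x \<in> interior K" using elim tri(4)[OF K(1)] by (auto simp: frontier_def compact_imp_closed)
      then show "x \<in> ?S" using K(1) by blast
    qed
  qed
  \<comment> \<open>Measurability of \<open>w\<close> is known only on each open triangle; the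
    version set to 0 outside of them is measurable on the whole plane.\<close>
  define w0 where "w0 x = (if x \<in> ?S then w x else 0)" for x
  have wm: "w \<in> borel_measurable (lebesgue_on (interior K))" if "K \<in> \<T>" for K using w[OF that] by (simp add: L2_space_def)
  have w0[measurable]: "w0 \<in> borel_measurable lebesgue"
  proof (rule measurable_piecewise_restrict[where C="insert (- ?S) (interior ` \<T>)"])
    show "countable (insert (- ?S) (interior ` \<T>))" using tri(1) by (simp add: countable_finite)
    show "C \<inter> space lebesgue \<in> sets lebesgue" if "C \<in> insert (- ?S) (interior ` \<T>)" for C
    proof -
      have "C \<in> sets borel" using that oS by (auto intro: borel_closed borel_open simp del: Compl_UN)
      then show ?thesis by simp
    qed
    show "w0 \<in> borel_measurable (lebesgue_on C)" if C: "C \<in> insert (- ?S) (interior ` \<T>)" for C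
    proof (cases "C = - ?S")
      case True
      have "w0 \<in> borel_measurable (lebesgue_on C) \<longleftrightarrow> (\<lambda>x. 0::real) \<in> borel_measurable (lebesgue_on C)"
        by (rule measurable_cong) (auto simp: True w0_def)
      then show ?thesis by simp
    next
      case False
      then obtain K where K: "K \<in> \<T>" "C = interior K" using C by blast
      have "w0 \<in> borel_measurable (lebesgue_on C) \<longleftrightarrow> w \<in> borel_measurable (lebesgue_on C)"
        by (rule measurable_cong) (use K in \<open>auto simp: w0_def\<close>)
      then show ?thesis using wm K by simp
    qed
  qed auto
  have \<Omega>l: "\<Omega> \<in> sets lebesgue" using \<Omega>(3) by auto
  have [measurable]: "interior K \<in> sets lebesgue" for K :: "pt set" by auto
  have "AE x in lebesgue_on \<Omega>. w0 x = w x"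
    using ae \<Omega>l by (auto simp: AE_restrict_space_iff w0_def elim!: eventually_mono)
  then have "w \<in> borel_measurable (lebesgue_on \<Omega>)"
    by (rule borel_measurable_lebesgue_on_AE[OF _ \<Omega>l]) (simp add: measurable_restrict_space1)
  then have "(L2_enorm \<Omega> w)\<^sup>2 = (\<integral>\<^sup>+x. (ennreal \<bar>w x\<bar>)\<^sup>2 * indicator \<Omega> x \<partial>lebesgue)"
    using \<Omega>l by (simp add: L2_enorm_eq nn_integral_restrict_space)
  also have "\<dots> \<le> (\<integral>\<^sup>+x. (\<Sum>K\<in>\<T>. (ennreal \<bar>w0 x\<bar>)\<^sup>2 * indicator (interior K) x) \<partial>lebesgue)"
  proof (rule nn_integral_mono_AE, use ae in eventually_elim)
    case (elim x)
    show ?case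
    proof (cases "x \<in> \<Omega>")
      case True
      then obtain K where K: "K \<in> \<T>" "x \<in> interior K" using elim by blast
      have "(ennreal \<bar>w x\<bar>)\<^sup>2 * indicator \<Omega> x = (ennreal \<bar>w0 x\<bar>)\<^sup>2 * indicator (interior K) x"
        using True K by (auto simp: w0_def)
      also have "\<dots> \<le> (\<Sum>K\<in>\<T>. (ennreal \<bar>w0 x\<bar>)\<^sup>2 * indicator (interior K) x)"
        by (rule member_le_sum[OF K(1)]) (use tri(1) in auto)
      finally show ?thesis .
    qed simp
  qed
  also have "\<dots> = (\<Sum>K\<in>\<T>. \<integral>\<^sup>+x. (ennreal \<bar>w0 x\<bar>)\<^sup>2 * indicator (interior K) x \<partial>lebesgue)"
    by (rule nn_integral_sum) measurable
  also have "\<dots> = (\<Sum>K\<in>\<T>. (L2_enorm (interior K) w)\<^sup>2)"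
  proof (rule sum.cong[OF refl])
    fix K assume K: "K \<in> \<T>"
    have "(\<integral>\<^sup>+x. (ennreal \<bar>w0 x\<bar>)\<^sup>2 * indicator (interior K) x \<partial>lebesgue) = (\<integral>\<^sup>+x. (ennreal \<bar>w x\<bar>)\<^sup>2 * indicator (interior K) x \<partial>lebesgue)"
      by (rule nn_integral_cong) (use K in \<open>auto simp: w0_def indicator_def\<close>)
    then show "(\<integral>\<^sup>+x. (ennreal \<bar>w0 x\<bar>)\<^sup>2 * indicator (interior K) x \<partial>lebesgue) = (L2_enorm (interior K) w)\<^sup>2"
      using wm[OF K] by (simp add: L2_enorm_eq nn_integral_restrict_space)
  qed
  finally show ?thesis .
qed

lemma broken_L2:
  assumes "bounded \<Omega>" "\<Omega> \<noteq> {}" "open \<Omega>" "triangulation_of \<Omega> \<T>"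
    and "\<And>K. K \<in> \<T> \<Longrightarrow> w \<in> L2_space (interior K)"
  shows "w \<in> L2_space \<Omega>"
proof -
  have "(\<Sum>K\<in>\<T>. (L2_enorm (interior K) w)\<^sup>2) < \<infinity>"
    using triangulation_mesh(1)[OF assms(1,2,4)] assms(5)
    by (auto simp: L2_enorm_eq_norm ennreal_power less_top[symmetric])
  then have "(L2_enorm \<Omega> w)\<^sup>2 < \<infinity>" using L2_enorm_le_pieces[OF assms] by (rule order_le_less_trans[rotated])
  then show ?thesis unfolding L2_enorm_finite_iff[symmetric] by (auto simp: power2_eq_square ennreal_mult_less_top)
qed

lemma h_norm_nonneg: "0 \<le> h_norm \<T> v"
  unfolding h_norm_def by (intro real_sqrt_ge_zero add_nonneg_nonneg sum_nonneg) auto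

section \<open>The space \<open>H20\<close> and the form \<open>a_form\<close>\<close>

lemma zero_H20: "open \<Omega> \<Longrightarrow> (\<lambda>x. 0) \<in> H20 \<Omega>"
  unfolding H20_def
  by (intro CollectI conjI zero_Hm_space exI[of _ "\<lambda>j x. 0"]) (auto simp: zero_test_fun sobolev_norm_zero)

lemma H20_linear:
  assumes "v \<in> H20 \<Omega>" "w \<in> H20 \<Omega>" "open \<Omega>"
  shows "(\<lambda>x. a * v x + b * w x) \<in> H20 \<Omega>"
proof -
  interpret bochner_norm \<Omega> "sobolev_norm \<Omega> 2" by (rule bochner_norm_sobolev[OF assms(3)])
  obtain p where p: "\<And>j::nat. p j \<in> test_fun \<Omega>" "(\<lambda>j. sobolev_norm \<Omega> 2 (\<lambda>x. v x - p j x)) \<longlonglongrightarrow> 0"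
    using assms(1) by (auto simp: H20_def)
  obtain q where q: "\<And>j::nat. q j \<in> test_fun \<Omega>" "(\<lambda>j. sobolev_norm \<Omega> 2 (\<lambda>x. w x - q j x)) \<longlonglongrightarrow> 0"
    using assms(2) by (auto simp: H20_def)
  let ?r = "\<lambda>j x. a * p j x + b * q j x"
  have "(\<lambda>j. sobolev_norm \<Omega> 2 (\<lambda>x. (a * v x + b * w x) - ?r j x)) \<longlonglongrightarrow> 0"
  proof (rule tendsto_sandwich[OF _ _ tendsto_const])
    have "sobolev_norm \<Omega> 2 (\<lambda>x. (a * v x + b * w x) - ?r j x)
        \<le> ennreal \<bar>a\<bar> * sobolev_norm \<Omega> 2 (\<lambda>x. v x - p j x) + ennreal \<bar>b\<bar> * sobolev_norm \<Omega> 2 (\<lambda>x. w x - q j x)" for j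
      using norm_add[of "\<lambda>x. a * (v x - p j x)" "\<lambda>x. b * (w x - q j x)"] norm_cmult[of a "\<lambda>x. v x - p j x"] norm_cmult[of b "\<lambda>x. w x - q j x"]
      by (simp add: algebra_simps)
    then show "\<forall>\<^sub>F j in sequentially. sobolev_norm \<Omega> 2 (\<lambda>x. (a * v x + b * w x) - ?r j x)
        \<le> ennreal \<bar>a\<bar> * sobolev_norm \<Omega> 2 (\<lambda>x. v x - p j x) + ennreal \<bar>b\<bar> * sobolev_norm \<Omega> 2 (\<lambda>x. w x - q j x)"
      by (intro always_eventually allI)
    have "(\<lambda>j. ennreal \<bar>a\<bar> * sobolev_norm \<Omega> 2 (\<lambda>x. v x - p j x) + ennreal \<bar>b\<bar> * sobolev_norm \<Omega> 2 (\<lambda>x. w x - q j x))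
        \<longlonglongrightarrow> ennreal \<bar>a\<bar> * 0 + ennreal \<bar>b\<bar> * 0"
      by (intro tendsto_add ennreal_tendsto_cmult p q) auto
    then show "(\<lambda>j. ennreal \<bar>a\<bar> * sobolev_norm \<Omega> 2 (\<lambda>x. v x - p j x) + ennreal \<bar>b\<bar> * sobolev_norm \<Omega> 2 (\<lambda>x. w x - q j x)) \<longlonglongrightarrow> 0" by simp
  qed auto
  moreover have "?r j \<in> test_fun \<Omega>" for j by (rule test_fun_linear[OF p(1) q(1)])
  ultimately show ?thesis unfolding H20_def using Hm_space_linear[OF _ _ assms(3)] assms(1,2)
    by (auto simp: H20_def intro!: exI[of _ ?r])
qed

lemma H20_diff: "v \<in> H20 \<Omega> \<Longrightarrow> w \<in> H20 \<Omega> \<Longrightarrow> open \<Omega> \<Longrightarrow> (\<lambda>x. v x - w x) \<in> H20 \<Omega>"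
  using H20_linear[of v \<Omega> w 1 "-1"] by simp

text \<open>The initial datum agrees with the solution at time 0 only almost everywhere, while
  \<open>H20\<close> is a set of functions.\<close>

lemma H20_cong_AE:
  assumes "AE x in lebesgue_on \<Omega>. v x = w x" "open \<Omega>" "v \<in> H20 \<Omega>"
  shows "w \<in> H20 \<Omega>"
proof -
  have "sobolev_norm \<Omega> 2 (\<lambda>x. v x - p x) = sobolev_norm \<Omega> 2 (\<lambda>x. w x - p x)" for p
    using assms(1) by (intro sobolev_norm_cong_AE[OF _ assms(2)]) (auto elim!: eventually_mono)
  then show ?thesis using assms(3) Hm_space_cong_AE[OF assms(1,2)] by (simp add: H20_def)
qed

lemma a_form_cong_AE:
  "AE x in lebesgue_on \<Omega>. v x = w x \<Longrightarrow> open \<Omega> \<Longrightarrow> a_form \<Omega> v z = a_form \<Omega> w z"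
  unfolding a_form_def by (simp add: wderiv_cong_AE)

text \<open>\<open>wderiv\<close> is linear only up to null sets, which the inner products do not
  see.\<close>

lemma a_form_linear:
  assumes "v \<in> Hm_space \<Omega> 2" "w \<in> Hm_space \<Omega> 2" "z \<in> Hm_space \<Omega> 2" "open \<Omega>"
  shows "a_form \<Omega> (\<lambda>x. a * v x + b * w x) z = a * a_form \<Omega> v z + b * a_form \<Omega> w z"
proof -
  have "L2_inner \<Omega> (wderiv \<Omega> il (\<lambda>x. a * v x + b * w x)) (wderiv \<Omega> il z)
      = a * L2_inner \<Omega> (wderiv \<Omega> il v) (wderiv \<Omega> il z) + b * L2_inner \<Omega> (wderiv \<Omega> il w) (wderiv \<Omega> il z)"
    if l: "length il = 2" for il
  proof -
    have l2: "length il \<le> 2" using l by simp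
    note L = wderiv_L2_space[OF _ l2 assms(4)]
    have "L2_inner \<Omega> (wderiv \<Omega> il (\<lambda>x. a * v x + b * w x)) (wderiv \<Omega> il z)
        = L2_inner \<Omega> (\<lambda>x. a * wderiv \<Omega> il v x + b * wderiv \<Omega> il w x) (wderiv \<Omega> il z)"
      by (rule L2_inner_cong_AE[OF wderiv_linear[OF assms(1,2,4) l2]])
        (intro L L2_space_add L2_space_cmult Hm_space_linear assms)+
    then show ?thesis by (simp add: L2_inner_add L2_inner_cmult L2_space_cmult L assms)
  qed
  then show ?thesis by (simp add: a_form_def sum.distrib sum_distrib_left)
qed

section \<open>The smoother, the discrete form and the CFL condition\<close>

text \<open>The smoother estimate of order s = 0 with the zero function as competitor in
  \<open>H20\<close>; the broken norm of order 0 dominates the \<open>L2\<close> norm on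
  \<Omega>.\<close>

lemma smoother_L2_bound:
  assumes \<Omega>: "bounded \<Omega>" "\<Omega> \<noteq> {}" "open \<Omega>" and \<T>: "triangulation_of \<Omega> \<T>"
    and sm: "smoother_estimate \<Omega> \<T> Vh C1 Q" and C1: "0 < C1 0" and v: "v \<in> Vh"
  shows "(\<lambda>x. v x - Q v x) \<in> L2_space \<Omega>"
    and "L2_norm \<Omega> (\<lambda>x. v x - Q v x) \<le> C1 0 * (mesh_size \<T>)\<^sup>2 * h_norm \<T> v"
proof -
  note tri = triangulation_mesh[OF \<Omega>(1,2) \<T>]
  let ?w = "\<lambda>x. v x - Q v x" and ?c = "C1 0 * (mesh_size \<T>)\<^sup>2 * h_norm \<T> v"
  have c0: "0 \<le> ?c" using C1 h_norm_nonneg by simp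
  have "broken_sobolev_norm \<T> 0 ?w \<le> ennreal (C1 0 * mesh_size \<T> powr (2 - 0) * h_norm \<T> (\<lambda>x. v x - 0))"
    by (rule sm[unfolded smoother_estimate_def, rule_format, OF v _ zero_H20[OF \<Omega>(3)]]) simp
  then have "broken_sobolev_norm \<T> 0 ?w \<le> ennreal ?c" using tri(2) by simp
  then have s: "(\<Sum>K\<in>\<T>. (sobolev_norm (interior K) 0 ?w)\<^sup>2) \<le> (ennreal ?c)\<^sup>2"
    by (simp add: broken_sobolev_norm_def esqrt_le_iff)
  have le: "L2_enorm (interior K) ?w \<le> sobolev_norm (interior K) 0 ?w" for K by (rule L2_enorm_le_sobolev_norm) simp
  have "?w \<in> L2_space (interior K)" if K: "K \<in> \<T>" for K
  proof -
    have "(sobolev_norm (interior K) 0 ?w)\<^sup>2 \<le> (\<Sum>K\<in>\<T>. (sobolev_norm (interior K) 0 ?w)\<^sup>2)"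
      by (rule member_le_sum[OF K]) (use tri(1) in auto)
    from order_trans[OF this s] have "sobolev_norm (interior K) 0 ?w \<le> ennreal ?c" unfolding ennreal_power2_le_iff .
    from order_trans[OF le this] have "L2_enorm (interior K) ?w \<le> ennreal ?c" .
    then show ?thesis unfolding L2_enorm_finite_iff[symmetric] by (rule order_le_less_trans) simp
  qed
  note L2 = broken_L2[OF \<Omega> \<T> this] L2_enorm_le_pieces[OF \<Omega> \<T> this]
  show "?w \<in> L2_space \<Omega>" by (rule L2(1))
  have "(L2_enorm \<Omega> ?w)\<^sup>2 \<le> (\<Sum>K\<in>\<T>. (sobolev_norm (interior K) 0 ?w)\<^sup>2)"
    using L2(2) by (rule order_trans) (auto intro!: sum_mono simp: ennreal_power2_le_iff le)
  then have "(L2_enorm \<Omega> ?w)\<^sup>2 \<le> (ennreal ?c)\<^sup>2" using s by (rule order_trans)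
  then show "L2_norm \<Omega> ?w \<le> ?c" using c0 by (simp add: ennreal_power2_le_iff L2_enorm_eq_norm[OF L2(1)] ennreal_le_iff)
qed

lemma finite_dim_space_lin_comb:
  assumes "finite_dim_space V" "v \<in> V" "w \<in> V"
  shows "(\<lambda>x. a * v x + b * w x) \<in> V"
proof -
  obtain B where B: "V = {v. \<exists>c. v = (\<lambda>x. \<Sum>b\<in>B. c b * b x)}" using assms(1) by (auto simp: finite_dim_space_def)
  obtain c c' where "v = (\<lambda>x. \<Sum>b\<in>B. c b * b x)" "w = (\<lambda>x. \<Sum>b\<in>B. c' b * b x)" using assms(2,3) B by auto
  then have "(\<lambda>x. a * v x + b * w x) = (\<lambda>x. \<Sum>e\<in>B. (a * c e + b * c' e) * e x)"
    by (auto simp: sum_distrib_left algebra_simps sum.distrib)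
  then show ?thesis unfolding B by (intro CollectI exI[of _ "\<lambda>e. a * c e + b * c' e"])
qed

text \<open>Bilinearity is assumed on the sum of \<open>Vh\<close> and the Morley space. That
  \<open>Vh\<close> is contained in this sum requires 0 in the Morley space: the interpolant of 0
  lies there, and linearity makes it the zero function.\<close>

lemma discrete_form_bilinear:
  assumes V: "finite_dim_space Vh" "Vh \<subseteq> broken_Hm \<T> 2" and ah: "discrete_form \<Omega> \<T> Vh \<alpha> \<beta> ah"
    and IM: "morley_interpolation \<Omega> \<T> IM"
  shows "sym_bilinear_space Vh ah"
proof -
  obtain B where "Vh = {v. \<exists>c. v = (\<lambda>x. \<Sum>b\<in>B. c b * b x)}" using V(1) by (auto simp: finite_dim_space_def)
  then have z: "(\<lambda>x. 0) \<in> Vh" by (auto intro!: exI[of _ "\<lambda>_. 0"])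
  then have zb: "(\<lambda>x. 0) \<in> broken_Hm \<T> 2" using V(2) by blast
  have "linear_op_on (broken_Hm \<T> 2) IM" "IM (\<lambda>x. 0) \<in> morley_space \<Omega> \<T>" using IM zb by (auto simp: morley_interpolation_def)
  from this(1)[unfolded linear_op_on_def, rule_format, OF zb zb, of 0 0]
  have "IM (\<lambda>x. 0) = (\<lambda>x. 0)" by simp
  then have zm: "(\<lambda>x. 0) \<in> morley_space \<Omega> \<T>" using \<open>IM (\<lambda>x. 0) \<in> _\<close> by simp
  have sub: "v \<in> sum_space Vh (morley_space \<Omega> \<T>)" if "v \<in> Vh" for v
    unfolding sum_space_def using that zm by (intro CollectI exI[of _ v] exI[of _ "\<lambda>x. 0"]) auto
  have sb: "symmetric_bilinear_on (sum_space Vh (morley_space \<Omega> \<T>)) ah" using ah by (simp add: discrete_form_def)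
  show ?thesis
  proof
    show "(\<lambda>x. a * v x + b * w x) \<in> Vh" if "v \<in> Vh" "w \<in> Vh" for v w a b
      by (rule finite_dim_space_lin_comb[OF V(1) that])
    show "ah v w = ah w v" if "v \<in> Vh" "w \<in> Vh" for v w
      using sb sub[OF that(1)] sub[OF that(2)] unfolding symmetric_bilinear_on_def by blast
    show "ah (\<lambda>x. a * v x + b * w x) z = a * ah v z + b * ah w z" if "v \<in> Vh" "w \<in> Vh" "z \<in> Vh" for v w z a b
      using sb sub[OF that(1)] sub[OF that(2)] sub[OF that(3)] unfolding symmetric_bilinear_on_def by blast
  qed
qed

text \<open>Continuity and the inverse inequality bound the form by \<beta> Cinv^2 h^(-4) times the
  squared \<open>L2\<close> norm; the CFL condition says that k^2 times this factor is at most
  1.\<close>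

lemma cfl_energy_bound:
  assumes ah: "discrete_form \<Omega> \<T> Vh \<alpha> \<beta> ah" and inv: "inverse_inequality \<Omega> \<T> Vh Cinv"
    and h: "0 < mesh_size \<T>" and \<beta>: "0 < \<beta>" and k: "0 < k" and cfl: "k \<le> \<beta> powr (-1/2) * inverse Cinv * (mesh_size \<T>)\<^sup>2"
    and v: "v \<in> Vh"
  shows "k\<^sup>2 * ah v v \<le> (L2_norm \<Omega> v)\<^sup>2"
proof -
  let ?h = "mesh_size \<T>"
  have C: "0 < Cinv" and hn: "h_norm \<T> v \<le> Cinv * (1 / ?h\<^sup>2) * L2_norm \<Omega> v" using inv v by (auto simp: inverse_inequality_def)
  have "ah v v \<le> \<beta> * (h_norm \<T> v)\<^sup>2" using ah v by (auto simp: discrete_form_def power2_eq_square mult.assoc)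
  also have "\<dots> \<le> \<beta> * (Cinv * (1 / ?h\<^sup>2) * L2_norm \<Omega> v)\<^sup>2"
    using \<beta> hn h_norm_nonneg by (intro mult_left_mono power_mono) auto
  finally have "k\<^sup>2 * ah v v \<le> k\<^sup>2 * (\<beta> * (Cinv * (1 / ?h\<^sup>2) * L2_norm \<Omega> v)\<^sup>2)" by (intro mult_left_mono) auto
  also have "\<dots> = (k\<^sup>2 * (\<beta> * (Cinv / ?h\<^sup>2)\<^sup>2)) * (L2_norm \<Omega> v)\<^sup>2" by (simp add: power_mult_distrib power_divide)
  also have "\<dots> \<le> 1 * (L2_norm \<Omega> v)\<^sup>2"
  proof (rule mult_right_mono)
    have "k\<^sup>2 \<le> (\<beta> powr (-1/2) * inverse Cinv * ?h\<^sup>2)\<^sup>2" using k cfl by (intro power_mono) auto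
    also have "\<dots> = (\<beta> powr (-1/2))\<^sup>2 * (inverse Cinv * ?h\<^sup>2)\<^sup>2" by (simp add: power_mult_distrib)
    also have "(\<beta> powr (-1/2))\<^sup>2 = \<beta> powr (-1/2 + -1/2)" by (simp only: power2_eq_square powr_add)
    also have "\<dots> = inverse \<beta>" using \<beta> by (simp add: powr_neg_one inverse_eq_divide)
    finally have "k\<^sup>2 * (\<beta> * (Cinv / ?h\<^sup>2)\<^sup>2) \<le> inverse \<beta> * (inverse Cinv * ?h\<^sup>2)\<^sup>2 * (\<beta> * (Cinv / ?h\<^sup>2)\<^sup>2)"
      using \<beta> by (intro mult_right_mono) auto
    also have "\<dots> = 1" using \<beta> C h by (simp add: field_simps)
    finally show "k\<^sup>2 * (\<beta> * (Cinv / ?h\<^sup>2)\<^sup>2) \<le> 1" .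
  qed simp
  finally show ?thesis by simp
qed

section \<open>The error estimate\<close>

text \<open>
  Built from the projections of the increments, so that no linearity of the projection is needed; the
  projection is only determined up to functions that the discrete form does not see.
\<close>

fun ritz_path :: "(sfun \<Rightarrow> sfun) \<Rightarrow> sfun \<Rightarrow> (nat \<Rightarrow> sfun) \<Rightarrow> nat \<Rightarrow> sfun" where
  "ritz_path Rh u0 w 0 = Rh u0"
| "ritz_path Rh u0 w (Suc 0) = (\<lambda>x. Rh u0 x + Rh (\<lambda>x. w 1 x - w 0 x) x)"
| "ritz_path Rh u0 w (Suc (Suc n)) = (\<lambda>x. 2 * ritz_path Rh u0 w (Suc n) x - ritz_path Rh u0 w n x
     + Rh (\<lambda>x. w (n+2) x - 2 * w (n+1) x + w n x) x)"

text \<open>Summing differences twice costs one factor of the number of steps, compensated in the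
  application by the factor k that \<open>r1\<close> and every \<open>r\<close> n contain.\<close>

lemma second_difference_growth:
  fixes q :: "nat \<Rightarrow> sfun"
  assumes q: "\<And>n. n \<le> m + 1 \<Longrightarrow> q n \<in> L2_space \<Omega>" and q0: "L2_norm \<Omega> (q 0) \<le> r0"
    and q1: "L2_norm \<Omega> (\<lambda>x. q 1 x - q 0 x) \<le> r1"
    and q2: "\<And>n. 1 \<le> n \<Longrightarrow> n \<le> m \<Longrightarrow> L2_norm \<Omega> (\<lambda>x. q (n+1) x - 2 * q n x + q (n-1) x) \<le> r n"
    and r: "\<And>n. 0 \<le> r n"
  shows "L2_norm \<Omega> (q (m+1)) \<le> r0 + real (m+1) * (r1 + (\<Sum>n=1..m. r n))"
proof -
  have d: "L2_norm \<Omega> (\<lambda>x. q (n+1) x - q n x) \<le> r1 + (\<Sum>j=1..n. r j)" if "n \<le> m" for n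
    using that
  proof (induction n)
    case 0
    then show ?case using q1 by simp
  next
    case (Suc n)
    have L: "q (n+2) \<in> L2_space \<Omega>" "q (n+1) \<in> L2_space \<Omega>" "q n \<in> L2_space \<Omega>" using q Suc.prems by auto
    have "(\<lambda>x. q (Suc n + 1) x - q (Suc n) x) = (\<lambda>x. (q (n+1) x - q n x) + (q (Suc n + 1) x - 2 * q (Suc n) x + q (Suc n - 1) x))"
      by auto
    then have "L2_norm \<Omega> (\<lambda>x. q (Suc n + 1) x - q (Suc n) x)
        \<le> L2_norm \<Omega> (\<lambda>x. q (n+1) x - q n x) + L2_norm \<Omega> (\<lambda>x. q (Suc n + 1) x - 2 * q (Suc n) x + q (Suc n - 1) x)"
      using L by (simp only:) (intro L2_norm_add_le L2_space_intros, auto)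
    also have "\<dots> \<le> (r1 + (\<Sum>j=1..n. r j)) + r (Suc n)" using Suc q2[of "Suc n"] by (intro add_mono) auto
    finally show ?case by simp
  qed
  have "L2_norm \<Omega> (q n) \<le> r0 + real n * (r1 + (\<Sum>n=1..m. r n))" if "n \<le> m + 1" for n
    using that
  proof (induction n)
    case 0
    then show ?case using q0 by simp
  next
    case (Suc n)
    have L: "q (n+1) \<in> L2_space \<Omega>" "q n \<in> L2_space \<Omega>" using q Suc.prems by auto
    have "L2_norm \<Omega> (\<lambda>x. q n x + (q (n+1) x - q n x)) \<le> L2_norm \<Omega> (q n) + L2_norm \<Omega> (\<lambda>x. q (n+1) x - q n x)"
      using L by (intro L2_norm_add_le L2_space_diff)
    also have "\<dots> \<le> (r0 + real n * (r1 + (\<Sum>n=1..m. r n))) + (r1 + (\<Sum>j=1..n. r j))"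
      using Suc d[of n] by (intro add_mono) auto
    also have "(\<Sum>j=1..n. r j) \<le> (\<Sum>j=1..m. r j)" using Suc.prems r by (intro sum_mono2) auto
    finally show ?case by (simp add: algebra_simps)
  qed
  from this[of "m+1"] show ?thesis by simp
qed

text \<open>Windows of width 2 k around consecutive grid points overlap twice, hence the factor 2 in
  the first sum; both sums telescope in the primitive \<open>F\<close>.\<close>

lemma grid_integral_sums:
  fixes \<nu> :: "real \<Rightarrow> real"
  assumes \<nu>: "integrable (lebesgue_on {0..T}) \<nu>" "\<And>t. 0 \<le> \<nu> t" and k: "0 < k" and m: "real (m+1) * k \<le> T"
  shows "(\<Sum>n=1..m. integral {real n * k - k..real n * k + k} \<nu>) \<le> 2 * integral {0..T} \<nu>"
    and "(\<Sum>n=1..<m. integral {real n * k..real (n+1) * k} \<nu>) \<le> integral {0..T} \<nu>"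
proof -
  have on: "\<nu> integrable_on {a..b}" if "0 \<le> a" "b \<le> T" for a b
    by (rule integrable_on_lebesgue_on[OF LINT_indicator_Icc(2)[OF \<nu>(1) that]]) auto
  define F where "F n = integral {0..real n * k} \<nu>" for n
  have le: "real n * k \<le> T" if "n \<le> m + 1" for n
    using m mult_right_mono[of "real n" "real (m+1)" k] that k by linarith
  have diff: "integral {real a * k..real b * k} \<nu> = F b - F a" if "a \<le> b" "b \<le> m + 1" for a b
    using Henstock_Kurzweil_Integration.integral_combine[of 0 "real a * k" "real b * k" \<nu>] that k on[of 0 "real b * k"] le[OF that(2)]
    by (simp add: F_def mult_right_mono)
  have F0: "0 \<le> F n" and FT: "F n \<le> integral {0..T} \<nu>" if "n \<le> m + 1" for n
    unfolding F_def using on le[OF that] \<nu>(2) k by (auto intro!: Henstock_Kurzweil_Integration.integral_nonneg integral_subset_le)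
  have mono: "F a \<le> F b" if "a \<le> b" "b \<le> m + 1" for a b
    using diff[OF that] Henstock_Kurzweil_Integration.integral_nonneg[OF on[of "real a * k" "real b * k"]] le[OF that(2)] \<nu>(2) k
    by simp
  have "(\<Sum>n=1..m. integral {real n * k - k..real n * k + k} \<nu>) = (\<Sum>n=1..m. F (n+1) - F (n-1))"
  proof (rule sum.cong[OF refl])
    fix n assume n: "n \<in> {1..m}"
    have "real n * k - k = real (n-1) * k" "real n * k + k = real (n+1) * k" using n by (auto simp: of_nat_diff algebra_simps)
    then show "integral {real n * k - k..real n * k + k} \<nu> = F (n+1) - F (n-1)" using diff[of "n-1" "n+1"] n by simp
  qed
  also have "\<dots> = F (m+1) + F m - F 1 - F 0" by (induction m) auto
  also have "\<dots> \<le> 2 * integral {0..T} \<nu>" using F0[of 0] F0[of 1] FT[of m] FT[of "m+1"] by simp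
  finally show "(\<Sum>n=1..m. integral {real n * k - k..real n * k + k} \<nu>) \<le> 2 * integral {0..T} \<nu>" .
  have "(\<Sum>n=1..<m. integral {real n * k..real (n+1) * k} \<nu>) = (\<Sum>n=1..<m. F (n+1) - F n)"
    by (intro sum.cong refl diff) auto
  also have "\<dots> \<le> F m - F 0"
  proof (cases "1 \<le> m")
    case True
    then have "(\<Sum>n=1..<m. F (n+1) - F n) = F m - F 1" by (induction m rule: dec_induct) auto
    then show ?thesis using mono[of 0 1] by simp
  qed (use mono[of 0 m] in simp)
  also have "\<dots> \<le> integral {0..T} \<nu>" using F0[of 0] FT[of m] by simp
  finally show "(\<Sum>n=1..<m. integral {real n * k..real (n+1) * k} \<nu>) \<le> integral {0..T} \<nu>" .
qed

context regular_solution
begin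

text \<open>\<open>H\<close> stands for h^(2\<gamma>). Terms with \<open>C2\<close> stem from Ritz
  errors, both of u itself and inside the residual; terms with \<open>E0\<close> stem from the
  smoother, and those with k^2 from Taylor remainders. The factor 2 T is the time accumulated in
  \<open>discrete_stability\<close>.\<close>

lemma error_estimate:
  fixes Vh :: "sfun set" and ah :: "sfun \<Rightarrow> sfun \<Rightarrow> real" and Q Rh :: "sfun \<Rightarrow> sfun" and U :: "nat \<Rightarrow> sfun"
  assumes f: "time_continuous (L2_enorm \<Omega>) T f"
    and p0: "has_time_deriv \<Omega> T 0 f p0" "Linf_time_norm (L2_enorm \<Omega>) T p0 \<le> ennreal cf" and cf: "0 \<le> cf"
    and p1: "has_time_deriv \<Omega> T 1 f p1" "L2_time_norm (L2_enorm \<Omega>) T p1 \<le> ennreal cf1" and cf1: "0 \<le> cf1"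
    and s: "s = 2 + \<gamma>"
    and V: "sym_bilinear_space Vh ah" "Vh \<subseteq> L2_space \<Omega>"
    and psd: "\<And>v. v \<in> Vh \<Longrightarrow> 0 \<le> ah v v"
    and Q: "\<And>v. v \<in> Vh \<Longrightarrow> Q v \<in> H20 \<Omega>"
      "\<And>v w a b. v \<in> Vh \<Longrightarrow> w \<in> Vh \<Longrightarrow> Q (\<lambda>x. a * v x + b * w x) = (\<lambda>x. a * Q v x + b * Q w x)"
      "\<And>v. v \<in> Vh \<Longrightarrow> L2_norm \<Omega> (\<lambda>x. Q v x - v x) \<le> E0 * H * sqrt (ah v v)"
    and E0: "0 \<le> E0" and H: "0 \<le> H" and C2: "0 \<le> C2"
    and Rh: "ritz_projection \<Omega> Vh ah Q Rh"
      "\<And>z. z \<in> H20 \<Omega> \<inter> Hs_space \<Omega> s \<Longrightarrow> L2_norm \<Omega> (\<lambda>x. z x - Rh z x) \<le> C2 * H * enn2real (sobolev_norm \<Omega> s z)"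
    and u0: "AE x in lebesgue_on \<Omega>. u 0 x = u0 x" and v0: "AE x in lebesgue_on \<Omega>. ut 0 x = v0 x"
    and N: "N > 0" "k = T / real N" and U: "explicit_scheme \<Omega> Vh ah Rh k N f u0 v0 U"
    and cfl: "\<And>v. v \<in> Vh \<Longrightarrow> k\<^sup>2 * ah v v \<le> (L2_norm \<Omega> v)\<^sup>2"
    and m: "m \<in> {1..N-1}"
  shows "L2_norm \<Omega> (\<lambda>x. u (real (m + 1) * k) x - U (m + 1) x)
    \<le> H * (C2 * (a0 + 2 * T * a1 + 4 * T * sqrt T * c2)
        + 2 * T * (2 * C2 * a1 + 5 * E0 * (cf + b2) + 16 * C2 * sqrt T * c2 + 2 * E0 * sqrt T * (cf1 + c3)))
      + k\<^sup>2 * (2 * T * (2 * b3 + 8 * sqrt T * c4))"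
proof -
  interpret A: sym_bilinear_space Vh ah by fact
  interpret L: sym_bilinear_space "L2_space \<Omega>" "L2_inner \<Omega>" by (rule sym_bilinear_L2)
  have L2: "v \<in> L2_space \<Omega>" if "v \<in> Vh" for v using that V(2) by blast
  have k: "0 < k" using N T by simp
  have Nk: "real N * k = T" using N by simp
  have grid: "real n * k \<in> {0..T}" if "n \<le> N" for n
    using mult_right_mono[of "real n" "real N" k] that k Nk by simp
  have m1: "1 \<le> m" "m + 1 \<le> N" using m N by auto
  have gT: "real (m+1) * k \<le> T" using grid[OF m1(2)] by simp
  obtain W where WL2: "\<And>t. t \<in> {0..T} \<Longrightarrow> W t \<in> L2_space \<Omega>"
    and Weq: "\<And>w t. w \<in> H20 \<Omega> \<Longrightarrow> t \<in> {0..T} \<Longrightarrow> L2_inner \<Omega> (W t) w + a_form \<Omega> (u t) w = L2_inner \<Omega> (f t) w"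
    and Wb: "\<And>t. t \<in> {0..T} \<Longrightarrow> L2_norm \<Omega> (W t) \<le> b2"
    and Wd: "\<And>a b. 0 \<le> a \<Longrightarrow> a \<le> b \<Longrightarrow> b \<le> T \<Longrightarrow> L2_norm \<Omega> (\<lambda>x. W b x - W a x) \<le> integral {a..b} \<nu>3"
    and X2: "\<And>t k. 0 \<le> k \<Longrightarrow> k \<le> t \<Longrightarrow> t + k \<le> T \<Longrightarrow>
      sobolev_norm \<Omega> s (\<lambda>x. u (t + k) x - 2 * u t x + u (t - k) x) \<le> ennreal (2 * k * integral {t-k..t+k} \<nu>2)"
    and tr: "\<And>v t k. v \<in> L2_space \<Omega> \<Longrightarrow> 0 \<le> k \<Longrightarrow> k \<le> t \<Longrightarrow> t + k \<le> T \<Longrightarrow>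
      \<bar>L2_inner \<Omega> (u (t + k)) v - 2 * L2_inner \<Omega> (u t) v + L2_inner \<Omega> (u (t - k)) v - k\<^sup>2 * L2_inner \<Omega> (W t) v\<bar>
        \<le> k ^ 3 * (integral {t-k..t+k} \<nu>4 * L2_norm \<Omega> v)"
    and st: "\<And>v k. v \<in> L2_space \<Omega> \<Longrightarrow> 0 \<le> k \<Longrightarrow> k \<le> T \<Longrightarrow>
      \<bar>2 * (L2_inner \<Omega> (u k) v - L2_inner \<Omega> (u 0) v - k * L2_inner \<Omega> (ut 0) v)
        - k\<^sup>2 * ((L2_inner \<Omega> (W 0) v + L2_inner \<Omega> (W k) v) / 2)\<bar> \<le> 2 * k ^ 3 * (b3 * L2_norm \<Omega> v)"
    by (rule second_derivative) blast
  define w where "w n = u (real n * k)" for n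
  define R where "R = ritz_path Rh u0 w"
  have wH: "w n \<in> H20 \<Omega>" if "n \<le> N" for n unfolding w_def by (rule u[OF grid[OF that]])
  have wL2: "w n \<in> L2_space \<Omega>" if "n \<le> N" for n unfolding w_def by (rule u_L2[OF grid[OF that]])
  have u0H: "u0 \<in> H20 \<Omega>" by (rule H20_cong_AE[OF u0 open_dom]) (use u T in simp)
  have RV: "Rh z \<in> Vh" and Req: "\<And>v. v \<in> Vh \<Longrightarrow> ah (Rh z) v = a_form \<Omega> z (Q v)" if "z \<in> H20 \<Omega>" for z
    using Rh(1) that by (auto simp: ritz_projection_def)
  have HHm: "z \<in> Hm_space \<Omega> 2" if "z \<in> H20 \<Omega>" for z using that by (simp add: H20_def)
  have d1H: "(\<lambda>x. w 1 x - w 0 x) \<in> H20 \<Omega>" by (rule H20_diff) (use wH m1 open_dom in auto)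
  have d2eq: "(\<lambda>x. w (n+2) x - 2 * w (n+1) x + w n x) = (\<lambda>x. 1 * (1 * w (n+2) x + (-2) * w (n+1) x) + 1 * w n x)" for n by auto
  have d2H: "(\<lambda>x. w (n+2) x - 2 * w (n+1) x + w n x) \<in> H20 \<Omega>" if "n + 2 \<le> N" for n
    unfolding d2eq by (intro H20_linear wH open_dom) (use that in auto)
  have R_simps: "R 0 = Rh u0" "R (Suc 0) = (\<lambda>x. R 0 x + Rh (\<lambda>x. w 1 x - w 0 x) x)"
    "R (Suc (Suc n)) = (\<lambda>x. (2 * R (Suc n) x - R n x) + Rh (\<lambda>x. w (n+2) x - 2 * w (n+1) x + w n x) x)" for n
    by (simp_all add: R_def)
  \<comment> \<open>Tested through the discrete form, R(n) acts as the projection of w(n): the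
    defining identity is additive, and R(n) is assembled from projected increments.\<close>
  have R_all: "R n \<in> Vh \<and> (\<forall>v\<in>Vh. ah (R n) v = a_form \<Omega> (w n) (Q v))" if "n \<le> N" for n
    using that
  proof (induction n rule: less_induct)
    case (less n)
    consider "n = 0" | "n = Suc 0" | j where "n = Suc (Suc j)" by (metis not0_implies_Suc)
    then show ?case
    proof cases
      case 1
      have "a_form \<Omega> (w 0) (Q v) = a_form \<Omega> u0 (Q v)" for v
        using a_form_cong_AE[OF u0 open_dom] by (simp add: w_def)
      then show ?thesis using 1 RV[OF u0H] Req[OF u0H] by (simp add: R_simps)
    next
      case 2
      have 0: "R 0 \<in> Vh" "\<And>v. v \<in> Vh \<Longrightarrow> ah (R 0) v = a_form \<Omega> (w 0) (Q v)" using less.IH[of 0] 2 by auto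
      have "ah (R (Suc 0)) v = a_form \<Omega> (w (Suc 0)) (Q v)" if v: "v \<in> Vh" for v
      proof -
        have "a_form \<Omega> (\<lambda>x. 1 * w 1 x + (-1) * w 0 x) (Q v) = 1 * a_form \<Omega> (w 1) (Q v) + (-1) * a_form \<Omega> (w 0) (Q v)"
          by (rule a_form_linear) (use HHm wH Q(1)[OF v] open_dom m1 in auto)
        then show ?thesis unfolding R_simps(2) A.left(1)[OF 0(1) RV[OF d1H] v] using 0(2)[OF v] Req[OF d1H v] by simp
      qed
      moreover have "R (Suc 0) \<in> Vh" unfolding R_simps(2) by (rule A.closed(1)[OF 0(1) RV[OF d1H]])
      ultimately show ?thesis using 2 by simp
    next
      case (3 j)
      have jN: "j + 2 \<le> N" using less.prems 3 by simp
      have IH: "R j \<in> Vh" "\<And>v. v \<in> Vh \<Longrightarrow> ah (R j) v = a_form \<Omega> (w j) (Q v)"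
        "R (Suc j) \<in> Vh" "\<And>v. v \<in> Vh \<Longrightarrow> ah (R (Suc j)) v = a_form \<Omega> (w (Suc j)) (Q v)"
        using less.IH[of j] less.IH[of "Suc j"] 3 less.prems by auto
      note dV = RV[OF d2H[OF jN]]
      have two: "(\<lambda>x. 2 * R (Suc j) x) \<in> Vh" by (rule A.closed(3)[OF IH(3)])
      have sub: "(\<lambda>x. 2 * R (Suc j) x - R j x) \<in> Vh" by (rule A.closed(2)[OF two IH(1)])
      have "ah (R n) v = a_form \<Omega> (w n) (Q v)" if v: "v \<in> Vh" for v
      proof -
        have i: "(\<lambda>x. 1 * w (j+2) x + (-2) * w (j+1) x) \<in> Hm_space \<Omega> 2"
          by (rule Hm_space_linear) (use HHm wH jN open_dom in auto)
        have "a_form \<Omega> (\<lambda>x. w (j+2) x - 2 * w (j+1) x + w j x) (Q v)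
            = 1 * a_form \<Omega> (\<lambda>x. 1 * w (j+2) x + (-2) * w (j+1) x) (Q v) + 1 * a_form \<Omega> (w j) (Q v)"
          unfolding d2eq by (rule a_form_linear[OF i]) (use HHm wH Q(1)[OF v] open_dom jN in auto)
        also have "a_form \<Omega> (\<lambda>x. 1 * w (j+2) x + (-2) * w (j+1) x) (Q v) = 1 * a_form \<Omega> (w (j+2)) (Q v) + (-2) * a_form \<Omega> (w (j+1)) (Q v)"
          by (rule a_form_linear) (use HHm wH Q(1)[OF v] open_dom jN in auto)
        finally have "ah (Rh (\<lambda>x. w (j+2) x - 2 * w (j+1) x + w j x)) v
            = a_form \<Omega> (w (j+2)) (Q v) - 2 * a_form \<Omega> (w (j+1)) (Q v) + a_form \<Omega> (w j) (Q v)"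
          using Req[OF d2H[OF jN] v] by simp
        then show ?thesis unfolding 3 R_simps(3) A.left(1)[OF sub dV v] A.left(2)[OF two IH(1) v] A.left(3)[OF IH(3) v]
          using IH(2,4)[OF v] by simp
      qed
      moreover have "R n \<in> Vh" unfolding 3 R_simps(3) by (rule A.closed(1)[OF sub dV])
      ultimately show ?thesis by blast
    qed
  qed
  have RnV: "R n \<in> Vh" and Rah: "\<And>v. v \<in> Vh \<Longrightarrow> ah (R n) v = a_form \<Omega> (w n) (Q v)" if "n \<le> N" for n
    using R_all[OF that] by auto
  have UV: "U n \<in> Vh" if "n \<le> N" for n using U that by (simp add: explicit_scheme_def)
  have U0: "U 0 = R 0" using U by (simp add: explicit_scheme_def R_simps)
  have fL2: "f t \<in> L2_space \<Omega>" if "t \<in> {0..T}" for t by (rule time_continuous_L2_pairing(1)[OF f L2_space_zero that])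
  note fb = continuous_rep_bounds[OF N.domain_measurable T f p0 cf p1 cf1]
  define \<nu>f where "\<nu>f = (\<lambda>t. enn2real (L2_enorm \<Omega> (p1 t)))"
  have \<nu>fi: "integrable (lebesgue_on {0..T}) \<nu>f" and \<nu>ft: "integral {0..T} \<nu>f \<le> sqrt T * cf1" and \<nu>f0: "\<And>t. 0 \<le> \<nu>f t"
    unfolding \<nu>f_def using N.norm_path_integrable[OF N.L2_time_norm_bound[OF p1(2) T0 cf1] sqrtT[OF cf1]] by auto
  have Rb: "L2_norm \<Omega> (\<lambda>x. z x - Rh z x) \<le> C2 * H * c"
    if z: "z \<in> H20 \<Omega>" and c: "sobolev_norm \<Omega> s z \<le> ennreal c" "0 \<le> c" for z c
  proof -
    have "sobolev_norm \<Omega> s z < \<infinity>" by (rule order_le_less_trans[OF c(1)]) simp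
    then have "L2_norm \<Omega> (\<lambda>x. z x - Rh z x) \<le> C2 * H * enn2real (sobolev_norm \<Omega> s z)"
      using z by (intro Rh(2)) (auto simp: Hs_space_def)
    also have "enn2real (sobolev_norm \<Omega> s z) \<le> c" using c by (simp add: enn2real_leI)
    finally show ?thesis using C2 H by (simp add: mult_left_mono)
  qed
  define I2 where "I2 n = integral {real n * k - k..real n * k + k} \<nu>2" for n
  define I4 where "I4 n = integral {real n * k - k..real n * k + k} \<nu>4" for n
  have on: "F integrable_on {a..b}" if "integrable M F" "0 \<le> a" "b \<le> T" for F :: "real \<Rightarrow> real" and a b
    by (rule integrable_on_lebesgue_on[OF LINT_indicator_Icc(2)[OF that]]) auto
  have gn: "k \<le> real n * k" "real n * k + k \<le> T" if "1 \<le> n" "n \<le> m" for n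
  proof -
    have "1 * k \<le> real n * k" "real n * k \<le> real m * k" using that k by (intro mult_right_mono; simp)+
    then show "k \<le> real n * k" "real n * k + k \<le> T" using gT by (auto simp: distrib_right)
  qed
  have I2_0: "0 \<le> I2 n" and I4_0: "0 \<le> I4 n" if "1 \<le> n" "n \<le> m" for n
    unfolding I2_def I4_def using on[OF \<nu>_integrable(1)] on[OF \<nu>_integrable(3)] gn[OF that] \<nu>_nonneg
    by (auto intro!: Henstock_Kurzweil_Integration.integral_nonneg)
  \<comment> \<open>By construction of the Ritz path, first and second differences of
    \<open>q\<close> are Ritz errors of differences of \<open>w\<close>.\<close>
  define q where "q n = (\<lambda>x. w n x - R n x)" for n
  have qL2: "q n \<in> L2_space \<Omega>" if "n \<le> N" for n unfolding q_def by (intro L2_space_diff wL2 L2 RnV that)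
  have q0: "L2_norm \<Omega> (q 0) \<le> C2 * H * (a0 + T * a1)"
  proof -
    have ae: "AE x in lebesgue_on \<Omega>. q 0 x = u0 x - Rh u0 x" using u0 by eventually_elim (simp add: q_def w_def R_simps)
    have u0L2: "(\<lambda>x. u0 x - Rh u0 x) \<in> L2_space \<Omega>"
      using Hm_space_L2[OF HHm[OF u0H] open_dom] L2[OF RV[OF u0H]] by (rule L2_space_diff)
    have "L2_norm \<Omega> (q 0) = L2_norm \<Omega> (\<lambda>x. u0 x - Rh u0 x)"
      using L2_enorm_cong_AE[OF ae N.domain_measurable] L2_enorm_eq_norm[OF qL2[of 0]] L2_enorm_eq_norm[OF u0L2] by simp
    also have "\<dots> \<le> C2 * H * (a0 + T * a1)"
    proof (rule Rb[OF u0H])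
      show "sobolev_norm \<Omega> s u0 \<le> ennreal (a0 + T * a1)"
        using sobolev_initial sobolev_norm_cong_AE[OF u0 open_dom] by simp
    qed (use nonneg T in simp)
    finally show ?thesis .
  qed
  have q1: "L2_norm \<Omega> (\<lambda>x. q 1 x - q 0 x) \<le> C2 * H * (k * a1)"
  proof -
    have "(\<lambda>x. q 1 x - q 0 x) = (\<lambda>x. (w 1 x - w 0 x) - Rh (\<lambda>x. w 1 x - w 0 x) x)"
      by (auto simp: q_def R_simps)
    moreover have "sobolev_norm \<Omega> s (\<lambda>x. w 1 x - w 0 x) \<le> ennreal (k * a1)"
      using sobolev_first_difference[of k] k grid[of 1] N by (simp add: w_def)
    ultimately show ?thesis using Rb[OF d1H, of "k * a1"] k nonneg by simp
  qed
  have q2: "L2_norm \<Omega> (\<lambda>x. q (n+1) x - 2 * q n x + q (n-1) x) \<le> C2 * H * (2 * k * I2 n)" if n: "1 \<le> n" "n \<le> m" for n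
  proof -
    obtain j where j: "n = Suc j" using n(1) by (cases n) auto
    have jN: "j + 2 \<le> N" using n j m1 by simp
    have "(\<lambda>x. q (n+1) x - 2 * q n x + q (n-1) x)
        = (\<lambda>x. (w (j+2) x - 2 * w (j+1) x + w j x) - Rh (\<lambda>x. w (j+2) x - 2 * w (j+1) x + w j x) x)"
      unfolding q_def j by (auto simp: R_simps(3))
    moreover have "sobolev_norm \<Omega> s (\<lambda>x. w (j+2) x - 2 * w (j+1) x + w j x) \<le> ennreal (2 * k * I2 n)"
    proof -
      have e: "real (j+2) * k = real n * k + k" "real (j+1) * k = real n * k" "real j * k = real n * k - k" by (simp_all add: j algebra_simps)
      show ?thesis unfolding w_def e I2_def using X2[of k "real n * k"] gn[OF n] k by simp
    qed
    ultimately show ?thesis using Rb[OF d2H[OF jN], of "2 * k * I2 n"] k I2_0[OF n] by simp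
  qed
  have S2: "(\<Sum>n=1..m. I2 n) \<le> 2 * (sqrt T * c2)" and S4: "(\<Sum>n=1..m. I4 n) \<le> 2 * (sqrt T * c4)"
    using grid_integral_sums(1)[OF \<nu>_integrable(1) \<nu>_nonneg(1) k gT] grid_integral_sums(1)[OF \<nu>_integrable(3) \<nu>_nonneg(3) k gT] \<nu>_total
    by (auto simp: I2_def I4_def)
  have mk: "0 \<le> real (m+1) * k" using k by simp
  have consistency: "L2_norm \<Omega> (q (m+1)) \<le> H * (C2 * (a0 + 2 * T * a1 + 4 * T * sqrt T * c2))"
  proof -
    \<comment> \<open>The default 0 outside \<open>{1..m}\<close> makes all \<open>r\<close> n
      nonnegative, as \<open>second_difference_growth\<close> asks; within the sum it does not
      occur.\<close>
    have "L2_norm \<Omega> (q (m+1)) \<le> C2 * H * (a0 + T * a1) + real (m+1) * (C2 * H * (k * a1) + (\<Sum>n=1..m. C2 * H * (2 * k * (if n \<in> {1..m} then I2 n else 0))))"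
      by (rule second_difference_growth[OF qL2 q0 q1]) (use q2 m1 C2 H k I2_0 in auto)
    also have "(\<Sum>n=1..m. C2 * H * (2 * k * (if n \<in> {1..m} then I2 n else 0))) = C2 * H * (2 * k) * (\<Sum>n=1..m. I2 n)"
      by (simp add: sum_distrib_left mult.assoc)
    also have "C2 * H * (a0 + T * a1) + real (m+1) * (C2 * H * (k * a1) + C2 * H * (2 * k) * (\<Sum>n=1..m. I2 n))
        = C2 * H * (a0 + T * a1) + C2 * H * ((real (m+1) * k) * (a1 + 2 * (\<Sum>n=1..m. I2 n)))" by (simp add: algebra_simps)
    also have "\<dots> \<le> C2 * H * (a0 + T * a1) + C2 * H * (T * (a1 + 2 * (2 * (sqrt T * c2))))"
    proof (intro add_left_mono mult_left_mono mult_mono gT)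
      show "0 \<le> a1 + 2 * (\<Sum>n=1..m. I2 n)" using nonneg I2_0 by (intro add_nonneg_nonneg mult_nonneg_nonneg sum_nonneg) auto
    qed (use S2 T0 C2 H in auto)
    finally show ?thesis by (simp add: algebra_simps)
  qed
  define \<theta> where "\<theta> n = (\<lambda>x. R n x - U n x)" for n
  define g where "g n = (\<lambda>x. f (real n * k) x - W (real n * k) x)" for n
  define P where "P v = (\<lambda>x. Q v x - v x)" for v
  \<comment> \<open>The starting step has its own residual, with \<open>v0\<close> in place of an
    earlier time level.\<close>
  define E where "E n v = (if n = 0 then 2 / k\<^sup>2 * L2_inner \<Omega> (\<lambda>x. R 1 x - R 0 x) v - L2_inner \<Omega> (\<lambda>x. (W (real 1 * k) x + W 0 x) / 2) v - 2 / k * L2_inner \<Omega> v0 v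
     else L2_inner \<Omega> (\<lambda>x. (R (n+1) x - 2 * R n x + R (n-1) x) / k\<^sup>2) v - L2_inner \<Omega> (W (real n * k)) v)" for n :: nat and v
  \<comment> \<open>Ritz errors of differences carry one factor k and are divided by k^2, which
    leaves 1/k; \<open>discrete_stability\<close> multiplies \<open>e\<close> by k again.\<close>
  define e where "e n = (if n = 0 then 2 * C2 * H * a1 / k + 2 * k * b3 else 2 * C2 * H * I2 n / k + k * I4 n)" for n :: nat
  define \<gamma>' where "\<gamma>' n = integral {real n * k..real (n+1) * k} \<nu>f + integral {real n * k..real (n+1) * k} \<nu>3" for n :: nat
  have QL2: "Q v \<in> L2_space \<Omega>" if "v \<in> Vh" for v using Hm_space_L2[OF HHm[OF Q(1)[OF that]] open_dom] .
  have PL2: "P v \<in> L2_space \<Omega>" if "v \<in> Vh" for v unfolding P_def using QL2[OF that] L2[OF that] by (rule L2_space_diff)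
  have fn: "f (real n * k) \<in> L2_space \<Omega>" "W (real n * k) \<in> L2_space \<Omega>" if "n \<le> N" for n
    using fL2[OF grid[OF that]] WL2[OF grid[OF that]] by auto
  \<comment> \<open>The weak equation tested with Q v turns the pairing of \<open>g\<close> with Q v
    into the form a; the pairing with v remains.\<close>
  have gP: "L2_inner \<Omega> (g n) (P v) = a_form \<Omega> (w n) (Q v) - L2_inner \<Omega> (f (real n * k)) v + L2_inner \<Omega> (W (real n * k)) v"
    if n: "n \<le> N" and v: "v \<in> Vh" for n v
    unfolding g_def P_def w_def
    using L.left(2)[OF fn[OF n] L.closed(2)[OF QL2[OF v] L2[OF v]]] L.right(2)[OF QL2[OF v] L2[OF v] fn(1)[OF n]]
      L.right(2)[OF QL2[OF v] L2[OF v] fn(2)[OF n]] Weq[OF Q(1)[OF v] grid[OF n]] by simp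
  have utL2: "ut 0 \<in> L2_space \<Omega>" using time_continuous_L2_pairing(1)[OF ut L2_space_zero] T by simp
  have v0L2: "v0 \<in> L2_space \<Omega>" by (rule L2_space_cong_AE[OF v0 N.domain_measurable utL2])
  have v0v: "L2_inner \<Omega> v0 v = L2_inner \<Omega> (ut 0) v" if "v \<in> Vh" for v
    using L2_inner_cong_AE[OF v0 utL2 v0L2 L2[OF that]] by simp
  have RL2: "R n \<in> L2_space \<Omega>" if "n \<le> N" for n by (rule L2[OF RnV[OF that]])
  have UL2: "U n \<in> L2_space \<Omega>" if "n \<le> N" for n by (rule L2[OF UV[OF that]])
  have Lle: "\<bar>x\<bar> \<le> a * n" if "x = (y + z) / c" "\<bar>y\<bar> \<le> a1 * n" "\<bar>z\<bar> \<le> a2 * n" "a = (a1 + a2) / c" "0 < c" for x y z c a a1 a2 n :: real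
  proof -
    have "\<bar>x\<bar> \<le> (\<bar>y\<bar> + \<bar>z\<bar>) / c" using that(1,5) by (simp add: divide_right_mono)
    also have "\<dots> \<le> (a1 * n + a2 * n) / c" using that by (intro divide_right_mono add_mono) auto
    finally show ?thesis using that(4) by (simp add: distrib_right)
  qed
  have Eb: "\<bar>E n v\<bar> \<le> e n * L2_norm \<Omega> v" if n: "n \<le> m" and v: "v \<in> Vh" for n v
  proof (cases "n = 0")
    case True
    have vL2: "v \<in> L2_space \<Omega>" by (rule L2[OF v])
    have mN: "1 \<le> N" "0 \<le> N" using m1 by auto
    have W0: "W 0 \<in> L2_space \<Omega>" using WL2 T by simp
    let ?qd = "\<lambda>x. q 1 x - q 0 x"
    have qd: "?qd \<in> L2_space \<Omega>" by (intro L2_space_diff qL2 mN)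
    have Rd: "(\<lambda>x. R 1 x - R 0 x) = (\<lambda>x. (w 1 x - w 0 x) - ?qd x)" by (auto simp: q_def)
    have "L2_inner \<Omega> (\<lambda>x. R 1 x - R 0 x) v = L2_inner \<Omega> (w 1) v - L2_inner \<Omega> (w 0) v - L2_inner \<Omega> ?qd v"
      unfolding Rd L.left(2)[OF L.closed(2)[OF wL2[OF mN(1)] wL2[OF mN(2)]] qd vL2] L.left(2)[OF wL2[OF mN(1)] wL2[OF mN(2)] vL2] ..
    then have RD: "L2_inner \<Omega> (\<lambda>x. R 1 x - R 0 x) v = L2_inner \<Omega> (u k) v - L2_inner \<Omega> (u 0) v - L2_inner \<Omega> ?qd v"
      by (simp add: w_def)
    have Ev: "E n v = 2 / k\<^sup>2 * L2_inner \<Omega> (\<lambda>x. R 1 x - R 0 x) v - (L2_inner \<Omega> (W k) v + L2_inner \<Omega> (W 0) v) / 2 - 2 / k * L2_inner \<Omega> (ut 0) v"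
      using True fn(2)[OF mN(1)] W0 vL2 by (simp add: E_def v0v[OF v] L.left(1,4) L.closed)
    \<comment> \<open>Separates the Ritz error of the first increment from the Taylor remainder
      estimated by \<open>first_step_error\<close>.\<close>
    have eq: "E n v = (- 2 * L2_inner \<Omega> ?qd v + (2 * (L2_inner \<Omega> (u k) v - L2_inner \<Omega> (u 0) v - k * L2_inner \<Omega> (ut 0) v)
        - k\<^sup>2 * ((L2_inner \<Omega> (W 0) v + L2_inner \<Omega> (W k) v) / 2))) / k\<^sup>2"
      unfolding Ev RD using k by (simp add: divide_simps power2_eq_square)
    have t1: "\<bar>- 2 * L2_inner \<Omega> ?qd v\<bar> \<le> (2 * (C2 * H * (k * a1))) * L2_norm \<Omega> v"
    proof -
      have "\<bar>L2_inner \<Omega> ?qd v\<bar> \<le> L2_norm \<Omega> ?qd * L2_norm \<Omega> v" by (rule L2_inner_le[OF qd vL2])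
      also have "\<dots> \<le> (C2 * H * (k * a1)) * L2_norm \<Omega> v" by (rule mult_right_mono[OF q1]) simp
      finally show ?thesis by simp
    qed
    have t2: "\<bar>2 * (L2_inner \<Omega> (u k) v - L2_inner \<Omega> (u 0) v - k * L2_inner \<Omega> (ut 0) v)
        - k\<^sup>2 * ((L2_inner \<Omega> (W 0) v + L2_inner \<Omega> (W k) v) / 2)\<bar> \<le> (2 * k ^ 3 * b3) * L2_norm \<Omega> v"
      using st[OF vL2, of k] k grid[of 1] mN by (simp add: mult.assoc)
    show ?thesis
      by (rule Lle[OF eq t1 t2]) (use k True in \<open>auto simp: e_def field_simps power2_eq_square power3_eq_cube\<close>)
  next
    case False
    then have n1: "1 \<le> n" by simp
    have vL2: "v \<in> L2_space \<Omega>" by (rule L2[OF v])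
    have nN: "n + 1 \<le> N" "n \<le> N" "n - 1 \<le> N" using n m1 by auto
    let ?qd = "\<lambda>x. q (n+1) x - 2 * q n x + q (n-1) x" and ?wd = "\<lambda>x. w (n+1) x - 2 * w n x + w (n-1) x"
    have qd: "?qd \<in> L2_space \<Omega>" by (intro L2_space_add L2_space_diff L2_space_cmult qL2 nN)
    have wd: "?wd \<in> L2_space \<Omega>" by (intro L2_space_add L2_space_diff L2_space_cmult wL2 nN)
    have Rd: "(\<lambda>x. (R (n+1) x - 2 * R n x + R (n-1) x) / k\<^sup>2) = (\<lambda>x. (?wd x - ?qd x) / k\<^sup>2)" by (auto simp: q_def)
    have wdv: "L2_inner \<Omega> ?wd v = L2_inner \<Omega> (w (n+1)) v - 2 * L2_inner \<Omega> (w n) v + L2_inner \<Omega> (w (n-1)) v"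
      using wL2[OF nN(1)] wL2[OF nN(2)] wL2[OF nN(3)] vL2 by (simp add: L.left L.closed)
    have eq: "E n v = (- L2_inner \<Omega> ?qd v + (L2_inner \<Omega> (w (n+1)) v - 2 * L2_inner \<Omega> (w n) v + L2_inner \<Omega> (w (n-1)) v
        - k\<^sup>2 * L2_inner \<Omega> (W (real n * k)) v)) / k\<^sup>2"
    proof -
      have "E n v = (L2_inner \<Omega> ?wd v - L2_inner \<Omega> ?qd v) / k\<^sup>2 - L2_inner \<Omega> (W (real n * k)) v"
        unfolding E_def Rd L2_inner_divide L.left(2)[OF wd qd vL2] using False by simp
      moreover have "(a - b) / k\<^sup>2 - c = (- b + (a - k\<^sup>2 * c)) / k\<^sup>2" for a b c :: real using k by (simp add: field_simps)
      ultimately show ?thesis unfolding wdv by simp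
    qed
    have t1: "\<bar>- L2_inner \<Omega> ?qd v\<bar> \<le> (C2 * H * (2 * k * I2 n)) * L2_norm \<Omega> v"
    proof -
      have "\<bar>L2_inner \<Omega> ?qd v\<bar> \<le> L2_norm \<Omega> ?qd * L2_norm \<Omega> v" by (rule L2_inner_le[OF qd vL2])
      also have "\<dots> \<le> (C2 * H * (2 * k * I2 n)) * L2_norm \<Omega> v" by (rule mult_right_mono[OF q2[OF n1 n]]) simp
      finally show ?thesis by simp
    qed
    have g3: "real (n+1) * k = real n * k + k" "real (n-1) * k = real n * k - k" using n1 by (auto simp: of_nat_diff algebra_simps)
    have t2: "\<bar>L2_inner \<Omega> (w (n+1)) v - 2 * L2_inner \<Omega> (w n) v + L2_inner \<Omega> (w (n-1)) v
        - k\<^sup>2 * L2_inner \<Omega> (W (real n * k)) v\<bar> \<le> (k ^ 3 * I4 n) * L2_norm \<Omega> v"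
      using tr[OF vL2, of k "real n * k"] k gn[OF n1 n] unfolding w_def g3 I4_def by (simp add: mult.assoc)
    show ?thesis
      by (rule Lle[OF eq t1 t2]) (use k False in \<open>auto simp: e_def field_simps power2_eq_square power3_eq_cube\<close>)
  qed
  have stability: "L2_norm \<Omega> (\<theta> (m+1)) \<le> 2 * (real (m+1) * k) *
    (k * e 0 + 5 * ((cf + b2) * (E0 * H)) + 4 * k * (\<Sum>n=1..m. e n) + 2 * (E0 * H) * (\<Sum>n=1..<m. \<gamma>' n))"
  proof (rule discrete_stability[where Vh=Vh and ah=ah and P=P and g=g and E=E, OF V psd k cfl PL2 _ _ _ _ _ _ _ _ Eb _ _ _ m1(1)])
    show "P (\<lambda>x. a * v x + b * z x) = (\<lambda>x. a * P v x + b * P z x)" if "v \<in> Vh" "z \<in> Vh" for v z a b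
      unfolding P_def Q(2)[OF that] by (auto simp: algebra_simps)
    show "L2_norm \<Omega> (P v) \<le> E0 * H * sqrt (ah v v)" if "v \<in> Vh" for v unfolding P_def by (rule Q(3)[OF that])
    show "0 \<le> E0 * H" using E0 H by simp
    show "\<theta> n \<in> Vh" if "n \<le> m + 1" for n unfolding \<theta>_def by (rule A.closed(2)) (use RnV UV that m1 in auto)
    show "\<theta> 0 = (\<lambda>x. 0)" by (simp add: \<theta>_def U0)
    have nN: "n \<le> N" if "n \<le> m" for n using that m1 by simp
    show "g n \<in> L2_space \<Omega>" if "n \<le> m" for n unfolding g_def using fn[OF nN[OF that]] by (rule L2_space_diff)
    show "L2_norm \<Omega> (g n) \<le> cf + b2" if "n \<le> m" for n
      unfolding g_def using L2_norm_diff_le[OF fn[OF nN[OF that]]] fb(1)[OF grid[OF nN[OF that]]] Wb[OF grid[OF nN[OF that]]] by simp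
    show "L2_norm \<Omega> (\<lambda>x. g (n+1) x - g n x) \<le> \<gamma>' n" if n: "1 \<le> n" "n < m" for n
    proof -
      have nn: "n + 1 \<le> N" "n \<le> N" using n m1 by auto
      have b: "0 \<le> real n * k" "real n * k \<le> real (n+1) * k" "real (n+1) * k \<le> T" using k grid[OF nn(1)] by (auto simp: algebra_simps)
      have "(\<lambda>x. g (n+1) x - g n x) = (\<lambda>x. (f (real (n+1) * k) x - f (real n * k) x) - (W (real (n+1) * k) x - W (real n * k) x))"
        by (auto simp: g_def)
      then have "L2_norm \<Omega> (\<lambda>x. g (n+1) x - g n x) \<le> L2_norm \<Omega> (\<lambda>x. f (real (n+1) * k) x - f (real n * k) x) + L2_norm \<Omega> (\<lambda>x. W (real (n+1) * k) x - W (real n * k) x)"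
        using L2_norm_diff_le[OF L2_space_diff[OF fn(1)[OF nn(1)] fn(1)[OF nn(2)]] L2_space_diff[OF fn(2)[OF nn(1)] fn(2)[OF nn(2)]]] by simp
      also have "\<dots> \<le> \<gamma>' n" unfolding \<gamma>'_def \<nu>f_def by (intro add_mono fb(2) Wd b)
      finally show ?thesis .
    qed
    show "0 \<le> e n" if "n \<le> m" for n
      using C2 H k nonneg I2_0[of n] I4_0[of n] that by (cases "n = 0") (auto simp: e_def)
    show "2 / k * L2_inner \<Omega> (\<lambda>x. \<theta> 1 x / k) v + ah (\<lambda>x. \<theta> 1 x / 2) v = E 0 v + L2_inner \<Omega> (\<lambda>x. (g 1 x + g 0 x) / 2) (P v)"
      if v: "v \<in> Vh" for v
    proof -
      have vL2: "v \<in> L2_space \<Omega>" by (rule L2[OF v])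
      have N1: "1 \<le> N" "0 \<le> N" using m1 by auto
      have sch: "2 / k * L2_inner \<Omega> (diff_quot k U 0) v + ah (half_avg U 0) v =
          L2_inner \<Omega> (\<lambda>x. half_avg (\<lambda>n. f (real n * k)) 0 x + 2 / k * v0 x) v"
        using U v by (simp add: explicit_scheme_def)
      note mem = RL2[OF N1(1)] RL2[OF N1(2)] UL2[OF N1(1)] fn(1)[OF N1(1)] fn(1)[OF N1(2)] fn(2)[OF N1(1)] fn(2)[OF N1(2)] v0L2 vL2
      note memV = RnV[OF N1(1)] RnV[OF N1(2)] UV[OF N1(1)] v
      have l1: "2 / k * ((L2_inner \<Omega> (U 1) v - L2_inner \<Omega> (R 0) v) / k) + (ah (U 1) v + ah (R 0) v) / 2
          = (L2_inner \<Omega> (f (real 1 * k)) v + L2_inner \<Omega> (f (real 0 * k)) v) / 2 + 2 / k * L2_inner \<Omega> v0 v"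
        using sch mem memV by (simp add: diff_quot_def half_avg_def U0 L.left L.closed A.left A.closed)
      have l2: "L2_inner \<Omega> (\<lambda>x. (g 1 x + g 0 x) / 2) (P v)
          = (a_form \<Omega> (w 1) (Q v) - L2_inner \<Omega> (f (real 1 * k)) v + L2_inner \<Omega> (W (real 1 * k)) v
            + (a_form \<Omega> (w 0) (Q v) - L2_inner \<Omega> (f (real 0 * k)) v + L2_inner \<Omega> (W (real 0 * k)) v)) / 2"
      proof -
        have g01: "g 1 \<in> L2_space \<Omega>" "g 0 \<in> L2_space \<Omega>" unfolding g_def by (intro L2_space_diff fn N1)+
        show ?thesis unfolding L.left(4)[OF L.closed(1)[OF g01] PL2[OF v]] L.left(1)[OF g01 PL2[OF v]] gP[OF N1(1) v] gP[OF N1(2) v] ..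
      qed
      have l3: "2 / k * L2_inner \<Omega> (\<lambda>x. \<theta> 1 x / k) v = 2 / k * ((L2_inner \<Omega> (R 1) v - L2_inner \<Omega> (U 1) v) / k)"
        unfolding \<theta>_def using mem by (simp add: L.left L.closed)
      have l4: "ah (\<lambda>x. \<theta> 1 x / 2) v = (ah (R 1) v - ah (U 1) v) / 2"
        unfolding \<theta>_def using memV by (simp add: A.left A.closed)
      have l5: "E 0 v = 2 / k\<^sup>2 * (L2_inner \<Omega> (R 1) v - L2_inner \<Omega> (R 0) v) - (L2_inner \<Omega> (W (real 1 * k)) v + L2_inner \<Omega> (W (real 0 * k)) v) / 2 - 2 / k * L2_inner \<Omega> v0 v"
        unfolding E_def using mem by (simp add: L.left L.closed)
      have l6: "ah (R 1) v = a_form \<Omega> (w 1) (Q v)" "ah (R 0) v = a_form \<Omega> (w 0) (Q v)" by (rule Rah[OF N1(1) v], rule Rah[OF N1(2) v])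
      \<comment> \<open>All pairings become real variables; the starting equation eliminates those
        of U(1).\<close>
      have arith: "2 / k * ((r1 - x1) / k) + (b1 - y1) / 2 = 2 / k\<^sup>2 * (r1 - r0) - (z1 + z0) / 2 - 2 / k * p + (b1 - f1 + z1 + (b0 - f0 + z0)) / 2"
        if "2 / k * ((x1 - r0) / k) + (y1 + b0) / 2 = (f1 + f0) / 2 + 2 / k * p" for r1 r0 x1 y1 b1 b0 z1 z0 p f1 f0 :: real
      proof -
        have "2 / k * ((r1 - x1) / k) = 2 / k\<^sup>2 * (r1 - r0) - 2 / k * ((x1 - r0) / k)"
          using k by (simp add: field_simps power2_eq_square)
        then show ?thesis using that by argo
      qed
      show ?thesis unfolding l2 l3 l4 l5 l6(1) by (rule arith) (use l1 l6(2) in simp)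
    qed
    show "L2_inner \<Omega> (\<lambda>x. (\<theta> (n+1) x - 2 * \<theta> n x + \<theta> (n-1) x) / k\<^sup>2) v + ah (\<theta> n) v = E n v + L2_inner \<Omega> (g n) (P v)"
      if n: "1 \<le> n" "n \<le> m" and v: "v \<in> Vh" for n v
    proof -
      have vL2: "v \<in> L2_space \<Omega>" by (rule L2[OF v])
      have n3: "n + 1 \<le> N" "n \<le> N" "n - 1 \<le> N" "n \<in> {1..N-1}" using n m1 by auto
      have sch: "L2_inner \<Omega> (\<lambda>x. (U (n+1) x - 2 * U n x + U (n-1) x) / k\<^sup>2) v + ah (U n) v = L2_inner \<Omega> (f (real n * k)) v"
        using U v n3(4) by (simp add: explicit_scheme_def diff_quot2_def)
      let ?Rd = "\<lambda>x. R (n+1) x - 2 * R n x + R (n-1) x" and ?Ud = "\<lambda>x. U (n+1) x - 2 * U n x + U (n-1) x"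
      have Rd: "?Rd \<in> L2_space \<Omega>" and Ud: "?Ud \<in> L2_space \<Omega>"
        by (intro L2_space_add L2_space_diff L2_space_cmult RL2 UL2 n3)+
      have \<theta>eq: "(\<lambda>x. (\<theta> (n+1) x - 2 * \<theta> n x + \<theta> (n-1) x) / k\<^sup>2) = (\<lambda>x. (?Rd x - ?Ud x) / k\<^sup>2)" by (auto simp: \<theta>_def)
      have "L2_inner \<Omega> (\<lambda>x. (\<theta> (n+1) x - 2 * \<theta> n x + \<theta> (n-1) x) / k\<^sup>2) v
          = L2_inner \<Omega> (\<lambda>x. ?Rd x / k\<^sup>2) v - L2_inner \<Omega> (\<lambda>x. ?Ud x / k\<^sup>2) v"
        unfolding \<theta>eq L2_inner_divide L.left(2)[OF Rd Ud vL2] by (rule diff_divide_distrib)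
      moreover have "ah (\<theta> n) v = a_form \<Omega> (w n) (Q v) - ah (U n) v"
        unfolding \<theta>_def A.left(2)[OF RnV[OF n3(2)] UV[OF n3(2)] v] Rah[OF n3(2) v] ..
      ultimately show ?thesis using sch gP[OF n3(2) v] n(1) by (simp add: E_def)
    qed
  qed
  have ke0: "k * e 0 = 2 * C2 * H * a1 + 2 * k\<^sup>2 * b3" using k by (simp add: e_def field_simps power2_eq_square)
  have kes: "k * (\<Sum>n=1..m. e n) \<le> 4 * C2 * H * (sqrt T * c2) + 2 * k\<^sup>2 * (sqrt T * c4)"
  proof -
    have "k * (\<Sum>n=1..m. e n) = (\<Sum>n=1..m. 2 * C2 * H * I2 n + k\<^sup>2 * I4 n)"
      unfolding sum_distrib_left by (rule sum.cong) (use k in \<open>auto simp: e_def field_simps power2_eq_square\<close>)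
    also have "\<dots> = 2 * C2 * H * (\<Sum>n=1..m. I2 n) + k\<^sup>2 * (\<Sum>n=1..m. I4 n)" by (simp add: sum.distrib sum_distrib_left)
    also have "\<dots> \<le> 2 * C2 * H * (2 * (sqrt T * c2)) + k\<^sup>2 * (2 * (sqrt T * c4))"
      using S2 S4 C2 H by (intro add_mono mult_left_mono) auto
    finally show ?thesis by simp
  qed
  have gs: "(\<Sum>n=1..<m. \<gamma>' n) \<le> sqrt T * (cf1 + c3)"
    using grid_integral_sums(2)[OF \<nu>fi \<nu>f0 k gT] grid_integral_sums(2)[OF \<nu>_integrable(2) \<nu>_nonneg(2) k gT] \<nu>ft \<nu>_total(2)
    by (simp add: \<gamma>'_def sum.distrib distrib_left)
  let ?B = "2 * C2 * H * a1 + 2 * k\<^sup>2 * b3 + 5 * ((cf + b2) * (E0 * H)) + 4 * (4 * C2 * H * (sqrt T * c2) + 2 * k\<^sup>2 * (sqrt T * c4)) + 2 * (E0 * H) * (sqrt T * (cf1 + c3))"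
  have SB: "k * e 0 + 5 * ((cf + b2) * (E0 * H)) + 4 * k * (\<Sum>n=1..m. e n) + 2 * (E0 * H) * (\<Sum>n=1..<m. \<gamma>' n) \<le> ?B"
  proof -
    have "2 * (E0 * H) * (\<Sum>n=1..<m. \<gamma>' n) \<le> 2 * (E0 * H) * (sqrt T * (cf1 + c3))" using gs E0 H by (intro mult_left_mono) auto
    moreover have "4 * k * (\<Sum>n=1..m. e n) \<le> 4 * (4 * C2 * H * (sqrt T * c2) + 2 * k\<^sup>2 * (sqrt T * c4))" using kes by simp
    ultimately show ?thesis using ke0 by (intro add_mono) auto
  qed
  have B0: "0 \<le> ?B" using C2 H E0 cf cf1 nonneg T0 by simp
  have "L2_norm \<Omega> (\<theta> (m+1)) \<le> 2 * (real (m+1) * k) * ?B"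
    by (rule order_trans[OF stability mult_left_mono[OF SB]]) (use mk in simp)
  also have "\<dots> \<le> 2 * T * ?B" using gT by (intro mult_right_mono B0) simp
  finally have \<theta>b: "L2_norm \<Omega> (\<theta> (m+1)) \<le> H * (2 * T * (2 * C2 * a1 + 5 * E0 * (cf + b2) + 16 * C2 * sqrt T * c2 + 2 * E0 * sqrt T * (cf1 + c3)))
      + k\<^sup>2 * (2 * T * (2 * b3 + 8 * sqrt T * c4))" by (simp add: algebra_simps)
  have tri: "L2_norm \<Omega> (\<lambda>x. q (m+1) x + \<theta> (m+1) x) \<le> L2_norm \<Omega> (q (m+1)) + L2_norm \<Omega> (\<theta> (m+1))"
    by (rule L2_norm_add_le[OF qL2[OF m1(2)]]) (unfold \<theta>_def, intro L2_space_diff RL2 UL2 m1)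
  have split: "(\<lambda>x. u (real (m + 1) * k) x - U (m + 1) x) = (\<lambda>x. q (m+1) x + \<theta> (m+1) x)"
    by (auto simp: q_def \<theta>_def w_def)
  have "n \<le> H * (x1 + x2) + c" if "n \<le> a + b" "a \<le> H * x1" "b \<le> H * x2 + c" for n a b c x1 x2 :: real
    using that by (simp add: distrib_left)
  from this[OF tri consistency \<theta>b] show ?thesis unfolding split .
qed

end

section \<open>Constants, near-optimal representatives and the final bound\<close>

text \<open>Since \<gamma> \<le> 1, part of h^2 is traded for a power of the bound \<open>D\<close>,
  leaving the rate h^(2\<gamma>) of the Ritz projection.\<close>

lemma powr_split_le:
  fixes h D \<gamma> :: real
  assumes "0 < h" "h \<le> D" "\<gamma> \<le> 1"
  shows "h\<^sup>2 \<le> D powr (2 - 2 * \<gamma>) * h powr (2 * \<gamma>)"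
proof -
  have "h\<^sup>2 = h powr ((2 - 2 * \<gamma>) + 2 * \<gamma>)" using assms(1) by simp
  also have "\<dots> = h powr (2 - 2 * \<gamma>) * h powr (2 * \<gamma>)" by (rule powr_add)
  also have "\<dots> \<le> D powr (2 - 2 * \<gamma>) * h powr (2 * \<gamma>)" using assms by (intro mult_right_mono powr_mono2) auto
  finally show ?thesis .
qed

text \<open>The infimum need not be attained, so a member within \<epsilon> of it is chosen;
  finiteness also guarantees that there is a member at all, as the infimum over the empty set is
  \<infinity>.\<close>

lemma INF_finite_near:
  fixes F :: "'a \<Rightarrow> ennreal"
  assumes "(INF g\<in>A. F g) \<noteq> \<infinity>" "0 < \<epsilon>"
  obtains g where "g \<in> A" "F g \<le> ennreal (enn2real (INF g\<in>A. F g) + \<epsilon>)"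
proof -
  have eq: "ennreal (enn2real (INF g\<in>A. F g)) = (INF g\<in>A. F g)"
    by (rule ennreal_enn2real) (use assms(1) in \<open>metis infinity_ennreal_def top.not_eq_extremum\<close>)
  have "ennreal (enn2real (INF g\<in>A. F g)) < ennreal (enn2real (INF g\<in>A. F g) + \<epsilon>)"
    using assms(2) by (intro ennreal_lessI) (simp_all add: add_nonneg_pos)
  then have "(INF g\<in>A. F g) < ennreal (enn2real (INF g\<in>A. F g) + \<epsilon>)" unfolding eq .
  then obtain g where "g \<in> A" "F g < ennreal (enn2real (INF g\<in>A. F g) + \<epsilon>)" unfolding INF_less_iff by blast
  then show ?thesis using that less_imp_le by blast
qed

text \<open>Origin of \<open>E0\<close>: \<open>C1\<close> 0 comes from the smoother estimate of
  order 0, the power of the diameter from \<open>powr_split_le\<close>, and 1 / sqrt \<alpha> from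
  coercivity.\<close>

lemma smoother_energy_bound:
  assumes \<Omega>: "bounded \<Omega>" "\<Omega> \<noteq> {}" "open \<Omega>" and \<T>: "triangulation_of \<Omega> \<T>"
    and sm: "smoother_estimate \<Omega> \<T> Vh C1 Q" and C1: "0 < C1 0" and \<alpha>: "0 < \<alpha>" and \<gamma>: "\<gamma> \<le> 1"
    and ah: "discrete_form \<Omega> \<T> Vh \<alpha> \<beta> ah" and v: "v \<in> Vh"
  shows "L2_norm \<Omega> (\<lambda>x. Q v x - v x)
    \<le> C1 0 * diameter \<Omega> powr (2 - 2 * \<gamma>) / sqrt \<alpha> * mesh_size \<T> powr (2 * \<gamma>) * sqrt (ah v v)"
proof -
  note tri = triangulation_mesh[OF \<Omega>(1,2) \<T>]
  have "sqrt (\<alpha> * (h_norm \<T> v)\<^sup>2) \<le> sqrt (ah v v)" using ah v by (simp add: discrete_form_def)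
  then have hn: "h_norm \<T> v \<le> sqrt (ah v v) / sqrt \<alpha>"
    using \<alpha> h_norm_nonneg[of \<T> v] by (simp add: real_sqrt_mult field_simps)
  have "L2_norm \<Omega> (\<lambda>x. Q v x - v x) = L2_norm \<Omega> (\<lambda>x. (-1) * (v x - Q v x))" by simp
  also have "\<dots> = L2_norm \<Omega> (\<lambda>x. v x - Q v x)" unfolding L2_norm_cmult by simp
  also have "\<dots> \<le> C1 0 * (mesh_size \<T>)\<^sup>2 * h_norm \<T> v" by (rule smoother_L2_bound(2)[where Vh=Vh, OF \<Omega> \<T> sm C1 v])
  also have "\<dots> \<le> C1 0 * (diameter \<Omega> powr (2 - 2 * \<gamma>) * mesh_size \<T> powr (2 * \<gamma>)) * (sqrt (ah v v) / sqrt \<alpha>)"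
    using powr_split_le[OF tri(2,3) \<gamma>] C1 hn h_norm_nonneg[of \<T> v] by (intro mult_mono) auto
  finally show ?thesis by (simp add: field_simps)
qed

lemma smoother_linear:
  assumes V: "Vh \<subseteq> broken_Hm \<T> 2" and IM: "morley_interpolation \<Omega> \<T> IM" and J: "companion_operator \<Omega> \<T> J"
    and v: "v \<in> Vh" and w: "w \<in> Vh"
  shows "(J \<circ> IM) v \<in> H20 \<Omega>"
    and "(J \<circ> IM) (\<lambda>x. a * v x + b * w x) = (\<lambda>x. a * (J \<circ> IM) v x + b * (J \<circ> IM) w x)"
proof -
  have b: "v \<in> broken_Hm \<T> 2" "w \<in> broken_Hm \<T> 2" using V v w by auto
  have m: "IM v \<in> morley_space \<Omega> \<T>" "IM w \<in> morley_space \<Omega> \<T>" using IM b by (auto simp: morley_interpolation_def)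
  show "(J \<circ> IM) v \<in> H20 \<Omega>" using J m(1) by (auto simp: companion_operator_def)
  have "IM (\<lambda>x. a * v x + b * w x) = (\<lambda>x. a * IM v x + b * IM w x)"
    using IM b unfolding morley_interpolation_def linear_op_on_def by blast
  moreover have "J (\<lambda>x. a * IM v x + b * IM w x) = (\<lambda>x. a * J (IM v) x + b * J (IM w) x)"
    using J m unfolding companion_operator_def linear_op_on_def by blast
  ultimately show "(J \<circ> IM) (\<lambda>x. a * v x + b * w x) = (\<lambda>x. a * (J \<circ> IM) v x + b * (J \<circ> IM) w x)" by simp
qed

text \<open>In \<open>cH\<close>, the coefficients 6 = 2 + 4 and 36 = 4 + 32 add the direct Ritz
  error of u to its effect through the residual; 4 T and 16 T sqrt T are the coefficients of the two
  Taylor terms. A single constant then covers all of them.\<close>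

lemma scheme_error_bound:
  fixes \<Omega> :: "(real^2) set" and T \<gamma> \<alpha> \<beta> C2 :: real and C1 :: "real \<Rightarrow> real"
  assumes \<Omega>: "polygonal_lipschitz_domain \<Omega>" and T: "T > 0" and \<gamma>: "\<gamma> \<le> 1" and \<alpha>: "\<alpha> > 0" and \<beta>: "\<beta> > 0"
    and C1: "0 < C1 0" and C2: "C2 > 0"
    and E0: "E0 = C1 0 * diameter \<Omega> powr (2 - 2 * \<gamma>) / sqrt \<alpha>"
    and cH: "cH = C2 + 6 * T * C2 + 36 * T * sqrt T * C2 + 10 * T * E0 + 4 * T * E0 * sqrt T"
    and \<T>: "triangulation_of \<Omega> \<T>" and h: "h = mesh_size \<T>"
    and V: "finite_dim_space Vh" "Vh \<subseteq> broken_Hm \<T> 2" and ah: "discrete_form \<Omega> \<T> Vh \<alpha> \<beta> ah"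
    and inv: "inverse_inequality \<Omega> \<T> Vh Cinv" and IM: "morley_interpolation \<Omega> \<T> IM" and J: "companion_operator \<Omega> \<T> J"
    and sm: "smoother_estimate \<Omega> \<T> Vh C1 (J \<circ> IM)"
    and Rh: "ritz_projection \<Omega> Vh ah (J \<circ> IM) Rh" "ritz_estimate \<Omega> \<T> \<gamma> C2 Rh"
    and f: "time_continuous (L2_enorm \<Omega>) T f" and sol: "weak_solution \<Omega> T f u0 v0 u"
    and N: "N > 0" "k = T / real N" and U: "explicit_scheme \<Omega> Vh ah Rh k N f u0 v0 U"
    and cfl: "k \<le> \<beta> powr (-1/2) * inverse Cinv * h\<^sup>2" and m: "m \<in> {1..N-1}"
    and p0: "has_time_deriv \<Omega> T 0 f p0" "Linf_time_norm (L2_enorm \<Omega>) T p0 \<le> ennreal cf"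
    and p1: "has_time_deriv \<Omega> T 1 f p1" "L2_time_norm (L2_enorm \<Omega>) T p1 \<le> ennreal cf1"
    and g0: "has_time_deriv \<Omega> T 0 u g0" "Linf_time_norm (sobolev_norm \<Omega> (2 + \<gamma>)) T g0 \<le> ennreal a0"
    and g1: "has_time_deriv \<Omega> T 1 u g1" "Linf_time_norm (sobolev_norm \<Omega> (2 + \<gamma>)) T g1 \<le> ennreal a1"
    and g2: "has_time_deriv \<Omega> T 2 u g2" "Linf_time_norm (L2_enorm \<Omega>) T g2 \<le> ennreal b2"
    and h2: "has_time_deriv \<Omega> T 2 u h2" "L2_time_norm (sobolev_norm \<Omega> (2 + \<gamma>)) T h2 \<le> ennreal c2"
    and g3: "has_time_deriv \<Omega> T 3 u g3" "L2_time_norm (L2_enorm \<Omega>) T g3 \<le> ennreal c3"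
    and h3: "has_time_deriv \<Omega> T 3 u h3" "Linf_time_norm (L2_enorm \<Omega>) T h3 \<le> ennreal b3"
    and g4: "has_time_deriv \<Omega> T 4 u g4" "L2_time_norm (L2_enorm \<Omega>) T g4 \<le> ennreal c4"
    and nonneg: "0 \<le> cf" "0 \<le> cf1" "0 \<le> a0" "0 \<le> a1" "0 \<le> b2" "0 \<le> c2" "0 \<le> c3" "0 \<le> b3" "0 \<le> c4"
  shows "L2_norm \<Omega> (\<lambda>x. u (real (m + 1) * k) x - U (m + 1) x)
    \<le> (cH + 4 * T + 16 * T * sqrt T) * (h powr (2 * \<gamma>) * (cf + cf1 + a0 + a1 + b2 + c2 + c3) + k\<^sup>2 * (b3 + c4))"
proof -
  have dom: "open \<Omega>" "bounded \<Omega>" "\<Omega> \<noteq> {}" using \<Omega> by (auto simp: polygonal_lipschitz_domain_def)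
  note tri = triangulation_mesh[OF dom(2,3) \<T>]
  obtain ut where ut: "time_continuous (L2_enorm \<Omega>) T ut"
    "\<And>t. t \<in> {0..T} \<Longrightarrow> ((\<lambda>s. L2_enorm \<Omega> (\<lambda>x. (u s x - u t x) / (s - t) - ut t x)) \<longlongrightarrow> 0) (at t within {0..T})"
    "\<And>v t. v \<in> H20 \<Omega> \<Longrightarrow> t \<in> {0..T} \<Longrightarrow> \<exists>d. ((\<lambda>s. L2_inner \<Omega> (ut s) v) has_real_derivative d) (at t within {0..T}) \<and>
        d + a_form \<Omega> (u t) v = L2_inner \<Omega> (f t) v"
    "AE x in lebesgue_on \<Omega>. u 0 x = u0 x" "AE x in lebesgue_on \<Omega>. ut 0 x = v0 x"
    using sol unfolding weak_solution_def by (elim exE conjE) simp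
  interpret RS: regular_solution \<Omega> T "2 + \<gamma>" u ut f g0 g1 g2 h2 g3 h3 g4 a0 a1 b2 c2 c3 b3 c4
    by unfold_locales (fact dom(1) T ut g0 g1 g2 h2 g3 h3 g4 nonneg | use sol in \<open>simp add: weak_solution_def\<close>)+
  let ?H = "h powr (2 * \<gamma>)"
  have E0': "0 \<le> E0" unfolding E0 using C1 \<alpha> by simp
  have "0 < k" using N T by simp
  note est = RS.error_estimate[OF f p0 nonneg(1) p1 nonneg(2), of \<gamma> Vh ah "J \<circ> IM" E0 ?H C2 Rh u0 v0 N k U m]
  have VL2: "Vh \<subseteq> L2_space \<Omega>"
  proof
    fix v assume "v \<in> Vh"
    then have "v \<in> Hm_space (interior K) 2" if "K \<in> \<T>" for K using V(2) that by (auto simp: broken_Hm_def)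
    then show "v \<in> L2_space \<Omega>" by (intro broken_L2[OF dom(2,3,1) \<T>] Hm_space_L2) auto
  qed
  have psd: "0 \<le> ah v v" if "v \<in> Vh" for v
  proof -
    have "\<alpha> * (h_norm \<T> v)\<^sup>2 \<le> ah v v" using ah that by (simp add: discrete_form_def)
    then show ?thesis using \<alpha> by (meson mult_nonneg_nonneg less_imp_le order_trans zero_le_power2)
  qed
  have ritz: "L2_norm \<Omega> (\<lambda>x. z x - Rh z x) \<le> C2 * ?H * enn2real (sobolev_norm \<Omega> (2 + \<gamma>) z)"
    if "z \<in> H20 \<Omega> \<inter> Hs_space \<Omega> (2 + \<gamma>)" for z
  proof -
    have "0 \<le> mesh_size \<T> powr \<gamma> * h_norm \<T> (\<lambda>x. z x - Rh z x)" using h_norm_nonneg by simp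
    moreover have "L2_norm \<Omega> (\<lambda>x. z x - Rh z x) + mesh_size \<T> powr \<gamma> * h_norm \<T> (\<lambda>x. z x - Rh z x)
        \<le> C2 * mesh_size \<T> powr (2 * \<gamma>) * enn2real (sobolev_norm \<Omega> (2 + \<gamma>) z)"
      using Rh(2) that unfolding ritz_estimate_def by blast
    ultimately show ?thesis unfolding h by linarith
  qed
  have "L2_norm \<Omega> (\<lambda>x. u (real (m + 1) * k) x - U (m + 1) x)
    \<le> ?H * (C2 * (a0 + 2 * T * a1 + 4 * T * sqrt T * c2)
        + 2 * T * (2 * C2 * a1 + 5 * E0 * (cf + b2) + 16 * C2 * sqrt T * c2 + 2 * E0 * sqrt T * (cf1 + c3)))
      + k\<^sup>2 * (2 * T * (2 * b3 + 8 * sqrt T * c4))"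
  proof (rule est)
    show "sym_bilinear_space Vh ah" by (rule discrete_form_bilinear[OF V ah IM])
    show "(J \<circ> IM) v \<in> H20 \<Omega>" if "v \<in> Vh" for v by (rule smoother_linear(1)[OF V(2) IM J that that])
    show "(J \<circ> IM) (\<lambda>x. a * v x + b * w x) = (\<lambda>x. a * (J \<circ> IM) v x + b * (J \<circ> IM) w x)" if "v \<in> Vh" "w \<in> Vh" for v w a b
      by (rule smoother_linear(2)[OF V(2) IM J that])
    show "L2_norm \<Omega> (\<lambda>x. (J \<circ> IM) v x - v x) \<le> E0 * ?H * sqrt (ah v v)" if "v \<in> Vh" for v
      unfolding E0 h by (rule smoother_energy_bound[OF dom(2,3,1) \<T> sm C1 \<alpha> \<gamma> ah that])
    show "k\<^sup>2 * ah v v \<le> (L2_norm \<Omega> v)\<^sup>2" if "v \<in> Vh" for v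
      by (rule cfl_energy_bound[OF ah inv tri(2) \<beta> \<open>0 < k\<close> cfl[unfolded h] that])
  qed (fact refl VL2 psd E0' Rh(1) ritz ut(4,5) N U m | use C2 in simp)+
  also have "\<dots> \<le> ?H * (cH * (cf + cf1 + a0 + a1 + b2 + c2 + c3)) + k\<^sup>2 * ((4 * T + 16 * T * sqrt T) * (b3 + c4))"
  proof (intro add_mono mult_left_mono)
    define S where "S = cf + cf1 + a0 + a1 + b2 + c2 + c3"
    have le: "a0 \<le> S" "a1 \<le> S" "c2 \<le> S" "cf + b2 \<le> S" "cf1 + c3 \<le> S" unfolding S_def using nonneg by simp_all
    have "C2 * (a0 + 2 * T * a1 + 4 * T * sqrt T * c2)
        + 2 * T * (2 * C2 * a1 + 5 * E0 * (cf + b2) + 16 * C2 * sqrt T * c2 + 2 * E0 * sqrt T * (cf1 + c3))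
      = C2 * a0 + 6 * T * C2 * a1 + 36 * T * sqrt T * C2 * c2 + 10 * T * E0 * (cf + b2) + 4 * T * E0 * sqrt T * (cf1 + c3)"
      by (simp add: algebra_simps)
    also have "\<dots> \<le> C2 * S + 6 * T * C2 * S + 36 * T * sqrt T * C2 * S + 10 * T * E0 * S + 4 * T * E0 * sqrt T * S"
      using C2 T E0' by (intro add_mono mult_left_mono le) auto
    also have "\<dots> = cH * S" unfolding cH by (simp only: distrib_right)
    finally show "C2 * (a0 + 2 * T * a1 + 4 * T * sqrt T * c2)
        + 2 * T * (2 * C2 * a1 + 5 * E0 * (cf + b2) + 16 * C2 * sqrt T * c2 + 2 * E0 * sqrt T * (cf1 + c3))
      \<le> cH * (cf + cf1 + a0 + a1 + b2 + c2 + c3)" unfolding S_def .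
    have "2 * T * (2 * b3 + 8 * sqrt T * c4) = 4 * T * b3 + 16 * T * sqrt T * c4" by (simp add: algebra_simps)
    also have "\<dots> \<le> 4 * T * (b3 + c4) + 16 * T * sqrt T * (b3 + c4)" using T nonneg by (intro add_mono mult_left_mono) auto
    finally show "2 * T * (2 * b3 + 8 * sqrt T * c4) \<le> (4 * T + 16 * T * sqrt T) * (b3 + c4)" by (simp only: distrib_right)
  qed simp_all
  also have "\<dots> \<le> (cH + (4 * T + 16 * T * sqrt T)) * (?H * (cf + cf1 + a0 + a1 + b2 + c2 + c3)) + (cH + (4 * T + 16 * T * sqrt T)) * (k\<^sup>2 * (b3 + c4))"
  proof -
    have "0 \<le> cH" unfolding cH using C2 T E0' by simp
    then have "?H * (cH * (cf + cf1 + a0 + a1 + b2 + c2 + c3)) \<le> ?H * ((cH + (4 * T + 16 * T * sqrt T)) * (cf + cf1 + a0 + a1 + b2 + c2 + c3))"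
      "k\<^sup>2 * ((4 * T + 16 * T * sqrt T) * (b3 + c4)) \<le> k\<^sup>2 * ((cH + (4 * T + 16 * T * sqrt T)) * (b3 + c4))"
      using T nonneg by (intro mult_left_mono mult_right_mono; simp)+
    then show ?thesis by (simp only: mult.left_commute[of ?H] mult.left_commute[of "k\<^sup>2"] add_mono)
  qed
  finally show ?thesis by (simp only: distrib_left add.assoc)
qed

theorem corollary3p9:
  fixes \<Omega> :: "(real^2) set" and T \<gamma>\<^sub>0 \<alpha> \<beta> C\<^sub>2 :: real and C\<^sub>1 :: "real \<Rightarrow> real"
  assumes "polygonal_lipschitz_domain \<Omega>"
    and "T > 0"
    and "\<gamma>\<^sub>0 \<in> {1/2<..1}" and "elliptic_regularity \<Omega> \<gamma>\<^sub>0"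
    and "\<alpha> > 0" and "\<beta> > 0" and "\<And>s. s \<in> {0..2} \<Longrightarrow> C\<^sub>1 s > 0" and "C\<^sub>2 > 0"
  shows "\<exists>C>0. \<forall>\<T> \<kappa> q Vh ah Cinv IM J Rh N k h u0 v0 f ft ftt fttt u U.
      triangulation_of \<Omega> \<T> \<and> shape_regular \<kappa> \<T> \<and> quasi_uniform q \<T> \<and> h = mesh_size \<T> \<and>
      finite_dim_space Vh \<and> Vh \<subseteq> broken_Hm \<T> 2 \<and>
      discrete_form \<Omega> \<T> Vh \<alpha> \<beta> ah \<and>
      inverse_inequality \<Omega> \<T> Vh Cinv \<and>
      morley_interpolation \<Omega> \<T> IM \<and> companion_operator \<Omega> \<T> J \<and>
      smoother_estimate \<Omega> \<T> Vh C\<^sub>1 (J \<circ> IM) \<and>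
      ritz_projection \<Omega> Vh ah (J \<circ> IM) Rh \<and> ritz_estimate \<Omega> \<T> \<gamma>\<^sub>0 C\<^sub>2 Rh \<and>
      admissible_data \<Omega> T u0 v0 f ft ftt fttt \<and>
      weak_solution \<Omega> T f u0 v0 u \<and>
      N > 0 \<and> k = T / real N \<and>
      explicit_scheme \<Omega> Vh ah Rh k N f u0 v0 U \<and>
      k \<le> \<beta> powr (-1/2) * inverse Cinv * h\<^sup>2
      \<longrightarrow> (\<forall>m\<in>{1..N-1}.
            ennreal (L2_norm \<Omega> (\<lambda>x. u (real (m + 1) * k) x - U (m + 1) x))
              \<le> ennreal C * (ennreal (h powr (2 * \<gamma>\<^sub>0)) * L_fu \<Omega> \<gamma>\<^sub>0 T f u + ennreal (k\<^sup>2) * M_u \<Omega> T u))"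
proof -
  \<comment> \<open>The constant is explicit and built from quantities fixed before the mesh and the
    time step, which gives its independence of h and k.\<close>
  define E0 where "E0 = C\<^sub>1 0 * diameter \<Omega> powr (2 - 2 * \<gamma>\<^sub>0) / sqrt \<alpha>"
  define cH where "cH = C\<^sub>2 + 6 * T * C\<^sub>2 + 36 * T * sqrt T * C\<^sub>2 + 10 * T * E0 + 4 * T * E0 * sqrt T"
  define C where "C = cH + 4 * T + 16 * T * sqrt T"
  have C1: "0 < C\<^sub>1 0" using assms(7)[of 0] by simp
  have E0: "0 \<le> E0" unfolding E0_def using C1 assms(5) by simp
  have C: "0 < C" unfolding C_def cH_def using E0 assms(2,8) by (intro add_pos_nonneg) auto
  show ?thesis
  proof (rule exI[of _ C], intro conjI C allI impI ballI, elim conjE)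
    fix \<T> \<kappa> q Vh ah Cinv IM J Rh N k h u0 v0 f ft ftt fttt u U m
    assume \<T>: "triangulation_of \<Omega> \<T>" and h: "h = mesh_size \<T>"
      and V: "finite_dim_space Vh" "Vh \<subseteq> broken_Hm \<T> 2" and ah: "discrete_form \<Omega> \<T> Vh \<alpha> \<beta> ah"
      and inv: "inverse_inequality \<Omega> \<T> Vh Cinv" and IM: "morley_interpolation \<Omega> \<T> IM" and J: "companion_operator \<Omega> \<T> J"
      and sm: "smoother_estimate \<Omega> \<T> Vh C\<^sub>1 (J \<circ> IM)"
      and Rh: "ritz_projection \<Omega> Vh ah (J \<circ> IM) Rh" "ritz_estimate \<Omega> \<T> \<gamma>\<^sub>0 C\<^sub>2 Rh"
      and data: "admissible_data \<Omega> T u0 v0 f ft ftt fttt" and sol: "weak_solution \<Omega> T f u0 v0 u"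
      and N: "0 < N" "k = T / real N" and U: "explicit_scheme \<Omega> Vh ah Rh k N f u0 v0 U"
      and cfl: "k \<le> \<beta> powr (-1/2) * inverse Cinv * h\<^sup>2" and m: "m \<in> {1..N-1}"
    have f: "time_continuous (L2_enorm \<Omega>) T f" using data by (simp add: admissible_data_def)
    have "0 < h" unfolding h using triangulation_mesh(2)[OF _ _ \<T>] assms(1) by (simp add: polygonal_lipschitz_domain_def)
    then have H: "0 < h powr (2 * \<gamma>\<^sub>0)" by simp
    have k: "0 < k\<^sup>2" using N assms(2) by simp
    let ?X = "sobolev_norm \<Omega> (2 + \<gamma>\<^sub>0)" and ?L = "L2_enorm \<Omega>"
    let ?n1 = "Linf_deriv_norm \<Omega> ?L T 0 f" and ?n2 = "L2_deriv_norm \<Omega> ?L T 1 f"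
      and ?n3 = "Linf_deriv_norm \<Omega> ?X T 0 u" and ?n4 = "Linf_deriv_norm \<Omega> ?X T 1 u" and ?n5 = "Linf_deriv_norm \<Omega> ?L T 2 u"
      and ?n6 = "L2_deriv_norm \<Omega> ?X T 2 u" and ?n7 = "L2_deriv_norm \<Omega> ?L T 3 u"
      and ?n8 = "Linf_deriv_norm \<Omega> ?L T 3 u" and ?n9 = "L2_deriv_norm \<Omega> ?L T 4 u"
    let ?rhs = "ennreal C * (ennreal (h powr (2 * \<gamma>\<^sub>0)) * L_fu \<Omega> \<gamma>\<^sub>0 T f u + ennreal (k\<^sup>2) * M_u \<Omega> T u)"
    show "ennreal (L2_norm \<Omega> (\<lambda>x. u (real (m + 1) * k) x - U (m + 1) x)) \<le> ?rhs"
    proof (cases "L_fu \<Omega> \<gamma>\<^sub>0 T f u = \<infinity> \<or> M_u \<Omega> T u = \<infinity>")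
      case True
      \<comment> \<open>Positivity of \<open>C\<close>, of the power of \<open>h\<close> and of k^2
        prevents an infinite norm from being multiplied by 0.\<close>
      then have "?rhs = \<infinity>" using C H k by (auto simp: ennreal_mult_eq_top_iff ennreal_eq_0_iff not_le)
      then show ?thesis by simp
    next
      case False
      then have fin: "?n1 \<noteq> \<infinity>" "?n2 \<noteq> \<infinity>" "?n3 \<noteq> \<infinity>" "?n4 \<noteq> \<infinity>" "?n5 \<noteq> \<infinity>" "?n6 \<noteq> \<infinity>" "?n7 \<noteq> \<infinity>" "?n8 \<noteq> \<infinity>" "?n9 \<noteq> \<infinity>"
        by (auto simp: L_fu_def M_u_def)
      \<comment> \<open>The right-hand side with every norm enlarged by \<epsilon>, the price for
        choosing near-optimal representatives.\<close>
      let ?B = "\<lambda>\<epsilon>. C * (h powr (2 * \<gamma>\<^sub>0) * ((enn2real ?n1 + \<epsilon>) + (enn2real ?n2 + \<epsilon>) + (enn2real ?n3 + \<epsilon>) + (enn2real ?n4 + \<epsilon>)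
          + (enn2real ?n5 + \<epsilon>) + (enn2real ?n6 + \<epsilon>) + (enn2real ?n7 + \<epsilon>)) + k\<^sup>2 * ((enn2real ?n8 + \<epsilon>) + (enn2real ?n9 + \<epsilon>)))"
      have bound: "L2_norm \<Omega> (\<lambda>x. u (real (m + 1) * k) x - U (m + 1) x) \<le> ?B \<epsilon>" if "0 < \<epsilon>" for \<epsilon>
      proof -
        note near = INF_finite_near[OF _ \<open>0 < \<epsilon>\<close>, where A="Collect (has_time_deriv \<Omega> T j w)" for j w]
        obtain p0 where p0: "has_time_deriv \<Omega> T 0 f p0" "Linf_time_norm ?L T p0 \<le> ennreal (enn2real ?n1 + \<epsilon>)"
          unfolding Linf_deriv_norm_def by (rule near[OF fin(1)[unfolded Linf_deriv_norm_def]]) simp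
        obtain p1 where p1: "has_time_deriv \<Omega> T 1 f p1" "L2_time_norm ?L T p1 \<le> ennreal (enn2real ?n2 + \<epsilon>)"
          unfolding L2_deriv_norm_def by (rule near[OF fin(2)[unfolded L2_deriv_norm_def]]) simp
        obtain g0 where g0: "has_time_deriv \<Omega> T 0 u g0" "Linf_time_norm ?X T g0 \<le> ennreal (enn2real ?n3 + \<epsilon>)"
          unfolding Linf_deriv_norm_def by (rule near[OF fin(3)[unfolded Linf_deriv_norm_def]]) simp
        obtain g1 where g1: "has_time_deriv \<Omega> T 1 u g1" "Linf_time_norm ?X T g1 \<le> ennreal (enn2real ?n4 + \<epsilon>)"
          unfolding Linf_deriv_norm_def by (rule near[OF fin(4)[unfolded Linf_deriv_norm_def]]) simp
        obtain g2 where g2: "has_time_deriv \<Omega> T 2 u g2" "Linf_time_norm ?L T g2 \<le> ennreal (enn2real ?n5 + \<epsilon>)"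
          unfolding Linf_deriv_norm_def by (rule near[OF fin(5)[unfolded Linf_deriv_norm_def]]) simp
        obtain h2 where h2: "has_time_deriv \<Omega> T 2 u h2" "L2_time_norm ?X T h2 \<le> ennreal (enn2real ?n6 + \<epsilon>)"
          unfolding L2_deriv_norm_def by (rule near[OF fin(6)[unfolded L2_deriv_norm_def]]) simp
        obtain g3 where g3: "has_time_deriv \<Omega> T 3 u g3" "L2_time_norm ?L T g3 \<le> ennreal (enn2real ?n7 + \<epsilon>)"
          unfolding L2_deriv_norm_def by (rule near[OF fin(7)[unfolded L2_deriv_norm_def]]) simp
        obtain h3 where h3: "has_time_deriv \<Omega> T 3 u h3" "Linf_time_norm ?L T h3 \<le> ennreal (enn2real ?n8 + \<epsilon>)"
          unfolding Linf_deriv_norm_def by (rule near[OF fin(8)[unfolded Linf_deriv_norm_def]]) simp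
        obtain g4 where g4: "has_time_deriv \<Omega> T 4 u g4" "L2_time_norm ?L T g4 \<le> ennreal (enn2real ?n9 + \<epsilon>)"
          unfolding L2_deriv_norm_def by (rule near[OF fin(9)[unfolded L2_deriv_norm_def]]) simp
        have nn: "0 \<le> enn2real x + \<epsilon>" for x using \<open>0 < \<epsilon>\<close> by simp
        have \<gamma>: "\<gamma>\<^sub>0 \<le> 1" using assms(3) by simp
        show ?thesis unfolding C_def
          by (rule scheme_error_bound[OF assms(1,2) \<gamma> assms(5,6) C1 assms(8) E0_def cH_def \<T> h V ah inv IM J sm Rh f sol N U cfl m
              p0 p1 g0 g1 g2 h2 g3 h3 g4 nn nn nn nn nn nn nn nn nn])
      qed
      have "((\<lambda>\<epsilon>. ?B \<epsilon>) \<longlongrightarrow> ?B 0) (at_right 0)" by (intro tendsto_intros)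
      moreover have "\<forall>\<^sub>F \<epsilon> in at_right 0. L2_norm \<Omega> (\<lambda>x. u (real (m + 1) * k) x - U (m + 1) x) \<le> ?B \<epsilon>"
        using bound by (auto simp: eventually_at_filter)
      ultimately have "L2_norm \<Omega> (\<lambda>x. u (real (m + 1) * k) x - U (m + 1) x) \<le> ?B 0"
        by (intro tendsto_lowerbound) auto
      then have "ennreal (L2_norm \<Omega> (\<lambda>x. u (real (m + 1) * k) x - U (m + 1) x)) \<le> ennreal (?B 0)" by (rule ennreal_leI)
      also have "\<dots> = ?rhs"
      proof -
        have e: "ennreal (enn2real x) = x" if "x \<noteq> \<infinity>" for x using that by (simp add: top.not_eq_extremum)
        show ?thesis using C H k by (simp add: L_fu_def M_u_def ennreal_mult del: One_nat_def add: e[OF fin(1)] e[OF fin(2)] e[OF fin(3)] e[OF fin(4)]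
          e[OF fin(5)] e[OF fin(6)] e[OF fin(7)] e[OF fin(8)] e[OF fin(9)])
      qed
      finally show ?thesis .
    qed
  qed
qed

end
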